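(* Assume that $A,\hat A,A_1,\hat A_1\in L^\infty(0,T;\mathbb R^{n\times n})$, $B,\hat B,B_1,\hat B_1\in L^\infty(0,T;\mathbb R^{n\times m})$, $Q,\hat Q\in L^\infty(0,T;\mathcal S^n)$, $R,\hat R\in L^\infty(0,T;\mathcal S^m)$ and $G,\hat G\in\mathcal S^n$. Let $x\in\mathbb R^n$ and let $(\bar X(\cdot),\bar u(\cdot))$ be an optimal pair of Problem (MF) with initial state $x$. Then the mean-field backward stochastic differential equation $$\begin{cases} dY(s)=-\Big(A(s)^TY(s)+A_1(s)^TZ(s)+\hat A(s)^T\mathbb E[Y(s)]+\hat A_1(s)^T\mathbb E[Z(s)]+Q(s)\bar X(s)+\hat Q(s)\mathbb E[\bar X(s)]\Big)ds+Z(s)\,dW(s),\quad s\in[0,T],\\ Y(T)=G\bar X(T)+\hat G\,\mathbb E[\bar X(T)]\end{cases}$$ admits a unique adapted solution $(Y(\cdot),Z(\cdot))$, and it satisfies $$R(s)\bar u(s)+B(s)^TY(s)+B_1(s)^TZ(s)+\hat R(s)\mathbb E[\bar u(s)]+\hat B(s)^T\mathbb E[Y(s)]+\hat B_1(s)^T\mathbb E[Z(s)]=0$$ for (almost every) $s\in[0,T]$, almost surely.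
   Context: Let $T>0$ and let $(\Omega,\mathcal F,\mathbb P,\mathbb F)$ be a complete filtered probability space carrying a one-dimensional standard Brownian motion $W$, where $\mathbb F=\{\mathcal F_t\}_{t\ge0}$ is the natural filtration of $W$ augmented by all $\mathbb P$-null sets. $\mathcal S^k$ is the set of symmetric $k\times k$ real matrices. $L^2_{\mathbb F}(0,T;H)$ is the set of $\mathbb F$-adapted $H$-valued processes $\varphi$ with $\mathbb E\int_0^T|\varphi(s)|^2ds<\infty$. The set of admissible controls is $\mathcal U[0,T]=L^2_{\mathbb F}(0,T;\mathbb R^m)$. $\hat{\mathcal X}[0,T]$ is the set of $\mathbb F$-adapted $\mathbb R^n$-valued processes $X$ with continuous paths and $\mathbb E[\sup_{s\in[0,T]}|X(s)|^2]<\infty$. All coefficients $A,\hat A,A_1,\hat A_1,B,\hat B,B_1,\hat B_1,Q,\hat Q,R,\hat R,G,\hat G$ are deterministic. For $x\in\mathbb R^n$ and $u\in\mathcal U[0,T]$, the state process $X=X(\cdot\,;x,u)\in\hat{\mathcal X}[0,T]$ is the unique solution of $$\begin{cases} dX=\{AX+Bu+\hat A\,\mathbb E[X]+\hat B\,\mathbb E[u]\}ds+\{A_1X+B_1u+\hat A_1\mathbb E[X]+\hat B_1\mathbb E[u]\}dW(s),\quad s\in[0,T],\\ X(0)=x,\end{cases}$$ and the cost functional is $$J(x;u)=\mathbb E\Big\{\int_0^T\big[\langle QX,X\rangle+\langle\hat Q\,\mathbb E[X],\mathbb E[X]\rangle+\langle Ru,u\rangle+\langle\hat R\,\mathbb E[u],\mathbb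 E[u]\rangle\big]ds+\langle GX(T),X(T)\rangle+\langle\hat G\,\mathbb E[X(T)],\mathbb E[X(T)]\rangle\Big\}.$$ Problem (MF): given $x\in\mathbb R^n$, find $\bar u\in\mathcal U[0,T]$ with $J(x;\bar u)=\inf_{u\in\mathcal U[0,T]}J(x;u)$. Such a $\bar u$ is an optimal control, $\bar X=X(\cdot\,;x,\bar u)$ is the corresponding optimal state process, and $(\bar X,\bar u)$ is an optimal pair. An adapted solution of the backward equation is a pair $(Y,Z)\in\hat{\mathcal X}[0,T]\times L^2_{\mathbb F}(0,T;\mathbb R^n)$ satisfying it. *)

theory Defs
  imports "HOL-Probability.Probability"
begin

section \<open>Brownian motion and its augmented natural filtration\<close>

locale brownian_motion = prob_space M for M :: "'w measure" +
  fixes W :: "real \<Rightarrow> 'w \<Rightarrow> real"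
  assumes W_measurable: "\<And>t. 0 \<le> t \<Longrightarrow> W t \<in> borel_measurable M"
    and W_zero: "AE \<omega> in M. W 0 \<omega> = 0"
    and W_continuous: "AE \<omega> in M. continuous_on {0..} (\<lambda>t. W t \<omega>)"
    and W_normal: "\<And>s t. 0 \<le> s \<Longrightarrow> s < t \<Longrightarrow>
      distributed M lborel (\<lambda>\<omega>. W t \<omega> - W s \<omega>) (\<lambda>x. ennreal (normal_density 0 (sqrt (t - s)) x))"
    and W_indep: "\<And>(\<tau> :: nat \<Rightarrow> real) k. 0 \<le> \<tau> 0 \<Longrightarrow> (\<forall>i<k. \<tau> i < \<tau> (Suc i)) \<Longrightarrow>
      indep_vars (\<lambda>_. borel) (\<lambda>i \<omega>. W (\<tau> (Suc i)) \<omega> - W (\<tau> i) \<omega>) {..<k}"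

text \<open>Only the sets of this measure matter. If \<open>M\<close> is complete, \<open>null_sets M\<close> contains every
  subset of a null set.\<close>

definition aug_filtration :: "'w measure \<Rightarrow> (real \<Rightarrow> 'w \<Rightarrow> real) \<Rightarrow> real \<Rightarrow> 'w measure" where
  "aug_filtration M W t =
     sigma (space M) ({W r -` S \<inter> space M | r S. r \<in> {0..t} \<and> S \<in> sets borel} \<union> null_sets M)"


section \<open>Function and process spaces\<close>

text \<open>Elements of these spaces are functions, not equivalence classes, and only their values
  on \<open>[0, T]\<close> matter.\<close>

definition Linf :: "real \<Rightarrow> (real \<Rightarrow> 'a::euclidean_space) set" where
  "Linf T = {f \<in> borel_measurable (lebesgue_on {0..T}).
     \<exists>C. AE s in lebesgue_on {0..T}. norm (f s) \<le> C}"

definition sym_matrix :: "real ^ 'k ^ 'k \<Rightarrow> bool" where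
  "sym_matrix S \<longleftrightarrow> transpose S = S"

definition Linf_sym :: "real \<Rightarrow> (real \<Rightarrow> real ^ 'k ^ 'k) set" where
  "Linf_sym T = {f \<in> Linf T. AE s in lebesgue_on {0..T}. sym_matrix (f s)}"

text \<open>Joint measurability is part of the notion of a square integrable adapted process:
  without it the double integral is meaningless.\<close>

definition L2F :: "'w measure \<Rightarrow> (real \<Rightarrow> 'w \<Rightarrow> real) \<Rightarrow> real
    \<Rightarrow> (real \<Rightarrow> 'w \<Rightarrow> 'a::euclidean_space) set" where
  "L2F M W T = {\<phi>.
     (\<forall>t\<in>{0..T}. \<phi> t \<in> borel_measurable (aug_filtration M W t)) \<and>
     (\<lambda>(s, \<omega>). \<phi> s \<omega>) \<in> borel_measurable (lebesgue_on {0..T} \<Otimes>\<^sub>M M) \<and>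
     (\<integral>\<^sup>+\<omega>. (\<integral>\<^sup>+s. ennreal ((norm (\<phi> s \<omega>))\<^sup>2) \<partial>lebesgue_on {0..T}) \<partial>M) < \<infinity>}"

definition Xhat :: "'w measure \<Rightarrow> (real \<Rightarrow> 'w \<Rightarrow> real) \<Rightarrow> real
    \<Rightarrow> (real \<Rightarrow> 'w \<Rightarrow> 'a::euclidean_space) set" where
  "Xhat M W T = {X.
     (\<forall>t\<in>{0..T}. X t \<in> borel_measurable (aug_filtration M W t)) \<and>
     (\<forall>\<omega>\<in>space M. continuous_on {0..T} (\<lambda>t. X t \<omega>)) \<and>
     (\<integral>\<^sup>+\<omega>. (SUP s\<in>{0..T}. ennreal ((norm (X s \<omega>))\<^sup>2)) \<partial>M) < \<infinity>}"


section \<open>The Ito integral\<close>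

text \<open>A simple process is given by a partition \<open>0 = \<tau> 0 < \<dots> < \<tau> k = T\<close> and bounded
  values \<open>\<xi> i\<close>, known at time \<open>\<tau> i\<close> and taken on \<open>(\<tau> i, \<tau> (i + 1)]\<close>.\<close>

definition simple_process :: "'w measure \<Rightarrow> (real \<Rightarrow> 'w \<Rightarrow> real) \<Rightarrow> real
    \<Rightarrow> nat \<Rightarrow> (nat \<Rightarrow> real) \<Rightarrow> (nat \<Rightarrow> 'w \<Rightarrow> 'a::euclidean_space) \<Rightarrow> bool" where
  "simple_process M W T k \<tau> \<xi> \<longleftrightarrow>
     \<tau> 0 = 0 \<and> \<tau> k = T \<and> (\<forall>i<k. \<tau> i < \<tau> (Suc i)) \<and>
     (\<forall>i<k. \<xi> i \<in> borel_measurable (aug_filtration M W (\<tau> i)) \<and> bounded (\<xi> i ` space M))"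

definition simple_value :: "nat \<Rightarrow> (nat \<Rightarrow> real) \<Rightarrow> (nat \<Rightarrow> 'w \<Rightarrow> 'a::euclidean_space)
    \<Rightarrow> real \<Rightarrow> 'w \<Rightarrow> 'a" where
  "simple_value k \<tau> \<xi> s \<omega> = (\<Sum>i<k. indicator {\<tau> i<..\<tau> (Suc i)} s *\<^sub>R \<xi> i \<omega>)"

definition simple_ito :: "(real \<Rightarrow> 'w \<Rightarrow> real) \<Rightarrow> nat \<Rightarrow> (nat \<Rightarrow> real)
    \<Rightarrow> (nat \<Rightarrow> 'w \<Rightarrow> 'a::euclidean_space) \<Rightarrow> real \<Rightarrow> 'w \<Rightarrow> 'a" where
  "simple_ito W k \<tau> \<xi> t \<omega> =
     (\<Sum>i<k. (W (min (\<tau> (Suc i)) t) \<omega> - W (min (\<tau> i) t) \<omega>) *\<^sub>R \<xi> i \<omega>)"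

text \<open>\<open>is_ito_integral M W T \<phi> I\<close>: the process \<open>I\<close> is a continuous adapted version of
  \<open>t \<mapsto> \<integral>\<^sub>0\<^sup>t \<phi> dW\<close> on \<open>[0, T]\<close>. The Ito integral is determined up to
  indistinguishability only, hence a relation.\<close>

definition is_ito_integral :: "'w measure \<Rightarrow> (real \<Rightarrow> 'w \<Rightarrow> real) \<Rightarrow> real
    \<Rightarrow> (real \<Rightarrow> 'w \<Rightarrow> 'a::euclidean_space) \<Rightarrow> (real \<Rightarrow> 'w \<Rightarrow> 'a) \<Rightarrow> bool" where
  "is_ito_integral M W T \<phi> I \<longleftrightarrow>
     \<phi> \<in> L2F M W T \<and>
     (\<forall>t\<in>{0..T}. I t \<in> borel_measurable (aug_filtration M W t)) \<and>
     (\<forall>\<omega>\<in>space M. continuous_on {0..T} (\<lambda>t. I t \<omega>)) \<and>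
     (\<exists>k \<tau> \<xi>. (\<forall>j::nat. simple_process M W T (k j) (\<tau> j) (\<xi> j)) \<and>
        (\<lambda>j. \<integral>\<^sup>+\<omega>. (\<integral>\<^sup>+s. ennreal ((norm (simple_value (k j) (\<tau> j) (\<xi> j) s \<omega> - \<phi> s \<omega>))\<^sup>2)
           \<partial>lebesgue_on {0..T}) \<partial>M) \<longlonglongrightarrow> 0 \<and>
        (\<forall>t\<in>{0..T}. (\<lambda>j. \<integral>\<^sup>+\<omega>. ennreal ((norm (simple_ito W (k j) (\<tau> j) (\<xi> j) t \<omega> - I t \<omega>))\<^sup>2) \<partial>M)
           \<longlonglongrightarrow> 0))"


section \<open>The mean-field linear-quadratic problem\<close>

text \<open>The suffix \<open>h\<close> marks the coefficients written with a hat.\<close>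

record ('n::finite, 'm::finite) mf_coeffs =
  cA :: "real \<Rightarrow> real ^ 'n ^ 'n"
  cAh :: "real \<Rightarrow> real ^ 'n ^ 'n"
  cA1 :: "real \<Rightarrow> real ^ 'n ^ 'n"
  cA1h :: "real \<Rightarrow> real ^ 'n ^ 'n"
  cB :: "real \<Rightarrow> real ^ 'm ^ 'n"
  cBh :: "real \<Rightarrow> real ^ 'm ^ 'n"
  cB1 :: "real \<Rightarrow> real ^ 'm ^ 'n"
  cB1h :: "real \<Rightarrow> real ^ 'm ^ 'n"
  cQ :: "real \<Rightarrow> real ^ 'n ^ 'n"
  cQh :: "real \<Rightarrow> real ^ 'n ^ 'n"
  cR :: "real \<Rightarrow> real ^ 'm ^ 'm"
  cRh :: "real \<Rightarrow> real ^ 'm ^ 'm"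
  cG :: "real ^ 'n ^ 'n"
  cGh :: "real ^ 'n ^ 'n"

definition mean :: "'w measure \<Rightarrow> (real \<Rightarrow> 'w \<Rightarrow> 'a::euclidean_space) \<Rightarrow> real \<Rightarrow> 'a" where
  "mean M X s = integral\<^sup>L M (X s)"

definition is_state :: "'w measure \<Rightarrow> (real \<Rightarrow> 'w \<Rightarrow> real) \<Rightarrow> real \<Rightarrow> ('n::finite, 'm::finite) mf_coeffs
    \<Rightarrow> real ^ 'n \<Rightarrow> (real \<Rightarrow> 'w \<Rightarrow> real ^ 'm) \<Rightarrow> (real \<Rightarrow> 'w \<Rightarrow> real ^ 'n) \<Rightarrow> bool" where
  "is_state M W T c x u X \<longleftrightarrow>
     X \<in> Xhat M W T \<and>
     (\<exists>I. is_ito_integral M W T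
            (\<lambda>s \<omega>. cA1 c s *v X s \<omega> + cB1 c s *v u s \<omega> + cA1h c s *v mean M X s + cB1h c s *v mean M u s) I \<and>
        (AE \<omega> in M. \<forall>t\<in>{0..T}.
           X t \<omega> = x
             + integral\<^sup>L (lebesgue_on {0..t})
                 (\<lambda>s. cA c s *v X s \<omega> + cB c s *v u s \<omega> + cAh c s *v mean M X s + cBh c s *v mean M u s)
             + I t \<omega>))"

text \<open>The state is unique up to indistinguishability, so the choice of the version does not
  affect the cost.\<close>

definition state :: "'w measure \<Rightarrow> (real \<Rightarrow> 'w \<Rightarrow> real) \<Rightarrow> real \<Rightarrow> ('n::finite, 'm::finite) mf_coeffs
    \<Rightarrow> real ^ 'n \<Rightarrow> (real \<Rightarrow> 'w \<Rightarrow> real ^ 'm) \<Rightarrow> real \<Rightarrow> 'w \<Rightarrow> real ^ 'n" where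
  "state M W T c x u = (SOME X. is_state M W T c x u X)"

definition cost :: "'w measure \<Rightarrow> (real \<Rightarrow> 'w \<Rightarrow> real) \<Rightarrow> real \<Rightarrow> ('n::finite, 'm::finite) mf_coeffs
    \<Rightarrow> real ^ 'n \<Rightarrow> (real \<Rightarrow> 'w \<Rightarrow> real ^ 'm) \<Rightarrow> real" where
  "cost M W T c x u = (let X = state M W T c x u in
     integral\<^sup>L M (\<lambda>\<omega>.
       integral\<^sup>L (lebesgue_on {0..T}) (\<lambda>s.
         (cQ c s *v X s \<omega>) \<bullet> X s \<omega> + (cQh c s *v mean M X s) \<bullet> mean M X s
         + (cR c s *v u s \<omega>) \<bullet> u s \<omega> + (cRh c s *v mean M u s) \<bullet> mean M u s)
       + (cG c *v X T \<omega>) \<bullet> X T \<omega> + (cGh c *v mean M X T) \<bullet> mean M X T))"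

text \<open>The infimum is taken in \<open>ereal\<close> since the cost may be unbounded below.\<close>

definition optimal_pair :: "'w measure \<Rightarrow> (real \<Rightarrow> 'w \<Rightarrow> real) \<Rightarrow> real \<Rightarrow> ('n::finite, 'm::finite) mf_coeffs
    \<Rightarrow> real ^ 'n \<Rightarrow> (real \<Rightarrow> 'w \<Rightarrow> real ^ 'n) \<Rightarrow> (real \<Rightarrow> 'w \<Rightarrow> real ^ 'm) \<Rightarrow> bool" where
  "optimal_pair M W T c x X u \<longleftrightarrow>
     u \<in> L2F M W T \<and> is_state M W T c x u X \<and>
     ereal (cost M W T c x u) = (INF v\<in>L2F M W T. ereal (cost M W T c x v))"

definition adjoint_solution :: "'w measure \<Rightarrow> (real \<Rightarrow> 'w \<Rightarrow> real) \<Rightarrow> real \<Rightarrow> ('n::finite, 'm::finite) mf_coeffs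
    \<Rightarrow> (real \<Rightarrow> 'w \<Rightarrow> real ^ 'n) \<Rightarrow> (real \<Rightarrow> 'w \<Rightarrow> real ^ 'n) \<Rightarrow> (real \<Rightarrow> 'w \<Rightarrow> real ^ 'n) \<Rightarrow> bool" where
  "adjoint_solution M W T c X Y Z \<longleftrightarrow>
     Y \<in> Xhat M W T \<and> Z \<in> L2F M W T \<and>
     (\<exists>I. is_ito_integral M W T Z I \<and>
        (AE \<omega> in M. \<forall>t\<in>{0..T}.
           Y t \<omega> = cG c *v X T \<omega> + cGh c *v mean M X T
             + integral\<^sup>L (lebesgue_on {t..T}) (\<lambda>s.
                 transpose (cA c s) *v Y s \<omega> + transpose (cA1 c s) *v Z s \<omega>
                 + transpose (cAh c s) *v mean M Y s + transpose (cA1h c s) *v mean M Z s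
                 + cQ c s *v X s \<omega> + cQh c s *v mean M X s)
             - (I T \<omega> - I t \<omega>)))"

end

theory Submission
  imports Defs
begin

text \<open>
  Optimality is a statement about first-order terms. The state depends affinely on the control and
  the cost is a quadratic form of state and control, so a control \<open>u\<close> with state \<open>X\<close>
  is optimal only if for every direction \<open>v\<close>, with \<open>X\<^sub>1\<close> the state that starts at \<open>0\<close> and is driven by \<open>v\<close>, the mixed term
  \<open>\<langle>Q X, X\<^sub>1\<rangle> + \<langle>R u, v\<rangle> + E (\<xi> \<bullet> X\<^sub>1(T))\<close> vanishes; here \<open>Q\<close> and \<open>R\<close> stand for the mean-field
  operators, \<open>\<langle>\<cdot>, \<cdot>\<rangle>\<close> for the inner product of adapted processes, and \<open>\<xi>\<close> for the terminal value of
  the adjoint equation (\<open>optimal_first_order\<close>). The adjoint pair is the object that turns this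
  functional of \<open>X\<^sub>1\<close> into a functional of \<open>v\<close>: if \<open>X\<^sub>f\<close> solves the linear state equation with zero
  initial value, drift forcing \<open>f\<^sub>0\<close> and diffusion forcing \<open>f\<^sub>1\<close>, then, with \<open>g = Q X\<close>,
  \<open>E (\<xi> \<bullet> X\<^sub>f(T)) + \<langle>g, X\<^sub>f\<rangle> = \<langle>Y, f\<^sub>0\<rangle> + \<langle>Z, f\<^sub>1\<rangle>\<close> (\<open>backward_duality\<close>). Inserting the forcing of a
  control and moving the control operators to the other side shows that the left hand side of the
  stationarity condition is orthogonal to every \<open>v\<close> (\<open>maximum_principle\<close>).

  The same identity gives existence and uniqueness of the adjoint pair. Its left hand side is a bounded
  functional of \<open>(f\<^sub>0, f\<^sub>1)\<close>, so Riesz' theorem provides a candidate \<open>(Y\<^sub>0, Z\<^sub>0)\<close>. With the candidate inserted into the drift, the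
  backward equation is solved by martingale representation, and testing its solution against all
  Ito processes identifies it with the candidate (\<open>backward_exists\<close>). Two solutions represent the
  same functional, hence coincide (\<open>backward_unique\<close>).

  The only stochastic calculus this needs is the expectation of the product rule
  (\<open>itoproc_duality\<close>). It follows from the bilinear Ito isometry, the martingale property, and
  integration by parts for Lebesgue integrals.

  Martingale representation is again a Hilbert space argument: Riesz' theorem gives the integrand,
  and the remaining error is orthogonal to constants and to all simple integrals. It vanishes
  because the complex exponentials of linear combinations of values of \<open>W\<close> are limits of constants
  plus simple integrals (\<open>trig_orthogonal\<close>) and determine the filtration (\<open>increments_total\<close>).

  The Ito integral comes from density of dyadic simple processes and Doob's maximal inequality.
  An adapted process is jointly measurable but need not be progressively measurable, so it is not
  clear that averages over the past are adapted. Density is therefore derived from triviality of the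
  orthogonal complement (\<open>dyadic_simple_orthogonal_trivial\<close>).
\<close>

section \<open>Square integrable functions on a measure space\<close>

lemmas LINT_cong = Bochner_Integration.integral_cong

text \<open>Functions and not equivalence classes: equality in the Hilbert space appears as equality almost
  everywhere, or as a vanishing \<open>nrm\<close> of the difference.\<close>

definition L2 :: "'x measure \<Rightarrow> ('x \<Rightarrow> 'a::euclidean_space) set" where
  "L2 N = {f \<in> borel_measurable N. integrable N (\<lambda>x. (norm (f x))\<^sup>2)}"

definition ip :: "'x measure \<Rightarrow> ('x \<Rightarrow> 'a::euclidean_space) \<Rightarrow> ('x \<Rightarrow> 'a) \<Rightarrow> real" where
  "ip N f g = (\<integral>x. f x \<bullet> g x \<partial>N)"

definition nrm :: "'x measure \<Rightarrow> ('x \<Rightarrow> 'a::euclidean_space) \<Rightarrow> real" where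
  "nrm N f = sqrt (ip N f f)"

abbreviation sqn :: "'a::real_normed_vector \<Rightarrow> ennreal" where
  "sqn x \<equiv> ennreal ((norm x)\<^sup>2)"

abbreviation dst :: "'x measure \<Rightarrow> ('x \<Rightarrow> 'a::euclidean_space) \<Rightarrow> ('x \<Rightarrow> 'a) \<Rightarrow> real" where
  "dst N f g \<equiv> nrm N (\<lambda>x. f x - g x)"

lemma L2_measurable: "f \<in> L2 N \<Longrightarrow> f \<in> borel_measurable N"
  by (simp add: L2_def)

lemma L2_inner_integrable:
  assumes "f \<in> L2 N" "g \<in> L2 N"
  shows "integrable N (\<lambda>x. f x \<bullet> g x)"
proof (rule Bochner_Integration.integrable_bound)
  show "integrable N (\<lambda>x. (norm (f x))\<^sup>2 + (norm (g x))\<^sup>2)"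
    using assms by (simp add: L2_def)
  show "(\<lambda>x. f x \<bullet> g x) \<in> borel_measurable N"
    using assms by (auto simp: L2_def intro: borel_measurable_inner)
  have "\<bar>f x \<bullet> g x\<bar> \<le> (norm (f x))\<^sup>2 + (norm (g x))\<^sup>2" for x
  proof -
    have "\<bar>f x \<bullet> g x\<bar> \<le> norm (f x) * norm (g x)" by (rule Cauchy_Schwarz_ineq2)
    also have "\<dots> \<le> (norm (f x))\<^sup>2 + (norm (g x))\<^sup>2"
      using sum_squares_bound[of "norm (f x)" "norm (g x)"] mult_nonneg_nonneg[OF norm_ge_zero[of "f x"] norm_ge_zero[of "g x"]]
      by linarith
    finally show ?thesis .
  qed
  then show "AE x in N. norm (f x \<bullet> g x) \<le> norm ((norm (f x))\<^sup>2 + (norm (g x))\<^sup>2)"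
    by (simp add: order_trans[OF _ abs_ge_self])
qed

lemma L2_zero [simp]: "(\<lambda>x. 0) \<in> L2 N"
  by (simp add: L2_def)

lemma L2_add:
  assumes "f \<in> L2 N" "g \<in> L2 N"
  shows "(\<lambda>x. f x + g x) \<in> L2 N"
proof -
  have eq: "(norm (f x + g x))\<^sup>2 = (norm (f x))\<^sup>2 + 2 * (f x \<bullet> g x) + (norm (g x))\<^sup>2" for x
    by (simp add: power2_norm_eq_inner inner_simps inner_commute)
  have "integrable N (\<lambda>x. (norm (f x + g x))\<^sup>2)"
    unfolding eq using assms L2_inner_integrable[OF assms] by (simp add: L2_def)
  then show ?thesis using assms by (auto simp: L2_def intro: borel_measurable_add)
qed

lemma L2_scaleR:
  assumes "f \<in> L2 N"
  shows "(\<lambda>x. r *\<^sub>R f x) \<in> L2 N"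
  using assms by (auto simp: L2_def power_mult_distrib intro: borel_measurable_scaleR)

lemma L2_uminus: "f \<in> L2 N \<Longrightarrow> (\<lambda>x. - f x) \<in> L2 N"
  using L2_scaleR[of f N "-1"] by simp

lemma L2_diff: "f \<in> L2 N \<Longrightarrow> g \<in> L2 N \<Longrightarrow> (\<lambda>x. f x - g x) \<in> L2 N"
  using L2_add[of f N "\<lambda>x. - g x"] L2_uminus[of g N] by simp

lemma L2_sum: "(\<And>i. i \<in> I \<Longrightarrow> f i \<in> L2 N) \<Longrightarrow> (\<lambda>x. \<Sum>i\<in>I. f i x) \<in> L2 N"
  by (induction I rule: infinite_finite_induct) (auto intro: L2_add)

lemma L2_cong_AE:
  assumes "f \<in> L2 N" "g \<in> borel_measurable N" "AE x in N. f x = g x"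
  shows "g \<in> L2 N"
proof -
  have "integrable N (\<lambda>x. (norm (f x))\<^sup>2) \<longleftrightarrow> integrable N (\<lambda>x. (norm (g x))\<^sup>2)"
    using assms by (intro integrable_cong_AE) (auto simp: L2_def)
  then show ?thesis using assms by (simp add: L2_def)
qed

lemma L2_bound:
  assumes "f \<in> borel_measurable N" "g \<in> L2 N" "AE x in N. norm (f x) \<le> K * norm (g x)"
  shows "f \<in> L2 N"
proof -
  have "integrable N (\<lambda>x. (norm (f x))\<^sup>2)"
  proof (rule Bochner_Integration.integrable_bound)
    show "integrable N (\<lambda>x. K\<^sup>2 * (norm (g x))\<^sup>2)" using assms by (simp add: L2_def)
    show "AE x in N. norm ((norm (f x))\<^sup>2) \<le> norm (K\<^sup>2 * (norm (g x))\<^sup>2)"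
      using assms(3)
      by eventually_elim (auto simp: power_mult_distrib[symmetric] simp del: power_mult_distrib intro!: power_mono)
  qed (use assms in auto)
  then show ?thesis using assms by (simp add: L2_def)
qed

lemma L2_iff_nn_integral:
  "f \<in> L2 N \<longleftrightarrow> f \<in> borel_measurable N \<and> (\<integral>\<^sup>+x. sqn (f x) \<partial>N) < \<infinity>"
  unfolding L2_def by (auto simp: integrable_iff_bounded)

lemma nn_integral_norm2:
  "f \<in> L2 N \<Longrightarrow> (\<integral>\<^sup>+x. sqn (f x) \<partial>N) = ennreal (ip N f f)"
  unfolding ip_def power2_norm_eq_inner[symmetric]
  by (intro nn_integral_eq_integral) (auto simp: L2_def)

lemma ip_commute: "ip N f g = ip N g f"
  by (simp add: ip_def inner_commute)

lemma ip_add_left: "f \<in> L2 N \<Longrightarrow> g \<in> L2 N \<Longrightarrow> h \<in> L2 N \<Longrightarrow>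
    ip N (\<lambda>x. f x + g x) h = ip N f h + ip N g h"
  by (simp add: ip_def inner_simps L2_inner_integrable)

lemma ip_diff_left: "f \<in> L2 N \<Longrightarrow> g \<in> L2 N \<Longrightarrow> h \<in> L2 N \<Longrightarrow>
    ip N (\<lambda>x. f x - g x) h = ip N f h - ip N g h"
  by (simp add: ip_def inner_simps L2_inner_integrable)

lemma ip_scaleR_left: "ip N (\<lambda>x. r *\<^sub>R f x) h = r * ip N f h"
  by (simp add: ip_def)

lemma ip_add_right: "f \<in> L2 N \<Longrightarrow> g \<in> L2 N \<Longrightarrow> h \<in> L2 N \<Longrightarrow>
    ip N h (\<lambda>x. f x + g x) = ip N h f + ip N h g"
  by (simp add: ip_def inner_simps L2_inner_integrable)

lemma ip_diff_right: "f \<in> L2 N \<Longrightarrow> g \<in> L2 N \<Longrightarrow> h \<in> L2 N \<Longrightarrow>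
    ip N h (\<lambda>x. f x - g x) = ip N h f - ip N h g"
  by (simp add: ip_def inner_simps L2_inner_integrable)

lemma ip_scaleR_right: "ip N h (\<lambda>x. r *\<^sub>R f x) = r * ip N h f"
  by (simp add: ip_def)

lemmas ip_simps = ip_add_left ip_diff_left ip_scaleR_left ip_add_right ip_diff_right
  ip_scaleR_right

lemma ip_cong_AE:
  assumes "AE x in N. f x = f' x" "AE x in N. g x = g' x"
    and "f \<in> borel_measurable N" "f' \<in> borel_measurable N"
    and "g \<in> borel_measurable N" "g' \<in> borel_measurable N"
  shows "ip N f g = ip N f' g'"
  unfolding ip_def
proof (rule integral_cong_AE)
  show "AE x in N. f x \<bullet> g x = f' x \<bullet> g' x" using assms(1,2) by eventually_elim simp
qed (use assms in measurable)

lemma ip_self_nonneg [simp]: "0 \<le> ip N f f"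
  by (simp add: ip_def)

lemma nrm_nonneg [simp]: "0 \<le> nrm N f"
  by (simp add: nrm_def)

lemma nrm_power2: "(nrm N f)\<^sup>2 = ip N f f"
  by (simp add: nrm_def)

lemma nrm_minus: "dst N f g = dst N g f"
  unfolding nrm_def ip_def power2_norm_eq_inner[symmetric] by (simp add: norm_minus_commute)

lemma ip_Cauchy_Schwarz:
  assumes "f \<in> L2 N" "g \<in> L2 N"
  shows "\<bar>ip N f g\<bar> \<le> nrm N f * nrm N g"
proof -
  let ?a = "ip N f f" and ?b = "ip N f g" and ?c = "ip N g g"
  have q: "0 \<le> ?a + 2 * t * ?b + t\<^sup>2 * ?c" for t
  proof -
    have "0 \<le> ip N (\<lambda>x. f x + t *\<^sub>R g x) (\<lambda>x. f x + t *\<^sub>R g x)" by simp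
    also have "\<dots> = ?a + 2 * t * ?b + t\<^sup>2 * ?c"
      using assms by (simp add: ip_simps L2_add L2_scaleR ip_commute[of N g f] power2_eq_square algebra_simps)
    finally show ?thesis .
  qed
  have "?b\<^sup>2 \<le> ?a * ?c"
  proof (cases "?c = 0")
    case True
    have "?b = 0"
    proof (rule ccontr)
      assume b: "?b \<noteq> 0"
      have "0 \<le> ?a + 2 * (- (?a + 1) / (2 * ?b)) * ?b" using q[of "- (?a + 1) / (2 * ?b)"] True by simp
      then show False using b by (simp add: field_simps)
    qed
    then show ?thesis using True by simp
  next
    case False
    then have c: "?c > 0" using ip_self_nonneg[of N g] by linarith
    have "0 \<le> ?a + 2 * (- ?b / ?c) * ?b + (- ?b / ?c)\<^sup>2 * ?c" by (rule q)
    also have "\<dots> = ?a - ?b\<^sup>2 / ?c" using c by (simp add: power2_eq_square field_simps)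
    finally show ?thesis using c by (simp add: field_simps)
  qed
  then have "sqrt (?b\<^sup>2) \<le> sqrt (?a * ?c)" by (rule real_sqrt_le_mono)
  then show ?thesis by (simp add: nrm_def real_sqrt_mult)
qed

lemma nrm_triangle:
  assumes "f \<in> L2 N" "g \<in> L2 N"
  shows "nrm N (\<lambda>x. f x + g x) \<le> nrm N f + nrm N g"
proof (rule power2_le_imp_le)
  have "(nrm N (\<lambda>x. f x + g x))\<^sup>2 = ip N f f + 2 * ip N f g + ip N g g"
    using assms by (simp add: nrm_power2 ip_simps L2_add ip_commute[of N g f])
  also have "\<dots> \<le> (nrm N f + nrm N g)\<^sup>2"
    using ip_Cauchy_Schwarz[OF assms] by (simp add: power2_sum nrm_power2)
  finally show "(nrm N (\<lambda>x. f x + g x))\<^sup>2 \<le> (nrm N f + nrm N g)\<^sup>2" .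
qed simp

lemma nrm_triangle_diff:
  assumes "f \<in> L2 N" "g \<in> L2 N" "h \<in> L2 N"
  shows "dst N f g \<le> dst N f h + dst N h g"
  using nrm_triangle[OF L2_diff[OF assms(1,3)] L2_diff[OF assms(3,2)]] by simp

lemma nrm_eq_0_iff:
  assumes "f \<in> L2 N"
  shows "nrm N f = 0 \<longleftrightarrow> (AE x in N. f x = 0)"
proof -
  have "nrm N f = 0 \<longleftrightarrow> (\<integral>x. (norm (f x))\<^sup>2 \<partial>N) = 0"
    by (simp add: nrm_def ip_def power2_norm_eq_inner)
  also have "\<dots> \<longleftrightarrow> (AE x in N. (norm (f x))\<^sup>2 = 0)"
    using assms by (intro integral_nonneg_eq_0_iff_AE) (auto simp: L2_def)
  finally show ?thesis by simp
qed

lemma ip_self_eq_0: "f \<in> L2 N \<Longrightarrow> ip N f f = 0 \<Longrightarrow> AE x in N. f x = 0"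
  using nrm_eq_0_iff[of f N] by (simp add: nrm_def)

lemma tendsto_nrm_ip:
  assumes "\<And>n. F n \<in> L2 N" "f \<in> L2 N" "(\<lambda>n. dst N (F n) f) \<longlonglongrightarrow> 0"
    and "\<And>n. G n \<in> L2 N" "g \<in> L2 N" "(\<lambda>n. dst N (G n) g) \<longlonglongrightarrow> 0"
  shows "(\<lambda>n. ip N (F n) (G n)) \<longlonglongrightarrow> ip N f g"
proof -
  have "(\<lambda>n. ip N (F n) (G n) - ip N f g) \<longlonglongrightarrow> 0"
  proof (rule Lim_null_comparison)
    let ?B = "\<lambda>n. dst N (F n) f * (dst N (G n) g + nrm N g)
      + nrm N f * dst N (G n) g"
    have "?B \<longlonglongrightarrow> 0 * (0 + nrm N g) + nrm N f * 0"
      by (intro tendsto_intros assms)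
    then show "?B \<longlonglongrightarrow> 0" by simp
    show "\<forall>\<^sub>F n in sequentially. norm (ip N (F n) (G n) - ip N f g) \<le> ?B n"
    proof (intro always_eventually allI)
      fix n
      have "ip N (F n) (G n) - ip N f g
          = ip N (\<lambda>x. F n x - f x) (G n) + ip N f (\<lambda>x. G n x - g x)"
        using assms by (simp add: ip_simps)
      moreover have "\<bar>ip N (\<lambda>x. F n x - f x) (G n)\<bar> \<le> dst N (F n) f * nrm N (G n)"
        using assms by (intro ip_Cauchy_Schwarz L2_diff) auto
      moreover have "nrm N (G n) \<le> dst N (G n) g + nrm N g"
        using nrm_triangle[OF L2_diff[OF assms(4) assms(5)] assms(5), of n] by simp
      then have "dst N (F n) f * nrm N (G n) \<le> dst N (F n) f * (dst N (G n) g + nrm N g)"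
        by (intro mult_left_mono) auto
      moreover have "\<bar>ip N f (\<lambda>x. G n x - g x)\<bar> \<le> nrm N f * dst N (G n) g"
        using assms by (intro ip_Cauchy_Schwarz L2_diff) auto
      ultimately show "norm (ip N (F n) (G n) - ip N f g) \<le> ?B n" unfolding real_norm_def by linarith
    qed
  qed
  then show ?thesis using LIM_zero_iff by blast
qed

lemma nrm_tendsto_0_iff_nn_integral:
  assumes "\<And>n. (\<lambda>x. F n x - f x) \<in> L2 N"
  shows "((\<lambda>n. dst N (F n) f) \<longlonglongrightarrow> 0) \<longleftrightarrow>
    ((\<lambda>n. \<integral>\<^sup>+x. sqn (F n x - f x) \<partial>N) \<longlonglongrightarrow> 0)"
proof -
  have "(\<lambda>n. \<integral>\<^sup>+x. sqn (F n x - f x) \<partial>N) = (\<lambda>n. ennreal ((dst N (F n) f)\<^sup>2))"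
    using assms nn_integral_norm2[of "\<lambda>x. F _ x - f x" N] by (simp add: nrm_power2)
  moreover have "((\<lambda>n. ennreal ((dst N (F n) f)\<^sup>2)) \<longlonglongrightarrow> ennreal 0) \<longleftrightarrow>
      ((\<lambda>n. (dst N (F n) f)\<^sup>2) \<longlonglongrightarrow> 0)"
    by (subst tendsto_ennreal_iff) auto
  moreover have "((\<lambda>n. (dst N (F n) f)\<^sup>2) \<longlonglongrightarrow> 0) \<longleftrightarrow> ((\<lambda>n. dst N (F n) f) \<longlonglongrightarrow> 0)"
    using tendsto_power[of "\<lambda>n. dst N (F n) f" 0 sequentially 2]
      tendsto_real_sqrt[of "\<lambda>n. (dst N (F n) f)\<^sup>2" 0 sequentially]
    by (auto simp: real_sqrt_abs)
  ultimately show ?thesis by simp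
qed

text \<open>The sum of the functions \<open>4\<^sup>k h\<^sub>k\<close> has a finite integral, hence is finite almost everywhere.\<close>

lemma AE_geometric_of_nn_integral:
  assumes [measurable]: "\<And>k. h k \<in> borel_measurable N"
    and le: "\<And>k. (\<integral>\<^sup>+x. h k x \<partial>N) \<le> ennreal ((1/8)^k)"
  shows "AE x in N. \<exists>C::real. \<forall>k. h k x \<le> ennreal (C * (1/4)^k)"
proof -
  have "(\<integral>\<^sup>+x. (\<Sum>k. ennreal (4^k) * h k x) \<partial>N) = (\<Sum>k. (\<integral>\<^sup>+x. ennreal (4^k) * h k x \<partial>N))"
    by (intro nn_integral_suminf) auto
  also have "\<dots> = (\<Sum>k. ennreal (4^k) * (\<integral>\<^sup>+x. h k x \<partial>N))"
    by (intro suminf_cong nn_integral_cmult) auto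
  also have "\<dots> \<le> (\<Sum>k. ennreal ((1/2)^k))"
  proof (intro suminf_le)
    fix k
    have "ennreal (4^k) * (\<integral>\<^sup>+x. h k x \<partial>N) \<le> ennreal (4^k) * ennreal ((1/8)^k)"
      by (intro mult_left_mono le) auto
    also have "\<dots> = ennreal ((1/2)^k)"
      by (simp add: ennreal_mult[symmetric] power_mult_distrib[symmetric] del: power_mult_distrib)
    finally show "ennreal (4^k) * (\<integral>\<^sup>+x. h k x \<partial>N) \<le> ennreal ((1/2)^k)" .
  qed auto
  also have "\<dots> = ennreal (\<Sum>k. (1/2)^k)" by (intro suminf_ennreal2) auto
  also have "\<dots> < \<infinity>" by simp
  finally have "(\<integral>\<^sup>+x. (\<Sum>k. ennreal (4^k) * h k x) \<partial>N) \<noteq> \<infinity>" by simp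
  then have "AE x in N. (\<Sum>k. ennreal (4^k) * h k x) \<noteq> \<infinity>"
    by (intro nn_integral_PInf_AE) auto
  then show ?thesis
  proof eventually_elim
    case (elim x)
    then obtain C where C: "(\<Sum>k. ennreal (4^k) * h k x) = ennreal C" "0 \<le> C"
      by (cases "\<Sum>k. ennreal (4^k) * h k x") auto
    have "h k x \<le> ennreal (C * (1/4)^k)" for k
    proof -
      have "ennreal (4^k) * h k x \<le> ennreal C"
        using sum_le_suminf[of "\<lambda>k. ennreal (4^k) * h k x" "{k}"] C by auto
      then have "ennreal ((1/4)^k) * (ennreal (4^k) * h k x) \<le> ennreal ((1/4)^k) * ennreal C"
        by (intro mult_left_mono) auto
      moreover have "ennreal ((1/4)^k) * (ennreal (4^k) * h k x) = h k x"
        by (simp add: mult.assoc[symmetric] ennreal_mult[symmetric] power_mult_distrib[symmetric] del: power_mult_distrib)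
      ultimately show ?thesis using C by (simp add: ennreal_mult[symmetric] mult.commute)
    qed
    then show ?case by blast
  qed
qed

lemma summable_norm_of_geometric_squares:
  assumes "\<And>k::nat. (norm (d k :: 'a::real_normed_vector))\<^sup>2 \<le> C * (1/4)^k"
  shows "summable (\<lambda>k. norm (d k))"
proof (rule summable_comparison_test)
  have "norm (d k) \<le> sqrt C * (1/2)^k" for k
  proof -
    have "norm (d k) = sqrt ((norm (d k))\<^sup>2)" by simp
    also have "\<dots> \<le> sqrt (C * (1/4)^k)" by (intro real_sqrt_le_mono assms)
    also have "\<dots> = sqrt C * (1/2)^k"
      by (simp add: real_sqrt_mult real_sqrt_power real_sqrt_divide)
    finally show ?thesis .
  qed
  then show "\<exists>N. \<forall>n\<ge>N. norm (norm (d n)) \<le> sqrt C * (1/2)^n" by simp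
  show "summable (\<lambda>n. sqrt C * (1/2)^n)" by (intro summable_mult) auto
qed

text \<open>Rates along a Cauchy sequence can be prescribed. Summable rates make limits in mean into limits
  almost everywhere, here for completeness and later for continuity of Ito integrals.\<close>

lemma fast_subsequence:
  fixes d :: "nat \<Rightarrow> nat \<Rightarrow> real"
  and \<epsilon> :: "nat \<Rightarrow> real"
  assumes "\<And>e. e > 0 \<Longrightarrow> \<exists>n0. \<forall>m\<ge>n0. \<forall>n\<ge>n0. d m n < e" and "\<And>k. \<epsilon> k > 0"
  shows "\<exists>r. strict_mono r \<and> (\<forall>k. d (r (Suc k)) (r k) < \<epsilon> k)"
proof -
  have "\<forall>k. \<exists>n0. \<forall>m\<ge>n0. \<forall>n\<ge>n0. d m n < \<epsilon> k" using assms by blast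
  then obtain n0 where n0: "\<And>k m n. m \<ge> n0 k \<Longrightarrow> n \<ge> n0 k \<Longrightarrow> d m n < \<epsilon> k"
    by (metis (no_types, lifting))
  define r where "r = rec_nat (n0 0) (\<lambda>k p. max (Suc p) (n0 (Suc k)))"
  have r: "r 0 = n0 0" "r (Suc k) = max (Suc (r k)) (n0 (Suc k))" for k
    by (auto simp: r_def)
  have mono: "strict_mono r" unfolding strict_mono_Suc_iff r(2) by (auto simp: less_max_iff_disj)
  have "r k \<ge> n0 k" for k by (cases k) (auto simp: r)
  then have "d (r (Suc k)) (r k) < \<epsilon> k" for k
    using n0[of k "r (Suc k)" "r k"] mono[THEN strict_monoD, of k "Suc k"] by (meson le_trans less_imp_le lessI)
  then show ?thesis using mono by blast
qed

text \<open>Along a fast subsequence the increments are summable almost everywhere; the pointwise limit is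
  the limit in norm by Fatou's lemma.\<close>

lemma L2_complete:
  fixes F :: "nat \<Rightarrow> 'x \<Rightarrow> 'a::euclidean_space"
  assumes F: "\<And>n. F n \<in> L2 N"
    and Cauchy: "\<And>e. e > 0 \<Longrightarrow> \<exists>n0. \<forall>m\<ge>n0. \<forall>n\<ge>n0. dst N (F m) (F n) < e"
  shows "\<exists>f\<in>L2 N. (\<lambda>n. dst N (F n) f) \<longlonglongrightarrow> 0"
proof -
  note [measurable] = L2_measurable[OF F]
  obtain r where r: "strict_mono r" and
    rd: "\<And>k. dst N (F (r (Suc k))) (F (r k)) < sqrt ((1/8)^k)"
    using fast_subsequence[of "\<lambda>m n. dst N (F m) (F n)" "\<lambda>k. sqrt ((1/8)^k)"] Cauchy by auto
  define h where "h k x = sqn (F (r (Suc k)) x - F (r k) x)" for k x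
  have [measurable]: "h k \<in> borel_measurable N" for k unfolding h_def by measurable
  have "(\<integral>\<^sup>+x. h k x \<partial>N) \<le> ennreal ((1/8)^k)" for k
  proof -
    have "(\<integral>\<^sup>+x. h k x \<partial>N) = ennreal ((dst N (F (r (Suc k))) (F (r k)))\<^sup>2)"
      unfolding h_def nrm_power2 by (intro nn_integral_norm2 L2_diff F)
    also have "\<dots> \<le> ennreal ((sqrt ((1/8)^k))\<^sup>2)"
      using rd[of k] by (intro ennreal_leI power_mono) auto
    finally show ?thesis by simp
  qed
  then have "AE x in N. \<exists>C::real. \<forall>k. h k x \<le> ennreal (C * (1/4)^k)"
    by (intro AE_geometric_of_nn_integral) auto
  then have conv: "AE x in N. (\<lambda>k. F (r k) x) \<longlonglongrightarrow> lim (\<lambda>k. F (r k) x)"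
  proof eventually_elim
    case (elim x)
    then obtain C where C: "\<And>k. h k x \<le> ennreal (C * (1/4)^k)" by blast
    have "(norm (F (r (Suc k)) x - F (r k) x))\<^sup>2 \<le> max C 0 * (1/4)^k" for k
    proof -
      have "h k x \<le> ennreal (max C 0 * (1/4)^k)"
        using C[of k] by (rule order_trans) (intro ennreal_leI mult_right_mono; simp)
      then show ?thesis unfolding h_def by (subst (asm) ennreal_le_iff) auto
    qed
    then have "summable (\<lambda>k. F (r (Suc k)) x - F (r k) x)"
      by (rule summable_norm_cancel[OF summable_norm_of_geometric_squares])
    then have "convergent (\<lambda>n. \<Sum>k<n. F (r (Suc k)) x - F (r k) x)"
      by (simp add: summable_iff_convergent)
    then have "convergent (\<lambda>n. F (r n) x - F (r 0) x)" using sum_lessThan_telescope[of "\<lambda>k. F (r k) x"] by simp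
    then have "convergent (\<lambda>n. (F (r n) x - F (r 0) x) + F (r 0) x)"
      by (intro convergent_add convergent_const)
    then show ?case by (simp add: convergent_LIMSEQ_iff)
  qed
  define f where "f x = lim (\<lambda>k. F (r k) x)" for x
  have fm[measurable]: "f \<in> borel_measurable N" unfolding f_def by measurable
  have fatou: "(\<integral>\<^sup>+x. sqn (F n x - f x) \<partial>N) \<le> ennreal (e\<^sup>2)"
    if n: "\<And>m. m \<ge> n0 \<Longrightarrow> dst N (F n) (F m) < e" for n n0 e
  proof -
    have "(\<integral>\<^sup>+x. sqn (F n x - f x) \<partial>N)
        = (\<integral>\<^sup>+x. liminf (\<lambda>k. sqn (F n x - F (r k) x)) \<partial>N)"
    proof (intro nn_integral_cong_AE)
      show "AE x in N. sqn (F n x - f x) = liminf (\<lambda>k. sqn (F n x - F (r k) x))"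
        using conv
      proof eventually_elim
        case (elim x)
        then have "(\<lambda>k. sqn (F n x - F (r k) x)) \<longlonglongrightarrow> sqn (F n x - f x)"
          unfolding f_def by (intro tendsto_intros tendsto_ennrealI)
        then show ?case using lim_imp_Liminf[OF sequentially_bot, of "\<lambda>k. sqn (F n x - F (r k) x)"]
            by (simp del: tendsto_ennreal_iff)
      qed
    qed
    also have "\<dots> \<le> liminf (\<lambda>k. \<integral>\<^sup>+x. sqn (F n x - F (r k) x) \<partial>N)"
      by (intro nn_integral_liminf) auto
    also have "\<dots> \<le> ennreal (e\<^sup>2)"
    proof (rule Liminf_le)
      show "\<forall>\<^sub>F k in sequentially. (\<integral>\<^sup>+x. sqn (F n x - F (r k) x) \<partial>N) \<le> ennreal (e\<^sup>2)"
        using eventually_ge_at_top[of n0]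
      proof eventually_elim
        case (elim k)
        then have "r k \<ge> n0" using seq_suble[OF r, of k] by linarith
        then have lt: "dst N (F n) (F (r k)) < e" by (rule n)
        show ?case
          unfolding nn_integral_norm2[OF L2_diff[OF F F]] nrm_power2[symmetric]
          using lt by (intro ennreal_leI power_mono) auto
      qed
    qed simp
    finally show ?thesis .
  qed
  have "\<exists>n0. \<forall>n\<ge>n0. \<forall>m\<ge>n0. dst N (F n) (F m) < 1" using Cauchy[of 1] by auto
  then obtain n1 where n1: "\<And>n m. n \<ge> n1 \<Longrightarrow> m \<ge> n1 \<Longrightarrow> dst N (F n) (F m) < 1" by blast
  have "(\<integral>\<^sup>+x. sqn (F n1 x - f x) \<partial>N) \<le> ennreal (1\<^sup>2)"
    using fatou[of n1 n1 1] n1 by auto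
  then have "(\<lambda>x. F n1 x - f x) \<in> L2 N"
    unfolding L2_iff_nn_integral by (auto simp: le_less_trans)
  from L2_diff[OF F[of n1] this] have f: "f \<in> L2 N" by simp
  have "(\<lambda>n. dst N (F n) f) \<longlonglongrightarrow> 0"
  proof (rule LIMSEQ_I)
    fix e :: real assume e: "e > 0"
    obtain n0 where n0: "\<And>n m. n \<ge> n0 \<Longrightarrow> m \<ge> n0 \<Longrightarrow> dst N (F n) (F m) < e / 2"
      using Cauchy[of "e/2"] e by auto
    have "dst N (F n) f \<le> e / 2" if "n \<ge> n0" for n
    proof -
      have "ennreal ((dst N (F n) f)\<^sup>2) \<le> ennreal ((e/2)\<^sup>2)"
        using fatou[of n0 n "e/2"] n0[OF that] nn_integral_norm2[OF L2_diff[OF F f], of n]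
        by (simp add: nrm_power2)
      then have "(dst N (F n) f)\<^sup>2 \<le> (e/2)\<^sup>2" by (subst (asm) ennreal_le_iff) auto
      then show ?thesis by (rule power2_le_imp_le) (use e in simp)
    qed
    then show "\<exists>n0. \<forall>n\<ge>n0. norm (dst N (F n) f - 0) < e"
      using e by (intro exI[of _ n0]) (auto intro!: le_less_trans[of "nrm N _" "e / 2" e])
  qed
  then show ?thesis using f by blast
qed

text \<open>A quadratic polynomial that is minimal at \<open>0\<close> has no linear term. Both the projection theorem and
  the optimality condition are read off in this way.\<close>

lemma quadratic_min_derivative:
  fixes a b :: real
  assumes "\<And>t. 0 \<le> 2 * t * a + t\<^sup>2 * b"
  shows "a = 0"
proof (rule ccontr)
  assume a: "a \<noteq> 0"
  define t where "t = - a / (\<bar>b\<bar> + 1)"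
  have "2 * t * a + t\<^sup>2 * b \<le> 2 * t * a + t\<^sup>2 * (\<bar>b\<bar> + 1)"
    by (intro add_left_mono mult_left_mono) auto
  also have "\<dots> = - a\<^sup>2 / (\<bar>b\<bar> + 1)"
    unfolding t_def by (simp add: power2_eq_square divide_simps)
  also have "\<dots> < 0" using a by (simp add: divide_neg_pos)
  finally show False using assms[of t] by simp
qed

text \<open>The representer minimises \<open>\<parallel>f\<parallel>\<^sup>2 - 2 l(f)\<close>. The subspace need not be closed, so the representer
  is a limit of elements of \<open>S\<close>; this limit property is what yields density theorems.\<close>

lemma L2_Riesz_subspace:
  fixes S :: "('x \<Rightarrow> 'a::euclidean_space) set"
  assumes S: "S \<subseteq> L2 N" "(\<lambda>x. 0) \<in> S"
    and Sadd: "\<And>f g. f \<in> S \<Longrightarrow> g \<in> S \<Longrightarrow> (\<lambda>x. f x + g x) \<in> S"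
    and Sscale: "\<And>f r. f \<in> S \<Longrightarrow> (\<lambda>x. r *\<^sub>R f x) \<in> S"
    and ladd: "\<And>f g. f \<in> S \<Longrightarrow> g \<in> S \<Longrightarrow> l (\<lambda>x. f x + g x) = l f + l g"
    and lscale: "\<And>f r. f \<in> S \<Longrightarrow> l (\<lambda>x. r *\<^sub>R f x) = r * l f"
    and lbound: "\<And>f. f \<in> S \<Longrightarrow> \<bar>l f\<bar> \<le> C * nrm N f"
  shows "\<exists>g\<in>L2 N. (\<forall>s\<in>S. l s = ip N g s) \<and>
    (\<exists>F. (\<forall>n. F n \<in> S) \<and> (\<lambda>n. dst N (F n) g) \<longlonglongrightarrow> 0)"
proof -
  define J where "J f = ip N f f - 2 * l f" for f
  have J_lower: "J f \<ge> - C\<^sup>2" if "f \<in> S" for f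
  proof -
    have "0 \<le> (nrm N f - C)\<^sup>2" by simp
    also have "\<dots> = ip N f f - 2 * (C * nrm N f) + C\<^sup>2"
      by (simp add: power2_diff nrm_power2)
    also have "\<dots> \<le> J f + C\<^sup>2" using lbound[OF that] by (simp add: J_def)
    finally show ?thesis by simp
  qed
  have bdd: "bdd_below (J ` S)" using J_lower by (auto intro!: bdd_belowI)
  define m where "m = Inf (J ` S)"
  have m: "m \<le> J f" if "f \<in> S" for f unfolding m_def using that bdd by (auto intro: cInf_lower)
  have "\<exists>f\<in>S. J f < m + 1 / (real n + 1)" for n
    using cInf_lessD[of "J ` S" "m + 1 / (real n + 1)"] S(2) unfolding m_def by auto
  then obtain F where F: "\<And>n. F n \<in> S" "\<And>n. J (F n) < m + 1 / (real n + 1)" by metis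
  have FL: "F n \<in> L2 N" for n using F S by auto
  \<comment> \<open>parallelogram identity: near-minimisers of \<open>J\<close> are close to each other\<close>
  have para: "(dst N f h)\<^sup>2 \<le> 2 * (J f - m) + 2 * (J h - m)" if f: "f \<in> S" and h: "h \<in> S" for f h
  proof -
    have L: "f \<in> L2 N" "h \<in> L2 N" using S f h by auto
    have mid: "(\<lambda>x. (1/2) *\<^sub>R (f x + h x)) \<in> S" by (intro Sscale Sadd f h)
    have "J (\<lambda>x. (1/2) *\<^sub>R (f x + h x)) = (ip N f f + 2 * ip N f h + ip N h h) / 4 - (l f + l h)"
      using L by (simp add: J_def ip_scaleR_left ip_scaleR_right lscale[OF Sadd[OF f h]] ladd f h
        ip_add_left ip_add_right L2_add ip_commute[of N h f] del: scaleR_add_right) (simp add: field_simps)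
    moreover have "(dst N f h)\<^sup>2 = ip N f f - 2 * ip N f h + ip N h h"
      using L by (simp add: nrm_power2 ip_diff_left ip_diff_right L2_diff ip_commute[of N h f])
    moreover have "j = (a + 2 * b + c) / 4 - (p + q) \<Longrightarrow> n = a - 2 * b + c \<Longrightarrow>
        n = 2 * (a - 2 * p) + 2 * (c - 2 * q) - 4 * j" for j a b c p q n :: real
      by (simp add: field_simps)
    ultimately have "(dst N f h)\<^sup>2 = 2 * J f + 2 * J h - 4 * J (\<lambda>x. (1/2) *\<^sub>R (f x + h x))"
      unfolding J_def[of f] J_def[of h] by blast
    then show ?thesis using m[OF mid] by simp
  qed
  have "\<exists>n0. \<forall>p\<ge>n0. \<forall>q\<ge>n0. dst N (F p) (F q) < e" if e: "e > 0" for e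
  proof -
    obtain n0 :: nat where n0: "4 / e\<^sup>2 < real n0" using reals_Archimedean2 by blast
    have "dst N (F p) (F q) < e" if p: "p \<ge> n0" and q: "q \<ge> n0" for p q
    proof (rule power2_less_imp_less)
      have b: "J (F i) - m < e\<^sup>2 / 4" if "i \<ge> n0" for i
      proof -
        have "4 / e\<^sup>2 < real i + 1" using n0 that by linarith
        moreover have "0 < 4 / e\<^sup>2" using e by simp
        ultimately have "1 / (real i + 1) < 1 / (4 / e\<^sup>2)" by (intro divide_strict_left_mono) auto
        then show ?thesis using F(2)[of i] by simp
      qed
      show "(dst N (F p) (F q))\<^sup>2 < e\<^sup>2"
      proof -
        note para[OF F(1)[of p] F(1)[of q]]
        also have "2 * (J (F p) - m) + 2 * (J (F q) - m) < 2 * (e\<^sup>2 / 4) + 2 * (e\<^sup>2 / 4)"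
          by (intro add_strict_mono mult_strict_left_mono b p q) auto
        finally show ?thesis by simp
      qed
    qed (use e in auto)
    then show ?thesis by blast
  qed
  from L2_complete[OF FL this] obtain g where g: "g \<in> L2 N" "(\<lambda>n. dst N (F n) g) \<longlonglongrightarrow> 0"
    by auto
  have "l s = ip N g s" if s: "s \<in> S" for s
  proof -
    have sL: "s \<in> L2 N" using S s by auto
    have ipl: "(\<lambda>n. ip N (F n) s) \<longlonglongrightarrow> ip N g s"
      by (rule tendsto_nrm_ip) (use FL g sL in \<open>auto simp: nrm_def ip_def\<close>)
    have "0 \<le> 2 * t * (ip N g s - l s) + t\<^sup>2 * ip N s s" for t
    proof (rule LIMSEQ_le_const)
      show "(\<lambda>n. 1 / (real n + 1) + (2 * t * (ip N (F n) s - l s) + t\<^sup>2 * ip N s s)) \<longlonglongrightarrow>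
          2 * t * (ip N g s - l s) + t\<^sup>2 * ip N s s"
      proof -
        have "(\<lambda>n. 1 / (real n + 1)) \<longlonglongrightarrow> 0"
          using LIMSEQ_inverse_real_of_nat by (simp add: inverse_eq_divide add.commute)
        then have "(\<lambda>n. 1 / (real n + 1) + (2 * t * (ip N (F n) s - l s) + t\<^sup>2 * ip N s s)) \<longlonglongrightarrow>
          0 + (2 * t * (ip N g s - l s) + t\<^sup>2 * ip N s s)"
          by (intro tendsto_intros ipl)
        then show ?thesis by simp
      qed
      have "0 \<le> 1 / (real n + 1) + (2 * t * (ip N (F n) s - l s) + t\<^sup>2 * ip N s s)" for n
      proof -
        have "m \<le> J (\<lambda>x. F n x + t *\<^sub>R s x)" by (intro m Sadd Sscale F s)
        also have "\<dots> = J (F n) + (2 * t * (ip N (F n) s - l s) + t\<^sup>2 * ip N s s)"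
          using FL sL by (simp add: J_def ip_add_left ip_add_right L2_add L2_scaleR ip_scaleR_left
            ip_scaleR_right ladd[OF F(1) Sscale[OF s]] lscale s ip_commute[of N s "F n"] power2_eq_square algebra_simps)
        finally show ?thesis using F(2)[of n] by simp
      qed
      then show "\<exists>N'. \<forall>n\<ge>N'. 0 \<le> 1 / (real n + 1) + (2 * t * (ip N (F n) s - l s) + t\<^sup>2 * ip N s s)" by blast
    qed
    then have "ip N g s - l s = 0" by (rule quadratic_min_derivative)
    then show ?thesis by simp
  qed
  then show ?thesis using g F(1) by blast
qed

text \<open>Represent the functional \<open>ip N f\<close> on \<open>S\<close> by a limit of elements of \<open>S\<close>: the difference to \<open>f\<close> is
  orthogonal to \<open>S\<close>.\<close>

lemma L2_dense_if_orthogonal_trivial: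
  fixes S :: "('x \<Rightarrow> 'a::euclidean_space) set"
  assumes S: "S \<subseteq> L2 N" "(\<lambda>x. 0) \<in> S"
    and Sadd: "\<And>f g. f \<in> S \<Longrightarrow> g \<in> S \<Longrightarrow> (\<lambda>x. f x + g x) \<in> S"
    and Sscale: "\<And>f r. f \<in> S \<Longrightarrow> (\<lambda>x. r *\<^sub>R f x) \<in> S"
    and orth: "\<And>f. f \<in> L2 N \<Longrightarrow> (\<And>s. s \<in> S \<Longrightarrow> ip N f s = 0) \<Longrightarrow> AE x in N. f x = 0"
    and f: "f \<in> L2 N"
  shows "\<exists>F. (\<forall>n. F n \<in> S) \<and> (\<lambda>n. dst N (F n) f) \<longlonglongrightarrow> 0"
proof -
  have "\<exists>g\<in>L2 N. (\<forall>s\<in>S. ip N f s = ip N g s) \<and>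
    (\<exists>F. (\<forall>n. F n \<in> S) \<and> (\<lambda>n. dst N (F n) g) \<longlonglongrightarrow> 0)"
  proof (rule L2_Riesz_subspace[where C = "nrm N f"])
    show "\<bar>ip N f s\<bar> \<le> nrm N f * nrm N s" if "s \<in> S" for s
      using that f S by (intro ip_Cauchy_Schwarz) auto
  qed (use S Sadd Sscale f in \<open>auto simp: ip_scaleR_right intro!: ip_add_right\<close>)
  then obtain g F where g: "g \<in> L2 N" "\<And>s. s \<in> S \<Longrightarrow> ip N f s = ip N g s"
    and F: "\<And>n. F n \<in> S" "(\<lambda>n. dst N (F n) g) \<longlonglongrightarrow> 0" by blast
  have "AE x in N. f x - g x = 0"
    using S f g by (intro orth) (auto simp: ip_diff_left L2_diff subset_iff)
  then have ae: "AE x in N. g x = f x" by eventually_elim simp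
  have "dst N (F n) g = dst N (F n) f" for n
  proof -
    have "(\<lambda>x. F n x - g x) \<in> borel_measurable N" "(\<lambda>x. F n x - f x) \<in> borel_measurable N"
      using S F(1)[of n] f g by (auto simp: L2_def subset_iff)
    moreover have "AE x in N. F n x - g x = F n x - f x" using ae by eventually_elim simp
    ultimately show ?thesis unfolding nrm_def by (intro arg_cong[where f = sqrt] ip_cong_AE)
  qed
  then show ?thesis using F by auto
qed

section \<open>Dyadic times\<close>

definition grid :: "real \<Rightarrow> nat \<Rightarrow> nat \<Rightarrow> real" where
  "grid s n j = s * real j / 2 ^ n"

definition dyad :: "real \<Rightarrow> real set" where
  "dyad s = {grid s n j | n j. j \<le> 2 ^ n}"

lemma grid_0 [simp]: "grid s n 0 = 0" and grid_top [simp]: "grid s n (2 ^ n) = s"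
  by (simp_all add: grid_def)

lemma grid_refine: "grid s (n + d) (j * 2 ^ d) = grid s n j"
  by (simp add: grid_def power_add field_simps)

lemma grid_mono: "0 \<le> s \<Longrightarrow> i \<le> j \<Longrightarrow> grid s n i \<le> grid s n j"
  by (simp add: grid_def divide_right_mono mult_left_mono)

lemma grid_less: "0 < s \<Longrightarrow> i < j \<Longrightarrow> grid s n i < grid s n j"
  by (simp add: grid_def divide_strict_right_mono)

lemma grid_range: "0 \<le> s \<Longrightarrow> j \<le> 2 ^ n \<Longrightarrow> grid s n j \<in> {0..s}"
  using grid_mono[of s 0 j n] grid_mono[of s j "2^n" n] by simp

lemma grid_step: "grid s n (Suc j) - grid s n j = s / 2 ^ n"
  by (simp add: grid_def field_simps)

lemma dyad_range: "0 \<le> s \<Longrightarrow> dyad s \<subseteq> {0..s}"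
  by (auto simp: dyad_def dest: grid_range)

lemma finite_dyad_common_grid:
  assumes "finite K" "K \<subseteq> dyad s"
  shows "\<exists>n. \<forall>m\<ge>n. \<forall>r\<in>K. \<exists>j\<le>2^m. r = grid s m j"
  using assms
proof (induction K)
  case (insert r K)
  then have "\<exists>n. \<forall>m\<ge>n. \<forall>r\<in>K. \<exists>j\<le>2^m. r = grid s m j" by simp
  then obtain n where n: "\<And>m r. m \<ge> n \<Longrightarrow> r \<in> K \<Longrightarrow> \<exists>j\<le>2^m. r = grid s m j" by meson
  from insert obtain p i where pi: "r = grid s p i" "i \<le> 2^p" by (auto simp: dyad_def)
  have "\<exists>j\<le>2^m. r = grid s m j" if mp: "m \<ge> p" for m
  proof -
    obtain d where m: "m = p + d" using le_Suc_ex[OF mp] by (elim exE)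
    show ?thesis using pi by (intro exI[of _ "i * 2^d"]) (simp add: m grid_refine power_add)
  qed
  then show ?case using n by (intro exI[of _ "max n p"]) auto
qed auto

lemma dyad_countable: "countable (dyad s)"
proof -
  have "dyad s \<subseteq> (\<lambda>(n, j). grid s n j) ` UNIV" by (auto simp: dyad_def)
  then show ?thesis by (rule countable_subset) auto
qed

text \<open>Approximation strictly from the left matters for adaptedness: information at dyadic times before
  \<open>r\<close> determines \<open>W r\<close>, by continuity of paths.\<close>

lemma dyad_dense_from_left:
  assumes "0 < r" "r \<le> s"
  shows "r \<in> closure (dyad s \<inter> {0..<r})"
  unfolding closure_approachable
proof (intro allI impI)
  fix e :: real assume e: "e > 0"
  obtain n where n: "s / e < 2 ^ n" using real_arch_pow[of 2 "s/e"] by auto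
  then have se: "s / 2 ^ n < e" using e by (simp add: field_simps)
  define j where "j = nat (\<lceil>r * 2 ^ n / s\<rceil> - 1)"
  have s: "s > 0" using assms by simp
  have pos: "0 < r * 2 ^ n / s" using assms s by simp
  then have c1: "1 \<le> \<lceil>r * 2 ^ n / s\<rceil>" by linarith
  have j: "real j = of_int \<lceil>r * 2 ^ n / s\<rceil> - 1" using c1 by (simp add: j_def)
  have lt: "real j < r * 2 ^ n / s" "r * 2 ^ n / s \<le> real j + 1" unfolding j by linarith+
  have jr: "grid s n j < r" using lt(1) s by (simp add: grid_def field_simps)
  have rj: "r \<le> grid s n j + s / 2 ^ n" using lt(2) s by (simp add: grid_def field_simps)
  have "real j < 2 ^ n"
  proof -
    have "r * 2 ^ n / s \<le> 2 ^ n" using assms s by (simp add: field_simps)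
    with lt(1) show ?thesis by linarith
  qed
  then have "j < 2 ^ n" by (metis of_nat_less_iff of_nat_numeral of_nat_power)
  then have "grid s n j \<in> dyad s" unfolding dyad_def by (auto intro: less_imp_le)
  moreover have "0 \<le> grid s n j" using s by (simp add: grid_def)
  moreover have "dist (grid s n j) r < e" using jr rj se by (simp add: dist_real_def)
  ultimately show "\<exists>y\<in>dyad s \<inter> {0..<r}. dist y r < e" using jr by auto
qed

lemma zero_in_dyad: "0 \<in> dyad s"
  unfolding dyad_def by (auto intro!: exI[of _ 0] simp: grid_def)

lemma dyad_closure: "0 \<le> t \<Longrightarrow> t \<le> s \<Longrightarrow> t \<in> closure (dyad s)"
  using zero_in_dyad closure_subset dyad_dense_from_left[of t s] closure_mono[of "dyad s \<inter> {0..<t}" "dyad s"]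
  by (cases "t = 0") auto

section \<open>Brownian motion and its augmented filtration\<close>

lemma set_integral_eq_0_sigma:
  fixes \<xi> :: "'x \<Rightarrow> real"
  assumes \<xi>: "integrable N \<xi>" and G: "G \<subseteq> sets N" "Int_stable G" "space N \<in> G"
    and 0: "\<And>A. A \<in> G \<Longrightarrow> (LINT w:A|N. \<xi> w) = 0" and A: "A \<in> sigma_sets (space N) G"
  shows "(LINT w:A|N. \<xi> w) = 0"
proof -
  have GP: "G \<subseteq> Pow (space N)" using G(1) sets.sets_into_space by auto
  have sub: "sigma_sets (space N) G \<subseteq> sets N" using G(1) by (rule sets.sigma_sets_subset)
  have si: "set_integrable N B \<xi>" if "B \<in> sigma_sets (space N) G" for B
    unfolding set_integrable_def using that sub \<xi> by (intro integrable_mult_indicator) auto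
  show ?thesis using G(2) GP A
  proof (induction rule: sigma_sets_induct_disjoint)
    case (compl B)
    have "(LINT w:space N - B|N. \<xi> w) = (\<integral>w. indicator (space N) w *\<^sub>R \<xi> w - indicator B w *\<^sub>R \<xi> w \<partial>N)"
      unfolding set_lebesgue_integral_def
      by (intro LINT_cong) (auto split: split_indicator)
    also have "\<dots> = (LINT w:space N|N. \<xi> w) - (LINT w:B|N. \<xi> w)"
      using si[of "space N"] si[OF compl(1)] G(3) unfolding set_lebesgue_integral_def set_integrable_def
      by (intro Bochner_Integration.integral_diff) (auto intro: sigma_sets.Basic)
    finally have "(LINT w:space N - B|N. \<xi> w) = (LINT w:space N|N. \<xi> w) - (LINT w:B|N. \<xi> w)" .
    then show ?case using compl(2) 0[OF G(3)] by simp
  next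
    case (union A)
    have "(\<Union>i. A i) \<in> sigma_sets (space N) G" using union(2) by (intro sigma_sets.Union) auto
    then have "(LINT w:(\<Union>i. A i)|N. \<xi> w) = (\<Sum>i. (LINT w:(A i)|N. \<xi> w))"
      using union(1,2) sub by (intro lebesgue_integral_countable_add si) (auto simp: disjoint_family_on_def range_subsetD subsetD)
    then show ?case using union(3) by simp
  qed (use 0 in \<open>auto simp: set_lebesgue_integral_def\<close>)
qed

locale bm_horizon = brownian_motion M W + complete_measure M
  for M :: "'w measure" and W :: "real \<Rightarrow> 'w \<Rightarrow> real" +
  fixes T :: real
  assumes T_pos: "0 < T"
begin

abbreviation Fil :: "real \<Rightarrow> 'w measure" where "Fil \<equiv> aug_filtration M W"

lemma Fil_generator_Pow: "{W r -` S \<inter> space M | r S. r \<in> {0..t} \<and> S \<in> sets borel} \<union> null_sets M \<subseteq> Pow (space M)"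
  using sets.sets_into_space by fastforce

lemma space_Fil [simp]: "space (Fil t) = space M"
  unfolding aug_filtration_def using Fil_generator_Pow by (rule space_measure_of)

lemma sets_Fil: "sets (Fil t) = sigma_sets (space M)
    ({W r -` S \<inter> space M | r S. r \<in> {0..t} \<and> S \<in> sets borel} \<union> null_sets M)"
  unfolding aug_filtration_def using Fil_generator_Pow by (rule sets_measure_of)

lemma sets_Fil_subset: "sets (Fil t) \<subseteq> sets M"
  unfolding sets_Fil using W_measurable by (intro sets.sigma_sets_subset) (auto intro: measurable_sets)

lemma subalgebra_Fil: "subalgebra M (Fil t)"
  using sets_Fil_subset by (simp add: subalgebra_def)

lemma Fil_mono: "s \<le> t \<Longrightarrow> sets (Fil s) \<subseteq> sets (Fil t)"
  unfolding sets_Fil by (intro sigma_sets_subseteq Un_mono subset_refl) (auto intro: order_trans)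

lemma Fil_measurable_mono: "s \<le> t \<Longrightarrow> f \<in> measurable (Fil s) N \<Longrightarrow> f \<in> measurable (Fil t) N"
  using Fil_mono[of s t] unfolding measurable_def by auto

lemma Fil_measurable_M: "f \<in> measurable (Fil s) N \<Longrightarrow> f \<in> measurable M N"
  using subalgebra_Fil[of s] by (rule measurable_from_subalg)

lemma W_Fil: "0 \<le> r \<Longrightarrow> r \<le> t \<Longrightarrow> W r \<in> borel_measurable (Fil t)"
  by (rule measurableI) (auto simp: sets_Fil)

lemma null_sets_Fil: "A \<in> null_sets M \<Longrightarrow> A \<in> sets (Fil t)"
  by (simp add: sets_Fil sigma_sets.Basic)

text \<open>The filtration contains all null sets, so modifications on null sets stay adapted.\<close>

lemma Fil_cong_AE:
  assumes f: "f \<in> measurable (Fil t) N" and g: "\<And>w. w \<in> space M \<Longrightarrow> g w \<in> space N"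
    and eq: "AE w in M. f w = g w"
  shows "g \<in> measurable (Fil t) N"
proof (rule measurableI)
  fix S assume S: "S \<in> sets N"
  let ?N = "{w\<in>space M. f w \<noteq> g w}"
  have N: "?N \<in> null_sets M" using eq by (simp add: AE_iff_null_sets)
  then have N2: "g -` S \<inter> ?N \<in> null_sets M" by (rule complete2[rotated]) auto
  have "g -` S \<inter> space (Fil t) = ((f -` S \<inter> space (Fil t)) - ?N) \<union> (g -` S \<inter> ?N)" by auto
  also have "\<dots> \<in> sets (Fil t)"
    using measurable_sets[OF f S] null_sets_Fil[OF N] null_sets_Fil[OF N2] by (intro sets.Un sets.Diff)
  finally show "g -` S \<inter> space (Fil t) \<in> sets (Fil t)" .
qed (use g in auto)

text \<open>These sets form a \<open>\<pi>\<close>-system that generates the filtration up to null sets.\<close>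

definition below :: "(real \<times> real) set \<Rightarrow> 'w set" where
  "below J = {w \<in> space M. \<forall>(r, a)\<in>J. W r w \<le> a}"

lemma below_empty [simp]: "below {} = space M"
  by (simp add: below_def)

lemma below_Un: "below (J \<union> K) = below J \<inter> below K"
  by (auto simp: below_def)

lemma below_sets:
  assumes "finite J" "J \<subseteq> {0..t} \<times> UNIV"
  shows "below J \<in> sets (Fil t)"
  using assms
proof (induction J)
  case (insert p J)
  obtain r a where p: "p = (r, a)" by (cases p)
  have "W r -` {..a} \<inter> space (Fil t) \<in> sets (Fil t)"
    using insert(4) p by (intro measurable_sets[OF W_Fil]) auto
  moreover have "below {p} = W r -` {..a} \<inter> space (Fil t)" by (auto simp: below_def p)
  ultimately show ?case using insert below_Un[of "{p}" J] by simp
qed (use sets.top[of "Fil t"] in simp)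

lemma W_AE_limit:
  assumes "\<And>n. 0 \<le> s n" "s \<longlonglongrightarrow> r" "0 \<le> r"
  shows "AE w in M. (\<lambda>n. W (s n) w) \<longlonglongrightarrow> W r w"
  using W_continuous
proof eventually_elim
  case (elim w)
  then show ?case using assms unfolding continuous_on_sequentially by (auto simp: o_def)
qed

text \<open>Testing a conditional expectation given \<open>Fil t\<close> needs only countably many sets: finitely many
  times from a dense set \<open>D\<close> and rational levels. Path continuity recovers the other times up to a
  null set, and the augmentation absorbs null sets. A countable family of test sets is what allows
  statements for almost every time later on.\<close>

lemma set_integral_eq_0_Fil:
  fixes \<xi> :: "'w \<Rightarrow> real"
  assumes t: "0 \<le> t" and D: "D \<subseteq> {0..t}" "\<And>r. 0 < r \<Longrightarrow> r \<le> t \<Longrightarrow> r \<in> closure D"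
    and \<xi>: "integrable M \<xi>"
    and 0: "\<And>J. finite J \<Longrightarrow> J \<subseteq> D \<times> \<rat> \<Longrightarrow> (LINT w:below J|M. \<xi> w) = 0"
    and A: "A \<in> sets (Fil t)"
  shows "(LINT w:A|M. \<xi> w) = 0"
proof -
  define G where "G = below ` {J. finite J \<and> J \<subseteq> D \<times> \<rat>}"
  define H where "H = sigma (space M) G"
  have GM: "G \<subseteq> sets M"
  proof
    fix A assume "A \<in> G"
    then obtain J where J: "finite J" "J \<subseteq> D \<times> \<rat>" "A = below J" by (auto simp: G_def)
    then have "J \<subseteq> {0..t} \<times> UNIV" using D(1) by auto
    then show "A \<in> sets M" using below_sets[OF J(1)] sets_Fil_subset[of t] J(3) by blast
  qed
  have GP: "G \<subseteq> Pow (space M)" using GM sets.sets_into_space by auto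
  have sH[simp]: "space H = space M" and setsH: "sets H = sigma_sets (space M) G"
    unfolding H_def using GP by (auto intro: space_measure_of sets_measure_of)
  have HM: "sets H \<subseteq> sets M" unfolding setsH using GM by (rule sets.sigma_sets_subset)
  have WD: "W r \<in> borel_measurable H" if r: "r \<in> D" for r
    unfolding borel_measurable_iff_le
  proof
    fix a
    have "{w \<in> space H. W r w \<le> a} = {w \<in> space H. \<forall>q::rat. a < of_rat q \<longrightarrow> W r w \<le> of_rat q}"
    proof safe
      fix w assume *: "\<forall>q::rat. a < of_rat q \<longrightarrow> W r w \<le> of_rat q"
      show "W r w \<le> a"
      proof (rule ccontr)
        assume "\<not> W r w \<le> a"
        then obtain q where "a < of_rat q" "of_rat q < W r w" using of_rat_dense[of a "W r w"] by auto
        with * show False by force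
      qed
    qed auto
    also have "\<dots> \<in> sets H"
    proof (intro sets.sets_Collect_countable_All)
      fix q :: rat
      have "below {(r, of_rat q)} \<in> sets H" unfolding setsH G_def using r by (intro sigma_sets.Basic) auto
      moreover have "{w \<in> space H. a < of_rat q \<longrightarrow> W r w \<le> of_rat q}
          = (if a < of_rat q then below {(r, of_rat q)} else space H)"
        by (auto simp: below_def)
      ultimately show "{w \<in> space H. a < of_rat q \<longrightarrow> W r w \<le> of_rat q} \<in> sets H"
        using sets.top[of H] by (auto simp del: sH)
    qed
    finally show "{w \<in> space H. W r w \<le> a} \<in> sets H" .
  qed
  have Wr: "\<exists>f\<in>borel_measurable H. AE w in M. W r w = f w" if r: "r \<in> {0..t}" for r
  proof (cases "r = 0")
    case True
    then show ?thesis using W_zero by (intro bexI[of _ "\<lambda>_. 0"]) auto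
  next
    case False
    then obtain s where s: "\<And>n. s n \<in> D" "s \<longlonglongrightarrow> r"
      using D(2)[of r] r unfolding closure_sequential by auto
    have "AE w in M. W r w = lim (\<lambda>n. W (s n) w)"
      using W_AE_limit[of s r] s D(1) r by (auto elim!: eventually_mono simp: limI subset_iff)
    moreover have "(\<lambda>w. lim (\<lambda>n. W (s n) w)) \<in> borel_measurable H"
      using WD s(1) by (intro borel_measurable_lim_metric) auto
    ultimately show ?thesis by (rule bexI)
  qed
  have AB: "A \<in> sets M \<and> (\<exists>B\<in>sets H. AE w in M. w \<in> A \<longleftrightarrow> w \<in> B)"
    using A unfolding sets_Fil
  proof (induction rule: sigma_sets.induct)
    case (Basic A)
    then consider r S where "A = W r -` S \<inter> space M" "r \<in> {0..t}" "S \<in> sets borel" | "A \<in> null_sets M"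
      by auto
    then show ?case
    proof cases
      case 1
      obtain f where f: "f \<in> borel_measurable H" "AE w in M. W r w = f w" using Wr 1 by blast
      have "f -` S \<inter> space H \<in> sets H" using f 1 by (intro measurable_sets)
      moreover have "AE w in M. w \<in> A \<longleftrightarrow> w \<in> f -` S \<inter> space H"
        using f(2) AE_space by eventually_elim (simp add: 1)
      moreover have "A \<in> sets M" using 1 W_measurable by (auto intro: measurable_sets)
      ultimately show ?thesis by blast
    next
      case 2
      then have "AE w in M. w \<in> A \<longleftrightarrow> w \<in> {}" by (simp add: AE_not_in)
      then show ?thesis using 2 by blast
    qed
  next
    case Empty
    then show ?case by (auto intro!: bexI[of _ "{}"])
  next
    case (Compl A)
    then obtain B where B: "A \<in> sets M" "B \<in> sets H" "AE w in M. w \<in> A \<longleftrightarrow> w \<in> B" by blast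
    have "AE w in M. w \<in> space M - A \<longleftrightarrow> w \<in> space H - B"
      using B(3) by eventually_elim simp
    then show ?case using B by blast
  next
    case (Union A)
    then have "\<forall>i. \<exists>B. B \<in> sets H \<and> (AE w in M. w \<in> A i \<longleftrightarrow> w \<in> B)" by blast
    then obtain B where B: "\<And>i. B i \<in> sets H" "\<And>i. AE w in M. w \<in> A i \<longleftrightarrow> w \<in> B i" by metis
    have "AE w in M. \<forall>i. w \<in> A i \<longleftrightarrow> w \<in> B i" using B(2) by (simp add: AE_all_countable)
    then have "AE w in M. w \<in> (\<Union>i. A i) \<longleftrightarrow> w \<in> (\<Union>i. B i)" by eventually_elim auto
    moreover have "(\<Union>i. B i) \<in> sets H" "(\<Union>i. A i) \<in> sets M" using B Union by auto
    ultimately show ?case by blast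
  qed
  then obtain B where B: "B \<in> sets H" "AE w in M. w \<in> A \<longleftrightarrow> w \<in> B" by blast
  have "(LINT w:A|M. \<xi> w) = (LINT w:B|M. \<xi> w)"
    unfolding set_lebesgue_integral_def
  proof (rule integral_cong_AE)
    show "AE w in M. indicat_real A w *\<^sub>R \<xi> w = indicat_real B w *\<^sub>R \<xi> w"
      using B(2) by eventually_elim (simp split: split_indicator)
  qed (use AB B HM \<xi> in \<open>auto intro!: borel_measurable_scaleR borel_measurable_indicator\<close>)
  also have "\<dots> = 0"
  proof (rule set_integral_eq_0_sigma[OF \<xi> GM])
    show "Int_stable G"
      unfolding G_def
      by (rule Int_stableI, clarsimp, metis (no_types, lifting) below_Un finite_Un image_eqI le_sup_iff mem_Collect_eq)
    show "space M \<in> G" unfolding G_def by (intro image_eqI[of _ _ "{}"]) auto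
  qed (use 0 B in \<open>auto simp: G_def setsH\<close>)
  finally show ?thesis .
qed

section \<open>Independence and moments of increments\<close>

lemma distr_increment:
  assumes "0 \<le> s" "s < t"
  shows "distributed M lborel (\<lambda>w. W t w - W s w) (\<lambda>x. ennreal (normal_density 0 (sqrt (t - s)) x))"
  using W_normal assms .

lemma increment_measurable [measurable]:
  "0 \<le> s \<Longrightarrow> 0 \<le> t \<Longrightarrow> (\<lambda>w. W t w - W s w) \<in> borel_measurable M"
  using W_measurable by (intro borel_measurable_diff) auto

lemma W_grid_sum: "W (grid s n j) w = W 0 w + (\<Sum>i<j. W (grid s n (Suc i)) w - W (grid s n i) w)"
  using sum_lessThan_telescope[of "\<lambda>i. W (grid s n i) w" j] by simp

text \<open>The locale provides independence of the increments over a partition only. A set \<open>below J\<close> with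
  dyadic times is a function of the increments over one dyadic grid of \<open>[0, s]\<close>, which together with
  the increment from \<open>s\<close> to \<open>t\<close> form a partition; \<open>set_integral_eq_0_Fil\<close> extends this to \<open>Fil s\<close>.\<close>

lemma increment_indep_set:
  assumes s: "0 \<le> s" "s < t" and A: "A \<in> sets (Fil s)" and S: "S \<in> sets borel"
  shows "prob (A \<inter> ((\<lambda>w. W t w - W s w) -` S \<inter> space M)) = prob A * prob ((\<lambda>w. W t w - W s w) -` S \<inter> space M)"
proof -
  let ?B = "(\<lambda>w. W t w - W s w) -` S \<inter> space M"
  have B[measurable]: "?B \<in> events" using S s by (intro measurable_sets[OF increment_measurable]) auto
  define \<xi> where "\<xi> w = indicat_real ?B w - prob ?B" for w
  have AM: "A \<in> events" using A sets_Fil_subset by blast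
  have int: "integrable M \<xi>" unfolding \<xi>_def using B by (auto simp: emeasure_eq_measure)
  have calc: "(LINT w:C|M. \<xi> w) = prob (C \<inter> ?B) - prob C * prob ?B" if C: "C \<in> events" for C
  proof -
    have "(LINT w:C|M. \<xi> w) = (\<integral>w. indicat_real (C \<inter> ?B) w - indicat_real C w * prob ?B \<partial>M)"
      unfolding set_lebesgue_integral_def \<xi>_def
      by (intro LINT_cong) (auto split: split_indicator)
    also have "\<dots> = prob (C \<inter> ?B) - prob C * prob ?B"
      using B C by (subst Bochner_Integration.integral_diff)
        (auto intro!: integrable_mult_left integrable_real_indicator simp: emeasure_eq_measure)
    finally show ?thesis .
  qed
  have "(LINT w:A|M. \<xi> w) = 0"
  proof (cases "s = 0")
    case True
    show ?thesis
    proof (rule set_integral_eq_0_Fil[OF s(1) _ _ int _ A, of "{}"])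
      fix J :: "(real \<times> real) set" assume "J \<subseteq> {} \<times> \<rat>"
      then show "(LINT w:below J|M. \<xi> w) = 0"
        using calc[of "space M"] B sets.sets_into_space[OF B] by (simp add: prob_space Int_absorb1)
    qed (use True in auto)
  next
    case False
    with s have s0: "0 < s" by simp
    show ?thesis
    proof (rule set_integral_eq_0_Fil[OF s(1) _ _ int _ A, of "dyad s"])
      show "dyad s \<subseteq> {0..s}" using s by (intro dyad_range)
      show "r \<in> closure (dyad s)" if "0 < r" "r \<le> s" for r
        using dyad_dense_from_left[OF that] closure_mono[of "dyad s \<inter> {0..<r}" "dyad s"] by auto
    next
      fix J :: "(real \<times> real) set" assume J: "finite J" "J \<subseteq> dyad s \<times> \<rat>"
      have "finite (fst ` J)" "fst ` J \<subseteq> dyad s" using J by auto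
      from finite_dyad_common_grid[OF this] obtain n where
        "\<And>r. r \<in> fst ` J \<Longrightarrow> \<exists>j\<le>2^n. r = grid s n j" by blast
      then obtain jj where jj: "\<And>r. r \<in> fst ` J \<Longrightarrow> jj r \<le> 2^n \<and> r = grid s n (jj r)" by metis
      define \<tau> where "\<tau> i = (if i \<le> 2^n then grid s n i else t)" for i
      define \<Delta> where "\<Delta> i w = W (\<tau> (Suc i)) w - W (\<tau> i) w" for i w
      have "indep_vars (\<lambda>_. borel) \<Delta> {..<Suc (2^n)}"
        unfolding \<Delta>_def
      proof (rule W_indep)
        show "\<forall>i<Suc (2^n). \<tau> i < \<tau> (Suc i)"
          using grid_less[OF s0] s by (auto simp: \<tau>_def not_le less_Suc_eq_le dest!: le_antisym)
      qed (auto simp: \<tau>_def)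
      then have ind: "indep_var (PiM {..<2^n} (\<lambda>_. borel)) (\<lambda>w. restrict (\<lambda>i. \<Delta> i w) {..<2^n})
          (PiM {2^n} (\<lambda>_. borel)) (\<lambda>w. restrict (\<lambda>i. \<Delta> i w) {2^n})"
        by (rule indep_var_restrict) auto
      define Y1 :: "(nat \<Rightarrow> real) \<Rightarrow> real" where
        "Y1 x = (\<Prod>(r,a)\<in>J. indicator {..a} (\<Sum>i<jj r. x i))" for x
      define Y2 :: "(nat \<Rightarrow> real) \<Rightarrow> real" where "Y2 x = indicator S (x (2^n))" for x
      have Y1m: "Y1 \<in> borel_measurable (PiM {..<2^n} (\<lambda>_. borel))"
        unfolding Y1_def
      proof (rule borel_measurable_prod)
        fix p assume p: "p \<in> J"
        obtain r a where ra: "p = (r, a)" by (cases p)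
        have "jj r \<le> 2^n" using jj[of r] p ra by force
        then have "(\<lambda>x. \<Sum>i<jj r. x i) \<in> borel_measurable (PiM {..<2^n} (\<lambda>_. borel :: real measure))"
          by (intro borel_measurable_sum measurable_component_singleton) auto
        then show "(\<lambda>x. case p of (r, a) \<Rightarrow> indicat_real {..a} (\<Sum>i<jj r. x i)) \<in> borel_measurable (PiM {..<2^n} (\<lambda>_. borel))"
          unfolding ra by simp
      qed
      have Y2m: "Y2 \<in> borel_measurable (PiM {2^n} (\<lambda>_. borel))"
        unfolding Y2_def using S measurable_component_singleton[of "2^n" "{2^n}" "\<lambda>_. borel :: real measure"] by simp
      let ?X1 = "Y1 \<circ> (\<lambda>w. restrict (\<lambda>i. \<Delta> i w) {..<2^n})" and ?X2 = "Y2 \<circ> (\<lambda>w. restrict (\<lambda>i. \<Delta> i w) {2^n})"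
      have iv: "indep_var borel ?X1 borel ?X2" by (rule indep_var_compose[OF ind Y1m Y2m])
      have X1eq: "AE w in M. ?X1 w = indicator (below J) w"
        using W_zero AE_space
      proof eventually_elim
        case (elim w)
        have "(\<Sum>i<jj r. restrict (\<lambda>i. \<Delta> i w) {..<2^n} i) = W r w" if "r \<in> fst ` J" for r
        proof -
          have "(\<Sum>i<jj r. restrict (\<lambda>i. \<Delta> i w) {..<2^n} i) = (\<Sum>i<jj r. W (grid s n (Suc i)) w - W (grid s n i) w)"
            using jj[OF that] by (intro sum.cong) (auto simp: \<Delta>_def \<tau>_def)
          also have "\<dots> = W (grid s n (jj r)) w" using W_grid_sum[of s n "jj r" w] elim by simp
          finally show ?thesis using jj[OF that] by simp
        qed
        then have "?X1 w = (\<Prod>(r,a)\<in>J. indicator {..a} (W r w))"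
          unfolding Y1_def o_def by (intro prod.cong refl) (auto simp: image_iff split: prod.splits, force)
        also have "\<dots> = indicator (below J) w"
        proof (cases "w \<in> below J")
          case True
          then show ?thesis by (simp add: below_def, intro prod.neutral, auto)
        next
          case False
          then obtain r a where "(r, a) \<in> J" "\<not> W r w \<le> a" using elim by (auto simp: below_def)
          then have "(\<Prod>(r,a)\<in>J. indicat_real {..a} (W r w)) = 0"
            using J(1) by (intro prod_zero) (auto intro!: bexI[of _ "(r, a)"])
          then show ?thesis using False by simp
        qed
        finally show ?case .
      qed
      have X2eq: "?X2 w = indicator ?B w" if "w \<in> space M" for w
        using that by (auto simp: Y2_def \<Delta>_def \<tau>_def split: split_indicator)
      have bJ: "below J \<in> events" using below_sets[of J s] J dyad_range[OF s(1)] sets_Fil_subset by blast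
      have X1m: "?X1 \<in> borel_measurable M" and X2m: "?X2 \<in> borel_measurable M"
        using iv by (auto dest: indep_var_rv1 indep_var_rv2)
      have "integrable M ?X1 \<longleftrightarrow> integrable M (indicat_real (below J))"
        using X1eq X1m bJ by (intro integrable_cong_AE) auto
      then have I1: "integrable M ?X1" using bJ by (simp add: emeasure_eq_measure)
      have "integrable M ?X2 \<longleftrightarrow> integrable M (indicat_real ?B)"
        using X2eq by (intro Bochner_Integration.integrable_cong) auto
      then have I2: "integrable M ?X2" using B by (simp add: emeasure_eq_measure)
      have "prob (below J \<inter> ?B) = (\<integral>w. indicat_real (below J) w * indicator ?B w \<partial>M)"
        using bJ by (simp add: indicator_inter_arith[symmetric])
      also have "\<dots> = (\<integral>w. ?X1 w * ?X2 w \<partial>M)"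
      proof (rule integral_cong_AE)
        show "AE w in M. indicat_real (below J) w * indicator ?B w = ?X1 w * ?X2 w"
          using X1eq AE_space by eventually_elim (simp only: X2eq)
      qed (use bJ X1m X2m in measurable)
      also have "\<dots> = (\<integral>w. ?X1 w \<partial>M) * (\<integral>w. ?X2 w \<partial>M)"
        by (rule indep_var_lebesgue_integral[OF iv I1 I2])
      also have "(\<integral>w. ?X1 w \<partial>M) = (\<integral>w. indicat_real (below J) w \<partial>M)"
        using X1eq bJ by (intro integral_cong_AE X1m borel_measurable_indicator)
      also have "(\<integral>w. ?X2 w \<partial>M) = (\<integral>w. indicat_real ?B w \<partial>M)"
        using X2eq by (intro LINT_cong) auto
      finally show "(LINT w:below J|M. \<xi> w) = 0" using calc[OF bJ] bJ B by simp
    qed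
  qed
  then show ?thesis using calc[OF AM] by simp
qed

lemma indep_var_increment:
  assumes s: "0 \<le> s" "s < t" and \<zeta>: "\<zeta> \<in> measurable (Fil s) N" and g: "g \<in> measurable borel N'"
  shows "indep_var N \<zeta> N' (\<lambda>w. g (W t w - W s w))"
proof -
  let ?\<Delta> = "\<lambda>w. g (W t w - W s w)"
  have "random_variable borel (\<lambda>w. W t w - W s w)" using s by simp
  then have rv: "random_variable N \<zeta>" "random_variable N' ?\<Delta>"
    using Fil_measurable_M[OF \<zeta>] measurable_compose[OF _ g] by auto
  show ?thesis unfolding indep_var_eq
  proof (intro conjI rv indep_set_sigma_sets)
    show "indep_set {\<zeta> -` A \<inter> space M |A. A \<in> sets N} {?\<Delta> -` A \<inter> space M |A. A \<in> sets N'}"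
    proof (rule indep_setI)
      fix a b assume "a \<in> {\<zeta> -` A \<inter> space M |A. A \<in> sets N}" "b \<in> {?\<Delta> -` A \<inter> space M |A. A \<in> sets N'}"
      then obtain A S where a: "a = \<zeta> -` A \<inter> space M" "A \<in> sets N" and S: "b = ?\<Delta> -` S \<inter> space M" "S \<in> sets N'"
        by blast
      have b: "b = (\<lambda>w. W t w - W s w) -` (g -` S) \<inter> space M" "g -` S \<in> sets borel"
        using S measurable_sets[OF g S(2)] by auto
      have "a \<in> sets (Fil s)" using measurable_sets[OF \<zeta> a(2)] a(1) by simp
      from increment_indep_set[OF s this b(2)] show "prob (a \<inter> b) = prob a * prob b" using b(1) by simp
    qed (use rv in \<open>auto intro: measurable_sets\<close>)
    show "Int_stable {\<zeta> -` A \<inter> space M |A. A \<in> sets N}"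
    proof (safe intro!: Int_stableI)
      fix A B assume "A \<in> sets N" "B \<in> sets N"
      then show "\<exists>C. \<zeta> -` A \<inter> space M \<inter> (\<zeta> -` B \<inter> space M) = \<zeta> -` C \<inter> space M \<and> C \<in> sets N"
        by (intro exI[of _ "A \<inter> B"]) auto
    qed
    show "Int_stable {?\<Delta> -` A \<inter> space M |A. A \<in> sets N'}"
    proof (safe intro!: Int_stableI)
      fix A B assume "A \<in> sets N'" "B \<in> sets N'"
      then show "\<exists>C. ?\<Delta> -` A \<inter> space M \<inter> (?\<Delta> -` B \<inter> space M) = ?\<Delta> -` C \<inter> space M \<and> C \<in> sets N'"
        by (intro exI[of _ "A \<inter> B"]) auto
    qed
  qed
qed

lemma
  fixes \<eta> :: "'w \<Rightarrow> 'b::{real_normed_field, banach, second_countable_topology}"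
  assumes s: "0 \<le> s" "s < t" and \<eta>: "\<eta> \<in> borel_measurable (Fil s)" "integrable M \<eta>"
    and g: "g \<in> borel_measurable borel" "integrable M (\<lambda>w. g (W t w - W s w))"
  shows increment_factor_integrable: "integrable M (\<lambda>w. \<eta> w * g (W t w - W s w))"
    and increment_factor_integral: "(\<integral>w. \<eta> w * g (W t w - W s w) \<partial>M)
      = (\<integral>w. \<eta> w \<partial>M) * (\<integral>w. g (W t w - W s w) \<partial>M)"
proof -
  have iv: "indep_var borel \<eta> borel (\<lambda>w. g (W t w - W s w))"
    by (rule indep_var_increment[OF s \<eta>(1) g(1)])
  show "integrable M (\<lambda>w. \<eta> w * g (W t w - W s w))"
    by (rule indep_var_integrable[OF iv \<eta>(2) g(2)])
  show "(\<integral>w. \<eta> w * g (W t w - W s w) \<partial>M) = (\<integral>w. \<eta> w \<partial>M) * (\<integral>w. g (W t w - W s w) \<partial>M)"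
    by (rule indep_var_lebesgue_integral[OF iv \<eta>(2) g(2)])
qed

lemma
  assumes s: "0 \<le> s" "s < t"
  shows increment_power_integrable: "integrable M (\<lambda>w. (W t w - W s w) ^ k)"
    and increment_mean: "(\<integral>w. W t w - W s w \<partial>M) = 0"
    and increment_second_moment: "(\<integral>w. (W t w - W s w)\<^sup>2 \<partial>M) = t - s"
    and increment_fourth_moment: "(\<integral>w. (W t w - W s w) ^ 4 \<partial>M) = 3 * (t - s)\<^sup>2"
    and increment_char: "(\<integral>w. iexp (f * (W t w - W s w)) \<partial>M) = exp (- (f\<^sup>2 * (t - s) / 2))"
proof -
  define \<sigma> where "\<sigma> = sqrt (t - s)"
  have \<sigma>: "0 < \<sigma>" "\<sigma>\<^sup>2 = t - s" using s by (auto simp: \<sigma>_def)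
  let ?\<Delta> = "\<lambda>w. W t w - W s w"
  have D: "distributed M lborel ?\<Delta> (\<lambda>x. ennreal (normal_density 0 \<sigma> x))"
    using distr_increment[OF s] by (simp add: \<sigma>_def)
  have int: "(\<integral>w. ?\<Delta> w ^ k \<partial>M) = (\<integral>x. normal_density 0 \<sigma> x * x ^ k \<partial>lborel)" for k
    using distributed_integral[OF D, of "\<lambda>x. x ^ k"] by simp
  show "integrable M (\<lambda>w. ?\<Delta> w ^ k)"
    using distributed_integrable[OF D, of "\<lambda>x. x ^ k"] integrable_normal_moment[OF \<sigma>(1), of 0 k] by simp
  show "(\<integral>w. ?\<Delta> w \<partial>M) = 0"
    using int[of 1] integral_normal_moment_odd[OF \<sigma>(1), of 0 0] by simp
  show "(\<integral>w. (?\<Delta> w)\<^sup>2 \<partial>M) = t - s"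
    using int[of 2] integral_normal_moment_even[OF \<sigma>(1), of 0 1] \<sigma> by (simp add: fact_numeral)
  show "(\<integral>w. (?\<Delta> w) ^ 4 \<partial>M) = 3 * (t - s)\<^sup>2"
    using int[of 4] integral_normal_moment_even[OF \<sigma>(1), of 0 2] \<sigma> by (simp add: fact_numeral power2_eq_square)
  have D': "distributed M lborel (\<lambda>w. ?\<Delta> w / \<sigma>) std_normal_density"
    using D normal_standard_normal_convert[OF \<sigma>(1), of ?\<Delta> 0] by simp
  have "(\<integral>w. iexp (f * ?\<Delta> w) \<partial>M) = (\<integral>w. iexp ((f * \<sigma>) * (?\<Delta> w / \<sigma>)) \<partial>M)"
    using \<sigma>(1) by simp
  also have "\<dots> = (\<integral>x. iexp ((f * \<sigma>) * x) \<partial>distr M lborel (\<lambda>w. ?\<Delta> w / \<sigma>))"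
    using distributed_measurable[OF D'] by (subst integral_distr) auto
  also have "\<dots> = char std_normal_distribution (f * \<sigma>)"
    unfolding distributed_distr_eq_density[OF D'] char_def by simp
  also have "\<dots> = exp (- (f\<^sup>2 * (t - s) / 2))"
    by (simp add: char_std_normal_distribution power_mult_distrib \<sigma>(2))
  finally show "(\<integral>w. iexp (f * ?\<Delta> w) \<partial>M) = exp (- (f\<^sup>2 * (t - s) / 2))" .
qed

end

section \<open>The Hilbert space of adapted processes\<close>

type_synonym ('w, 'a) process = "real \<Rightarrow> 'w \<Rightarrow> 'a"

sublocale bm_horizon \<subseteq> TI: finite_measure "lebesgue_on {0..T}"
  by (rule finite_measure_lebesgue_on) simp

sublocale bm_horizon \<subseteq> LM: pair_sigma_finite "lebesgue_on {0..T}" M ..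

context bm_horizon
begin

abbreviation "TI \<equiv> lebesgue_on {0..T}"
abbreviation "LM \<equiv> TI \<Otimes>\<^sub>M M"
abbreviation "L2P \<equiv> L2F M W T"

text \<open>Being adapted and jointly measurable is measurability with respect to one \<open>\<sigma>\<close>-algebra. Hence the
  space \<open>L2F\<close> is the space \<open>L2\<close> of a measure, and completeness and Riesz' theorem carry over.\<close>

definition ADP :: "(real \<times> 'w) measure" where
  "ADP = sigma ({0..T} \<times> space M) {A \<in> sets LM. \<forall>t\<in>{0..T}. {w \<in> space M. (t, w) \<in> A} \<in> sets (Fil t)}"

definition PM :: "(real \<times> 'w) measure" where "PM = restr_to_subalg LM ADP"

lemma space_LM: "space LM = {0..T} \<times> space M"
  by (simp add: space_pair_measure)

lemma ADP_generator_Pow: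
  "{A \<in> sets LM. \<forall>t\<in>{0..T}. {w \<in> space M. (t, w) \<in> A} \<in> sets (Fil t)} \<subseteq> Pow ({0..T} \<times> space M)"
  using sets.sets_into_space[of _ LM] by (auto simp: space_LM)

lemma space_ADP [simp]: "space ADP = {0..T} \<times> space M"
  unfolding ADP_def by (rule space_measure_of[OF ADP_generator_Pow])

lemma sets_ADP: "sets ADP = {A \<in> sets LM. \<forall>t\<in>{0..T}. {w \<in> space M. (t, w) \<in> A} \<in> sets (Fil t)}"
proof -
  let ?A = "{A \<in> sets LM. \<forall>t\<in>{0..T}. {w \<in> space M. (t, w) \<in> A} \<in> sets (Fil t)}"
  have "sigma_algebra ({0..T} \<times> space M) ?A"
    unfolding sigma_algebra_iff2
  proof (intro conjI ballI allI impI ADP_generator_Pow)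
    fix A assume A: "A \<in> ?A"
    show "{0..T} \<times> space M - A \<in> ?A"
    proof (intro CollectI conjI ballI)
      show "{0..T} \<times> space M - A \<in> sets LM" using A space_LM by (metis (no_types, lifting) mem_Collect_eq sets.compl_sets)
      fix t assume t: "t \<in> {0..T}"
      have "{w \<in> space M. (t, w) \<in> {0..T} \<times> space M - A} = space (Fil t) - {w \<in> space M. (t, w) \<in> A}"
        using t by auto
      then show "{w \<in> space M. (t, w) \<in> {0..T} \<times> space M - A} \<in> sets (Fil t)" using A t by (metis (no_types, lifting) mem_Collect_eq sets.compl_sets)
    qed
  next
    fix A :: "nat \<Rightarrow> _" assume A: "range A \<subseteq> ?A"
    show "(\<Union>i. A i) \<in> ?A"
    proof (intro CollectI conjI ballI)
      show "(\<Union>i. A i) \<in> sets LM" using A by (intro sets.countable_UN) auto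
      fix t assume t: "t \<in> {0..T}"
      have "{w \<in> space M. (t, w) \<in> (\<Union>i. A i)} = (\<Union>i. {w \<in> space M. (t, w) \<in> A i})" by auto
      also have "\<dots> \<in> sets (Fil t)" using A t by (intro sets.countable_UN) auto
      finally show "{w \<in> space M. (t, w) \<in> (\<Union>i. A i)} \<in> sets (Fil t)" .
    qed
  qed auto
  then show ?thesis unfolding ADP_def by (rule sigma_algebra.sets_measure_of_eq)
qed

lemma subalgebra_ADP: "subalgebra LM ADP"
  unfolding subalgebra_def by (auto simp: sets_ADP space_LM)

lemma measurable_ADP_iff:
  "f \<in> measurable ADP N \<longleftrightarrow> f \<in> measurable LM N \<and> (\<forall>t\<in>{0..T}. (\<lambda>w. f (t, w)) \<in> measurable (Fil t) N)"
proof safe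
  assume f: "f \<in> measurable ADP N"
  then show "f \<in> measurable LM N" by (rule measurable_from_subalg[OF subalgebra_ADP])
  fix t assume t: "t \<in> {0..T}"
  show "(\<lambda>w. f (t, w)) \<in> measurable (Fil t) N"
  proof (rule measurableI)
    fix S assume S: "S \<in> sets N"
    have "{w \<in> space M. (t, w) \<in> f -` S \<inter> space ADP} \<in> sets (Fil t)"
      using measurable_sets[OF f S] t unfolding sets_ADP by blast
    moreover have "{w \<in> space M. (t, w) \<in> f -` S \<inter> space ADP} = (\<lambda>w. f (t, w)) -` S \<inter> space (Fil t)"
      using t by auto
    ultimately show "(\<lambda>w. f (t, w)) -` S \<inter> space (Fil t) \<in> sets (Fil t)" by simp
  qed (use measurable_space[OF f] t in auto)
next
  assume f: "f \<in> measurable LM N" "\<forall>t\<in>{0..T}. (\<lambda>w. f (t, w)) \<in> measurable (Fil t) N"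
  show "f \<in> measurable ADP N"
  proof (rule measurableI)
    fix S assume S: "S \<in> sets N"
    show "f -` S \<inter> space ADP \<in> sets ADP"
      unfolding sets_ADP
    proof (intro CollectI conjI ballI)
      show "f -` S \<inter> space ADP \<in> sets LM" using measurable_sets[OF f(1) S] by (simp add: space_LM)
      fix t assume t: "t \<in> {0..T}"
      have "(\<lambda>w. f (t, w)) -` S \<inter> space (Fil t) \<in> sets (Fil t)" using f(2) t S by (intro measurable_sets) auto
      moreover have "{w \<in> space M. (t, w) \<in> f -` S \<inter> space ADP} = (\<lambda>w. f (t, w)) -` S \<inter> space (Fil t)"
        using t by auto
      ultimately show "{w \<in> space M. (t, w) \<in> f -` S \<inter> space ADP} \<in> sets (Fil t)" by simp
    qed
  qed (use measurable_space[OF f(1)] in \<open>auto simp: space_LM\<close>)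
qed

lemma measurable_PM: "measurable PM N = measurable ADP N"
  unfolding PM_def by (rule measurable_cong_sets) (simp_all add: sets_restr_to_subalg subalgebra_ADP)

lemma nn_integral_PM: "f \<in> borel_measurable ADP \<Longrightarrow> (\<integral>\<^sup>+p. f p \<partial>PM) = (\<integral>\<^sup>+p. f p \<partial>LM)"
  unfolding PM_def by (rule nn_integral_subalgebra2[OF subalgebra_ADP])

lemma integral_PM:
  fixes f :: "_ \<Rightarrow> 'b::{banach, second_countable_topology}"
  shows "f \<in> borel_measurable ADP \<Longrightarrow> (\<integral>p. f p \<partial>PM) = (\<integral>p. f p \<partial>LM)"
  unfolding PM_def by (rule integral_subalgebra2[OF subalgebra_ADP])

lemma integrable_PM:
  fixes f :: "_ \<Rightarrow> 'b::{banach, second_countable_topology}"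
  assumes "integrable PM f" shows "integrable LM f"
  using integrable_from_subalg[OF subalgebra_ADP] assms unfolding PM_def .

lemma L2P_iff: "\<phi> \<in> L2P \<longleftrightarrow> case_prod \<phi> \<in> L2 PM"
proof -
  have ad: "case_prod \<phi> \<in> borel_measurable ADP \<longleftrightarrow> (\<forall>t\<in>{0..T}. \<phi> t \<in> borel_measurable (Fil t)) \<and>
      (\<lambda>(s, w). \<phi> s w) \<in> borel_measurable LM"
    by (auto simp: measurable_ADP_iff)
  have "(\<integral>\<^sup>+w. (\<integral>\<^sup>+s. sqn (\<phi> s w) \<partial>TI) \<partial>M) = (\<integral>\<^sup>+p. sqn (case_prod \<phi> p) \<partial>PM)"
    if "case_prod \<phi> \<in> borel_measurable ADP"
  proof -
    have [measurable]: "case_prod \<phi> \<in> borel_measurable LM" "case_prod \<phi> \<in> borel_measurable ADP"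
      using that by (auto simp: measurable_ADP_iff)
    have "(\<integral>\<^sup>+p. sqn (case_prod \<phi> p) \<partial>PM) = (\<integral>\<^sup>+p. sqn (case_prod \<phi> p) \<partial>LM)"
      by (intro nn_integral_PM) measurable
    also have "\<dots> = (\<integral>\<^sup>+w. (\<integral>\<^sup>+s. sqn (case_prod \<phi> (s, w)) \<partial>TI) \<partial>M)"
      by (intro LM.nn_integral_snd[symmetric]) measurable
    finally show ?thesis by simp
  qed
  then show ?thesis
    unfolding L2F_def L2_iff_nn_integral measurable_PM using ad by auto
qed

lemma L2P_adapted: "\<phi> \<in> L2P \<Longrightarrow> t \<in> {0..T} \<Longrightarrow> \<phi> t \<in> borel_measurable (Fil t)"
  by (simp add: L2F_def)

lemma L2P_measurable: "\<phi> \<in> L2P \<Longrightarrow> case_prod \<phi> \<in> borel_measurable LM"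
  by (simp add: L2F_def)

lemma L2P_measurable_path:
  assumes "\<phi> \<in> L2P" "w \<in> space M" shows "(\<lambda>s. \<phi> s w) \<in> borel_measurable TI"
  using measurable_compose[OF measurable_Pair2'[OF assms(2)] L2P_measurable[OF assms(1)]] by simp

lemma L2P_measurable_at:
  assumes "\<phi> \<in> L2P" "s \<in> {0..T}" shows "\<phi> s \<in> borel_measurable M"
  using L2P_adapted[OF assms] by (rule Fil_measurable_M)

text \<open>Inner product and norm of \<open>L2F\<close>, for curried processes.\<close>

definition IP :: "('w, 'a::euclidean_space) process \<Rightarrow> ('w, 'a) process \<Rightarrow> real" where
  "IP \<phi> \<psi> = ip PM (case_prod \<phi>) (case_prod \<psi>)"

definition NR :: "('w, 'a::euclidean_space) process \<Rightarrow> real" where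
  "NR \<phi> = nrm PM (case_prod \<phi>)"

abbreviation DR :: "('w, 'a::euclidean_space) process \<Rightarrow> ('w, 'a) process \<Rightarrow> real" where
  "DR \<phi> \<psi> \<equiv> NR (\<lambda>s w. \<phi> s w - \<psi> s w)"

lemma case_prod_add: "case_prod (\<lambda>s w. \<phi> s w + \<psi> s w) = (\<lambda>p. case_prod \<phi> p + case_prod \<psi> p)"
  and case_prod_diff: "case_prod (\<lambda>s w. \<phi>' s w - \<psi>' s w) = (\<lambda>p. case_prod \<phi>' p - case_prod \<psi>' p)"
  and case_prod_scaleR: "case_prod (\<lambda>s w. r *\<^sub>R \<theta> s w) = (\<lambda>p. r *\<^sub>R case_prod \<theta> p)"
  and case_prod_zero: "case_prod (\<lambda>s w. c) = (\<lambda>p. c)"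
  by (auto simp: fun_eq_iff)

lemmas case_prod_simps = case_prod_add case_prod_diff case_prod_scaleR case_prod_zero

lemma case_prod_curry: "case_prod (\<lambda>s w. f (s, w)) = f"
  by auto

lemma L2P_zero [simp]: "(\<lambda>s w. 0) \<in> L2P"
  by (simp add: L2P_iff case_prod_simps)
lemma L2P_add: "\<phi> \<in> L2P \<Longrightarrow> \<psi> \<in> L2P \<Longrightarrow> (\<lambda>s w. \<phi> s w + \<psi> s w) \<in> L2P"
  unfolding L2P_iff case_prod_simps by (rule L2_add)
lemma L2P_diff: "\<phi> \<in> L2P \<Longrightarrow> \<psi> \<in> L2P \<Longrightarrow> (\<lambda>s w. \<phi> s w - \<psi> s w) \<in> L2P"
  unfolding L2P_iff case_prod_simps by (rule L2_diff)
lemma L2P_scaleR: "\<phi> \<in> L2P \<Longrightarrow> (\<lambda>s w. r *\<^sub>R \<phi> s w) \<in> L2P"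
  unfolding L2P_iff case_prod_simps by (rule L2_scaleR)

lemma IP_commute: "IP \<phi> \<psi> = IP \<psi> \<phi>"
  by (simp add: IP_def ip_commute)
lemma IP_add_left: "\<phi> \<in> L2P \<Longrightarrow> \<psi> \<in> L2P \<Longrightarrow> \<theta> \<in> L2P \<Longrightarrow> IP (\<lambda>s w. \<phi> s w + \<psi> s w) \<theta> = IP \<phi> \<theta> + IP \<psi> \<theta>"
  unfolding L2P_iff IP_def case_prod_simps by (rule ip_add_left)
lemma IP_diff_left: "\<phi> \<in> L2P \<Longrightarrow> \<psi> \<in> L2P \<Longrightarrow> \<theta> \<in> L2P \<Longrightarrow> IP (\<lambda>s w. \<phi> s w - \<psi> s w) \<theta> = IP \<phi> \<theta> - IP \<psi> \<theta>"
  unfolding L2P_iff IP_def case_prod_simps by (rule ip_diff_left)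
lemma IP_add_right: "\<phi> \<in> L2P \<Longrightarrow> \<psi> \<in> L2P \<Longrightarrow> \<theta> \<in> L2P \<Longrightarrow> IP \<theta> (\<lambda>s w. \<phi> s w + \<psi> s w) = IP \<theta> \<phi> + IP \<theta> \<psi>"
  unfolding L2P_iff IP_def case_prod_simps by (rule ip_add_right)
lemma IP_diff_right: "\<phi> \<in> L2P \<Longrightarrow> \<psi> \<in> L2P \<Longrightarrow> \<theta> \<in> L2P \<Longrightarrow> IP \<theta> (\<lambda>s w. \<phi> s w - \<psi> s w) = IP \<theta> \<phi> - IP \<theta> \<psi>"
  unfolding L2P_iff IP_def case_prod_simps by (rule ip_diff_right)
lemma IP_scaleR_left: "IP (\<lambda>s w. r *\<^sub>R \<phi> s w) \<theta> = r * IP \<phi> \<theta>"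
  unfolding IP_def case_prod_simps by (rule ip_scaleR_left)
lemma IP_scaleR_right: "IP \<theta> (\<lambda>s w. r *\<^sub>R \<phi> s w) = r * IP \<theta> \<phi>"
  unfolding IP_def case_prod_simps by (rule ip_scaleR_right)

lemma IP_self_nonneg [simp]: "0 \<le> IP \<phi> \<phi>"
  by (simp add: IP_def)
lemma NR_nonneg [simp]: "0 \<le> NR \<phi>"
  by (simp add: NR_def)
lemma NR_power2: "(NR \<phi>)\<^sup>2 = IP \<phi> \<phi>"
  by (simp add: NR_def IP_def nrm_power2)
lemma NR_def_IP: "NR \<phi> = sqrt (IP \<phi> \<phi>)"
  by (simp add: NR_def IP_def nrm_def)
lemma IP_Cauchy_Schwarz: "\<phi> \<in> L2P \<Longrightarrow> \<psi> \<in> L2P \<Longrightarrow> \<bar>IP \<phi> \<psi>\<bar> \<le> NR \<phi> * NR \<psi>"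
  by (simp add: L2P_iff IP_def NR_def ip_Cauchy_Schwarz)
lemma NR_triangle: "\<phi> \<in> L2P \<Longrightarrow> \<psi> \<in> L2P \<Longrightarrow> NR (\<lambda>s w. \<phi> s w + \<psi> s w) \<le> NR \<phi> + NR \<psi>"
  unfolding L2P_iff NR_def case_prod_simps by (rule nrm_triangle)
lemma NR_triangle_diff: "\<phi> \<in> L2P \<Longrightarrow> \<psi> \<in> L2P \<Longrightarrow> \<theta> \<in> L2P \<Longrightarrow>
    DR \<phi> \<psi> \<le> DR \<phi> \<theta> + DR \<theta> \<psi>"
  unfolding L2P_iff NR_def case_prod_simps by (rule nrm_triangle_diff)
lemma NR_minus: "DR \<phi> \<psi> = DR \<psi> \<phi>"
  unfolding NR_def case_prod_simps by (rule nrm_minus)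

lemma tendsto_IP:
  assumes "\<And>n. F n \<in> L2P" "f \<in> L2P" "(\<lambda>n. DR (F n) f) \<longlonglongrightarrow> 0"
    and "\<And>n. G n \<in> L2P" "g \<in> L2P" "(\<lambda>n. DR (G n) g) \<longlonglongrightarrow> 0"
  shows "(\<lambda>n. IP (F n) (G n)) \<longlonglongrightarrow> IP f g"
  using assms unfolding L2P_iff NR_def IP_def case_prod_simps by (rule tendsto_nrm_ip)

lemma L2P_complete:
  fixes F :: "nat \<Rightarrow> ('w, 'a::euclidean_space) process"
  assumes F: "\<And>n. F n \<in> L2P"
    and "\<And>e. e > 0 \<Longrightarrow> \<exists>n0. \<forall>m\<ge>n0. \<forall>n\<ge>n0. DR (F m) (F n) < e"
  shows "\<exists>f\<in>L2P. (\<lambda>n. DR (F n) f) \<longlonglongrightarrow> 0"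
proof -
  obtain f where "f \<in> L2 PM" "(\<lambda>n. dst PM (case_prod (F n)) f) \<longlonglongrightarrow> 0"
    using L2_complete[of "\<lambda>n. case_prod (F n)" PM] assms unfolding L2P_iff NR_def case_prod_simps by blast
  then show ?thesis
    by (intro bexI[of _ "\<lambda>s w. f (s, w)"]) (simp_all add: L2P_iff NR_def case_prod_simps case_prod_curry)
qed

lemma L2P_Riesz:
  fixes l :: "('w, 'a::euclidean_space) process \<Rightarrow> real"
  assumes ladd: "\<And>\<phi> \<psi>. \<phi> \<in> L2P \<Longrightarrow> \<psi> \<in> L2P \<Longrightarrow> l (\<lambda>s w. \<phi> s w + \<psi> s w) = l \<phi> + l \<psi>"
    and lscale: "\<And>\<phi> r. \<phi> \<in> L2P \<Longrightarrow> l (\<lambda>s w. r *\<^sub>R \<phi> s w) = r * l \<phi>"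
    and lbound: "\<And>\<phi>. \<phi> \<in> L2P \<Longrightarrow> \<bar>l \<phi>\<bar> \<le> C * NR \<phi>"
  shows "\<exists>\<psi>\<in>L2P. \<forall>\<phi>\<in>L2P. l \<phi> = IP \<psi> \<phi>"
proof -
  have c: "(\<lambda>s w. f (s, w)) \<in> L2P" if "f \<in> L2 PM" for f :: "_ \<Rightarrow> 'a"
    using that by (simp add: L2P_iff case_prod_curry)
  have "\<exists>g\<in>L2 PM. (\<forall>f\<in>L2 PM. l (\<lambda>s w. f (s, w)) = ip PM g f) \<and>
    (\<exists>F. (\<forall>n. F n \<in> L2 PM) \<and> (\<lambda>n. dst PM (F n) g) \<longlonglongrightarrow> 0)"
  proof (rule L2_Riesz_subspace)
    show "\<bar>l (\<lambda>s w. f (s, w))\<bar> \<le> C * nrm PM f" if "f \<in> L2 PM" for f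
      using lbound[OF c[OF that]] by (simp add: NR_def case_prod_curry)
  qed (auto intro: L2_add L2_scaleR ladd[OF c c] lscale[OF c])
  then obtain g where g: "g \<in> L2 PM" "\<And>f. f \<in> L2 PM \<Longrightarrow> l (\<lambda>s w. f (s, w)) = ip PM g f" by blast
  show ?thesis
  proof (intro bexI[of _ "\<lambda>s w. g (s, w)"] ballI)
    fix \<phi> :: "('w, 'a) process" assume "\<phi> \<in> L2P"
    then show "l \<phi> = IP (\<lambda>s w. g (s, w)) \<phi>" using g(2)[of "case_prod \<phi>"] by (simp add: L2P_iff IP_def case_prod_curry)
  qed (use c g in blast)
qed

lemma IP_inner_integrable:
  assumes "\<phi> \<in> L2P" "\<psi> \<in> L2P"
  shows "integrable LM (\<lambda>(s, w). \<phi> s w \<bullet> \<psi> s w)"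
proof -
  have "integrable PM (\<lambda>p. case_prod \<phi> p \<bullet> case_prod \<psi> p)"
    using assms unfolding L2P_iff by (rule L2_inner_integrable)
  then have "integrable LM (\<lambda>p. case_prod \<phi> p \<bullet> case_prod \<psi> p)" by (rule integrable_PM)
  then show ?thesis by (simp add: case_prod_beta')
qed

lemma IP_eq_LM:
  assumes "\<phi> \<in> L2P" "\<psi> \<in> L2P"
  shows "IP \<phi> \<psi> = (\<integral>(s, w). \<phi> s w \<bullet> \<psi> s w \<partial>LM)"
proof -
  have m: "case_prod \<phi> \<in> borel_measurable ADP" "case_prod \<psi> \<in> borel_measurable ADP"
    using assms unfolding L2P_iff by (auto dest!: L2_measurable simp: measurable_PM)
  have "IP \<phi> \<psi> = (\<integral>p. case_prod \<phi> p \<bullet> case_prod \<psi> p \<partial>LM)"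
    unfolding IP_def ip_def using m by (intro integral_PM borel_measurable_inner)
  then show ?thesis by (simp add: case_prod_beta')
qed

lemma IP_eq_time_outer:
  assumes "\<phi> \<in> L2P" "\<psi> \<in> L2P"
  shows "IP \<phi> \<psi> = (\<integral>s. ip M (\<phi> s) (\<psi> s) \<partial>TI)"
  unfolding IP_eq_LM[OF assms] ip_def by (rule LM.integral_fst[OF IP_inner_integrable[OF assms], symmetric])

lemma IP_eq_time_inner:
  assumes "\<phi> \<in> L2P" "\<psi> \<in> L2P"
  shows "IP \<phi> \<psi> = (\<integral>w. (\<integral>s. \<phi> s w \<bullet> \<psi> s w \<partial>TI) \<partial>M)"
  unfolding IP_eq_LM[OF assms] by (rule LM.integral_snd[OF IP_inner_integrable[OF assms], symmetric])

lemma ip_time_integrable: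
  assumes "\<phi> \<in> L2P" "\<psi> \<in> L2P"
  shows "integrable TI (\<lambda>s. ip M (\<phi> s) (\<psi> s))"
  unfolding ip_def by (rule LM.integrable_fst[OF IP_inner_integrable[OF assms]])

lemma nn_integral_L2P:
  assumes "\<phi> \<in> L2P"
  shows "(\<integral>\<^sup>+w. (\<integral>\<^sup>+s. sqn (\<phi> s w) \<partial>TI) \<partial>M) = ennreal ((NR \<phi>)\<^sup>2)"
    and "(\<integral>\<^sup>+s. (\<integral>\<^sup>+w. sqn (\<phi> s w) \<partial>M) \<partial>TI) = ennreal ((NR \<phi>)\<^sup>2)"
proof -
  have [measurable]: "case_prod \<phi> \<in> borel_measurable LM" "case_prod \<phi> \<in> borel_measurable ADP"
    using assms unfolding L2P_iff by (auto dest!: L2_measurable simp: measurable_PM measurable_ADP_iff)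
  have eq: "ennreal ((NR \<phi>)\<^sup>2) = (\<integral>\<^sup>+p. sqn (case_prod \<phi> p) \<partial>LM)"
  proof -
    have "ennreal ((NR \<phi>)\<^sup>2) = (\<integral>\<^sup>+p. sqn (case_prod \<phi> p) \<partial>PM)"
      using assms unfolding L2P_iff NR_def nrm_power2 by (rule nn_integral_norm2[symmetric])
    also have "\<dots> = (\<integral>\<^sup>+p. sqn (case_prod \<phi> p) \<partial>LM)"
      by (intro nn_integral_PM) measurable
    finally show ?thesis .
  qed
  have "(\<integral>\<^sup>+w. (\<integral>\<^sup>+s. sqn (case_prod \<phi> (s, w)) \<partial>TI) \<partial>M) = (\<integral>\<^sup>+p. sqn (case_prod \<phi> p) \<partial>LM)"
    by (intro LM.nn_integral_snd) measurable
  then show "(\<integral>\<^sup>+w. (\<integral>\<^sup>+s. sqn (\<phi> s w) \<partial>TI) \<partial>M) = ennreal ((NR \<phi>)\<^sup>2)" using eq by simp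
  have "(\<integral>\<^sup>+s. (\<integral>\<^sup>+w. sqn (case_prod \<phi> (s, w)) \<partial>M) \<partial>TI) = (\<integral>\<^sup>+p. sqn (case_prod \<phi> p) \<partial>LM)"
    by (intro nn_integral_fst) measurable
  then show "(\<integral>\<^sup>+s. (\<integral>\<^sup>+w. sqn (\<phi> s w) \<partial>M) \<partial>TI) = ennreal ((NR \<phi>)\<^sup>2)" using eq by simp
qed

lemma L2P_AE_L2:
  assumes "\<phi> \<in> L2P"
  shows "AE s in TI. \<phi> s \<in> L2 M"
proof -
  have [measurable]: "case_prod \<phi> \<in> borel_measurable LM" using assms by (rule L2P_measurable)
  have "(\<lambda>s. \<integral>\<^sup>+w. sqn (case_prod \<phi> (s, w)) \<partial>M) \<in> borel_measurable TI" by measurable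
  then have "AE s in TI. (\<integral>\<^sup>+w. sqn (\<phi> s w) \<partial>M) \<noteq> \<infinity>"
    using nn_integral_L2P(2)[OF assms] by (intro nn_integral_PInf_AE) auto
  then show ?thesis using AE_space
    by eventually_elim (use L2P_measurable_at[OF assms] in \<open>auto simp: L2_iff_nn_integral less_top\<close>)
qed

lemma L2P_AE_path:
  assumes "\<phi> \<in> L2P"
  shows "AE w in M. (\<lambda>s. \<phi> s w) \<in> L2 TI"
proof -
  have [measurable]: "case_prod \<phi> \<in> borel_measurable LM" using assms by (rule L2P_measurable)
  have "(\<lambda>w. \<integral>\<^sup>+s. sqn (case_prod \<phi> (s, w)) \<partial>TI) \<in> borel_measurable M" by measurable
  then have "AE w in M. (\<integral>\<^sup>+s. sqn (\<phi> s w) \<partial>TI) \<noteq> \<infinity>"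
    using nn_integral_L2P(1)[OF assms] by (intro nn_integral_PInf_AE) auto
  then show ?thesis using AE_space
    by eventually_elim (use L2P_measurable_path[OF assms] in \<open>auto simp: L2_iff_nn_integral less_top\<close>)
qed

lemma L2P_eq_AE_testing:
  assumes "\<phi> \<in> L2P" "\<psi> \<in> L2P" "\<And>\<theta>. \<theta> \<in> L2P \<Longrightarrow> IP \<phi> \<theta> = IP \<psi> \<theta>"
  shows "DR \<phi> \<psi> = 0"
  using assms(3)[OF L2P_diff[OF assms(1,2)]] assms(1,2) by (simp add: NR_def_IP IP_diff_left L2P_diff)

lemma NR_eq_0:
  assumes "\<phi> \<in> L2P" "NR \<phi> = 0"
  shows "AE s in TI. AE w in M. \<phi> s w = 0" and "AE w in M. AE s in TI. \<phi> s w = 0"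
proof -
  have [measurable]: "case_prod \<phi> \<in> borel_measurable LM" using assms by (intro L2P_measurable)
  have m1: "(\<lambda>s. \<integral>\<^sup>+w. sqn (case_prod \<phi> (s, w)) \<partial>M) \<in> borel_measurable TI" by measurable
  have m2: "(\<lambda>w. \<integral>\<^sup>+s. sqn (case_prod \<phi> (s, w)) \<partial>TI) \<in> borel_measurable M" by measurable
  have "AE s in TI. (\<integral>\<^sup>+w. sqn (\<phi> s w) \<partial>M) = 0"
    using nn_integral_L2P(2)[OF assms(1)] assms(2) m1 by (subst nn_integral_0_iff_AE[symmetric]) auto
  then show "AE s in TI. AE w in M. \<phi> s w = 0" using AE_space
  proof eventually_elim
    case (elim s)
    then have "(\<lambda>w. sqn (\<phi> s w)) \<in> borel_measurable M"
      using L2P_measurable_at[OF assms(1)] by auto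
    from nn_integral_0_iff_AE[OF this] elim show ?case by simp
  qed
  have "AE w in M. (\<integral>\<^sup>+s. sqn (\<phi> s w) \<partial>TI) = 0"
    using nn_integral_L2P(1)[OF assms(1)] assms(2) m2 by (subst nn_integral_0_iff_AE[symmetric]) auto
  then show "AE w in M. AE s in TI. \<phi> s w = 0" using AE_space
  proof eventually_elim
    case (elim w)
    then have "(\<lambda>s. sqn (\<phi> s w)) \<in> borel_measurable TI"
      using L2P_measurable_path[OF assms(1)] by auto
    from nn_integral_0_iff_AE[OF this] elim show ?case by simp
  qed
qed

lemma NR_eq_0_I:
  assumes "\<phi> \<in> L2P" "AE s in TI. AE w in M. \<phi> s w = 0"
  shows "NR \<phi> = 0"
proof -
  have "(\<integral>\<^sup>+s. (\<integral>\<^sup>+w. sqn (\<phi> s w) \<partial>M) \<partial>TI) = (\<integral>\<^sup>+s. 0 \<partial>TI)"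
  proof (rule nn_integral_cong_AE)
    show "AE s in TI. (\<integral>\<^sup>+w. sqn (\<phi> s w) \<partial>M) = 0"
      using assms(2)
    proof eventually_elim
      case (elim s)
      then have "(\<integral>\<^sup>+w. sqn (\<phi> s w) \<partial>M) = (\<integral>\<^sup>+w. 0 \<partial>M)"
        by (intro nn_integral_cong_AE) (auto elim: eventually_mono)
      then show ?case by simp
    qed
  qed
  then show ?thesis using nn_integral_L2P(2)[OF assms(1)] by simp
qed

lemma IP_cong:
  assumes "\<phi> \<in> L2P" "\<phi>' \<in> L2P" "DR \<phi> \<phi>' = 0" "\<psi> \<in> L2P"
  shows "IP \<phi> \<psi> = IP \<phi>' \<psi>"
  using IP_Cauchy_Schwarz[OF L2P_diff[OF assms(1,2)] assms(4)] assms by (simp add: IP_diff_left)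

text \<open>Restriction of a process to \<open>[0, t]\<close>: norms up to time \<open>t\<close> stay norms of processes on \<open>[0, T]\<close>.\<close>

definition cut :: "real \<Rightarrow> ('w, 'a::euclidean_space) process \<Rightarrow> ('w, 'a) process" where
  "cut t \<phi> s w = indicator {0..t} s *\<^sub>R \<phi> s w"

lemma L2P_bounded_mult:
  assumes \<phi>: "\<phi> \<in> L2P" and r: "r \<in> borel_measurable TI" "\<And>s. \<bar>r s\<bar> \<le> K"
  shows "(\<lambda>s w. r s *\<^sub>R \<phi> s w) \<in> L2P"
  unfolding L2P_iff
proof (rule L2_bound)
  have m[measurable]: "case_prod \<phi> \<in> borel_measurable LM" using \<phi> by (rule L2P_measurable)
  note r(1)[measurable]
  have "(\<lambda>p. r (fst p) *\<^sub>R case_prod \<phi> p) \<in> borel_measurable LM" by measurable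
  then show "case_prod (\<lambda>s w. r s *\<^sub>R \<phi> s w) \<in> borel_measurable PM"
    using L2P_adapted[OF \<phi>] by (auto simp: measurable_PM measurable_ADP_iff case_prod_beta')
  show "case_prod \<phi> \<in> L2 PM" using \<phi> by (simp add: L2P_iff)
  show "AE p in PM. norm (case_prod (\<lambda>s w. r s *\<^sub>R \<phi> s w) p) \<le> K * norm (case_prod \<phi> p)"
    using r(2) by (auto intro!: AE_I2 mult_right_mono)
qed

lemma cut_L2P: "\<phi> \<in> L2P \<Longrightarrow> cut t \<phi> \<in> L2P"
  unfolding cut_def[abs_def]
  by (rule L2P_bounded_mult[OF _ measurable_restrict_space1[OF borel_measurable_indicator], where K = 1])
    (auto split: split_indicator)

lemma cut_T: "\<phi> \<in> L2P \<Longrightarrow> IP (cut T \<phi>) \<psi> = IP \<phi> \<psi>"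
  unfolding IP_def ip_def cut_def[abs_def]
  by (intro LINT_cong) (auto simp: PM_def space_restr_to_subalg space_LM split: split_indicator)

lemma IP_cut:
  assumes "\<phi> \<in> L2P" "\<psi> \<in> L2P"
  shows "IP (cut t \<phi>) \<psi> = (\<integral>s. indicator {0..t} s * ip M (\<phi> s) (\<psi> s) \<partial>TI)"
  unfolding IP_eq_time_outer[OF cut_L2P[OF assms(1)] assms(2)]
  by (intro LINT_cong) (simp_all add: cut_def[abs_def] ip_scaleR_left)

end

section \<open>Simple processes and their integrals\<close>

lemma sum_split_pairs:
  fixes f :: "nat \<Rightarrow> 'a::comm_monoid_add"
  shows "(\<Sum>i<2 * k. f i) = (\<Sum>i<k. f (2 * i) + f (2 * i + 1))"
  by (induction k) (simp_all add: algebra_simps)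

lemma integral_TI_atMost:
  fixes f :: "real \<Rightarrow> 'a::euclidean_space"
  assumes "0 \<le> t" "t \<le> T"
  shows "(\<integral>s. f s \<partial>lebesgue_on {0..t}) = (\<integral>s. indicator {0..t} s *\<^sub>R f s \<partial>lebesgue_on {0..T})"
proof -
  have eq: "indicat_real {0..T} s *\<^sub>R indicat_real {0..t} s *\<^sub>R f s = indicat_real {0..t} s *\<^sub>R f s" for s
    using assms by (auto split: split_indicator)
  have "(\<integral>s. f s \<partial>lebesgue_on {0..t}) = (\<integral>s. indicat_real {0..t} s *\<^sub>R f s \<partial>lebesgue)"
    by (intro integral_restrict_space) auto
  also have "\<dots> = (\<integral>s. indicat_real {0..T} s *\<^sub>R indicat_real {0..t} s *\<^sub>R f s \<partial>lebesgue)"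
    unfolding eq ..
  also have "\<dots> = (\<integral>s. indicat_real {0..t} s *\<^sub>R f s \<partial>lebesgue_on {0..T})"
    by (intro integral_restrict_space[symmetric]) auto
  finally show ?thesis .
qed

text \<open>The primitive vanishes at dyadic times, hence everywhere by continuity, and integrals over
  half-lines determine the density. The hypothesis on fine grids
  covers coarse ones, whose intervals are unions.\<close>

lemma AE_zero_if_dyadic_integrals_zero:
  fixes h :: "real \<Rightarrow> real"
  assumes T: "0 < T" and h: "integrable (lebesgue_on {0..T}) h"
    and 0: "\<And>n i. n0 \<le> n \<Longrightarrow> i < 2^n \<Longrightarrow>
      (\<integral>s. indicator {grid T n i<..grid T n (Suc i)} s * h s \<partial>lebesgue_on {0..T}) = 0"
  shows "AE s in lebesgue_on {0..T}. h s = 0"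
proof -
  define H where "H t = (\<integral>s. h s \<partial>lebesgue_on {0..t})" for t
  have H: "H t = (\<integral>s. indicator {0..t} s * h s \<partial>lebesgue_on {0..T})" if "0 \<le> t" "t \<le> T" for t
    unfolding H_def using integral_TI_atMost[OF that, of h] by simp
  have cont: "continuous_on {0..T} H" unfolding H_def using h by (rule indefinite_integral_continuous_real)
  have ind_int: "integrable (lebesgue_on {0..T}) (\<lambda>s. indicator A s * h s)" if "A \<in> sets lebesgue" for A
  proof (rule Bochner_Integration.integrable_bound[OF h])
    have "indicat_real A \<in> borel_measurable (lebesgue_on {0..T})"
      using that by (intro measurable_restrict_space1 borel_measurable_indicator) auto
    then show "(\<lambda>s. indicat_real A s * h s) \<in> borel_measurable (lebesgue_on {0..T})"
      using h by (intro borel_measurable_times) auto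
  qed (auto split: split_indicator)
  have Hgrid: "H (grid T n i) = 0" if n: "n0 \<le> n" and i: "i \<le> 2^n" for n i
    using i
  proof (induction i)
    case 0
    have "H 0 = 0"
    proof -
      have "AE s in lebesgue_on {0..T}. indicator {0..0} s * h s = 0"
        by (rule AE_I'[of "{0}"]) (use T in \<open>auto simp: null_sets_restrict_space split: split_indicator_asm\<close>)
      then show ?thesis using T by (simp add: H integral_eq_zero_AE)
    qed
    then show ?case by simp
  next
    case (Suc i)
    have g: "0 \<le> grid T n i" "grid T n i \<le> grid T n (Suc i)" "grid T n (Suc i) \<le> T"
      using grid_range[of T i n] grid_range[of T "Suc i" n] grid_mono[of T i "Suc i" n] T Suc by auto
    have "H (grid T n (Suc i)) = (\<integral>s. indicator {0..grid T n i} s * h s + indicator {grid T n i<..grid T n (Suc i)} s * h s \<partial>lebesgue_on {0..T})"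
      using g by (subst H) (auto intro!: LINT_cong split: split_indicator)
    also have "\<dots> = H (grid T n i) + 0"
      using g Suc n by (subst Bochner_Integration.integral_add) (auto intro!: ind_int simp: H 0)
    finally show ?case using Suc by simp
  qed
  have H0: "H t = 0" if "0 \<le> t" "t \<le> T" for t
  proof -
    have sub: "dyad T \<subseteq> {0..T}" using T by (intro dyad_range) auto
    then have csub: "closure (dyad T) \<subseteq> {0..T}" by (rule closure_minimal) auto
    have "H r = 0" if r: "r \<in> dyad T" for r
    proof -
      obtain n j where nj: "r = grid T n j" "j \<le> 2^n" using r by (auto simp: dyad_def)
      have "r = grid T (n + n0) (j * 2^n0)" by (simp add: nj grid_refine)
      then show ?thesis using Hgrid[of "n + n0" "j * 2^n0"] nj by (simp add: power_add)
    qed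
    moreover have "t \<in> closure (dyad T)" using that by (intro dyad_closure)
    ultimately show ?thesis
      using continuous_constant_on_closure[of "dyad T" H 0 t] cont csub continuous_on_subset by blast
  qed
  have gint: "integrable lebesgue (\<lambda>s. indicator {0..T} s * h s)"
    using h by (simp add: integrable_restrict_space)
  then obtain g where g: "g \<in> borel_measurable lborel" "AE s in lborel. indicator {0..T} s * h s = g s"
    using completion_ex_borel_measurable_real[of "\<lambda>s. indicator {0..T} s * h s" lborel] by auto
  have gl: "AE s in lebesgue. indicator {0..T} s * h s = g s" using g(2) by (rule AE_completion)
  have gi: "integrable lborel g"
  proof -
    have gm: "g \<in> borel_measurable lebesgue" using g(1) by (rule measurable_completion)
    have "integrable lebesgue g"
      using integrable_cong_AE[OF borel_measurable_integrable[OF gint] gm gl] gint by simp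
    then show ?thesis using g(1) by (simp add: integrable_completion)
  qed
  have gint_eq: "(LINT s:A|lborel. g s) = (\<integral>s. indicator A s * h s \<partial>lebesgue_on {0..T})" if A: "A \<in> sets borel" for A
  proof -
    have "(LINT s:A|lborel. g s) = (LINT s:A|lebesgue. g s)"
      unfolding set_lebesgue_integral_def using g(1) A by (intro integral_completion[symmetric]) auto
    also have "\<dots> = (\<integral>s. indicator {0..T} s *\<^sub>R (indicator A s * h s) \<partial>lebesgue)"
      unfolding set_lebesgue_integral_def
    proof (rule integral_cong_AE)
      show "AE s in lebesgue. indicat_real A s *\<^sub>R g s = indicat_real {0..T} s *\<^sub>R (indicat_real A s * h s)"
        using gl by eventually_elim (auto split: split_indicator)
      have "(\<lambda>s. indicat_real A s * (indicator {0..T} s * h s)) \<in> borel_measurable lebesgue"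
      proof (rule borel_measurable_times[OF _ borel_measurable_integrable[OF gint]])
        show "indicat_real A \<in> borel_measurable lebesgue" using A by (intro borel_measurable_indicator) auto
      qed
      then show "(\<lambda>s. indicat_real {0..T} s *\<^sub>R (indicat_real A s * h s)) \<in> borel_measurable lebesgue"
        by (simp add: mult_ac)
      show "(\<lambda>s. indicat_real A s *\<^sub>R g s) \<in> borel_measurable lebesgue"
        using A measurable_completion[OF g(1)]
        by (intro borel_measurable_scaleR borel_measurable_indicator) auto
    qed
    also have "\<dots> = (\<integral>s. indicator A s * h s \<partial>lebesgue_on {0..T})" by (simp add: integral_restrict_space)
    finally show ?thesis .
  qed
  have "(LINT s:A|lborel. g s) = 0" if A: "A \<in> sets lborel" for A
  proof (rule set_integral_eq_0_sigma[OF gi])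
    let ?G = "insert UNIV (range (\<lambda>a::real. {..a}))"
    show "Int_stable ?G" by (rule Int_stableI) (auto simp: Int_atMost)
    have "sets lborel = sigma_sets UNIV (range (\<lambda>a::real. {..a}))"
      unfolding sets_lborel borel_eq_atMost[where 'a=real] by (rule sets_measure_of) auto
    also have "\<dots> \<subseteq> sigma_sets UNIV ?G" by (rule sigma_sets_subseteq) auto
    finally show "A \<in> sigma_sets (space lborel) ?G" using A by auto
    have "(\<integral>s. indicator {..a} s * h s \<partial>lebesgue_on {0..T}) = (if a < 0 then 0 else H (min a T))" for a
      using T by (auto simp: H intro!: LINT_cong integral_eq_zero_AE AE_I2 split: split_indicator)
    moreover have "(\<integral>s. indicator UNIV s * h s \<partial>lebesgue_on {0..T}) = H T" by (simp add: H_def)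
    ultimately show "(LINT s:B|lborel. g s) = 0" if "B \<in> ?G" for B
      using that H0 T gint_eq[of B] by fastforce
  qed auto
  then have "AE s in lborel. g s = 0" by (rule sigma_finite_measure.density_zero[OF sigma_finite_lborel gi])
  then have "AE s in lebesgue. g s = 0" by (rule AE_completion)
  with gl have "AE s in lebesgue. s \<in> {0..T} \<longrightarrow> h s = 0"
    by eventually_elim auto
  then show ?thesis by (subst AE_restrict_space_iff) auto
qed

context bm_horizon
begin

lemma
  fixes \<eta> :: "'w \<Rightarrow> real"
  assumes s: "0 \<le> s" "s \<le> t" and \<eta>: "\<eta> \<in> borel_measurable (Fil s)" "integrable M \<eta>"
  shows increment_orthogonal_integrable: "integrable M (\<lambda>w. \<eta> w * (W t w - W s w))"
    and increment_orthogonal: "(\<integral>w. \<eta> w * (W t w - W s w) \<partial>M) = 0"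
    and increment_square_integrable: "integrable M (\<lambda>w. \<eta> w * (W t w - W s w)\<^sup>2)"
    and increment_square: "(\<integral>w. \<eta> w * (W t w - W s w)\<^sup>2 \<partial>M) = (t - s) * (\<integral>w. \<eta> w \<partial>M)"
proof -
  have "s = t \<or> s < t" using s by auto
  then have *: "integrable M (\<lambda>w. \<eta> w * (W t w - W s w)) \<and> (\<integral>w. \<eta> w * (W t w - W s w) \<partial>M) = 0 \<and>
    integrable M (\<lambda>w. \<eta> w * (W t w - W s w)\<^sup>2) \<and> (\<integral>w. \<eta> w * (W t w - W s w)\<^sup>2 \<partial>M) = (t - s) * (\<integral>w. \<eta> w \<partial>M)"
  proof
    assume st: "s < t"
    note p = increment_power_integrable[OF s(1) st]
    show ?thesis
      using increment_factor_integrable[OF s(1) st \<eta>, of "\<lambda>x. x"] increment_factor_integral[OF s(1) st \<eta>, of "\<lambda>x. x"]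
        increment_factor_integrable[OF s(1) st \<eta>, of "\<lambda>x. x\<^sup>2"] increment_factor_integral[OF s(1) st \<eta>, of "\<lambda>x. x\<^sup>2"]
        p[of 1] p[of 2] increment_mean[OF s(1) st] increment_second_moment[OF s(1) st]
      by simp
  qed simp
  then show "integrable M (\<lambda>w. \<eta> w * (W t w - W s w))" "(\<integral>w. \<eta> w * (W t w - W s w) \<partial>M) = 0"
    "integrable M (\<lambda>w. \<eta> w * (W t w - W s w)\<^sup>2)" "(\<integral>w. \<eta> w * (W t w - W s w)\<^sup>2 \<partial>M) = (t - s) * (\<integral>w. \<eta> w \<partial>M)"
    by auto
qed

lemma increment_Fil: "0 \<le> a \<Longrightarrow> a \<le> t \<Longrightarrow> 0 \<le> b \<Longrightarrow> b \<le> t \<Longrightarrow> (\<lambda>w. W b w - W a w) \<in> borel_measurable (Fil t)"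
  by (intro borel_measurable_diff W_Fil)

lemma increment_L2: assumes "0 \<le> a" "0 \<le> b" shows "(\<lambda>w. W b w - W a w) \<in> L2 M"
proof -
  have *: "(\<lambda>w. W b w - W a w) \<in> L2 M" if "0 \<le> a" "a \<le> b" for a b
  proof -
    have "integrable M (\<lambda>w. 1 * (W b w - W a w)\<^sup>2)"
      by (rule increment_square_integrable[OF that]) auto
    moreover have "(\<lambda>w. W b w - W a w) \<in> borel_measurable M" using that by (intro increment_measurable) auto
    ultimately show ?thesis unfolding L2_def by simp
  qed
  show ?thesis using *[of a b] L2_uminus[OF *[of b a]] assms by (cases "a \<le> b") auto
qed

definition bounded_Fil :: "real \<Rightarrow> ('w \<Rightarrow> 'a::euclidean_space) \<Rightarrow> bool" where
  "bounded_Fil a \<xi> \<longleftrightarrow> \<xi> \<in> borel_measurable (Fil a) \<and> bounded (\<xi> ` space M)"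

lemma bounded_Fil_bound:
  assumes "bounded_Fil a \<xi>" obtains K where "\<And>w. w \<in> space M \<Longrightarrow> norm (\<xi> w) \<le> K" "0 \<le> K"
proof -
  obtain K where K: "\<And>w. w \<in> space M \<Longrightarrow> norm (\<xi> w) \<le> K"
    using assms unfolding bounded_Fil_def bounded_iff by auto
  show thesis by (rule that[of "max K 0"]) (auto simp: K le_max_iff_disj)
qed

lemma bounded_Fil_mono: "bounded_Fil a \<xi> \<Longrightarrow> a \<le> b \<Longrightarrow> bounded_Fil b \<xi>"
  unfolding bounded_Fil_def using Fil_measurable_mono[of a b \<xi> borel] by blast

lemma bounded_Fil_measurable: "bounded_Fil a \<xi> \<Longrightarrow> a \<le> t \<Longrightarrow> \<xi> \<in> borel_measurable (Fil t)"
  unfolding bounded_Fil_def by (rule Fil_measurable_mono) auto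

lemma bounded_Fil_measurable_M: "bounded_Fil a \<xi> \<Longrightarrow> \<xi> \<in> borel_measurable M"
  unfolding bounded_Fil_def by (rule Fil_measurable_M) auto

lemma bounded_Fil_L2: assumes "bounded_Fil a \<xi>" shows "\<xi> \<in> L2 M"
proof -
  obtain K where K: "\<And>w. w \<in> space M \<Longrightarrow> norm (\<xi> w) \<le> K" "0 \<le> K" using bounded_Fil_bound[OF assms] by blast
  have "(\<lambda>_. 1::real) \<in> L2 M" by (simp add: L2_def)
  then show ?thesis
  proof (rule L2_bound[OF bounded_Fil_measurable_M[OF assms]])
    show "AE w in M. norm (\<xi> w) \<le> K * norm (1::real)" using AE_space by eventually_elim (simp add: K)
  qed
qed

lemma bounded_Fil_scaleR_L2:
  fixes \<xi> :: "'w \<Rightarrow> 'a::euclidean_space" and f :: "'w \<Rightarrow> real"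
  assumes "bounded_Fil a \<xi>" "f \<in> L2 M" shows "(\<lambda>w. f w *\<^sub>R \<xi> w) \<in> L2 M"
proof -
  obtain K where K: "\<And>w. w \<in> space M \<Longrightarrow> norm (\<xi> w) \<le> K" "0 \<le> K" using bounded_Fil_bound[OF assms(1)] by blast
  show ?thesis
  proof (rule L2_bound[OF _ assms(2), where K = K])
    show "(\<lambda>w. f w *\<^sub>R \<xi> w) \<in> borel_measurable M"
      by (intro borel_measurable_scaleR bounded_Fil_measurable_M[OF assms(1)] L2_measurable[OF assms(2)])
    show "AE w in M. norm (f w *\<^sub>R \<xi> w) \<le> K * norm (f w)"
      using AE_space
    proof eventually_elim
      case (elim w)
      show ?case using mult_left_mono[OF K(1)[OF elim] abs_ge_zero[of "f w"]] by (simp add: mult.commute)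
    qed
  qed
qed

lemma bounded_Fil_inner:
  assumes "bounded_Fil a \<xi>" "bounded_Fil a \<zeta>" shows "bounded_Fil a (\<lambda>w. \<xi> w \<bullet> \<zeta> w)"
proof -
  obtain K L where K: "\<And>w. w \<in> space M \<Longrightarrow> norm (\<xi> w) \<le> K" "0 \<le> K"
    and L: "\<And>w. w \<in> space M \<Longrightarrow> norm (\<zeta> w) \<le> L" "0 \<le> L" using assms bounded_Fil_bound by metis
  have "norm (\<xi> w \<bullet> \<zeta> w) \<le> K * L" if "w \<in> space M" for w
    using order_trans[OF Cauchy_Schwarz_ineq2 mult_mono[OF K(1)[OF that] L(1)[OF that]]] K(2) by simp
  then show ?thesis using assms unfolding bounded_Fil_def bounded_iff by (auto intro!: borel_measurable_inner)
qed

text \<open>The Ito integral up to time \<open>t\<close> of the process with value \<open>\<xi>\<close> on \<open>(a, b]\<close>.\<close>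

definition elem :: "real \<Rightarrow> real \<Rightarrow> ('w \<Rightarrow> 'a::euclidean_space) \<Rightarrow> ('w, 'a) process" where
  "elem a b \<xi> t w = (W (min b t) w - W (min a t) w) *\<^sub>R \<xi> w"

lemma simple_ito_elem: "simple_ito W k \<tau> \<xi> t = (\<lambda>w. \<Sum>i<k. elem (\<tau> i) (\<tau> (Suc i)) (\<xi> i) t w)"
  by (simp add: simple_ito_def elem_def fun_eq_iff)

lemma elem_L2: "bounded_Fil a \<xi> \<Longrightarrow> 0 \<le> a \<Longrightarrow> 0 \<le> b \<Longrightarrow> 0 \<le> t \<Longrightarrow> elem a b \<xi> t \<in> L2 M"
  unfolding elem_def[abs_def] by (intro bounded_Fil_scaleR_L2 increment_L2) auto

lemma elem_Fil:
  assumes "bounded_Fil a \<xi>" "0 \<le> a" "a \<le> b" "0 \<le> t"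
  shows "elem a b \<xi> t \<in> borel_measurable (Fil t)"
proof (cases "a \<le> t")
  case True
  then have "\<xi> \<in> borel_measurable (Fil t)" using assms by (intro bounded_Fil_measurable[of a])
  then show ?thesis unfolding elem_def[abs_def] using assms
    by (intro borel_measurable_scaleR increment_Fil) auto
next
  case False
  then have "elem a b \<xi> t = (\<lambda>_. 0)" using assms by (auto simp: elem_def fun_eq_iff min_def)
  then show ?thesis by simp
qed

text \<open>The part of the longer increment beyond the shorter one is orthogonal to the past.\<close>

lemma increment_product:
  fixes \<eta> :: "'w \<Rightarrow> real"
  assumes \<eta>: "bounded_Fil c \<eta>" and c: "0 \<le> c" "c \<le> p" "c \<le> q"
  shows "(\<integral>w. \<eta> w * (W p w - W c w) * (W q w - W c w) \<partial>M) = (min p q - c) * (\<integral>w. \<eta> w \<partial>M)"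
proof -
  have \<eta>i: "integrable M \<eta>" and \<eta>m: "\<eta> \<in> borel_measurable (Fil c)"
    using bounded_Fil_L2[OF \<eta>] L2_inner_integrable[of \<eta> M "\<lambda>_. 1"] \<eta> by (auto simp: L2_def bounded_Fil_def)
  have *: "(\<integral>w. \<eta> w * (W p w - W c w) * (W q w - W c w) \<partial>M) = (p - c) * (\<integral>w. \<eta> w \<partial>M)"
    if "c \<le> p" "p \<le> q" for p q
  proof -
    have i1: "integrable M (\<lambda>w. \<eta> w * (W p w - W c w))"
      by (rule increment_orthogonal_integrable[OF c(1) that(1) \<eta>m \<eta>i])
    have m1: "(\<lambda>w. \<eta> w * (W p w - W c w)) \<in> borel_measurable (Fil p)"
      using that c Fil_measurable_mono[OF that(1) \<eta>m] by (intro borel_measurable_times increment_Fil) auto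
    have p0: "0 \<le> p" using c that by simp
    have "(\<integral>w. \<eta> w * (W p w - W c w) * (W q w - W c w) \<partial>M)
        = (\<integral>w. (\<eta> w * (W p w - W c w)\<^sup>2) + (\<eta> w * (W p w - W c w)) * (W q w - W p w) \<partial>M)"
      by (intro LINT_cong) (auto simp: power2_eq_square algebra_simps)
    also have "\<dots> = (\<integral>w. \<eta> w * (W p w - W c w)\<^sup>2 \<partial>M) + (\<integral>w. (\<eta> w * (W p w - W c w)) * (W q w - W p w) \<partial>M)"
      by (intro Bochner_Integration.integral_add increment_square_integrable[OF c(1) that(1) \<eta>m \<eta>i]
          increment_orthogonal_integrable[OF p0 that(2) m1 i1])
    also have "\<dots> = (p - c) * (\<integral>w. \<eta> w \<partial>M)"
      using increment_square[OF c(1) that(1) \<eta>m \<eta>i] increment_orthogonal[OF p0 that(2) m1 i1] by simp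
    finally show ?thesis .
  qed
  show ?thesis
  proof (cases "p \<le> q")
    case True
    then show ?thesis using *[of p q] c by (simp add: min_def)
  next
    case False
    have "(\<integral>w. \<eta> w * (W p w - W c w) * (W q w - W c w) \<partial>M) = (\<integral>w. \<eta> w * (W q w - W c w) * (W p w - W c w) \<partial>M)"
      by (simp add: mult_ac)
    then show ?thesis using *[of q p] c False by (simp add: min_def)
  qed
qed

text \<open>The isometry holds for each pair of elementary integrals separately, with the length of the
  common part of the intervals as a factor. Simple processes with different partitions are thus
  compared directly.\<close>

lemma elem_ip:
  fixes \<xi> \<zeta> :: "'w \<Rightarrow> 'a::euclidean_space"
  assumes "bounded_Fil a \<xi>" "bounded_Fil c \<zeta>" "0 \<le> a" "a \<le> b" "0 \<le> c" "c \<le> d" "0 \<le> t"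
  shows "ip M (elem a b \<xi> t) (elem c d \<zeta> t) = max 0 (min (min b d) t - max a c) * ip M \<xi> \<zeta>"
proof -
  have main: "ip M (elem a b \<xi> t) (elem c d \<zeta> t) = max 0 (min (min b d) t - max a c) * ip M \<xi> \<zeta>"
    if as: "bounded_Fil a \<xi>" "bounded_Fil c \<zeta>" "0 \<le> a" "a \<le> b" "0 \<le> c" "c \<le> d" and ac: "a \<le> c"
    for a b c d :: real and \<xi> \<zeta> :: "'w \<Rightarrow> 'a"
  proof (cases "c \<le> t")
    case False
    then have "elem c d \<zeta> t = (\<lambda>_. 0)" using as by (auto simp: elem_def fun_eq_iff min_def)
    then show ?thesis using False ac by (simp add: ip_def)
  next
    case True
    define \<eta> where "\<eta> w = \<xi> w \<bullet> \<zeta> w" for w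
    have \<eta>b: "bounded_Fil c \<eta>"
      unfolding \<eta>_def[abs_def] using bounded_Fil_mono[OF as(1) ac] as(2) by (rule bounded_Fil_inner)
    let ?b = "min b t" and ?d = "min d t"
    define b1 where "b1 = min ?b c"
    define b2 where "b2 = max ?b c"
    have b12: "W ?b w - W a w = (W b1 w - W a w) + (W b2 w - W c w)" for w
      by (cases "?b \<le> c") (simp_all add: b1_def b2_def min_def max_def)
    have bc: "a \<le> b1" "b1 \<le> c" "c \<le> b2" "c \<le> ?d" "0 \<le> b1" using as ac True by (auto simp: b1_def b2_def)
    have L: "(\<lambda>w. (W b1 w - W a w) *\<^sub>R \<eta> w) \<in> L2 M"
      using \<eta>b as bc by (intro bounded_Fil_scaleR_L2 increment_L2) auto
    have m1: "(\<lambda>w. \<eta> w * (W b1 w - W a w)) \<in> borel_measurable (Fil c)"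
      using as bc ac \<eta>b by (intro borel_measurable_times increment_Fil) (auto simp: bounded_Fil_def)
    have i1: "integrable M (\<lambda>w. \<eta> w * (W b1 w - W a w))"
      using L2_inner_integrable[OF L, of "\<lambda>_. 1"] by (simp add: L2_def mult.commute)
    have L2': "(\<lambda>w. (W b2 w - W c w) *\<^sub>R \<eta> w) \<in> L2 M"
      using \<eta>b as bc by (intro bounded_Fil_scaleR_L2 increment_L2) auto
    have Ld: "(\<lambda>w. W ?d w - W c w) \<in> L2 M" using as True by (intro increment_L2) auto
    have i2: "integrable M (\<lambda>w. \<eta> w * (W b2 w - W c w) * (W ?d w - W c w))"
      using L2_inner_integrable[OF L2' Ld] by (simp add: mult_ac)
    have "ip M (elem a b \<xi> t) (elem c d \<zeta> t) = (\<integral>w. \<eta> w * (W ?b w - W a w) * (W ?d w - W c w) \<partial>M)"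
      unfolding ip_def elem_def \<eta>_def using True ac by (simp add: mult_ac min_absorb1)
    also have "\<dots> = (\<integral>w. (\<eta> w * (W b1 w - W a w)) * (W ?d w - W c w) + \<eta> w * (W b2 w - W c w) * (W ?d w - W c w) \<partial>M)"
      unfolding b12 by (simp add: algebra_simps)
    also have "\<dots> = (\<integral>w. (\<eta> w * (W b1 w - W a w)) * (W ?d w - W c w) \<partial>M) + (\<integral>w. \<eta> w * (W b2 w - W c w) * (W ?d w - W c w) \<partial>M)"
      by (intro Bochner_Integration.integral_add increment_orthogonal_integrable[OF as(5) bc(4) m1 i1] i2)
    also have "\<dots> = (min b2 ?d - c) * (\<integral>w. \<eta> w \<partial>M)"
      using increment_orthogonal[OF as(5) bc(4) m1 i1] increment_product[OF \<eta>b as(5) bc(3,4)] by simp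
    also have "min b2 ?d - c = max 0 (min (min b d) t - max a c)"
      using ac bc(4) by (auto simp: b2_def min_def max_def)
    finally show ?thesis by (simp add: ip_def \<eta>_def)
  qed
  show ?thesis
  proof (cases "a \<le> c")
    case True
    then show ?thesis using main assms by blast
  next
    case False
    then have "ip M (elem c d \<zeta> t) (elem a b \<xi> t) = max 0 (min (min d b) t - max c a) * ip M \<zeta> \<xi>"
      using assms by (intro main) auto
    then show ?thesis by (simp add: ip_commute min.commute max.commute)
  qed
qed

lemma elem_martingale:
  fixes \<xi> :: "'w \<Rightarrow> 'a::euclidean_space"
  assumes \<xi>: "bounded_Fil a \<xi>" and ab: "0 \<le> a" "a \<le> b" and st: "0 \<le> s" "s \<le> t"
    and \<zeta>: "\<zeta> \<in> borel_measurable (Fil s)" "\<zeta> \<in> L2 M"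
  shows "ip M (\<lambda>w. elem a b \<xi> t w - elem a b \<xi> s w) \<zeta> = 0"
proof (cases "b \<le> s \<or> t \<le> a")
  case True
  then have "(\<lambda>w. elem a b \<xi> t w - elem a b \<xi> s w) = (\<lambda>_. 0)"
    using ab st by (auto simp: elem_def fun_eq_iff min_def dest: antisym)
  then show ?thesis by (simp add: ip_def)
next
  case False
  define c where "c = max a s"
  define \<eta> where "\<eta> w = \<xi> w \<bullet> \<zeta> w" for w
  have c: "0 \<le> c" "c \<le> min b t" using False ab st by (auto simp: c_def)
  have m: "\<eta> \<in> borel_measurable (Fil c)"
    unfolding \<eta>_def[abs_def]
    by (intro borel_measurable_inner bounded_Fil_measurable[OF \<xi>] Fil_measurable_mono[OF _ \<zeta>(1)]) (auto simp: c_def)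
  have i: "integrable M \<eta>" unfolding \<eta>_def[abs_def] by (intro L2_inner_integrable bounded_Fil_L2[OF \<xi>] \<zeta>)
  have "elem a b \<xi> t w - elem a b \<xi> s w = (W (min b t) w - W c w) *\<^sub>R \<xi> w" for w
    using False ab st by (cases "a \<le> s") (simp_all add: elem_def c_def min_def max_def algebra_simps)
  then have "ip M (\<lambda>w. elem a b \<xi> t w - elem a b \<xi> s w) \<zeta> = (\<integral>w. \<eta> w * (W (min b t) w - W c w) \<partial>M)"
    by (simp add: ip_def \<eta>_def mult.commute)
  then show ?thesis using increment_orthogonal[OF c m i] by simp
qed

lemma simple_process_range:
  assumes "simple_process M W T k \<tau> \<xi>" "i \<le> k" shows "0 \<le> \<tau> i \<and> \<tau> i \<le> T"
proof -
  have step: "\<forall>i<k. \<tau> i < \<tau> (Suc i)" and e: "\<tau> 0 = 0" "\<tau> k = T" using assms(1) by (auto simp: simple_process_def)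
  have mono: "\<tau> i \<le> \<tau> j" if "i \<le> j" "j \<le> k" for i j
    using that
  proof (induction j rule: dec_induct)
    case (step n)
    then show ?case using \<open>\<forall>i<k. \<tau> i < \<tau> (Suc i)\<close> by (meson Suc_le_lessD Suc_leD less_imp_le order_trans)
  qed simp
  show ?thesis using mono[of 0 i] mono[of i k] assms(2) e by simp
qed

lemma simple_processD:
  assumes "simple_process M W T k \<tau> \<xi>" "i < k"
  shows "bounded_Fil (\<tau> i) (\<xi> i)" "0 \<le> \<tau> i" "\<tau> i \<le> \<tau> (Suc i)" "\<tau> (Suc i) \<le> T"
  using assms simple_process_range[OF assms(1), of i] simple_process_range[OF assms(1), of "Suc i"]
  by (auto simp: simple_process_def bounded_Fil_def)

lemma simple_ito_L2:
  assumes "simple_process M W T k \<tau> \<xi>" "0 \<le> t"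
  shows "simple_ito W k \<tau> \<xi> t \<in> L2 M"
  unfolding simple_ito_elem
proof (rule L2_sum)
  fix i assume "i \<in> {..<k}"
  then show "elem (\<tau> i) (\<tau> (Suc i)) (\<xi> i) t \<in> L2 M"
    using simple_processD[OF assms(1), of i] assms(2) by (intro elem_L2) auto
qed

lemma simple_ito_Fil:
  assumes "simple_process M W T k \<tau> \<xi>" "0 \<le> t"
  shows "simple_ito W k \<tau> \<xi> t \<in> borel_measurable (Fil t)"
  unfolding simple_ito_elem
  using simple_processD[OF assms(1)] assms(2) by (intro borel_measurable_sum elem_Fil) auto

lemma ip_sum_left: "(\<And>i. i \<in> I \<Longrightarrow> f i \<in> L2 N) \<Longrightarrow> g \<in> L2 N \<Longrightarrow> ip N (\<lambda>x. \<Sum>i\<in>I. f i x) g = (\<Sum>i\<in>I. ip N (f i) g)"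
  by (simp add: ip_def inner_sum_left L2_inner_integrable)

lemma ip_sum_right: "(\<And>i. i \<in> I \<Longrightarrow> f i \<in> L2 N) \<Longrightarrow> g \<in> L2 N \<Longrightarrow> ip N g (\<lambda>x. \<Sum>i\<in>I. f i x) = (\<Sum>i\<in>I. ip N g (f i))"
  by (simp add: ip_def inner_sum_right L2_inner_integrable)

lemma ip_sum_sum:
  assumes "\<And>i. i \<in> I \<Longrightarrow> f i \<in> L2 N" "\<And>j. j \<in> J \<Longrightarrow> g j \<in> L2 N"
  shows "ip N (\<lambda>x. \<Sum>i\<in>I. f i x) (\<lambda>x. \<Sum>j\<in>J. g j x) = (\<Sum>i\<in>I. \<Sum>j\<in>J. ip N (f i) (g j))"
  using assms by (subst ip_sum_left) (auto intro!: sum.cong ip_sum_right L2_sum)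

lemma simple_ito_martingale:
  fixes \<xi> :: "nat \<Rightarrow> 'w \<Rightarrow> 'a::euclidean_space"
  assumes sp: "simple_process M W T k \<tau> \<xi>" and st: "0 \<le> s" "s \<le> t"
    and \<zeta>: "\<zeta> \<in> borel_measurable (Fil s)" "\<zeta> \<in> L2 M"
  shows "ip M (\<lambda>w. simple_ito W k \<tau> \<xi> t w - simple_ito W k \<tau> \<xi> s w) \<zeta> = 0"
proof -
  have L: "(\<lambda>w. elem (\<tau> i) (\<tau> (Suc i)) (\<xi> i) t w - elem (\<tau> i) (\<tau> (Suc i)) (\<xi> i) s w) \<in> L2 M" if "i < k" for i
    using simple_processD[OF sp that] st by (intro L2_diff elem_L2) auto
  have "ip M (\<lambda>w. simple_ito W k \<tau> \<xi> t w - simple_ito W k \<tau> \<xi> s w) \<zeta>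
      = (\<Sum>i<k. ip M (\<lambda>w. elem (\<tau> i) (\<tau> (Suc i)) (\<xi> i) t w - elem (\<tau> i) (\<tau> (Suc i)) (\<xi> i) s w) \<zeta>)"
    unfolding simple_ito_elem sum_subtractf[symmetric] using L \<zeta> by (intro ip_sum_left) auto
  also have "\<dots> = 0"
    using simple_processD[OF sp] st \<zeta> by (intro sum.neutral ballI elem_martingale) auto
  finally show ?thesis .
qed

lemma indicator_bounded_Fil_L2P:
  fixes \<xi> :: "'w \<Rightarrow> 'a::euclidean_space"
  assumes \<xi>: "bounded_Fil a \<xi>"
  shows "(\<lambda>s w. indicator {a<..b} s *\<^sub>R \<xi> w) \<in> L2P"
proof -
  obtain K where K: "\<And>w. w \<in> space M \<Longrightarrow> norm (\<xi> w) \<le> K" "0 \<le> K" using bounded_Fil_bound[OF \<xi>] by blast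
  have [measurable]: "\<xi> \<in> borel_measurable M" by (rule bounded_Fil_measurable_M[OF \<xi>])
  have [measurable]: "indicat_real {a<..b} \<in> borel_measurable TI"
    by (intro measurable_restrict_space1 borel_measurable_indicator) auto
  have m: "(\<lambda>p. indicat_real {a<..b} (fst p) *\<^sub>R \<xi> (snd p)) \<in> borel_measurable LM" by measurable
  have "(\<integral>\<^sup>+w. (\<integral>\<^sup>+s. sqn (indicat_real {a<..b} s *\<^sub>R \<xi> w) \<partial>TI) \<partial>M)
      \<le> (\<integral>\<^sup>+w. (\<integral>\<^sup>+s. ennreal (K\<^sup>2) \<partial>TI) \<partial>M)"
    using K by (intro nn_integral_mono ennreal_leI power_mono) (auto split: split_indicator)
  also have "\<dots> < \<infinity>" by (simp add: emeasure_space_1 ennreal_mult_less_top TI.emeasure_eq_measure)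
  finally have fin: "(\<integral>\<^sup>+w. (\<integral>\<^sup>+s. sqn (indicat_real {a<..b} s *\<^sub>R \<xi> w) \<partial>TI) \<partial>M) < \<infinity>" .
  have ad: "(\<lambda>w. indicat_real {a<..b} t *\<^sub>R \<xi> w) \<in> borel_measurable (Fil t)" for t
    using bounded_Fil_measurable[OF \<xi>, of t] by (cases "t \<in> {a<..b}") simp_all
  show ?thesis unfolding L2F_def using fin ad m by (simp add: case_prod_beta')
qed

lemma simple_value_L2P:
  fixes \<xi> :: "nat \<Rightarrow> 'w \<Rightarrow> 'a::euclidean_space"
  assumes sp: "simple_process M W T k \<tau> \<xi>"
  shows "simple_value k \<tau> \<xi> \<in> L2P"
proof -
  have e: "(\<lambda>s w. indicator {\<tau> i<..\<tau> (Suc i)} s *\<^sub>R \<xi> i w) \<in> L2P" if "i < k" for i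
    by (rule indicator_bounded_Fil_L2P[OF simple_processD(1)[OF sp that]])
  have "(\<lambda>s w. \<Sum>i\<in>I. indicator {\<tau> i<..\<tau> (Suc i)} s *\<^sub>R \<xi> i w) \<in> L2P" if "finite I" "I \<subseteq> {..<k}" for I
    using that
  proof (induction I)
    case (insert i I)
    then have "(\<lambda>s w. indicator {\<tau> i<..\<tau> (Suc i)} s *\<^sub>R \<xi> i w + (\<Sum>i\<in>I. indicator {\<tau> i<..\<tau> (Suc i)} s *\<^sub>R \<xi> i w)) \<in> L2P"
      by (intro L2P_add e) auto
    then show ?case by (simp only: sum.insert[OF insert(1,2)])
  qed simp
  from this[of "{..<k}"] show ?thesis by (simp add: simple_value_def[abs_def])
qed

lemma integral_indicator_intervals:
  assumes "0 \<le> a" "0 \<le> c" "b \<le> T" "d \<le> T"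
  shows "(\<integral>s. indicator {0..t} s * (indicator {a<..b} s * indicator {c<..d} s) \<partial>TI) = max 0 (min (min b d) t - max a c)"
proof -
  let ?A = "{max a c<..min (min b d) t}"
  have eq: "indicator {0..t} s * (indicator {a<..b} s * indicator {c<..d} s) = indicat_real ?A s" for s
    using assms by (auto split: split_indicator)
  have sub: "?A \<subseteq> {0..T}" using assms by auto
  then have "(\<integral>s. indicat_real ?A s \<partial>TI) = measure TI ?A"
    by (simp add: Int_absorb2)
  also have "\<dots> = measure lebesgue ?A" using sub by (intro measure_restrict_space) auto
  also have "\<dots> = max 0 (min (min b d) t - max a c)"
    by (simp add: measure_completion, cases "max a c \<le> min (min b d) t") (auto simp: max_def)
  finally show ?thesis by (simp only: eq)
qed

lemma simple_ito_ip:
  fixes \<xi> \<xi>' :: "nat \<Rightarrow> 'w \<Rightarrow> 'a::euclidean_space"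
  assumes sp: "simple_process M W T k \<tau> \<xi>" and sp': "simple_process M W T k' \<tau>' \<xi>'" and t: "0 \<le> t"
  shows "ip M (simple_ito W k \<tau> \<xi> t) (simple_ito W k' \<tau>' \<xi>' t) = IP (cut t (simple_value k \<tau> \<xi>)) (simple_value k' \<tau>' \<xi>')"
proof -
  note d = simple_processD[OF sp] and d' = simple_processD[OF sp']
  have "ip M (simple_ito W k \<tau> \<xi> t) (simple_ito W k' \<tau>' \<xi>' t)
     = (\<Sum>i<k. \<Sum>j<k'. ip M (elem (\<tau> i) (\<tau> (Suc i)) (\<xi> i) t) (elem (\<tau>' j) (\<tau>' (Suc j)) (\<xi>' j) t))"
  proof -
    have L: "elem (\<tau> i) (\<tau> (Suc i)) (\<xi> i) t \<in> L2 M" if "i < k" for i using d[OF that] t by (intro elem_L2) auto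
    have L': "elem (\<tau>' i) (\<tau>' (Suc i)) (\<xi>' i) t \<in> L2 M" if "i < k'" for i using d'[OF that] t by (intro elem_L2) auto
    show ?thesis unfolding simple_ito_elem by (intro ip_sum_sum L L') (simp_all only: lessThan_iff)
  qed
  also have "\<dots> = (\<Sum>i<k. \<Sum>j<k'. max 0 (min (min (\<tau> (Suc i)) (\<tau>' (Suc j))) t - max (\<tau> i) (\<tau>' j)) * ip M (\<xi> i) (\<xi>' j))"
    using d d' t by (intro sum.cong refl elem_ip) auto
  also have "\<dots> = (\<Sum>i<k. \<Sum>j<k'. (\<integral>s. indicator {0..t} s * (indicator {\<tau> i<..\<tau> (Suc i)} s * indicator {\<tau>' j<..\<tau>' (Suc j)} s) \<partial>TI) * ip M (\<xi> i) (\<xi>' j))"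
  proof (intro sum.cong refl)
    fix i j assume "i \<in> {..<k}" "j \<in> {..<k'}"
    then have "(\<integral>s. indicator {0..t} s * (indicator {\<tau> i<..\<tau> (Suc i)} s * indicator {\<tau>' j<..\<tau>' (Suc j)} s) \<partial>TI)
      = max 0 (min (min (\<tau> (Suc i)) (\<tau>' (Suc j))) t - max (\<tau> i) (\<tau>' j))"
      using d(2,4)[of i] d'(2,4)[of j] by (intro integral_indicator_intervals) auto
    then show "max 0 (min (min (\<tau> (Suc i)) (\<tau>' (Suc j))) t - max (\<tau> i) (\<tau>' j)) * ip M (\<xi> i) (\<xi>' j) =
      (\<integral>s. indicator {0..t} s * (indicator {\<tau> i<..\<tau> (Suc i)} s * indicator {\<tau>' j<..\<tau>' (Suc j)} s) \<partial>TI) * ip M (\<xi> i) (\<xi>' j)"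
      by (rule arg_cong2[where f = "(*)", OF sym refl])
  qed
  also have "\<dots> = (\<Sum>i<k. \<Sum>j<k'. (\<integral>s. indicator {0..t} s * (indicator {\<tau> i<..\<tau> (Suc i)} s * indicator {\<tau>' j<..\<tau>' (Suc j)} s) * ip M (\<xi> i) (\<xi>' j) \<partial>TI))"
    by simp
  also have "\<dots> = (\<integral>s. (\<Sum>i<k. \<Sum>j<k'. indicator {0..t} s * (indicator {\<tau> i<..\<tau> (Suc i)} s * indicator {\<tau>' j<..\<tau>' (Suc j)} s) * ip M (\<xi> i) (\<xi>' j)) \<partial>TI)"
  proof -
    have int: "integrable TI (\<lambda>s. indicat_real {0..t} s * (indicator {a<..b} s * indicator {c<..d} s) * r)" for a b c d r
    proof (rule integrable_mult_left, rule TI.integrable_const_bound[where B = 1])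
      show "(\<lambda>s. indicat_real {0..t} s * (indicator {a<..b} s * indicator {c<..d} s)) \<in> borel_measurable TI"
        by (intro measurable_restrict_space1 borel_measurable_times borel_measurable_indicator) auto
    qed (auto split: split_indicator)
    show ?thesis
      by (simp only: Bochner_Integration.integral_sum Bochner_Integration.integrable_sum int)
  qed
  also have "\<dots> = (\<integral>s. indicator {0..t} s * ip M (simple_value k \<tau> \<xi> s) (simple_value k' \<tau>' \<xi>' s) \<partial>TI)"
  proof (intro LINT_cong refl)
    fix s :: real
    have L: "(\<lambda>w. indicat_real A s *\<^sub>R \<xi> i w) \<in> L2 M" if "i < k" for i A using d[OF that] bounded_Fil_L2 by (intro L2_scaleR) auto
    have L': "(\<lambda>w. indicat_real A s *\<^sub>R \<xi>' i w) \<in> L2 M" if "i < k'" for i A using d'[OF that] bounded_Fil_L2 by (intro L2_scaleR) auto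
    have "ip M (simple_value k \<tau> \<xi> s) (simple_value k' \<tau>' \<xi>' s) =
       (\<Sum>i<k. \<Sum>j<k'. ip M (\<lambda>w. indicator {\<tau> i<..\<tau> (Suc i)} s *\<^sub>R \<xi> i w) (\<lambda>w. indicator {\<tau>' j<..\<tau>' (Suc j)} s *\<^sub>R \<xi>' j w))"
      unfolding simple_value_def[abs_def] by (intro ip_sum_sum L L') (simp_all only: lessThan_iff)
    then show "(\<Sum>i<k. \<Sum>j<k'. indicator {0..t} s * (indicator {\<tau> i<..\<tau> (Suc i)} s * indicator {\<tau>' j<..\<tau>' (Suc j)} s) * ip M (\<xi> i) (\<xi>' j))
      = indicator {0..t} s * ip M (simple_value k \<tau> \<xi> s) (simple_value k' \<tau>' \<xi>' s)"
      by (simp add: ip_scaleR_left ip_scaleR_right sum_distrib_left mult_ac)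
  qed
  also have "\<dots> = IP (cut t (simple_value k \<tau> \<xi>)) (simple_value k' \<tau>' \<xi>')"
    by (rule IP_cut[symmetric]) (intro simple_value_L2P sp sp')+
  finally show ?thesis .
qed

section \<open>Density of dyadic simple processes\<close>

text \<open>On dyadic grids two simple processes always have a common refinement, so these processes form a
  vector space.\<close>

definition dyadic_simple :: "('w, 'a::euclidean_space) process set" where
  "dyadic_simple = {simple_value (2^n) (grid T n) \<xi> | n \<xi>. \<forall>i<2^n. bounded_Fil (grid T n i) (\<xi> i)}"

lemma grid_simple_process:
  "(\<And>i. i < 2^n \<Longrightarrow> bounded_Fil (grid T n i) (\<xi> i)) \<Longrightarrow> simple_process M W T (2^n) (grid T n) \<xi>"
  unfolding simple_process_def bounded_Fil_def using grid_less[OF T_pos] by auto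

lemma simple_value_refine1:
  "simple_value (2^n) (grid T n) \<xi> = simple_value (2 ^ Suc n) (grid T (Suc n)) (\<lambda>i. \<xi> (i div 2))"
proof (intro ext)
  fix s w
  have g: "grid T (Suc n) (2 * i) = grid T n i" for i
    using grid_refine[of T n 1 i] by (simp add: mult.commute)
  have "simple_value (2 ^ Suc n) (grid T (Suc n)) (\<lambda>i. \<xi> (i div 2)) s w =
    (\<Sum>i<2^n. indicator {grid T (Suc n) (2 * i)<..grid T (Suc n) (Suc (2 * i))} s *\<^sub>R \<xi> i w +
      indicator {grid T (Suc n) (Suc (2 * i))<..grid T (Suc n) (2 * Suc i)} s *\<^sub>R \<xi> i w)"
    unfolding simple_value_def power_Suc sum_split_pairs by simp
  also have "\<dots> = simple_value (2^n) (grid T n) \<xi> s w"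
    unfolding simple_value_def
  proof (rule sum.cong)
    fix i
    have "grid T (Suc n) (2 * i) < grid T (Suc n) (Suc (2 * i))" "grid T (Suc n) (Suc (2 * i)) < grid T (Suc n) (2 * Suc i)"
      by (auto intro!: grid_less T_pos)
    then show "indicator {grid T (Suc n) (2 * i)<..grid T (Suc n) (Suc (2 * i))} s *\<^sub>R \<xi> i w +
      indicator {grid T (Suc n) (Suc (2 * i))<..grid T (Suc n) (2 * Suc i)} s *\<^sub>R \<xi> i w = indicator {grid T n i<..grid T n (Suc i)} s *\<^sub>R \<xi> i w"
      unfolding g by (auto split: split_indicator)
  qed simp
  finally show "simple_value (2^n) (grid T n) \<xi> s w = simple_value (2 ^ Suc n) (grid T (Suc n)) (\<lambda>i. \<xi> (i div 2)) s w" ..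
qed

lemma dyadic_simple_level:
  assumes "\<forall>i<2^n. bounded_Fil (grid T n i) (\<xi> i)" "n \<le> m"
  shows "\<exists>\<zeta>. (\<forall>i<2^m. bounded_Fil (grid T m i) (\<zeta> i)) \<and> simple_value (2^n) (grid T n) \<xi> = simple_value (2^m) (grid T m) \<zeta>"
  using assms(2)
proof (induction m rule: dec_induct)
  case (step m)
  then obtain \<zeta> where \<zeta>: "\<forall>i<2^m. bounded_Fil (grid T m i) (\<zeta> i)" "simple_value (2^n) (grid T n) \<xi> = simple_value (2^m) (grid T m) \<zeta>"
    by blast
  have "bounded_Fil (grid T (Suc m) i) (\<zeta> (i div 2))" if i: "i < 2 ^ Suc m" for i
  proof (rule bounded_Fil_mono)
    show "bounded_Fil (grid T m (i div 2)) (\<zeta> (i div 2))" using \<zeta>(1) i by auto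
    have "grid T m (i div 2) = grid T (Suc m) (2 * (i div 2))" using grid_refine[of T m 1 "i div 2"] by (simp add: mult.commute)
    also have "\<dots> \<le> grid T (Suc m) i" using T_pos by (intro grid_mono) auto
    finally show "grid T m (i div 2) \<le> grid T (Suc m) i" .
  qed
  then show ?case using \<zeta>(2) simple_value_refine1[of m \<zeta>] by (intro exI[of _ "\<lambda>i. \<zeta> (i div 2)"]) auto
qed (use assms(1) in blast)

lemma dyadic_simple_L2P: "\<phi> \<in> dyadic_simple \<Longrightarrow> \<phi> \<in> L2P"
  unfolding dyadic_simple_def using simple_value_L2P[OF grid_simple_process] by auto

lemma bounded_Fil_add:
  assumes "bounded_Fil a \<xi>" "bounded_Fil a \<zeta>" shows "bounded_Fil a (\<lambda>w. \<xi> w + \<zeta> w)"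
  using assms unfolding bounded_Fil_def by (auto intro!: borel_measurable_add bounded_plus_comp)

lemma bounded_Fil_scaleR:
  assumes "bounded_Fil a \<xi>" shows "bounded_Fil a (\<lambda>w. r *\<^sub>R \<xi> w)"
  using assms unfolding bounded_Fil_def
  by (auto intro!: borel_measurable_scaleR simp: image_image[symmetric, of "(*\<^sub>R) r" \<xi>] intro: bounded_scaling)

lemma dyadic_simple_zero: "(\<lambda>s w. 0) \<in> dyadic_simple"
proof -
  have "(\<lambda>s w. 0) = simple_value (2^0) (grid T 0) (\<lambda>i (w::'w). 0::'a)" by (auto simp: simple_value_def fun_eq_iff)
  moreover have "bounded_Fil a (\<lambda>w. 0 :: 'a)" for a by (auto simp: bounded_Fil_def image_constant_conv)
  ultimately show ?thesis unfolding dyadic_simple_def by blast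
qed

lemma dyadic_simple_add: assumes "\<phi> \<in> dyadic_simple" "\<psi> \<in> dyadic_simple" shows "(\<lambda>s w. \<phi> s w + \<psi> s w) \<in> dyadic_simple"
proof -
  obtain n \<xi> p \<zeta> where "\<phi> = simple_value (2^n) (grid T n) \<xi>" "\<forall>i<2^n. bounded_Fil (grid T n i) (\<xi> i)"
    "\<psi> = simple_value (2^p) (grid T p) \<zeta>" "\<forall>i<2^p. bounded_Fil (grid T p i) (\<zeta> i)"
    using assms unfolding dyadic_simple_def by blast
  moreover define m where "m = max n p"
  ultimately obtain \<xi>' \<zeta>' where e: "\<phi> = simple_value (2^m) (grid T m) \<xi>'" "\<forall>i<2^m. bounded_Fil (grid T m i) (\<xi>' i)"
    "\<psi> = simple_value (2^m) (grid T m) \<zeta>'" "\<forall>i<2^m. bounded_Fil (grid T m i) (\<zeta>' i)"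
    using dyadic_simple_level[of n \<xi> m] dyadic_simple_level[of p \<zeta> m] by auto
  have "(\<lambda>s w. \<phi> s w + \<psi> s w) = simple_value (2^m) (grid T m) (\<lambda>i w. \<xi>' i w + \<zeta>' i w)"
    unfolding e simple_value_def by (intro ext) (simp only: scaleR_add_right sum.distrib)
  then show ?thesis unfolding dyadic_simple_def using e(2,4) by (blast intro: bounded_Fil_add)
qed

lemma dyadic_simple_scaleR: assumes "\<phi> \<in> dyadic_simple" shows "(\<lambda>s w. r *\<^sub>R \<phi> s w) \<in> dyadic_simple"
proof -
  obtain n \<xi> where e: "\<phi> = simple_value (2^n) (grid T n) \<xi>" "\<forall>i<2^n. bounded_Fil (grid T n i) (\<xi> i)"
    using assms unfolding dyadic_simple_def by blast
  have "(\<lambda>s w. r *\<^sub>R \<phi> s w) = simple_value (2^n) (grid T n) (\<lambda>i w. r *\<^sub>R \<xi> i w)"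
    unfolding e simple_value_def by (intro ext) (simp only: scaleR_sum_right scaleR_left_commute)
  then show ?thesis unfolding dyadic_simple_def using e(2) by (blast intro: bounded_Fil_scaleR)
qed

lemma AE_eq_0_if_Fil_integrals_zero:
  fixes f :: "'w \<Rightarrow> real"
  assumes f: "f \<in> borel_measurable (Fil t)" "integrable M f" and 0: "\<And>A. A \<in> sets (Fil t) \<Longrightarrow> (LINT w:A|M. f w) = 0"
  shows "AE w in M. f w = 0"
proof -
  let ?N = "restr_to_subalg M (Fil t)"
  have "AE w in ?N. f w = 0"
  proof (rule sigma_finite_measure.density_zero)
    show "sigma_finite_measure ?N"
      using finite_measure_restr_to_subalg[OF subalgebra_Fil finite_measure_axioms]
      by (rule finite_measure.axioms(1))
  next
    show "integrable ?N f" using integrable_in_subalg[OF subalgebra_Fil f] .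
    fix A assume "A \<in> sets ?N"
    then have A: "A \<in> sets (Fil t)" by (simp add: sets_restr_to_subalg subalgebra_Fil)
    have "(LINT w:A|?N. f w) = (LINT w:A|M. f w)"
      unfolding set_lebesgue_integral_def using A f
      by (intro integral_subalgebra2[OF subalgebra_Fil] borel_measurable_scaleR borel_measurable_indicator) auto
    then show "(LINT w:A|?N. f w) = 0" using 0[OF A] by simp
  qed
  then show ?thesis by (rule AE_restr_to_subalg[OF subalgebra_Fil])
qed

text \<open>Test \<open>\<phi>\<close> with \<open>b\<close> times the indicator of \<open>below J\<close> on dyadic intervals to the right of all times in
  \<open>J\<close>. For each of countably many \<open>J\<close> this makes \<open>E (\<phi> s \<bullet> b; below J) = 0\<close> for almost every \<open>s\<close> beyond
  \<open>J\<close>, with one exceptional null set of times for all \<open>J\<close>. At any other \<open>s\<close> these sets determine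
  \<open>Fil s\<close>, and \<open>\<phi> s\<close> is measurable with respect to \<open>Fil s\<close>.\<close>

lemma dyadic_simple_orthogonal_trivial:
  fixes \<phi> :: "('w, 'a::euclidean_space) process"
  assumes \<phi>: "\<phi> \<in> L2P" and 0: "\<And>\<psi>. \<psi> \<in> dyadic_simple \<Longrightarrow> IP \<phi> \<psi> = 0"
  shows "NR \<phi> = 0"
proof -
  \<comment> \<open>countably many test sets, so that their null sets of times have a null union\<close>
  define JJ :: "(real \<times> real) set set" where "JJ = {J. finite J \<and> J \<subseteq> dyad T \<times> \<rat>}"
  have cJJ: "countable JJ" unfolding JJ_def
    by (intro countable_Collect_finite_subset countable_SIGMA dyad_countable countable_rat)
  have dT: "dyad T \<subseteq> {0..T}" using T_pos by (intro dyad_range) auto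
  have test: "AE s in lebesgue_on {0..T}. 0 < s \<and> (\<forall>r\<in>fst ` J. r < s) \<longrightarrow> (LINT w:below J|M. \<phi> s w \<bullet> b) = 0" if J: "J \<in> JJ" for J :: "(real \<times> real) set" and b :: 'a
  proof -
    have J': "finite J" "finite (insert 0 (fst ` J))" "insert 0 (fst ` J) \<subseteq> dyad T"
      using J zero_in_dyad unfolding JJ_def by auto
    define r0 where "r0 = Max (insert 0 (fst ` J))"
    have r0: "r0 \<in> dyad T" "\<And>r. r \<in> fst ` J \<Longrightarrow> r \<le> r0" using Max_in[OF J'(2)] J' by (auto simp: r0_def)

    obtain n0 where n0: "\<And>m. m \<ge> n0 \<Longrightarrow> \<exists>j\<le>2^m. r0 = grid T m j"
      using finite_dyad_common_grid[of "{r0}" T] r0(1) by auto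
    define \<beta> where "\<beta> w = indicat_real (below J) w *\<^sub>R b" for w
    have bJ: "below J \<in> sets (Fil r0)"
    proof (rule below_sets[OF J'(1)])
      show "J \<subseteq> {0..r0} \<times> UNIV"
      proof
        fix p assume "p \<in> J"
        then have "fst p \<in> dyad T" "fst p \<le> r0" using J'(3) r0(2) by auto
        then have "fst p \<in> {0..T}" "fst p \<le> r0" using dT by blast+
        then show "p \<in> {0..r0} \<times> UNIV" by (cases p) auto
      qed
    qed
    have \<beta>b: "bounded_Fil r0 \<beta>"
      unfolding bounded_Fil_def \<beta>_def[abs_def] bounded_iff using bJ
      by (auto intro!: borel_measurable_scaleR borel_measurable_indicator exI[of _ "norm b"] split: split_indicator)
    define h where "h s = indicator {r0<..T} s * ip M (\<phi> s) \<beta>" for s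
    have step: "(\<lambda>s w. indicator {grid T n i<..grid T n (Suc i)} s *\<^sub>R \<beta> w) \<in> dyadic_simple" if i: "i < 2^n" "r0 \<le> grid T n i" for n i
    proof -
      have "simple_value (2^n) (grid T n) (\<lambda>j w. if j = i then \<beta> w else 0) = (\<lambda>s w. indicator {grid T n i<..grid T n (Suc i)} s *\<^sub>R \<beta> w)"
      proof (intro ext)
        fix s w
        have "simple_value (2^n) (grid T n) (\<lambda>j w. if j = i then \<beta> w else 0) s w
          = (\<Sum>j<2^n. if j = i then indicator {grid T n i<..grid T n (Suc i)} s *\<^sub>R \<beta> w else 0)"
          unfolding simple_value_def by (intro sum.cong) auto
        also have "\<dots> = indicator {grid T n i<..grid T n (Suc i)} s *\<^sub>R \<beta> w" using i by (simp add: sum.delta)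
        finally show "simple_value (2^n) (grid T n) (\<lambda>j w. if j = i then \<beta> w else 0) s w = indicator {grid T n i<..grid T n (Suc i)} s *\<^sub>R \<beta> w" .
      qed
      moreover have "bounded_Fil (grid T n j) (\<lambda>w. if j = i then \<beta> w else 0)" for j
        using bounded_Fil_mono[OF \<beta>b i(2)] by (cases "j = i") (auto simp: bounded_Fil_def image_constant_conv)
      ultimately show ?thesis unfolding dyadic_simple_def mem_Collect_eq by (intro exI conjI) (auto dest: sym)
    qed
    have hint: "integrable TI h"
    proof -
      have "(\<lambda>s w. indicator {r0<..T} s *\<^sub>R \<beta> w) \<in> L2P"
        by (rule indicator_bounded_Fil_L2P[OF \<beta>b])
      from ip_time_integrable[OF \<phi> this] show ?thesis by (simp add: h_def[abs_def] ip_scaleR_right)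
    qed
    have "AE s in TI. h s = 0"
    proof (rule AE_zero_if_dyadic_integrals_zero[OF T_pos hint, of n0])
      fix n i assume n: "n0 \<le> n" and i: "i < (2::nat)^n"
      obtain j where j: "j \<le> 2^n" "r0 = grid T n j" using n0[OF n] by blast
      show "(\<integral>s. indicator {grid T n i<..grid T n (Suc i)} s * h s \<partial>TI) = 0"
      proof (cases "j \<le> i")
        case True
        then have r0i: "r0 \<le> grid T n i" using j T_pos by (simp add: grid_mono)
        have "grid T n (Suc i) \<le> T" using grid_range[of T "Suc i" n] i T_pos by auto
        then have "(\<integral>s. indicator {grid T n i<..grid T n (Suc i)} s * h s \<partial>TI)
          = (\<integral>s. ip M (\<phi> s) (\<lambda>w. indicator {grid T n i<..grid T n (Suc i)} s *\<^sub>R \<beta> w) \<partial>TI)"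
          using r0i by (intro LINT_cong) (auto simp: h_def ip_scaleR_right split: split_indicator)
        also have "\<dots> = IP \<phi> (\<lambda>s w. indicator {grid T n i<..grid T n (Suc i)} s *\<^sub>R \<beta> w)"
          by (rule IP_eq_time_outer[symmetric, OF \<phi> dyadic_simple_L2P[OF step[OF i r0i]]])
        also have "\<dots> = 0" by (rule 0[OF step[OF i r0i]])
        finally show ?thesis .
      next
        case False
        then have "grid T n (Suc i) \<le> r0" using j T_pos by (simp add: grid_mono)
        then have "(\<lambda>s. indicator {grid T n i<..grid T n (Suc i)} s * h s) = (\<lambda>s. 0)"
          by (auto simp: h_def fun_eq_iff split: split_indicator)
        then show ?thesis by (simp only: Bochner_Integration.integral_zero)
      qed
    qed
    then show ?thesis using AE_space
    proof eventually_elim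
      case (elim s)
      show ?case
      proof
        assume lt: "0 < s \<and> (\<forall>r\<in>fst ` J. r < s)"
        then have "r0 < s" using J'(2) by (simp add: r0_def)
        then have "ip M (\<phi> s) \<beta> = 0" using elim by (simp add: h_def)
        then show "(LINT w:below J|M. \<phi> s w \<bullet> b) = 0"
          by (simp add: ip_def \<beta>_def set_lebesgue_integral_def)
      qed
    qed
  qed
  have "AE s in TI. \<forall>J\<in>JJ. \<forall>b\<in>Basis. 0 < s \<and> (\<forall>r\<in>fst ` J. r < s) \<longrightarrow> (LINT w:below J|M. \<phi> s w \<bullet> (b::'a)) = 0"
    by (intro AE_ball_countable[THEN iffD2] countable_finite finite_Basis ballI test cJJ)
  moreover have "AE s in TI. s \<noteq> 0"
    by (rule AE_I'[of "{0}"]) (use T_pos in \<open>auto simp: null_sets_restrict_space\<close>)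
  ultimately have "AE s in TI. AE w in M. \<phi> s w = 0" using L2P_AE_L2[OF \<phi>] AE_space
  proof eventually_elim
    case (elim s)
    have s: "0 \<le> s" "s \<le> T" "0 < s" using elim by auto
    have "AE w in M. \<phi> s w \<bullet> b = 0" if b: "b \<in> Basis" for b
    proof (rule AE_eq_0_if_Fil_integrals_zero)
      show "(\<lambda>w. \<phi> s w \<bullet> b) \<in> borel_measurable (Fil s)" using L2P_adapted[OF \<phi>, of s] s by (intro borel_measurable_inner) auto
      show i: "integrable M (\<lambda>w. \<phi> s w \<bullet> b)" using elim(3) by (intro L2_inner_integrable[of "\<phi> s"]) (auto simp: L2_def)
      fix A assume A: "A \<in> sets (Fil s)"
      show "(LINT w:A|M. \<phi> s w \<bullet> b) = 0"
      proof (rule set_integral_eq_0_Fil[OF s(1) _ _ i _ A, of "dyad T \<inter> {0..<s}"])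
        show "r \<in> closure (dyad T \<inter> {0..<s})" if "0 < r" "r \<le> s" for r
        proof -
          have "dyad T \<inter> {0..<r} \<subseteq> dyad T \<inter> {0..<s}" using that by auto
          from closure_mono[OF this] show ?thesis using dyad_dense_from_left[of r T] that s by auto
        qed
        fix J :: "(real \<times> real) set" assume "finite J" "J \<subseteq> (dyad T \<inter> {0..<s}) \<times> \<rat>"
        then show "(LINT w:below J|M. \<phi> s w \<bullet> b) = 0"         proof -
          have "J \<in> JJ" "\<forall>r\<in>fst ` J. r < s"
            using \<open>finite J\<close> \<open>J \<subseteq> (dyad T \<inter> {0..<s}) \<times> \<rat>\<close> unfolding JJ_def by force+
          then show ?thesis using bspec[OF bspec[OF elim(1)] b] s(3) by blast
        qed
      qed auto
    qed
    then have "AE w in M. \<forall>b\<in>Basis. \<phi> s w \<bullet> b = 0" by (simp add: AE_ball_countable countable_finite)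
    then show ?case by eventually_elim (rule euclidean_eqI, simp)
  qed
  then show ?thesis by (rule NR_eq_0_I[OF \<phi>])
qed

lemma dyadic_simple_dense:
  fixes \<phi> :: "('w, 'a::euclidean_space) process"
  assumes "\<phi> \<in> L2P"
  shows "\<exists>F. (\<forall>n. F n \<in> dyadic_simple) \<and> (\<lambda>n. DR (F n) \<phi>) \<longlonglongrightarrow> 0"
proof -
  let ?S = "case_prod ` (dyadic_simple :: ('w, 'a) process set)"
  have "\<exists>F. (\<forall>n. F n \<in> ?S) \<and> (\<lambda>n. dst PM (F n) (case_prod \<phi>)) \<longlonglongrightarrow> 0"
  proof (rule L2_dense_if_orthogonal_trivial)
    show "?S \<subseteq> L2 PM" using dyadic_simple_L2P by (auto simp: L2P_iff)
    show "(\<lambda>x. 0) \<in> ?S" by (intro image_eqI[where x = "\<lambda>s w. 0"] dyadic_simple_zero) auto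
    show "(\<lambda>x. f x + g x) \<in> ?S" if fg: "f \<in> ?S" "g \<in> ?S" for f g
    proof -
      obtain \<psi> \<theta> where "f = case_prod \<psi>" "\<psi> \<in> dyadic_simple" "g = case_prod \<theta>" "\<theta> \<in> dyadic_simple" using fg by blast
      then show ?thesis by (intro image_eqI[where x = "\<lambda>s w. \<psi> s w + \<theta> s w"] dyadic_simple_add) auto
    qed
    show "(\<lambda>x. r *\<^sub>R f x) \<in> ?S" if fg: "f \<in> ?S" for f r
    proof -
      obtain \<psi> where "f = case_prod \<psi>" "\<psi> \<in> dyadic_simple" using fg by blast
      then show ?thesis by (intro image_eqI[where x = "\<lambda>s w. r *\<^sub>R \<psi> s w"] dyadic_simple_scaleR) auto
    qed
    show "case_prod \<phi> \<in> L2 PM" using assms by (simp add: L2P_iff)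
    fix f assume f: "f \<in> L2 PM" and 0: "\<And>s. s \<in> ?S \<Longrightarrow> ip PM f s = 0"
    have "NR (\<lambda>s w. f (s, w)) = 0"
    proof (rule dyadic_simple_orthogonal_trivial)
      show "(\<lambda>s w. f (s, w)) \<in> L2P" using f by (simp add: L2P_iff case_prod_curry)
      show "IP (\<lambda>s w. f (s, w)) \<psi> = 0" if "\<psi> \<in> dyadic_simple" for \<psi> using 0 that by (simp add: IP_def case_prod_curry)
    qed
    then show "AE x in PM. f x = 0" using nrm_eq_0_iff[OF f] by (simp add: NR_def case_prod_curry)
  qed
  then obtain F where F: "\<And>n. F n \<in> ?S" "(\<lambda>n. dst PM (F n) (case_prod \<phi>)) \<longlonglongrightarrow> 0" by blast
  then have "\<forall>n. \<exists>G. G \<in> dyadic_simple \<and> F n = case_prod G" by blast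
  then obtain G where G: "\<And>n. G n \<in> dyadic_simple" "\<And>n. F n = case_prod (G n)" by metis
  show ?thesis using F(2) G(1) unfolding G(2) NR_def case_prod_diff by blast
qed

end

section \<open>Limits in mean and the maximal inequality\<close>

lemma L2_limit_AE_subsequence:
  fixes F :: "nat \<Rightarrow> 'x \<Rightarrow> 'a::euclidean_space"
  assumes F: "\<And>n. F n \<in> L2 N" "f \<in> L2 N" and lim: "(\<lambda>n. dst N (F n) f) \<longlonglongrightarrow> 0"
  shows "\<exists>r. strict_mono r \<and> (AE x in N. (\<lambda>k. F (r k) x) \<longlonglongrightarrow> f x)"
proof -
  have "\<exists>n0. \<forall>m\<ge>n0. \<forall>n\<ge>n0. dst N (F m) f < e" if "e > 0" for e
    using LIMSEQ_D[OF lim that] by auto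
  then obtain r where r: "strict_mono r" "\<And>k. dst N (F (r (Suc k))) f < sqrt ((1/8)^k)"
    using fast_subsequence[of "\<lambda>m n. dst N (F m) f" "\<lambda>k. sqrt ((1/8)^k)"] by auto
  have "AE x in N. \<exists>C::real. \<forall>k. sqn (F (r (Suc k)) x - f x) \<le> ennreal (C * (1/4)^k)"
  proof (rule AE_geometric_of_nn_integral)
    show "(\<lambda>x. sqn (F (r (Suc k)) x - f x)) \<in> borel_measurable N" for k
      using L2_measurable[OF F(1)] L2_measurable[OF F(2)] by measurable
    fix k
    have "(\<integral>\<^sup>+x. sqn (F (r (Suc k)) x - f x) \<partial>N) = ennreal ((dst N (F (r (Suc k))) f)\<^sup>2)"
      unfolding nrm_power2 by (intro nn_integral_norm2 L2_diff F)
    also have "\<dots> \<le> ennreal ((sqrt ((1/8)^k))\<^sup>2)"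
      using r(2)[of k] by (intro ennreal_leI power_mono) auto
    finally show "(\<integral>\<^sup>+x. sqn (F (r (Suc k)) x - f x) \<partial>N) \<le> ennreal ((1/8)^k)" by simp
  qed
  then have "AE x in N. (\<lambda>k. F (r (Suc k)) x) \<longlonglongrightarrow> f x"
  proof eventually_elim
    case (elim x)
    then obtain C where C: "\<And>k. sqn (F (r (Suc k)) x - f x) \<le> ennreal (C * (1/4)^k)" by blast
    have "(norm (F (r (Suc k)) x - f x))\<^sup>2 \<le> max C 0 * (1/4)^k" for k
    proof -
      have "sqn (F (r (Suc k)) x - f x) \<le> ennreal (max C 0 * (1/4)^k)"
        using C[of k] by (rule order_trans) (intro ennreal_leI mult_right_mono; simp)
      then show ?thesis by (subst (asm) ennreal_le_iff) auto
    qed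
    then have "summable (\<lambda>k. norm (F (r (Suc k)) x - f x))" by (rule summable_norm_of_geometric_squares)
    then have "(\<lambda>k. norm (F (r (Suc k)) x - f x)) \<longlonglongrightarrow> 0" by (rule summable_LIMSEQ_zero)
    then show ?case using LIM_zero_iff tendsto_norm_zero_iff by blast
  qed
  moreover have "strict_mono (\<lambda>k. r (Suc k))" using r(1) by (simp add: strict_mono_def)
  ultimately show ?thesis by blast
qed

lemma L2_limit_of_AE_limit:
  fixes F :: "nat \<Rightarrow> 'x \<Rightarrow> 'a::euclidean_space"
  assumes F: "\<And>n. F n \<in> L2 N" and f: "f \<in> borel_measurable N"
    and Cauchy: "\<And>e. e > 0 \<Longrightarrow> \<exists>n0. \<forall>m\<ge>n0. \<forall>n\<ge>n0. dst N (F m) (F n) < e"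
    and lim: "AE x in N. (\<lambda>n. F n x) \<longlonglongrightarrow> f x"
  shows "f \<in> L2 N" and "(\<lambda>n. dst N (F n) f) \<longlonglongrightarrow> 0"
proof -
  obtain g where g: "g \<in> L2 N" "(\<lambda>n. dst N (F n) g) \<longlonglongrightarrow> 0"
    using L2_complete[OF F Cauchy] by blast
  obtain r where r: "strict_mono r" "AE x in N. (\<lambda>k. F (r k) x) \<longlonglongrightarrow> g x"
    using L2_limit_AE_subsequence[OF F g] by blast
  have gf: "AE x in N. g x = f x" using r(2) lim
  proof eventually_elim
    case (elim x)
    then show ?case using LIMSEQ_subseq_LIMSEQ[OF elim(2) r(1)] LIMSEQ_unique by (fastforce simp: o_def)
  qed
  show fL: "f \<in> L2 N" by (rule L2_cong_AE[OF g(1) f gf])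
  have "dst N (F n) g = dst N (F n) f" for n
  proof -
    have "AE x in N. F n x - g x = F n x - f x" using gf by eventually_elim simp
    then show ?thesis unfolding nrm_def
      by (intro arg_cong[where f = sqrt] ip_cong_AE L2_measurable L2_diff F g fL)
  qed
  then show "(\<lambda>n. dst N (F n) f) \<longlonglongrightarrow> 0" using g(2) by simp
qed

primrec run_max :: "(nat \<Rightarrow> real) \<Rightarrow> nat \<Rightarrow> real" where
  "run_max s 0 = s 0"
| "run_max s (Suc n) = max (run_max s n) (s (Suc n))"

lemma run_max_ge: "i \<le> n \<Longrightarrow> s i \<le> run_max s n"
  by (induction n) (auto simp: le_Suc_eq max_def intro: order_trans)

lemma run_max_attained: "\<exists>i\<le>n. run_max s n = s i"
  by (induction n) (auto simp: max_def intro: le_SucI)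

text \<open>The pathwise form of Doob's inequality: after taking expectations, the sum contributes a
  nonnegative amount for a submartingale and the constant \<open>4\<close> remains.\<close>

lemma Doob_pathwise:
  assumes "\<And>i. 0 \<le> s i"
  shows "(run_max s n)\<^sup>2 \<le> 4 * (s n)\<^sup>2 - 4 * (\<Sum>i<n. run_max s i * (s (Suc i) - s i))"
proof -
  let ?S = "\<lambda>n. \<Sum>i<n. run_max s i * (s (Suc i) - s i)"
  have "(run_max s n)\<^sup>2 / 2 + ?S n \<le> run_max s n * s n"
  proof (induction n)
    case 0
    show ?case using assms[of 0] by (simp add: power2_eq_square)
  next
    case (Suc n)
    show ?case
    proof (cases "s (Suc n) \<le> run_max s n")
      case True
      then show ?thesis using Suc by (simp add: max_absorb1 right_diff_distrib)
    next
      case False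
      then have "0 \<le> (s (Suc n) - run_max s n)\<^sup>2" by simp
      then show ?thesis using Suc False by (simp add: max_absorb2 power2_eq_square algebra_simps)
    qed
  qed
  moreover have "run_max s n * s n \<le> (run_max s n)\<^sup>2 / 4 + (s n)\<^sup>2"
    using zero_le_power2[of "run_max s n / 2 - s n"] by (simp add: power2_eq_square algebra_simps)
  ultimately show ?thesis by simp
qed

context bm_horizon
begin

text \<open>The martingale property in weak form: increments are orthogonal to the past in \<open>L2\<close>.\<close>

definition L2mart :: "('w, 'a::euclidean_space) process \<Rightarrow> bool" where
  "L2mart N \<longleftrightarrow> (\<forall>t\<in>{0..T}. N t \<in> borel_measurable (Fil t) \<and> N t \<in> L2 M) \<and>
    (\<forall>s t \<zeta>. 0 \<le> s \<and> s \<le> t \<and> t \<le> T \<and> \<zeta> \<in> borel_measurable (Fil s) \<and> \<zeta> \<in> L2 M \<longrightarrow>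
      ip M (\<lambda>w. N t w - N s w) \<zeta> = 0)"

lemma L2martD:
  assumes "L2mart N" "0 \<le> t" "t \<le> T"
  shows "N t \<in> borel_measurable (Fil t)" "N t \<in> L2 M"
    "0 \<le> s \<Longrightarrow> s \<le> t \<Longrightarrow> \<zeta> \<in> borel_measurable (Fil s) \<Longrightarrow> \<zeta> \<in> L2 M \<Longrightarrow> ip M (\<lambda>w. N t w - N s w) \<zeta> = 0"
  using assms by (auto simp: L2mart_def)

lemma L2mart_diff:
  assumes N: "L2mart N" and N': "L2mart N'"
  shows "L2mart (\<lambda>t w. N t w - N' t w)"
  unfolding L2mart_def
proof (intro conjI ballI allI impI)
  fix t assume "t \<in> {0..T}"
  then show "(\<lambda>w. N t w - N' t w) \<in> borel_measurable (Fil t)" "(\<lambda>w. N t w - N' t w) \<in> L2 M"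
    using L2martD[OF N, of t] L2martD[OF N', of t] by (auto intro!: L2_diff borel_measurable_diff)
next
  fix s t and \<zeta> :: "'w \<Rightarrow> 'a"
  assume a: "0 \<le> s \<and> s \<le> t \<and> t \<le> T \<and> \<zeta> \<in> borel_measurable (Fil s) \<and> \<zeta> \<in> L2 M"
  then have L: "N t \<in> L2 M" "N s \<in> L2 M" "N' t \<in> L2 M" "N' s \<in> L2 M"
    using L2martD(2)[OF N] L2martD(2)[OF N'] by auto
  have "ip M (\<lambda>w. (N t w - N s w) - (N' t w - N' s w)) \<zeta> = 0"
    using a L L2martD(3)[OF N, of t s \<zeta>] L2martD(3)[OF N', of t s \<zeta>] by (simp add: ip_diff_left L2_diff)
  then show "ip M (\<lambda>w. (N t w - N' t w) - (N s w - N' s w)) \<zeta> = 0" by (simp add: algebra_simps)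
qed

text \<open>The running maximum times the sign of \<open>N\<close> is an admissible test variable, and the tangent inequality
  \<open>(u - v) \<bullet> sgn v \<le> \<parallel>u\<parallel> - \<parallel>v\<parallel>\<close> turns the martingale property into the submartingale inequality that
  the pathwise bound needs.\<close>

lemma Doob_discrete:
  fixes N :: "('w, 'a::euclidean_space) process"
  assumes N: "L2mart N" and \<tau>: "\<And>i. i \<le> n \<Longrightarrow> 0 \<le> \<tau> i \<and> \<tau> i \<le> T" "\<And>i. i < n \<Longrightarrow> \<tau> i \<le> \<tau> (Suc i)"
  shows "(\<lambda>w. run_max (\<lambda>i. norm (N (\<tau> i) w)) n) \<in> L2 M"
    and "(\<integral>w. (run_max (\<lambda>i. norm (N (\<tau> i) w)) n)\<^sup>2 \<partial>M) \<le> 4 * ip M (N (\<tau> n)) (N (\<tau> n))"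
proof -
  define R where "R k w = run_max (\<lambda>i. norm (N (\<tau> i) w)) k" for k w
  have L: "N (\<tau> i) \<in> L2 M" and F: "N (\<tau> i) \<in> borel_measurable (Fil (\<tau> i))" if "i \<le> n" for i
    using L2martD[OF N] \<tau>(1)[OF that] by auto
  have nL: "(\<lambda>w. norm (N (\<tau> i) w)) \<in> L2 M" if "i \<le> n" for i
    using L[OF that] measurable_compose[OF L2_measurable[OF L[OF that]] borel_measurable_norm] by (simp add: L2_def)
  have R0: "0 \<le> R k w" for k w using run_max_ge[of 0 k "\<lambda>i. norm (N (\<tau> i) w)"] norm_ge_zero order_trans unfolding R_def by blast
  have RF: "R k \<in> borel_measurable (Fil (\<tau> k)) \<and> R k \<in> L2 M" if "k \<le> n" for k
    using that
  proof (induction k)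
    case 0
    then show ?case using nL[of 0] measurable_compose[OF F[of 0] borel_measurable_norm] by (simp add: R_def[abs_def])
  next
    case (Suc k)
    have eq: "R (Suc k) = (\<lambda>w. max (R k w) (norm (N (\<tau> (Suc k)) w)))" by (simp add: R_def[abs_def])
    have m: "R (Suc k) \<in> borel_measurable (Fil (\<tau> (Suc k)))"
      unfolding eq
    proof (intro borel_measurable_max measurable_compose[OF _ borel_measurable_norm])
      show "R k \<in> borel_measurable (Fil (\<tau> (Suc k)))"
        by (rule Fil_measurable_mono[OF \<tau>(2)]) (use Suc in auto)
    qed (use F[of "Suc k"] Suc in auto)
    have "R (Suc k) \<in> L2 M"
    proof (rule L2_bound[OF Fil_measurable_M[OF m] L2_add[OF conjunct2[OF Suc.IH] nL], where K = 1])
      show "AE w in M. norm (R (Suc k) w) \<le> 1 * norm (R k w + norm (N (\<tau> (Suc k)) w))"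
        using R0 by (intro AE_I2) (simp add: eq max_def abs_of_nonneg add_nonneg_nonneg)
    qed (use Suc in auto)
    then show ?case using m by blast
  qed
  then show "(\<lambda>w. run_max (\<lambda>i. norm (N (\<tau> i) w)) n) \<in> L2 M" by (simp add: R_def[abs_def])
  have step: "0 \<le> (\<integral>w. R i w * (norm (N (\<tau> (Suc i)) w) - norm (N (\<tau> i) w)) \<partial>M)" if i: "i < n" for i
  proof -
    \<comment> \<open>the test variable for the martingale property between \<open>\<tau> i\<close> and \<open>\<tau> (i + 1)\<close>\<close>
    define \<zeta> where "\<zeta> w = R i w *\<^sub>R sgn (N (\<tau> i) w)" for w
    have \<zeta>F: "\<zeta> \<in> borel_measurable (Fil (\<tau> i))"
      unfolding \<zeta>_def[abs_def] sgn_div_norm using RF[of i] F[of i] i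
      by (intro borel_measurable_scaleR borel_measurable_inverse measurable_compose[OF _ borel_measurable_norm]) auto
    have \<zeta>L: "\<zeta> \<in> L2 M"
    proof (rule L2_bound[OF Fil_measurable_M[OF \<zeta>F] conjunct2[OF RF], where K = 1])
      show "AE w in M. norm (\<zeta> w) \<le> 1 * norm (R i w)"
        by (intro AE_I2) (simp add: \<zeta>_def norm_sgn)
    qed (use i in auto)
    have "0 = ip M (\<lambda>w. N (\<tau> (Suc i)) w - N (\<tau> i) w) \<zeta>"
      using L2martD(3)[OF N, of "\<tau> (Suc i)" "\<tau> i" \<zeta>] \<tau>(1)[of i] \<tau>(1)[of "Suc i"] \<tau>(2)[OF i] i \<zeta>F \<zeta>L by simp
    also have "\<dots> \<le> (\<integral>w. R i w * (norm (N (\<tau> (Suc i)) w) - norm (N (\<tau> i) w)) \<partial>M)"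
      unfolding ip_def
    proof (rule integral_mono)
      show "integrable M (\<lambda>w. (N (\<tau> (Suc i)) w - N (\<tau> i) w) \<bullet> \<zeta> w)"
        using i by (intro L2_inner_integrable L2_diff L \<zeta>L) auto
      show "integrable M (\<lambda>w. R i w * (norm (N (\<tau> (Suc i)) w) - norm (N (\<tau> i) w)))"
        using L2_inner_integrable[OF conjunct2[OF RF] L2_diff[OF nL nL], of i "Suc i" i] i by simp
      fix w
      have a: "v \<bullet> sgn v = norm v" for v :: 'a
        by (cases "v = 0") (simp_all add: sgn_div_norm dot_square_norm power2_eq_square)
      have b: "u \<bullet> sgn v \<le> norm u" for u v :: 'a
        using norm_cauchy_schwarz[of u "sgn v"] by (cases "v = 0") (simp_all add: norm_sgn)
      have "(u - v) \<bullet> sgn v \<le> norm u - norm v" for u v :: 'a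
        using b[of u v] unfolding inner_diff_left a by simp
      then show "(N (\<tau> (Suc i)) w - N (\<tau> i) w) \<bullet> \<zeta> w \<le> R i w * (norm (N (\<tau> (Suc i)) w) - norm (N (\<tau> i) w))"
        unfolding \<zeta>_def inner_scaleR_right by (intro mult_left_mono R0)
    qed
    finally show ?thesis .
  qed
  have int: "integrable M (\<lambda>w. R i w * (norm (N (\<tau> (Suc i)) w) - norm (N (\<tau> i) w)))" if "i < n" for i
    using L2_inner_integrable[OF conjunct2[OF RF] L2_diff[OF nL nL], of i "Suc i" i] that by simp
  have "(\<integral>w. (R n w)\<^sup>2 \<partial>M) \<le> (\<integral>w. 4 * (norm (N (\<tau> n) w))\<^sup>2 - 4 * (\<Sum>i<n. R i w * (norm (N (\<tau> (Suc i)) w) - norm (N (\<tau> i) w))) \<partial>M)"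
  proof (rule integral_mono)
    show "integrable M (\<lambda>w. (R n w)\<^sup>2)" using RF[of n] by (simp add: L2_def)
    show "integrable M (\<lambda>w. 4 * (norm (N (\<tau> n) w))\<^sup>2 - 4 * (\<Sum>i<n. R i w * (norm (N (\<tau> (Suc i)) w) - norm (N (\<tau> i) w))))"
      using L[of n] int
      by (intro Bochner_Integration.integrable_diff integrable_mult_right Bochner_Integration.integrable_sum) (auto simp: L2_def)
    show "(R n w)\<^sup>2 \<le> 4 * (norm (N (\<tau> n) w))\<^sup>2 - 4 * (\<Sum>i<n. R i w * (norm (N (\<tau> (Suc i)) w) - norm (N (\<tau> i) w)))" for w
      unfolding R_def by (rule Doob_pathwise) simp
  qed
  also have "\<dots> = 4 * ip M (N (\<tau> n)) (N (\<tau> n)) - 4 * (\<Sum>i<n. \<integral>w. R i w * (norm (N (\<tau> (Suc i)) w) - norm (N (\<tau> i) w)) \<partial>M)"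
    using L[of n] int by (subst Bochner_Integration.integral_diff) (auto simp: L2_def ip_def dot_square_norm)
  also have "\<dots> \<le> 4 * ip M (N (\<tau> n)) (N (\<tau> n))"
  proof -
    have "0 \<le> (\<Sum>i<n. \<integral>w. R i w * (norm (N (\<tau> (Suc i)) w) - norm (N (\<tau> i) w)) \<partial>M)"
      by (rule sum_nonneg) (rule step, simp only: lessThan_iff)
    then show ?thesis by linarith
  qed
  finally show "(\<integral>w. (run_max (\<lambda>i. norm (N (\<tau> i) w)) n)\<^sup>2 \<partial>M) \<le> 4 * ip M (N (\<tau> n)) (N (\<tau> n))" by (simp add: R_def)
qed

lemma dyad_norm_bound:
  fixes X :: "real \<Rightarrow> 'a::real_normed_vector"
  assumes c: "continuous_on {0..T} X" and d: "\<And>r. r \<in> dyad T \<Longrightarrow> sqn (X r) \<le> g" and t: "t \<in> {0..T}"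
  shows "sqn (X t) \<le> g"
proof (cases g)
  case (real k)
  have "norm (X t) \<le> sqrt k"
  proof (rule continuous_le_on_closure[of "dyad T" "\<lambda>t. norm (X t)" t])
    have "closure (dyad T) \<subseteq> {0..T}" using T_pos by (intro closure_minimal dyad_range) auto
    then show "continuous_on (closure (dyad T)) (\<lambda>t. norm (X t))"
      by (intro continuous_on_norm continuous_on_subset[OF c])
    show "norm (X r) \<le> sqrt k" if "r \<in> dyad T" for r
      using d[OF that] real by (intro real_le_rsqrt) (simp add: ennreal_le_iff)
  qed (use t dyad_closure in auto)
  then have "(norm (X t))\<^sup>2 \<le> (sqrt k)\<^sup>2" by (intro power_mono) auto
  then show ?thesis using real by (simp add: ennreal_leI)
qed simp

lemma Doob_maximal:
  fixes N :: "('w, 'a::euclidean_space) process"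
  assumes N: "L2mart N" and cont: "AE w in M. continuous_on {0..T} (\<lambda>t. N t w)"
  shows "\<exists>G\<in>borel_measurable M. (AE w in M. \<forall>t\<in>{0..T}. sqn (N t w) \<le> G w) \<and>
    (\<integral>\<^sup>+w. G w \<partial>M) \<le> ennreal (4 * ip M (N T) (N T))"
proof -
  define R where "R m w = run_max (\<lambda>i. norm (N (grid T m i) w)) (2^m)" for m w
  have gr: "i \<le> 2^m \<Longrightarrow> 0 \<le> grid T m i \<and> grid T m i \<le> T" "grid T m i \<le> grid T m (Suc i)" for m i
    using grid_range[of T i m] grid_mono[of T i "Suc i" m] T_pos by auto
  have RL: "R m \<in> L2 M" and RE: "(\<integral>w. (R m w)\<^sup>2 \<partial>M) \<le> 4 * ip M (N T) (N T)" for m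
    unfolding R_def using Doob_discrete[OF N, of "2^m" "grid T m"] gr by auto
  have R0: "0 \<le> R m w" for m w
    using run_max_ge[of 0 "2^m" "\<lambda>i. norm (N (grid T m i) w)"] norm_ge_zero order_trans unfolding R_def by blast
  have Rge: "norm (N r w) \<le> R m w" if "i \<le> 2^m" "r = grid T m i" for r m i w
    unfolding R_def using run_max_ge[OF that(1), of "\<lambda>i. norm (N (grid T m i) w)"] that by simp
  have Rmono: "R m w \<le> R (Suc m) w" for m w
  proof -
    obtain i where "i \<le> 2^m" "R m w = norm (N (grid T m i) w)"
      using run_max_attained[of "2^m" "\<lambda>i. norm (N (grid T m i) w)"] unfolding R_def by blast
    moreover have "grid T m i = grid T (Suc m) (i * 2)" using grid_refine[of T m 1 i] by simp
    ultimately show ?thesis using Rge[of "i * 2" "Suc m" "grid T m i" w] by simp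
  qed
  define G where "G w = (SUP m. ennreal ((R m w)\<^sup>2))" for w
  note L2_measurable[OF RL, measurable]
  have Gm: "G \<in> borel_measurable M" unfolding G_def by measurable
  have "(\<integral>\<^sup>+w. G w \<partial>M) = (SUP m. \<integral>\<^sup>+w. ennreal ((R m w)\<^sup>2) \<partial>M)"
    unfolding G_def
  proof (intro nn_integral_monotone_convergence_SUP)
    show "incseq (\<lambda>m w. ennreal ((R m w)\<^sup>2))"
      using R0 Rmono by (intro incseq_SucI le_funI ennreal_leI power_mono) auto
  qed measurable
  also have "\<dots> \<le> ennreal (4 * ip M (N T) (N T))"
  proof (rule SUP_least)
    fix m
    have "(\<integral>\<^sup>+w. ennreal ((R m w)\<^sup>2) \<partial>M) = ennreal (\<integral>w. (R m w)\<^sup>2 \<partial>M)"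
      using RL[of m] by (intro nn_integral_eq_integral) (auto simp: L2_def)
    then show "(\<integral>\<^sup>+w. ennreal ((R m w)\<^sup>2) \<partial>M) \<le> ennreal (4 * ip M (N T) (N T))"
      using RE[of m] by (simp add: ennreal_leI)
  qed
  finally have GE: "(\<integral>\<^sup>+w. G w \<partial>M) \<le> ennreal (4 * ip M (N T) (N T))" .
  have "AE w in M. \<forall>t\<in>{0..T}. sqn (N t w) \<le> G w"
    using cont
  proof eventually_elim
    case (elim w)
    have "sqn (N r w) \<le> G w" if "r \<in> dyad T" for r
    proof -
      obtain n i where ni: "i \<le> 2^n" "r = grid T n i" using \<open>r \<in> dyad T\<close> by (auto simp: dyad_def)
      have "sqn (N r w) \<le> ennreal ((R n w)\<^sup>2)"
        by (intro ennreal_leI power_mono Rge[OF ni]) simp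
      also have "\<dots> \<le> G w" unfolding G_def by (rule SUP_upper) simp
      finally show ?thesis .
    qed
    from dyad_norm_bound[OF elim this] show ?case by blast
  qed
  with Gm GE show ?thesis by blast
qed

abbreviation "is_ito \<equiv> is_ito_integral M W T"

section \<open>The Ito integral\<close>

lemma simple_ito_L2mart: "simple_process M W T k \<tau> \<xi> \<Longrightarrow> L2mart (simple_ito W k \<tau> \<xi>)"
  unfolding L2mart_def by (auto intro: simple_ito_L2 simple_ito_Fil simple_ito_martingale)

lemma simple_ito_continuous:
  assumes sp: "simple_process M W T k \<tau> \<xi>" and c: "continuous_on {0..} (\<lambda>t. W t w)"
  shows "continuous_on {0..T} (\<lambda>t. simple_ito W k \<tau> \<xi> t w)"
  unfolding simple_ito_def
proof (intro continuous_on_sum continuous_on_scaleR continuous_on_diff continuous_on_const)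
  fix i assume i: "i \<in> {..<k}"
  then have "0 \<le> \<tau> i" "0 \<le> \<tau> (Suc i)" using simple_processD(2,3)[OF sp, of i] by auto
  moreover have "continuous_on {0..T} (\<lambda>t. W (min a t) w)" if "0 \<le> a" for a
    by (rule continuous_on_compose2[OF c]) (use that in \<open>auto intro!: continuous_intros\<close>)
  ultimately show "continuous_on {0..T} (\<lambda>t. W (min (\<tau> (Suc i)) t) w)" "continuous_on {0..T} (\<lambda>t. W (min (\<tau> i) t) w)"
    by auto
qed

lemma cut_diff: "cut t (\<lambda>s w. \<phi> s w - \<psi> s w) = (\<lambda>s w. cut t \<phi> s w - cut t \<psi> s w)"
  by (simp add: cut_def fun_eq_iff scaleR_diff_right)

lemma IP_cut_cut:
  assumes "\<phi> \<in> L2P" "\<psi> \<in> L2P" shows "IP (cut t \<phi>) (cut t \<psi>) = IP (cut t \<phi>) \<psi>"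
  unfolding IP_eq_time_outer[OF cut_L2P[OF assms(1)] cut_L2P[OF assms(2)]] IP_eq_time_outer[OF cut_L2P[OF assms(1)] assms(2)]
  by (intro LINT_cong) (auto simp: cut_def[abs_def] ip_def split: split_indicator)

lemma NR_cut_le:
  assumes "\<phi> \<in> L2P" shows "NR (cut t \<phi>) \<le> NR \<phi>"
proof (cases "NR (cut t \<phi>) = 0")
  case False
  have "(NR (cut t \<phi>))\<^sup>2 = IP (cut t \<phi>) \<phi>" using IP_cut_cut[OF assms assms] by (simp add: NR_power2)
  also have "\<dots> \<le> NR (cut t \<phi>) * NR \<phi>" using IP_Cauchy_Schwarz[OF cut_L2P[OF assms, of t] assms] by linarith
  finally show ?thesis using False NR_nonneg[of "cut t \<phi>"] by (simp add: power2_eq_square)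
qed simp

lemma simple_ito_nrm:
  assumes sp: "simple_process M W T k \<tau> \<xi>" "simple_process M W T k' \<tau>' \<xi>'" and t: "0 \<le> t"
  shows "dst M (simple_ito W k \<tau> \<xi> t) (simple_ito W k' \<tau>' \<xi>' t)
    = NR (cut t (\<lambda>s w. simple_value k \<tau> \<xi> s w - simple_value k' \<tau>' \<xi>' s w))"
proof -
  note v = simple_value_L2P[OF sp(1)] simple_value_L2P[OF sp(2)]
  note L = simple_ito_L2[OF sp(1) t] simple_ito_L2[OF sp(2) t]
  show ?thesis
    unfolding nrm_def NR_def_IP IP_cut_cut[OF L2P_diff[OF v] L2P_diff[OF v]] unfolding cut_diff
    by (intro arg_cong[where f = sqrt])
      (simp add: ip_diff_left ip_diff_right L2_diff L IP_diff_left IP_diff_right L2P_diff v cut_L2P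
        simple_ito_ip[OF sp(1) sp(1) t] simple_ito_ip[OF sp(1) sp(2) t] simple_ito_ip[OF sp(2) sp(1) t] simple_ito_ip[OF sp(2) sp(2) t])
qed

lemma approximation_iff_NR:
  assumes "\<And>j. simple_process M W T (k j) (\<tau> j) (\<xi> j)" "\<phi> \<in> L2P"
  shows "(\<lambda>j. \<integral>\<^sup>+w. (\<integral>\<^sup>+s. sqn (simple_value (k j) (\<tau> j) (\<xi> j) s w - \<phi> s w) \<partial>TI) \<partial>M) \<longlonglongrightarrow> 0
    \<longleftrightarrow> (\<lambda>j. DR (simple_value (k j) (\<tau> j) (\<xi> j)) \<phi>) \<longlonglongrightarrow> 0" (is "?A \<longlonglongrightarrow> 0 \<longleftrightarrow> ?B \<longlonglongrightarrow> 0")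
proof -
  have "?A = (\<lambda>j. ennreal ((?B j)\<^sup>2))"
    by (intro ext nn_integral_L2P(1) L2P_diff simple_value_L2P assms)
  moreover have "(\<lambda>j. ennreal ((?B j)\<^sup>2)) \<longlonglongrightarrow> ennreal 0 \<longleftrightarrow> (\<lambda>j. (?B j)\<^sup>2) \<longlonglongrightarrow> 0"
    by (subst tendsto_ennreal_iff) auto
  moreover have "(\<lambda>j. (?B j)\<^sup>2) \<longlonglongrightarrow> 0 \<longleftrightarrow> ?B \<longlonglongrightarrow> 0"
    using tendsto_power[of ?B 0 sequentially 2] tendsto_real_sqrt[of "\<lambda>j. (?B j)\<^sup>2" 0 sequentially]
    by (auto simp: real_sqrt_abs)
  ultimately show ?thesis by simp
qed

text \<open>Approximate by dyadic simple processes with norm distances decreasing geometrically. Doob's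
  inequality makes their integrals converge uniformly in time for almost every path, so the limit is
  continuous; on the exceptional null set it is replaced by \<open>0\<close>.\<close>

lemma ito_integral_exists:
  fixes \<phi> :: "('w, 'a::euclidean_space) process"
  assumes \<phi>: "\<phi> \<in> L2P"
  shows "\<exists>I. is_ito \<phi> I"
proof -
  obtain F where F: "\<And>n. F n \<in> dyadic_simple" and Flim: "(\<lambda>n. DR (F n) \<phi>) \<longlonglongrightarrow> 0"
    using dyadic_simple_dense[OF \<phi>] by blast
  note FL = dyadic_simple_L2P[OF F]
  have Cauchy: "\<exists>n0. \<forall>m\<ge>n0. \<forall>n\<ge>n0. DR (F m) (F n) < e" if e: "e > 0" for e
  proof -
    obtain n0 where n0: "\<And>m. m \<ge> n0 \<Longrightarrow> DR (F m) \<phi> < e / 2"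
      using LIMSEQ_D[OF Flim half_gt_zero[OF e]] by auto
    have "DR (F m) (F n) < e" if "m \<ge> n0" "n \<ge> n0" for m n
      using NR_triangle_diff[OF FL FL \<phi>, of m n] n0[OF that(1)] n0[OF that(2)] NR_minus[of "F n" \<phi>] by linarith
    then show ?thesis by blast
  qed
  \<comment> \<open>the division by \<open>4\<close> makes up for the constant in Doob's inequality\<close>
  obtain r where r: "strict_mono r" "\<And>k. DR (F (r (Suc k))) (F (r k)) < sqrt ((1/8)^k / 4)"
    using fast_subsequence[of "\<lambda>m n. DR (F m) (F n)" "\<lambda>k. sqrt ((1/8)^k / 4)"] Cauchy by auto
  have "\<forall>j. \<exists>n \<xi>. F (r j) = simple_value (2^n) (grid T n) \<xi> \<and> (\<forall>i<2^n. bounded_Fil (grid T n i) (\<xi> i))"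
    using F unfolding dyadic_simple_def by blast
  then obtain lev \<xi> where Fr: "\<And>j. F (r j) = simple_value (2^lev j) (grid T (lev j)) (\<xi> j)"
    and b: "\<And>j. \<forall>i<2^lev j. bounded_Fil (grid T (lev j) i) (\<xi> j i)" by metis
  have sp: "simple_process M W T (2^lev j) (grid T (lev j)) (\<xi> j)" for j using b by (intro grid_simple_process) auto
  define J where "J j = simple_ito W (2^lev j) (grid T (lev j)) (\<xi> j)" for j
  have JL: "J j t \<in> L2 M" and JF: "J j t \<in> borel_measurable (Fil t)" if "0 \<le> t" for j t
    unfolding J_def using simple_ito_L2[OF sp that] simple_ito_Fil[OF sp that] by auto
  have Jn: "dst M (J m t) (J n t) \<le> DR (F (r m)) (F (r n))" if "0 \<le> t" for m n t
    unfolding J_def simple_ito_nrm[OF sp sp that] Fr[symmetric] by (intro NR_cut_le L2P_diff FL)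
  have Jcont: "AE w in M. \<forall>j. continuous_on {0..T} (\<lambda>t. J j t w)"
    using W_continuous by eventually_elim (auto simp: J_def intro: simple_ito_continuous[OF sp])
  have "\<exists>G\<in>borel_measurable M. (AE w in M. \<forall>t\<in>{0..T}. sqn (J (Suc k) t w - J k t w) \<le> G w) \<and>
    (\<integral>\<^sup>+w. G w \<partial>M) \<le> ennreal ((1/8)^k)" for k
  proof -
    have m: "L2mart (\<lambda>t w. J (Suc k) t w - J k t w)" unfolding J_def by (intro L2mart_diff simple_ito_L2mart sp)
    have c: "AE w in M. continuous_on {0..T} (\<lambda>t. J (Suc k) t w - J k t w)"
      using Jcont by eventually_elim (intro continuous_on_diff; simp)
    have "4 * ip M (\<lambda>w. J (Suc k) T w - J k T w) (\<lambda>w. J (Suc k) T w - J k T w) \<le> 4 * (sqrt ((1/8)^k / 4))\<^sup>2"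
      unfolding nrm_power2[symmetric] using Jn[of T "Suc k" k] r(2)[of k] T_pos
      by (intro mult_left_mono power_mono) auto
    then have "ennreal (4 * ip M (\<lambda>w. J (Suc k) T w - J k T w) (\<lambda>w. J (Suc k) T w - J k T w)) \<le> ennreal ((1/8)^k)"
      by (intro ennreal_leI) simp
    then show ?thesis using Doob_maximal[OF m c] order_trans by blast
  qed
  then have "\<forall>k. \<exists>G. G \<in> borel_measurable M \<and> (AE w in M. \<forall>t\<in>{0..T}. sqn (J (Suc k) t w - J k t w) \<le> G w) \<and>
    (\<integral>\<^sup>+w. G w \<partial>M) \<le> ennreal ((1/8)^k)" by blast
  from choice[OF this] obtain G where Gm: "\<And>k. G k \<in> borel_measurable M"
    and Gd: "\<And>k. AE w in M. \<forall>t\<in>{0..T}. sqn (J (Suc k) t w - J k t w) \<le> G k w"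
    and GE: "\<And>k. (\<integral>\<^sup>+w. G k w \<partial>M) \<le> ennreal ((1/8)^k)" by blast
  \<comment> \<open>the paths along which the integrals converge uniformly\<close>
  define good where "good w \<longleftrightarrow> (\<forall>j. continuous_on {0..T} (\<lambda>t. J j t w)) \<and>
    uniform_limit {0..T} (\<lambda>j t. J j t w) (\<lambda>t. lim (\<lambda>j. J j t w)) sequentially" for w
  have AEgood: "AE w in M. good w"
  proof -
    have "AE w in M. \<forall>k. \<forall>t\<in>{0..T}. sqn (J (Suc k) t w - J k t w) \<le> G k w"
      using Gd by (simp add: AE_all_countable)
    then show ?thesis using AE_geometric_of_nn_integral[OF Gm GE] Jcont
    proof eventually_elim
      case (elim w)
      from elim(2) obtain C where C: "\<And>k. G k w \<le> ennreal (C * (1/4)^k)" by blast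
      define D where "D = max C 0"
      have "norm (J (Suc k) t w - J k t w) \<le> sqrt D * (1/2)^k" if t: "t \<in> {0..T}" for k t
      proof (rule power2_le_imp_le)
        have "sqn (J (Suc k) t w - J k t w) \<le> ennreal (C * (1/4)^k)"
          using elim(1) t C[of k] order_trans by blast
        also have "\<dots> \<le> ennreal (D * (1/4)^k)" by (intro ennreal_leI mult_right_mono) (auto simp: D_def)
        finally have "(norm (J (Suc k) t w - J k t w))\<^sup>2 \<le> D * (1/4)^k" by (subst (asm) ennreal_le_iff) (auto simp: D_def)
        also have "\<dots> = (sqrt D * (1/2)^k)\<^sup>2"
          by (simp add: D_def power_mult_distrib power_mult[symmetric] mult.commute[of _ 2]) (simp add: power_mult power2_eq_square)
        finally show "(norm (J (Suc k) t w - J k t w))\<^sup>2 \<le> (sqrt D * (1/2)^k)\<^sup>2" .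
      qed (simp add: D_def)
      then have "uniform_limit {0..T} (\<lambda>n t. \<Sum>k<n. J (Suc k) t w - J k t w) (\<lambda>t. suminf (\<lambda>k. J (Suc k) t w - J k t w)) sequentially"
        by (intro Weierstrass_m_test[where M = "\<lambda>k. sqrt D * (1/2)^k"] summable_mult) auto
      then have "uniform_limit {0..T} (\<lambda>n t. J n t w - J 0 t w) (\<lambda>t. suminf (\<lambda>k. J (Suc k) t w - J k t w)) sequentially"
        by (subst (asm) sum_lessThan_telescope)
      then have u: "uniform_limit {0..T} (\<lambda>n t. J n t w - J 0 t w + J 0 t w) (\<lambda>t. suminf (\<lambda>k. J (Suc k) t w - J k t w) + J 0 t w) sequentially"
        by (intro uniform_limit_add uniform_limit_const)
      then have u: "uniform_limit {0..T} (\<lambda>n t. J n t w) (\<lambda>t. suminf (\<lambda>k. J (Suc k) t w - J k t w) + J 0 t w) sequentially"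
        by simp
      have "lim (\<lambda>j. J j t w) = suminf (\<lambda>k. J (Suc k) t w - J k t w) + J 0 t w" if "t \<in> {0..T}" for t
        using tendsto_uniform_limitI[OF u that] by (rule limI)
      then have "uniform_limit {0..T} (\<lambda>n t. J n t w) (\<lambda>t. lim (\<lambda>j. J j t w)) sequentially"
        using u by (subst uniform_limit_cong') auto
      then show ?case using elim(3) by (simp add: good_def)
    qed
  qed
  define I where "I t w = (if good w then lim (\<lambda>j. J j t w) else 0)" for t w
  have Ilim: "AE w in M. (\<lambda>j. J j t w) \<longlonglongrightarrow> I t w" if "t \<in> {0..T}" for t
    using AEgood
  proof eventually_elim
    case (elim w)
    then have "uniform_limit {0..T} (\<lambda>j t. J j t w) (\<lambda>t. lim (\<lambda>j. J j t w)) sequentially" by (simp add: good_def)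
    from tendsto_uniform_limitI[OF this that] show ?case using elim by (simp add: I_def)
  qed
  have Im: "I t \<in> borel_measurable (Fil t)" if t: "t \<in> {0..T}" for t
  proof (rule Fil_cong_AE)
    show "(\<lambda>w. lim (\<lambda>j. J j t w)) \<in> borel_measurable (Fil t)"
      using JF t by (intro borel_measurable_lim_metric) auto
    show "AE w in M. lim (\<lambda>j. J j t w) = I t w" using AEgood by eventually_elim (simp add: I_def)
  qed simp
  have Ic: "continuous_on {0..T} (\<lambda>t. I t w)" for w
  proof (cases "good w")
    case True
    then have "continuous_on {0..T} (\<lambda>t. lim (\<lambda>j. J j t w))"
      unfolding good_def by (intro uniform_limit_theorem[where F = sequentially]) auto
    then show ?thesis using True by (simp add: I_def)
  qed (simp add: I_def)
  have IL: "I t \<in> L2 M \<and> (\<lambda>j. dst M (J j t) (I t)) \<longlonglongrightarrow> 0" if t: "t \<in> {0..T}" for t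
  proof -
    have t0: "0 \<le> t" using t by simp
    have Jc: "\<exists>n0. \<forall>m\<ge>n0. \<forall>n\<ge>n0. dst M (J m t) (J n t) < e" if e: "e > 0" for e
    proof -
      obtain n0 where n0: "\<And>m n. m \<ge> n0 \<Longrightarrow> n \<ge> n0 \<Longrightarrow> DR (F m) (F n) < e"
        using Cauchy[OF e] by blast
      have "dst M (J m t) (J n t) < e" if "m \<ge> n0" "n \<ge> n0" for m n
        using Jn[OF t0, of m n] n0[of "r m" "r n"] that seq_suble[OF r(1), of m] seq_suble[OF r(1), of n] by fastforce
      then show ?thesis by blast
    qed
    show ?thesis
      using L2_limit_of_AE_limit[OF JL[OF t0] Fil_measurable_M[OF Im[OF t]] Jc Ilim[OF t]] by blast
  qed
  have "is_ito \<phi> I"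
    unfolding is_ito_integral_def
  proof (intro conjI ballI \<phi> Im Ic exI[of _ "\<lambda>j. 2^lev j"] exI[of _ "\<lambda>j. grid T (lev j)"] exI[of _ \<xi>] allI sp)
    show "(\<lambda>j. \<integral>\<^sup>+w. (\<integral>\<^sup>+s. sqn (simple_value (2^lev j) (grid T (lev j)) (\<xi> j) s w - \<phi> s w) \<partial>TI) \<partial>M) \<longlonglongrightarrow> 0"
      unfolding approximation_iff_NR[OF sp \<phi>] unfolding Fr[symmetric]
      using LIMSEQ_subseq_LIMSEQ[OF Flim r(1)] by (simp add: o_def)
    fix t assume t: "t \<in> {0..T}"
    have "(\<lambda>j. \<integral>\<^sup>+w. sqn (J j t w - I t w) \<partial>M) \<longlonglongrightarrow> 0"
      using IL[OF t] t by (subst nrm_tendsto_0_iff_nn_integral[symmetric]) (auto intro: L2_diff JL)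
    then show "(\<lambda>j. \<integral>\<^sup>+w. sqn (simple_ito W (2^lev j) (grid T (lev j)) (\<xi> j) t w - I t w) \<partial>M) \<longlonglongrightarrow> 0"
      by (simp add: J_def)
  qed
  then show ?thesis by blast
qed

lemma ito_approximation:
  assumes "is_ito \<phi> I"
  obtains k \<tau> \<xi> where "\<And>j. simple_process M W T (k j) (\<tau> j) (\<xi> j)"
    "(\<lambda>j. DR (simple_value (k j) (\<tau> j) (\<xi> j)) \<phi>) \<longlonglongrightarrow> 0"
    "\<And>t. t \<in> {0..T} \<Longrightarrow> I t \<in> L2 M"
    "\<And>t. t \<in> {0..T} \<Longrightarrow> (\<lambda>j. dst M (simple_ito W (k j) (\<tau> j) (\<xi> j) t) (I t)) \<longlonglongrightarrow> 0"
proof -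
  have \<phi>: "\<phi> \<in> L2P" and Im: "\<And>t. t \<in> {0..T} \<Longrightarrow> I t \<in> borel_measurable (Fil t)"
    using assms by (auto simp: is_ito_integral_def)
  obtain k \<tau> \<xi> where sp: "\<And>j. simple_process M W T (k j) (\<tau> j) (\<xi> j)"
    and v: "(\<lambda>j. \<integral>\<^sup>+w. (\<integral>\<^sup>+s. sqn (simple_value (k j) (\<tau> j) (\<xi> j) s w - \<phi> s w) \<partial>TI) \<partial>M) \<longlonglongrightarrow> 0"
    and i: "\<And>t. t \<in> {0..T} \<Longrightarrow> (\<lambda>j. \<integral>\<^sup>+w. sqn (simple_ito W (k j) (\<tau> j) (\<xi> j) t w - I t w) \<partial>M) \<longlonglongrightarrow> 0"
    using assms unfolding is_ito_integral_def by blast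
  have IL: "I t \<in> L2 M" if t: "t \<in> {0..T}" for t
  proof -
    have "\<forall>\<^sub>F j in sequentially. (\<integral>\<^sup>+w. sqn (simple_ito W (k j) (\<tau> j) (\<xi> j) t w - I t w) \<partial>M) < 1"
      using i[OF t] by (rule order_tendstoD) simp
    then obtain j where j: "(\<integral>\<^sup>+w. sqn (simple_ito W (k j) (\<tau> j) (\<xi> j) t w - I t w) \<partial>M) < 1"
      by (auto simp: eventually_sequentially)
    have sL: "simple_ito W (k j) (\<tau> j) (\<xi> j) t \<in> L2 M" using simple_ito_L2[OF sp] t by auto
    have "(\<lambda>w. simple_ito W (k j) (\<tau> j) (\<xi> j) t w - I t w) \<in> L2 M"
      unfolding L2_iff_nn_integral using j L2_measurable[OF sL] Fil_measurable_M[OF Im[OF t]]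
      by (auto intro!: borel_measurable_diff order.strict_trans[OF j])
    from L2_diff[OF sL this] show ?thesis by simp
  qed
  show thesis
  proof (rule that[OF sp _ IL])
    show "(\<lambda>j. DR (simple_value (k j) (\<tau> j) (\<xi> j)) \<phi>) \<longlonglongrightarrow> 0"
      using v unfolding approximation_iff_NR[OF sp \<phi>] .
    show "(\<lambda>j. dst M (simple_ito W (k j) (\<tau> j) (\<xi> j) t) (I t)) \<longlonglongrightarrow> 0" if t: "t \<in> {0..T}" for t
      using i[OF t] simple_ito_L2[OF sp] IL[OF t] t
      by (subst nrm_tendsto_0_iff_nn_integral) (auto intro: L2_diff)
  qed
qed

lemma ito_isometry:
  assumes I: "is_ito \<phi> I" and J: "is_ito \<psi> J" and t: "t \<in> {0..T}"
  shows "ip M (I t) (J t) = IP (cut t \<phi>) \<psi>"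
proof -
  have \<phi>: "\<phi> \<in> L2P" and \<psi>: "\<psi> \<in> L2P" using I J by (auto simp: is_ito_integral_def)
  obtain k \<tau> \<xi> where 1: "\<And>j. simple_process M W T (k j) (\<tau> j) (\<xi> j)"
    "(\<lambda>j. DR (simple_value (k j) (\<tau> j) (\<xi> j)) \<phi>) \<longlonglongrightarrow> 0"
    "\<And>t. t \<in> {0..T} \<Longrightarrow> I t \<in> L2 M"
    "\<And>t. t \<in> {0..T} \<Longrightarrow> (\<lambda>j. dst M (simple_ito W (k j) (\<tau> j) (\<xi> j) t) (I t)) \<longlonglongrightarrow> 0"
    by (rule ito_approximation[OF I]) blast
  obtain k' \<tau>' \<xi>' where 2: "\<And>j. simple_process M W T (k' j) (\<tau>' j) (\<xi>' j)"
    "(\<lambda>j. DR (simple_value (k' j) (\<tau>' j) (\<xi>' j)) \<psi>) \<longlonglongrightarrow> 0"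
    "\<And>t. t \<in> {0..T} \<Longrightarrow> J t \<in> L2 M"
    "\<And>t. t \<in> {0..T} \<Longrightarrow> (\<lambda>j. dst M (simple_ito W (k' j) (\<tau>' j) (\<xi>' j) t) (J t)) \<longlonglongrightarrow> 0"
    by (rule ito_approximation[OF J]) blast
  have t0: "0 \<le> t" using t by simp
  have "(\<lambda>j. ip M (simple_ito W (k j) (\<tau> j) (\<xi> j) t) (simple_ito W (k' j) (\<tau>' j) (\<xi>' j) t)) \<longlonglongrightarrow> ip M (I t) (J t)"
    by (intro tendsto_nrm_ip simple_ito_L2 1 2 t t0)
  moreover have "(\<lambda>j. IP (cut t (simple_value (k j) (\<tau> j) (\<xi> j))) (simple_value (k' j) (\<tau>' j) (\<xi>' j))) \<longlonglongrightarrow> IP (cut t \<phi>) \<psi>"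
  proof (intro tendsto_IP cut_L2P simple_value_L2P 1 2 \<phi> \<psi>)
    show "(\<lambda>n. DR (cut t (simple_value (k n) (\<tau> n) (\<xi> n))) (cut t \<phi>)) \<longlonglongrightarrow> 0"
      unfolding cut_diff[symmetric]
      by (rule tendsto_sandwich[OF _ _ tendsto_const 1(2)])
        (auto intro!: always_eventually NR_cut_le L2P_diff simple_value_L2P 1 \<phi>)
  qed
  ultimately show ?thesis
    unfolding simple_ito_ip[OF 1(1) 2(1) t0] by (rule LIMSEQ_unique)
qed

lemma ito_L2mart:
  assumes I: "is_ito \<phi> I"
  shows "L2mart I"
proof -
  obtain k \<tau> \<xi> where 1: "\<And>j. simple_process M W T (k j) (\<tau> j) (\<xi> j)"
    "\<And>t. t \<in> {0..T} \<Longrightarrow> I t \<in> L2 M"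
    "\<And>t. t \<in> {0..T} \<Longrightarrow> (\<lambda>j. dst M (simple_ito W (k j) (\<tau> j) (\<xi> j) t) (I t)) \<longlonglongrightarrow> 0"
    by (rule ito_approximation[OF I]) blast
  show ?thesis unfolding L2mart_def
  proof (intro conjI ballI allI impI)
    fix t assume "t \<in> {0..T}"
    then show "I t \<in> borel_measurable (Fil t)" "I t \<in> L2 M" using 1 I by (auto simp: is_ito_integral_def)
  next
    fix s t and \<zeta> :: "'w \<Rightarrow> 'a"
    assume a: "0 \<le> s \<and> s \<le> t \<and> t \<le> T \<and> \<zeta> \<in> borel_measurable (Fil s) \<and> \<zeta> \<in> L2 M"
    have *: "(\<lambda>j. ip M (simple_ito W (k j) (\<tau> j) (\<xi> j) u) \<zeta>) \<longlonglongrightarrow> ip M (I u) \<zeta>" if "u \<in> {0..T}" for u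
      by (intro tendsto_nrm_ip simple_ito_L2 1 that) (use a that in \<open>auto simp: nrm_def ip_def\<close>)
    have "ip M (simple_ito W (k j) (\<tau> j) (\<xi> j) t) \<zeta> = ip M (simple_ito W (k j) (\<tau> j) (\<xi> j) s) \<zeta>" for j
      using simple_ito_martingale[OF 1(1), of s t \<zeta> j] a simple_ito_L2[OF 1(1)] by (simp add: ip_diff_left)
    then have "ip M (I t) \<zeta> = ip M (I s) \<zeta>" using *[of t] *[of s] a LIMSEQ_unique by fastforce
    then show "ip M (\<lambda>w. I t w - I s w) \<zeta> = 0" using a 1(2)[of t] 1(2)[of s] by (simp add: ip_diff_left)
  qed
qed

lemma indistinguishable:
  fixes X Y :: "('w, 'a::euclidean_space) process"
  assumes "AE w in M. continuous_on {0..T} (\<lambda>t. X t w)" "AE w in M. continuous_on {0..T} (\<lambda>t. Y t w)"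
    and "\<And>t. t \<in> dyad T \<Longrightarrow> AE w in M. X t w = Y t w"
  shows "AE w in M. \<forall>t\<in>{0..T}. X t w = Y t w"
proof -
  have cl: "closure (dyad T) \<subseteq> {0..T}" using T_pos by (intro closure_minimal dyad_range) auto
  have "AE w in M. \<forall>t\<in>dyad T. X t w = Y t w"
    using assms(3) by (simp add: AE_ball_countable dyad_countable)
  then show ?thesis using assms(1,2)
  proof eventually_elim
    case (elim w)
    have "X t w - Y t w = 0" if "t \<in> {0..T}" for t
    proof (rule continuous_constant_on_closure[of "dyad T" "\<lambda>t. X t w - Y t w"])
      show "continuous_on (closure (dyad T)) (\<lambda>t. X t w - Y t w)"
        using elim cl by (intro continuous_on_diff) (auto intro: continuous_on_subset)
    qed (use elim that dyad_closure in auto)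
    then show ?case by simp
  qed
qed

lemma ito_continuous: "is_ito \<phi> I \<Longrightarrow> AE w in M. continuous_on {0..T} (\<lambda>t. I t w)"
  by (auto simp: is_ito_integral_def intro: AE_I2)

text \<open>Linearity up to equality of the integrands almost everywhere. With \<open>r = 0\<close> it gives uniqueness of the
  integral.\<close>

lemma ito_linear:
  assumes I: "is_ito \<phi> I" and J: "is_ito \<psi> J"
    and K: "is_ito \<theta> K" and \<theta>: "NR (\<lambda>s w. \<theta> s w - (\<phi> s w + r *\<^sub>R \<psi> s w)) = 0"
  shows "AE w in M. \<forall>t\<in>{0..T}. K t w = I t w + r *\<^sub>R J t w"
proof (rule indistinguishable)
  show "AE w in M. continuous_on {0..T} (\<lambda>t. K t w)" by (rule ito_continuous[OF K])
  show "AE w in M. continuous_on {0..T} (\<lambda>t. I t w + r *\<^sub>R J t w)"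
    using ito_continuous[OF I] ito_continuous[OF J] by eventually_elim (intro continuous_intros)
  fix t assume "t \<in> dyad T"
  then have t: "t \<in> {0..T}" using dyad_range[of T] T_pos by auto
  have v: "\<phi> \<in> L2P" "\<psi> \<in> L2P" "\<theta> \<in> L2P" using I J K by (auto simp: is_ito_integral_def)
  have L: "I t \<in> L2 M" "J t \<in> L2 M" "K t \<in> L2 M" using t L2martD(2) ito_L2mart I J K by (metis atLeastAtMost_iff)+
  let ?D = "\<lambda>w. K t w - (I t w + r *\<^sub>R J t w)" and ?d = "\<lambda>s w. \<theta> s w - (\<phi> s w + r *\<^sub>R \<psi> s w)"
  have dL: "?d \<in> L2P" by (intro L2P_diff L2P_add L2P_scaleR v)
  have cd: "cut t ?d = (\<lambda>s w. cut t \<theta> s w - (cut t \<phi> s w + r *\<^sub>R cut t \<psi> s w))"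
    by (simp add: cut_def fun_eq_iff algebra_simps)
  have "ip M ?D ?D = IP (cut t ?d) ?d"
    unfolding cd using L v
    by (simp add: ip_simps IP_add_left IP_add_right IP_diff_left IP_diff_right IP_scaleR_left IP_scaleR_right
      L2_diff L2_add L2_scaleR L2P_diff L2P_add L2P_scaleR cut_L2P ito_isometry[OF I I t] ito_isometry[OF I J t] ito_isometry[OF I K t]
      ito_isometry[OF J I t] ito_isometry[OF J J t] ito_isometry[OF J K t] ito_isometry[OF K I t] ito_isometry[OF K J t] ito_isometry[OF K K t])
  also have "\<dots> = 0" using IP_Cauchy_Schwarz[OF cut_L2P[OF dL] dL, of t] \<theta> by simp
  finally have "AE w in M. ?D w = 0" by (intro ip_self_eq_0 L2_diff L2_add L2_scaleR L)
  then show "AE w in M. K t w = I t w + r *\<^sub>R J t w" by eventually_elim simp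
qed

lemma ito_at_0:
  assumes I: "is_ito \<phi> I" shows "AE w in M. I 0 w = 0"
proof -
  have \<phi>: "\<phi> \<in> L2P" using I by (auto simp: is_ito_integral_def)
  have "ip M (I 0) (I 0) = (\<integral>s. indicator {0..0} s * ip M (\<phi> s) (\<phi> s) \<partial>TI)"
    using ito_isometry[OF I I, of 0] IP_cut[OF \<phi> \<phi>, of 0] T_pos by simp
  also have "\<dots> = 0"
  proof (rule integral_eq_zero_AE)
    show "AE s in TI. indicator {0..0} s * ip M (\<phi> s) (\<phi> s) = 0"
      by (rule AE_I'[of "{0}"]) (use T_pos in \<open>auto simp: null_sets_restrict_space split: split_indicator_asm\<close>)
  qed
  finally show ?thesis using L2martD(2)[OF ito_L2mart[OF I], of 0] T_pos by (intro ip_self_eq_0) auto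
qed

end

section \<open>Martingale representation\<close>

lemma integrable_trig_mult:
  fixes \<zeta> X :: "'x \<Rightarrow> real"
  assumes "integrable N \<zeta>" "X \<in> borel_measurable N"
  shows "integrable N (\<lambda>x. \<zeta> x * cos (X x))" "integrable N (\<lambda>x. \<zeta> x * sin (X x))"
  using assms by (auto intro!: Bochner_Integration.integrable_bound[OF assms(1)] AE_I2 simp: abs_mult mult_left_le)

text \<open>Normalise the positive and the negative part of \<open>\<zeta>\<close> to densities. The two laws of \<open>X\<close> have equal
  characteristic functions, so they agree by Levy's uniqueness theorem.\<close>

lemma (in prob_space) set_integral_eq_0_of_char:
  fixes \<zeta> X :: "'a \<Rightarrow> real"
  assumes \<zeta>: "integrable M \<zeta>" and X[measurable]: "X \<in> borel_measurable M"
    and c: "\<And>l. (\<integral>w. \<zeta> w * cos (l * X w) \<partial>M) = 0" and s: "\<And>l. (\<integral>w. \<zeta> w * sin (l * X w) \<partial>M) = 0"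
    and S[measurable]: "S \<in> sets borel"
  shows "(\<integral>w. indicator S (X w) * \<zeta> w \<partial>M) = 0"
proof -
  have [measurable]: "\<zeta> \<in> borel_measurable M" using \<zeta> by simp
  define p where "p w = max 0 (\<zeta> w)" for w
  define q where "q w = max 0 (- \<zeta> w)" for w
  have pq: "\<zeta> w = p w - q w" "0 \<le> p w" "0 \<le> q w" for w by (auto simp: p_def q_def max_def)
  have ip: "integrable M p" and iq: "integrable M q"
    unfolding p_def[abs_def] q_def[abs_def] using \<zeta> by (auto intro!: integrable_max)
  note [measurable] = borel_measurable_integrable[OF ip] borel_measurable_integrable[OF iq]
  define C where "C = (\<integral>w. p w \<partial>M)"
  have "(\<integral>w. p w - q w \<partial>M) = 0" using c[of 0] by (simp add: pq(1))
  then have Cq: "(\<integral>w. q w \<partial>M) = C" using ip iq by (simp add: C_def)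
  have C0: "0 \<le> C" unfolding C_def using pq by simp
  show ?thesis
  proof (cases "C = 0")
    case True
    then have "AE w in M. p w = 0" "AE w in M. q w = 0"
      using integral_nonneg_eq_0_iff_AE[OF ip] integral_nonneg_eq_0_iff_AE[OF iq] pq Cq C_def by auto
    then have "AE w in M. indicator S (X w) * \<zeta> w = 0" by eventually_elim (simp add: pq(1))
    then show ?thesis by (rule integral_eq_zero_AE)
  next
    case False
    with C0 have Cpos: "0 < C" by simp
    define \<mu> where "\<mu> g = distr (density M (\<lambda>w. ennreal (g w / C))) borel X" for g :: "'a \<Rightarrow> real"
    have RD: "real_distribution (\<mu> g)" if [measurable]: "g \<in> borel_measurable M" and g: "integrable M g" "\<And>w. 0 \<le> g w" "(\<integral>w. g w \<partial>M) = C" for g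
    proof -
      have "(\<integral>\<^sup>+w. ennreal (g w / C) \<partial>M) = ennreal (\<integral>w. g w / C \<partial>M)"
        using g Cpos by (intro nn_integral_eq_integral) auto
      then have "prob_space (density M (\<lambda>w. ennreal (g w / C)))"
        using g Cpos by (intro prob_spaceI) (simp add: emeasure_density cong: nn_integral_cong)
      then show ?thesis unfolding \<mu>_def by (intro prob_space.real_distribution_distr) auto
    qed
    have int: "(\<integral>x. h x \<partial>\<mu> g) = (\<integral>w. (g w / C) *\<^sub>R h (X w) \<partial>M)"
      if [measurable]: "g \<in> borel_measurable M" "h \<in> borel_measurable borel" and g: "\<And>w. 0 \<le> g w"
      for g and h :: "real \<Rightarrow> 'b::{banach, second_countable_topology}"
      unfolding \<mu>_def using Cpos g by (subst integral_distr) (auto intro!: integral_density)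
    have "char (\<mu> p) l = char (\<mu> q) l" for l
    proof -
      have ie: "integrable M (\<lambda>w. (g w / C) *\<^sub>R iexp (l * X w))" if g: "integrable M g" for g :: "'a \<Rightarrow> real"
      proof (rule Bochner_Integration.integrable_bound[OF g[THEN integrable_divide, of C]])
        show "(\<lambda>w. (g w / C) *\<^sub>R iexp (l * X w)) \<in> borel_measurable M" using g by simp
      qed simp
      have "char (\<mu> p) l - char (\<mu> q) l = (\<integral>w. (p w / C) *\<^sub>R iexp (l * X w) - (q w / C) *\<^sub>R iexp (l * X w) \<partial>M)"
        unfolding char_def using ie[OF ip] ie[OF iq] pq by (simp add: int)
      also have "\<dots> = (\<integral>w. Complex (\<zeta> w * cos (l * X w) / C) (\<zeta> w * sin (l * X w) / C) \<partial>M)"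
        by (intro LINT_cong) (auto simp: pq(1) complex_eq_iff Re_exp Im_exp algebra_simps diff_divide_distrib)
      also have "\<dots> = (\<integral>w. complex_of_real (\<zeta> w * cos (l * X w) / C) + \<i> * complex_of_real (\<zeta> w * sin (l * X w) / C) \<partial>M)"
        by (simp add: Complex_eq)
      also have "\<dots> = (\<integral>w. complex_of_real (\<zeta> w * cos (l * X w) / C) \<partial>M) + \<i> * (\<integral>w. complex_of_real (\<zeta> w * sin (l * X w) / C) \<partial>M)"
        using integrable_trig_mult[OF \<zeta>, of "\<lambda>w. l * X w"] borel_measurable_times[OF borel_measurable_const[of l] X]
        by (intro Bochner_Integration.integral_add[THEN trans] arg_cong2[where f = "(+)"] refl
            integral_mult_right_zero integrable_mult_right integrable_of_real integrable_divide)
      also have "\<dots> = 0" by (simp only: integral_complex_of_real) (simp add: c s)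
      finally show ?thesis by simp
    qed
    then have eq: "\<mu> p = \<mu> q" using RD[of p] RD[of q] ip iq pq Cq by (intro Levy_uniqueness) (auto simp: C_def)
    have "(\<integral>x. indicat_real S x \<partial>\<mu> p) = (\<integral>w. (p w / C) *\<^sub>R indicat_real S (X w) \<partial>M)"
      "(\<integral>x. indicat_real S x \<partial>\<mu> q) = (\<integral>w. (q w / C) *\<^sub>R indicat_real S (X w) \<partial>M)"
      by (rule int; simp add: pq)+
    then have "(\<integral>w. (indicator S (X w) * p w) / C \<partial>M) = (\<integral>w. (indicator S (X w) * q w) / C \<partial>M)"
      unfolding eq by (simp add: mult.commute)
    then have "(\<integral>w. indicator S (X w) * p w \<partial>M) = (\<integral>w. indicator S (X w) * q w \<partial>M)"
      using Cpos by simp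
    moreover have "integrable M (\<lambda>w. indicator S (X w) * g w)" if "integrable M g" for g :: "'a \<Rightarrow> real"
      using that by (intro Bochner_Integration.integrable_bound[OF that]) (auto split: split_indicator)
    ultimately show ?thesis using ip iq by (simp add: pq(1) right_diff_distrib)
  qed
qed

context bm_horizon
begin

text \<open>The list holds pairs of coefficient and time.\<close>

definition lin :: "(real \<times> real) list \<Rightarrow> 'w \<Rightarrow> real" where
  "lin l w = (\<Sum>(c, r)\<leftarrow>l. c * W r w)"

text \<open>The coefficient of the \<open>j\<close>-th grid increment in \<open>lin l\<close> after summation by parts.\<close>

definition slope :: "(real \<times> real) list \<Rightarrow> nat \<Rightarrow> nat \<Rightarrow> real" where
  "slope l n j = (\<Sum>(c, r)\<leftarrow>l. if grid T n (Suc j) \<le> r then c else 0)"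

lemma lin_measurable:
  assumes "\<forall>(c, r)\<in>set l. r \<in> dyad T" shows "lin l \<in> borel_measurable M"
  using assms
proof (induction l)
  case (Cons p l)
  obtain c r where p: "p = (c, r)" by (cases p)
  have "0 \<le> r" using Cons(2) dyad_range[of T] T_pos p by auto
  then show ?case using Cons W_measurable unfolding lin_def p by auto
qed (simp add: lin_def[abs_def])

lemma slope_bound: "\<bar>slope l n j\<bar> \<le> (\<Sum>(c, r)\<leftarrow>l. \<bar>c\<bar>)"
  by (induction l) (auto simp: slope_def)

lemma lin_eq_slopes:
  assumes "\<forall>(c, r)\<in>set l. \<exists>j\<le>2^n. r = grid T n j" and W0: "W 0 w = 0"
  shows "lin l w = (\<Sum>j<2^n. slope l n j * (W (grid T n (Suc j)) w - W (grid T n j) w))"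
  using assms(1)
proof (induction l)
  case (Cons p l)
  obtain c r where p: "p = (c, r)" by (cases p)
  obtain k where k: "k \<le> 2^n" "r = grid T n k" using Cons(2) p by auto
  let ?d = "\<lambda>j. W (grid T n (Suc j)) w - W (grid T n j) w"
  have iff: "grid T n (Suc j) \<le> r \<longleftrightarrow> j < k" for j
    using grid_mono[of T "Suc j" k n] grid_less[OF T_pos, of k "Suc j" n] T_pos k(2) by (cases "j < k") auto
  have "W r w = (\<Sum>j<k. ?d j)" using W_grid_sum[of T n k w] W0 k(2) by simp
  also have "\<dots> = (\<Sum>j<2^n. if j < k then ?d j else 0)"
    using k(1) by (intro sum.mono_neutral_cong_left) auto
  finally have "c * W r w = (\<Sum>j<2^n. (if grid T n (Suc j) \<le> r then c else 0) * ?d j)"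
    unfolding iff by (simp only: sum_distrib_left) (intro sum.cong refl, simp)
  moreover have "lin (p # l) w = c * W r w + lin l w" by (simp add: lin_def p)
  moreover have "slope (p # l) n j = (if grid T n (Suc j) \<le> r then c else 0) + slope l n j" for j
    by (simp add: slope_def p)
  ultimately show ?case using Cons by (simp add: distrib_right sum.distrib)
qed (simp add: lin_def slope_def)

lemma bounded_Fil_const: "bounded_Fil a (\<lambda>w. v)"
  by (auto simp: bounded_Fil_def image_constant_conv)

text \<open>The factor \<open>exp (i f x + f\<^sup>2 d / 2)\<close> has mean \<open>1\<close> under a Gaussian \<open>x\<close> of variance \<open>d\<close>. What it differs
  from \<open>1 + i f x\<close> has mean \<open>0\<close> and variance of order \<open>d\<^sup>2\<close>.\<close>

definition compensated :: "real \<Rightarrow> real \<Rightarrow> real \<Rightarrow> complex" where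
  "compensated f d x = iexp (f * x) * complex_of_real (exp (f\<^sup>2 * d / 2)) - 1 - \<i> * complex_of_real (f * x)"

lemma compensated_measurable [measurable]: "compensated f d \<in> borel_measurable borel"
  unfolding compensated_def[abs_def] by measurable

lemma compensated_bound:
  assumes d: "0 \<le> d" and B: "exp (f\<^sup>2 * d / 2) \<le> B"
  shows "norm (compensated f d x) \<le> f\<^sup>2 * d / 2 * B + (f * x)\<^sup>2 / 2"
proof -
  let ?a = "f\<^sup>2 * d / 2"
  have a: "0 \<le> ?a" using d by simp
  have "exp ?a * (1 - ?a) \<le> exp ?a * exp (- ?a)"
    using exp_ge_add_one_self[of "- ?a"] by (intro mult_left_mono) auto
  then have "exp ?a - 1 \<le> ?a * exp ?a" by (simp add: exp_minus algebra_simps)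
  also have "\<dots> \<le> ?a * B" using a B by (intro mult_left_mono)
  finally have e: "exp ?a - 1 \<le> ?a * B" .
  have "compensated f d x = iexp (f * x) * complex_of_real (exp ?a - 1) + (iexp (f * x) - (\<Sum>k\<le>1. (\<i> * (f * x))^k / fact k))"
    by (simp add: compensated_def algebra_simps)
  also have "norm \<dots> \<le> norm (iexp (f * x) * complex_of_real (exp ?a - 1)) + norm (iexp (f * x) - (\<Sum>k\<le>1. (\<i> * (f * x))^k / fact k))"
    by (rule norm_triangle_ineq)
  also have "\<dots> \<le> (exp ?a - 1) + \<bar>f * x\<bar>^(Suc 1) / fact (Suc 1)"
  proof (rule add_mono[OF _ iexp_approx1])
    have "1 \<le> exp ?a" using a by (simp only: one_le_exp_iff)
    then show "norm (iexp (f * x) * complex_of_real (exp ?a - 1)) \<le> exp ?a - 1"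
      unfolding norm_mult norm_of_real norm_exp_i_times by simp
  qed
  also have "\<dots> \<le> ?a * B + (f * x)\<^sup>2 / 2" using e by (simp add: numeral_2_eq_2[symmetric] del: power_Suc)
  finally show ?thesis .
qed

lemma
  assumes s: "0 \<le> s" "s < t"
  shows compensated_mean: "(\<integral>w. compensated f (t - s) (W t w - W s w) \<partial>M) = 0"
    and compensated_L2: "(\<lambda>w. compensated f (t - s) (W t w - W s w)) \<in> L2 M"
    and compensated_second_moment: "exp (f\<^sup>2 * (t - s) / 2) \<le> B \<Longrightarrow> f\<^sup>2 \<le> K \<Longrightarrow>
      ip M (\<lambda>w. compensated f (t - s) (W t w - W s w)) (\<lambda>w. compensated f (t - s) (W t w - W s w)) \<le> (t - s)\<^sup>2 * (K\<^sup>2 * B\<^sup>2 + 3 * K\<^sup>2)"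
proof -
  let ?D = "\<lambda>w. W t w - W s w" and ?d = "t - s"
  note p = increment_power_integrable[OF s]
  have [measurable]: "?D \<in> borel_measurable M" using s by (intro increment_measurable) auto
  have m: "(\<lambda>w. compensated f ?d (?D w)) \<in> borel_measurable M" by measurable
  have "(\<lambda>w. iexp (f * ?D w)) \<in> borel_measurable M" by measurable
  then have ie: "integrable M (\<lambda>w. iexp (f * ?D w))"
    by (intro integrable_const_bound[where B = 1] AE_I2) (simp_all only: norm_exp_i_times order_refl)
  have ig: "integrable M (\<lambda>w. iexp (f * ?D w) * complex_of_real (exp (f\<^sup>2 * ?d / 2)) - 1)"
    using ie by (intro Bochner_Integration.integrable_diff integrable_mult_left) auto
  have id: "integrable M (\<lambda>w. \<i> * complex_of_real (f * ?D w))"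
    using p[of 1] by (intro integrable_mult_right integrable_of_real) simp
  have "(\<integral>w. compensated f ?d (?D w) \<partial>M) = (\<integral>w. iexp (f * ?D w) * complex_of_real (exp (f\<^sup>2 * ?d / 2)) - 1 \<partial>M) - (\<integral>w. \<i> * complex_of_real (f * ?D w) \<partial>M)"
    unfolding compensated_def by (rule Bochner_Integration.integral_diff[OF ig id])
  also have "(\<integral>w. \<i> * complex_of_real (f * ?D w) \<partial>M) = \<i> * complex_of_real (f * (\<integral>w. ?D w \<partial>M))"
    by (simp only: integral_mult_right_zero integral_complex_of_real)
  also have "(\<integral>w. ?D w \<partial>M) = 0" by (rule increment_mean[OF s])
  also have "(\<integral>w. iexp (f * ?D w) * complex_of_real (exp (f\<^sup>2 * ?d / 2)) - 1 \<partial>M)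
      = (\<integral>w. iexp (f * ?D w) \<partial>M) * complex_of_real (exp (f\<^sup>2 * ?d / 2)) - 1"
    using ie by (subst Bochner_Integration.integral_diff) (auto intro!: integrable_mult_left simp: prob_space)
  also have "\<dots> = 0"
    unfolding increment_char[OF s] by (simp add: exp_of_real[symmetric] exp_minus)
  finally show "(\<integral>w. compensated f ?d (?D w) \<partial>M) = 0" by simp
  have sq: "(norm (compensated f ?d (?D w)))\<^sup>2 \<le> 2 * (f\<^sup>2 * ?d / 2 * B)\<^sup>2 + f ^ 4 * ?D w ^ 4 / 2"
    if B: "exp (f\<^sup>2 * ?d / 2) \<le> B" for B w
  proof -
    let ?x = "f\<^sup>2 * ?d / 2 * B" and ?y = "(f * ?D w)\<^sup>2 / 2"
    have "(norm (compensated f ?d (?D w)))\<^sup>2 \<le> (?x + ?y)\<^sup>2"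
      using compensated_bound[of ?d f B "?D w"] s B by (intro power_mono) auto
    also have "\<dots> \<le> 2 * ?x\<^sup>2 + 2 * ?y\<^sup>2"
      using zero_le_power2[of "?x - ?y"] unfolding power2_sum power2_diff by linarith
    also have "2 * ?y\<^sup>2 = f ^ 4 * ?D w ^ 4 / 2" by (simp add: power_mult_distrib power_divide power2_eq_square power4_eq_xxxx)
    finally show ?thesis .
  qed
  show L: "(\<lambda>w. compensated f ?d (?D w)) \<in> L2 M"
    unfolding L2_def
  proof (intro CollectI conjI m, rule Bochner_Integration.integrable_bound)
    show "integrable M (\<lambda>w. 2 * (f\<^sup>2 * ?d / 2 * exp (f\<^sup>2 * ?d / 2))\<^sup>2 + f ^ 4 * ?D w ^ 4 / 2)"
      using p[of 4] by auto
    show "AE w in M. norm ((norm (compensated f ?d (?D w)))\<^sup>2) \<le> norm (2 * (f\<^sup>2 * ?d / 2 * exp (f\<^sup>2 * ?d / 2))\<^sup>2 + f ^ 4 * ?D w ^ 4 / 2)"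
      using sq[OF order_refl] by (intro AE_I2) (auto intro: order_trans[OF _ abs_ge_self])
  qed (use m in measurable)
  assume B: "exp (f\<^sup>2 * ?d / 2) \<le> B" and K: "f\<^sup>2 \<le> K"
  have "ip M (\<lambda>w. compensated f ?d (?D w)) (\<lambda>w. compensated f ?d (?D w)) = (\<integral>w. (norm (compensated f ?d (?D w)))\<^sup>2 \<partial>M)"
    by (simp add: ip_def dot_square_norm)
  also have "\<dots> \<le> (\<integral>w. 2 * (f\<^sup>2 * ?d / 2 * B)\<^sup>2 + f ^ 4 * ?D w ^ 4 / 2 \<partial>M)"
    using L p[of 4] by (intro integral_mono sq B) (auto simp: L2_def)
  also have "\<dots> = 2 * (f\<^sup>2 * ?d / 2 * B)\<^sup>2 + f ^ 4 * (3 * ?d\<^sup>2) / 2"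
    using p[of 4] by (simp add: increment_fourth_moment[OF s] prob_space)
  also have "\<dots> = ?d\<^sup>2 * ((f\<^sup>2)\<^sup>2 * B\<^sup>2 / 2 + 3 * (f\<^sup>2)\<^sup>2 / 2)"
  proof -
    have "2 * (f\<^sup>2 * d / 2 * B)\<^sup>2 + f ^ 4 * (3 * d\<^sup>2) / 2 = d\<^sup>2 * ((f\<^sup>2)\<^sup>2 * B\<^sup>2 / 2 + 3 * (f\<^sup>2)\<^sup>2 / 2)" for d
      by (simp add: power_mult_distrib power_divide power2_eq_square power4_eq_xxxx algebra_simps)
    then show ?thesis .
  qed
  also have "\<dots> \<le> ?d\<^sup>2 * (K\<^sup>2 * B\<^sup>2 + 3 * K\<^sup>2)"
  proof (intro mult_left_mono)
    have "(f\<^sup>2)\<^sup>2 \<le> K\<^sup>2" using K by (intro power_mono) auto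
    moreover from this have "(f\<^sup>2)\<^sup>2 * B\<^sup>2 \<le> K\<^sup>2 * B\<^sup>2" by (intro mult_right_mono) auto
    moreover have "0 \<le> (f\<^sup>2)\<^sup>2 * B\<^sup>2" "0 \<le> (f\<^sup>2)\<^sup>2" by auto
    ultimately show "(f\<^sup>2)\<^sup>2 * B\<^sup>2 / 2 + 3 * (f\<^sup>2)\<^sup>2 / 2 \<le> K\<^sup>2 * B\<^sup>2 + 3 * K\<^sup>2" by linarith
  qed simp
  finally show "ip M (\<lambda>w. compensated f ?d (?D w)) (\<lambda>w. compensated f ?d (?D w)) \<le> ?d\<^sup>2 * (K\<^sup>2 * B\<^sup>2 + 3 * K\<^sup>2)" .
qed

text \<open>Let \<open>V j\<close> be the exponential martingale along the grid of level \<open>n\<close>. Each step is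
  \<open>V (j + 1) = V j + i f V j \<Delta> + R j\<close>, so \<open>V\<close> is a constant plus a simple integral plus the sum of the
  remainders \<open>R j\<close>. The first two are orthogonal to \<open>\<eta>\<close>. The remainders are orthogonal to each other and
  have squared norm of order \<open>4\<^sup>-\<^sup>n\<close>, and there are \<open>2\<^sup>n\<close> of them, so their sum tends to \<open>0\<close>. At the
  last time, \<open>V\<close> is \<open>exp (i lin l)\<close> up to a deterministic factor that is at least \<open>1\<close>.\<close>

lemma trig_orthogonal:
  fixes \<eta> :: "'w \<Rightarrow> real" and u :: complex
  assumes \<eta>: "\<eta> \<in> L2 M" and mean0: "(\<integral>w. \<eta> w \<partial>M) = 0"
    and orth: "\<And>n i \<zeta>. i < 2^n \<Longrightarrow> bounded_Fil (grid T n i) \<zeta> \<Longrightarrow>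
      ip M \<eta> (\<lambda>w. (W (grid T n (Suc i)) w - W (grid T n i) w) * \<zeta> w) = 0"
    and l: "\<forall>(c, r)\<in>set l. r \<in> dyad T"
  shows "ip M (\<lambda>w. \<eta> w *\<^sub>R u) (\<lambda>w. iexp (lin l w)) = 0"
proof -
  define C where "C = (\<Sum>(c, r)\<leftarrow>l. \<bar>c\<bar>)"
  define B where "B = exp (C\<^sup>2 * T / 2)"
  define \<gamma> where "\<gamma> = (C\<^sup>2)\<^sup>2 * B\<^sup>2 + 3 * (C\<^sup>2)\<^sup>2"
  define K where "K = T\<^sup>2 * B\<^sup>2 * \<gamma>"
  define \<eta>u where "\<eta>u w = \<eta> w *\<^sub>R u" for w
  have \<eta>uL: "\<eta>u \<in> L2 M"
    by (rule L2_bound[OF _ \<eta>, where K = "norm u"])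
      (use L2_measurable[OF \<eta>] in \<open>auto simp: \<eta>u_def[abs_def] mult.commute intro!: borel_measurable_scaleR\<close>)
  have "finite (snd ` set l)" "snd ` set l \<subseteq> dyad T" using l by auto
  from finite_dyad_common_grid[OF this] obtain n0 where
    n0: "\<And>n. n \<ge> n0 \<Longrightarrow> \<forall>(c, r)\<in>set l. \<exists>j\<le>2^n. r = grid T n j" by fastforce
  have bound: "(ip M \<eta>u (\<lambda>w. iexp (lin l w)))\<^sup>2 \<le> ip M \<eta>u \<eta>u * K * (1/2)^n" if n: "n \<ge> n0" for n
  proof -
    define g where "g = grid T n"
    define d where "d = T / 2^n"
    define \<Delta> where "\<Delta> j w = W (g (Suc j)) w - W (g j) w" for j w
    define f where "f j = slope l n j" for j
    have gd: "0 \<le> g j" "g j < g (Suc j)" "g (Suc j) - g j = d" for j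
      using grid_mono[of T 0 j n] grid_less[OF T_pos, of j "Suc j" n] grid_step[of T n j] T_pos by (auto simp: g_def d_def)
    have d0: "0 < d" using T_pos by (simp add: d_def)
    have f2: "(f j)\<^sup>2 \<le> C\<^sup>2" for j
      using power_mono[OF slope_bound[of l n j], of 2] by (simp add: f_def C_def)
    define H where "H j w = compensated (f j) d (\<Delta> j w)" for j w
    define V where "V j w = (\<Prod>i<j. iexp (f i * \<Delta> i w) * complex_of_real (exp ((f i)\<^sup>2 * d / 2)))" for j w
    define U where "U j w = \<Delta> j w *\<^sub>R (\<i> * complex_of_real (f j) * V j w)" for j w
    define R where "R j w = V j w * H j w" for j w
    define S where "S m w = (\<Sum>j<m. R j w)" for m w
    have \<Delta>F: "\<Delta> j \<in> borel_measurable (Fil (g (Suc j)))" for j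
      unfolding \<Delta>_def[abs_def] using gd[of j] gd(1)[of "Suc j"] by (intro increment_Fil) auto
    have VF: "V j \<in> borel_measurable (Fil (g j))" for j
    proof (induction j)
      case 0
      then show ?case by (simp add: V_def[abs_def])
    next
      case (Suc j)
      have "V (Suc j) = (\<lambda>w. V j w * (iexp (f j * \<Delta> j w) * complex_of_real (exp ((f j)\<^sup>2 * d / 2))))"
        by (simp add: V_def[abs_def])
      moreover have "(\<lambda>x. iexp (f j * x) * complex_of_real (exp ((f j)\<^sup>2 * d / 2))) \<in> borel_measurable borel" by measurable
      ultimately show ?case
        using measurable_compose[OF \<Delta>F[of j]] Fil_measurable_mono[OF less_imp_le[OF gd(2)] Suc]
        by (simp only:) (rule borel_measurable_times)
    qed
    have norm_V: "norm (V j w) = exp (\<Sum>i<j. (f i)\<^sup>2 * d / 2)" for j w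
      unfolding V_def prod_norm[symmetric] norm_mult norm_exp_i_times norm_of_real by (simp add: exp_sum)
    have sum_le: "(\<Sum>i<j. (f i)\<^sup>2 * d / 2) \<le> C\<^sup>2 * T / 2" if "j \<le> 2^n" for j
    proof -
      have "(\<Sum>i<j. (f i)\<^sup>2 * d / 2) \<le> (\<Sum>i<j. C\<^sup>2 * d / 2)" using f2 d0 by (intro sum_mono) auto
      also have "\<dots> = real j * (C\<^sup>2 * d / 2)" by simp
      also have "\<dots> \<le> 2^n * (C\<^sup>2 * d / 2)" using that d0 by (intro mult_right_mono) (auto simp: numeral_power_le_of_nat_cancel_iff of_nat_le_numeral_power_cancel_iff)
      also have "\<dots> = C\<^sup>2 * T / 2" by (simp add: d_def)
      finally show ?thesis .
    qed
    have VB: "norm (V j w) \<le> B" if "j \<le> 2^n" for j w unfolding norm_V B_def using sum_le[OF that] by simp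
    have V1: "1 \<le> norm (V j w)" for j w unfolding norm_V using d0 by (simp add: sum_nonneg)
    have Vb: "bounded_Fil (g j) (V j)" if "j \<le> 2^n" for j
      unfolding bounded_Fil_def bounded_iff using VF[of j] VB[OF that] by auto
    have expB: "exp ((f j)\<^sup>2 * d / 2) \<le> B" for j
    proof -
      have "(f j)\<^sup>2 * d \<le> C\<^sup>2 * T" using f2[of j] d0 T_pos by (intro mult_mono) (auto simp: d_def divide_le_eq)
      then show ?thesis by (simp add: B_def)
    qed
    have HL: "H j \<in> L2 M" and H2: "ip M (H j) (H j) \<le> d\<^sup>2 * \<gamma>" and H0: "(\<integral>w. H j w \<partial>M) = 0" for j
      using compensated_L2[OF gd(1,2), of "f j" j] compensated_second_moment[OF gd(1,2), of "f j" j B "C\<^sup>2"]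
        compensated_mean[OF gd(1,2), of "f j" j] expB[of j] f2[of j]
      by (simp_all add: H_def[abs_def] \<Delta>_def gd(3) \<gamma>_def)
    have HF: "H j \<in> borel_measurable (Fil (g (Suc j)))" for j
      unfolding H_def[abs_def] by (rule measurable_compose[OF \<Delta>F]) simp
    have RF: "R j \<in> borel_measurable (Fil (g (Suc j)))" for j
      unfolding R_def[abs_def] using HF[of j] Fil_measurable_mono[OF less_imp_le[OF gd(2)] VF] by (intro borel_measurable_times)
    have Rn: "norm (R j w) \<le> B * norm (H j w)" if "j \<le> 2^n" for j w
      unfolding R_def norm_mult using VB[OF that] by (intro mult_right_mono) auto
    have RL: "R j \<in> L2 M" if "j \<le> 2^n" for j
      by (rule L2_bound[OF Fil_measurable_M[OF RF] HL, where K = B]) (use Rn[OF that] in auto)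
    have R2: "ip M (R j) (R j) \<le> B\<^sup>2 * (d\<^sup>2 * \<gamma>)" if j: "j \<le> 2^n" for j
    proof -
      have "ip M (R j) (R j) \<le> (\<integral>w. B\<^sup>2 * (H j w \<bullet> H j w) \<partial>M)"
        unfolding ip_def
      proof (intro integral_mono L2_inner_integrable RL j integrable_mult_right HL)
        fix w
        have "(norm (R j w))\<^sup>2 \<le> (B * norm (H j w))\<^sup>2" using Rn[OF j] by (intro power_mono) auto
        then show "R j w \<bullet> R j w \<le> B\<^sup>2 * (H j w \<bullet> H j w)" by (simp add: dot_square_norm power_mult_distrib)
      qed
      also have "\<dots> = B\<^sup>2 * ip M (H j) (H j)" by (simp add: ip_def)
      also have "\<dots> \<le> B\<^sup>2 * (d\<^sup>2 * \<gamma>)" by (intro mult_left_mono H2) auto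
      finally show ?thesis .
    qed
    have SL: "S m \<in> L2 M" if "m \<le> 2^n" for m unfolding S_def[abs_def] using that by (intro L2_sum RL) auto
    have SF: "S m \<in> borel_measurable (Fil (g m))" for m
      unfolding S_def[abs_def]
    proof (intro borel_measurable_sum)
      fix j assume "j \<in> {..<m}"
      then have "g (Suc j) \<le> g m" using T_pos by (auto simp: g_def intro: grid_mono)
      then show "R j \<in> borel_measurable (Fil (g m))" using Fil_measurable_mono RF by blast
    qed
    \<comment> \<open>the remainders are martingale differences\<close>
    have SR: "ip M (S m) (R m) = 0" if m: "m < 2^n" for m
    proof -
      define Q where "Q w = cnj (S m w) * V m w" for w
      have QF: "Q \<in> borel_measurable (Fil (g m))"
        unfolding Q_def[abs_def] using SF[of m] VF[of m] by (intro borel_measurable_times measurable_compose[OF SF]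
            borel_measurable_continuous_onI continuous_intros)
      have Qi: "integrable M Q"
      proof (rule Bochner_Integration.integrable_bound)
        have "(\<lambda>w. norm (S m w)) \<in> L2 M" using SL[of m] m measurable_compose[OF L2_measurable[OF SL] borel_measurable_norm, of m] by (simp add: L2_def)
        from L2_inner_integrable[OF this, of "\<lambda>_. B"] show "integrable M (\<lambda>w. norm (S m w) * B)" by (simp add: L2_def)
        show "AE w in M. norm (Q w) \<le> norm (norm (S m w) * B)"
          using VB[of m] m by (intro AE_I2) (auto simp: Q_def norm_mult abs_mult intro!: mult_mono order_trans[OF _ abs_ge_self])
      qed (rule Fil_measurable_M[OF QF])
      have "integrable M (\<lambda>w. compensated (f m) d (W (g (Suc m)) w - W (g m) w))"
        using L2_inner_integrable[OF HL, of "\<lambda>_. 1" m] L2_inner_integrable[OF HL, of "\<lambda>_. \<i>" m]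
          L2_measurable[OF HL, of m]
        by (subst complex_eq[of "compensated _ _ _"]) (auto simp: L2_def H_def \<Delta>_def inner_complex_def intro!: integrable_of_real)
      note fac = increment_factor_integral[OF gd(1,2) QF Qi _ this] increment_factor_integrable[OF gd(1,2) QF Qi _ this]
      have "ip M (S m) (R m) = (\<integral>w. Re (Q w * compensated (f m) d (W (g (Suc m)) w - W (g m) w)) \<partial>M)"
        unfolding ip_def R_def Q_def H_def \<Delta>_def by (intro LINT_cong) (auto simp: inner_complex_def algebra_simps)
      also have "\<dots> = Re (\<integral>w. Q w * compensated (f m) d (W (g (Suc m)) w - W (g m) w) \<partial>M)"
        using fac(2) by (intro integral_Re) simp
      also have "\<dots> = 0" using fac(1) H0[of m] by (simp add: H_def \<Delta>_def)
      finally show ?thesis .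
    qed
    have S2: "ip M (S m) (S m) \<le> real m * (B\<^sup>2 * (d\<^sup>2 * \<gamma>))" if "m \<le> 2^n" for m
      using that
    proof (induction m)
      case (Suc m)
      have "ip M (S (Suc m)) (S (Suc m)) = ip M (S m) (S m) + ip M (R m) (R m)"
        using SL[of m] RL[of m] SR[of m] Suc(2) ip_commute[of M "R m" "S m"]
        by (simp add: S_def[abs_def] ip_add_left ip_add_right L2_add)
      then show ?case using Suc R2[of m] by (simp add: distrib_right)
    qed (simp add: S_def ip_def)
    have tele: "V m w = 1 + (\<Sum>j<m. U j w) + S m w" for m w
    proof (induction m)
      case (Suc m)
      have "V (Suc m) w = V m w + U m w + R m w"
        by (simp add: U_def V_def R_def H_def compensated_def scaleR_conv_of_real algebra_simps)
      moreover have "v = 1 + a + s \<Longrightarrow> v + b + c = 1 + (a + b) + (s + c)" for v a b c s :: complex by simp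
      ultimately show ?case using Suc unfolding S_def sum.lessThan_Suc by (simp only:)
    qed (simp add: V_def S_def)
    have UL: "U j \<in> L2 M \<and> ip M \<eta>u (U j) = 0" if j: "j < 2^n" for j
    proof
      have b: "bounded_Fil (g j) (\<lambda>w. \<i> * complex_of_real (f j) * V j w)"
        unfolding bounded_Fil_def bounded_iff using VF[of j] VB[of j] j
        by (auto intro!: exI[of _ "\<bar>f j\<bar> * B"] simp: norm_mult mult_left_mono)
      show "U j \<in> L2 M"
        using gd(1)[of j] gd(1)[of "Suc j"] unfolding U_def[abs_def] \<Delta>_def
        by (intro bounded_Fil_scaleR_L2[OF b] increment_L2)
      have "ip M \<eta>u (U j)
        = ip M \<eta> (\<lambda>w. (W (grid T n (Suc j)) w - W (grid T n j) w) * (u \<bullet> (\<i> * complex_of_real (f j) * V j w)))"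
        unfolding ip_def \<eta>u_def U_def \<Delta>_def g_def by (intro LINT_cong) (auto simp: mult_ac)
      also have "\<dots> = 0" using bounded_Fil_inner[OF bounded_Fil_const[of "g j" u] b] j by (intro orth) (auto simp: g_def)
      finally show "ip M \<eta>u (U j) = 0" .
    qed
    have "ip M \<eta>u (\<lambda>w. 1 + (\<Sum>j<2^n. U j w) + S (2^n) w) = ip M \<eta>u (S (2^n))"
    proof -
      have c: "(\<lambda>w. 1) \<in> L2 M" by (simp add: L2_def)
      have "ip M \<eta>u (\<lambda>w. 1) = 0" unfolding ip_def \<eta>u_def by (simp add: mean0)
      moreover have "ip M \<eta>u (\<lambda>w. \<Sum>j<2^n. U j w) = 0"
        using UL by (subst ip_sum_right) (auto simp: \<eta>uL)
      moreover have A: "(\<lambda>w. \<Sum>j<2^n. U j w) \<in> L2 M" using UL by (intro L2_sum) auto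
      ultimately show ?thesis
        unfolding ip_add_right[OF L2_add[OF c A] SL[OF order_refl] \<eta>uL] ip_add_right[OF c A \<eta>uL] by simp
    qed
    then have eV: "ip M \<eta>u (V (2^n)) = ip M \<eta>u (S (2^n))" unfolding tele[symmetric] by simp
    have "AE w in M. V (2^n) w = exp (\<Sum>i<2^n. (f i)\<^sup>2 * d / 2) *\<^sub>R iexp (lin l w)"
      using W_zero
    proof eventually_elim
      case (elim w)
      have "V (2^n) w = (\<Prod>i<2^n. iexp (f i * \<Delta> i w)) * (\<Prod>i<2^n. complex_of_real (exp ((f i)\<^sup>2 * d / 2)))"
        unfolding V_def by (rule prod.distrib)
      also have "(\<Prod>i<2^n. iexp (f i * \<Delta> i w)) = iexp (\<Sum>i<2^n. f i * \<Delta> i w)"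
        by (simp add: exp_sum sum_distrib_left)
      also have "(\<Sum>i<2^n. f i * \<Delta> i w) = lin l w"
        using lin_eq_slopes[of l n w, OF n0[OF n] elim] by (simp add: f_def \<Delta>_def g_def)
      also have "(\<Prod>i<2^n. complex_of_real (exp ((f i)\<^sup>2 * d / 2))) = complex_of_real (exp (\<Sum>i<2^n. (f i)\<^sup>2 * d / 2))"
        by (simp add: exp_sum)
      finally show ?case by (simp add: scaleR_conv_of_real mult.commute)
    qed
    moreover have lm: "(\<lambda>w. iexp (lin l w)) \<in> borel_measurable M" using lin_measurable[OF l] by measurable
    ultimately have "ip M \<eta>u (V (2^n)) = ip M \<eta>u (\<lambda>w. exp (\<Sum>i<2^n. (f i)\<^sup>2 * d / 2) *\<^sub>R iexp (lin l w))"
      using L2_measurable[OF \<eta>uL] Fil_measurable_M[OF VF] by (intro ip_cong_AE) auto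
    then have scaled: "exp (\<Sum>i<2^n. (f i)\<^sup>2 * d / 2) * ip M \<eta>u (\<lambda>w. iexp (lin l w)) = ip M \<eta>u (S (2^n))"
      using eV by (simp add: ip_scaleR_right)
    have e1: "1 \<le> exp (\<Sum>i<2^n. (f i)\<^sup>2 * d / 2)" using d0 by (simp add: sum_nonneg)
    have "\<bar>ip M \<eta>u (\<lambda>w. iexp (lin l w))\<bar> \<le> \<bar>ip M \<eta>u (S (2^n))\<bar>"
    proof -
      have "e * x = y \<Longrightarrow> 1 \<le> e \<Longrightarrow> \<bar>x\<bar> \<le> \<bar>y\<bar>" for e x y :: real
        using mult_right_mono[of 1 e "\<bar>x\<bar>"] by (auto simp: abs_mult)
      then show ?thesis using scaled e1 by blast
    qed
    also have "\<dots> \<le> nrm M \<eta>u * nrm M (S (2^n))" by (intro ip_Cauchy_Schwarz \<eta>uL SL) auto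
    finally have "\<bar>ip M \<eta>u (\<lambda>w. iexp (lin l w))\<bar>\<^sup>2 \<le> (nrm M \<eta>u * nrm M (S (2^n)))\<^sup>2" by (intro power_mono) auto
    then have "(ip M \<eta>u (\<lambda>w. iexp (lin l w)))\<^sup>2 \<le> ip M \<eta>u \<eta>u * ip M (S (2^n)) (S (2^n))"
      by (simp add: power_mult_distrib nrm_power2)
    also have "\<dots> \<le> ip M \<eta>u \<eta>u * (real (2^n) * (B\<^sup>2 * (d\<^sup>2 * \<gamma>)))"
      by (intro mult_left_mono S2) auto
    also have "\<dots> = ip M \<eta>u \<eta>u * K * (1/2)^n"
      by (simp add: K_def d_def power_divide power2_eq_square field_simps)
    finally show ?thesis .
  qed
  have "(ip M \<eta>u (\<lambda>w. iexp (lin l w)))\<^sup>2 \<le> 0"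
  proof (rule LIMSEQ_le_const)
    have "(\<lambda>n. (1/2::real)^n) \<longlonglongrightarrow> 0" by (rule LIMSEQ_power_zero) simp
    from tendsto_mult_right_zero[OF this] show "(\<lambda>n. ip M \<eta>u \<eta>u * K * (1/2)^n) \<longlonglongrightarrow> 0" .
    show "\<exists>N. \<forall>n\<ge>N. (ip M \<eta>u (\<lambda>w. iexp (lin l w)))\<^sup>2 \<le> ip M \<eta>u \<eta>u * K * (1/2)^n" using bound by blast
  qed
  then show ?thesis by (simp add: \<eta>u_def[abs_def])
qed

text \<open>Levy's theorem is used for one-dimensional laws, so the indicator of \<open>below J\<close> is built up one
  coordinate at a time, while the remaining coordinates stay in the exponential.\<close>

lemma increments_total:
  fixes \<eta> :: "'w \<Rightarrow> real"
  assumes \<eta>F: "\<eta> \<in> borel_measurable (Fil T)" and \<eta>: "\<eta> \<in> L2 M" and mean0: "(\<integral>w. \<eta> w \<partial>M) = 0"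
    and orth: "\<And>n i \<zeta>. i < 2^n \<Longrightarrow> bounded_Fil (grid T n i) \<zeta> \<Longrightarrow>
      ip M \<eta> (\<lambda>w. (W (grid T n (Suc i)) w - W (grid T n i) w) * \<zeta> w) = 0"
  shows "AE w in M. \<eta> w = 0"
proof -
  have \<eta>i: "integrable M \<eta>" using L2_inner_integrable[OF \<eta>, of "\<lambda>_. 1"] by (simp add: L2_def)
  have dT: "dyad T \<subseteq> {0..T}" using T_pos by (intro dyad_range) auto
  have bM: "below J \<in> sets M" if "finite J" "J \<subseteq> dyad T \<times> UNIV" for J
    using below_sets[OF that(1), of T] that(2) dT sets_Fil_subset by blast
  \<comment> \<open>coordinates are turned one at a time from exponentials into indicators\<close>
  have claim: "\<forall>l. (\<forall>(c, r)\<in>set l. r \<in> dyad T) \<longrightarrow>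
      (\<integral>w. indicator (below J) w * \<eta> w * cos (lin l w) \<partial>M) = 0 \<and>
      (\<integral>w. indicator (below J) w * \<eta> w * sin (lin l w) \<partial>M) = 0"
    if "finite J" "J \<subseteq> dyad T \<times> UNIV" for J
    using that
  proof (induction J)
    case empty
    show ?case
    proof (intro allI impI)
      fix l :: "(real \<times> real) list" assume l: "\<forall>(c, r)\<in>set l. r \<in> dyad T"
      have "(\<integral>w. indicator (below {}) w * \<eta> w * cos (lin l w) \<partial>M) = ip M (\<lambda>w. \<eta> w *\<^sub>R 1) (\<lambda>w. iexp (lin l w))"
        unfolding ip_def by (intro LINT_cong) (auto simp: inner_complex_def Re_exp)
      moreover have "(\<integral>w. indicator (below {}) w * \<eta> w * sin (lin l w) \<partial>M) = ip M (\<lambda>w. \<eta> w *\<^sub>R \<i>) (\<lambda>w. iexp (lin l w))"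
        unfolding ip_def by (intro LINT_cong) (auto simp: inner_complex_def Im_exp)
      ultimately show "(\<integral>w. indicator (below {}) w * \<eta> w * cos (lin l w) \<partial>M) = 0 \<and>
          (\<integral>w. indicator (below {}) w * \<eta> w * sin (lin l w) \<partial>M) = 0"
        using trig_orthogonal[OF \<eta> mean0 orth l] by simp
    qed
  next
    case (insert p J)
    obtain r a where p: "p = (r, a)" by (cases p)
    have r: "r \<in> dyad T" "0 \<le> r" using insert(4) p dT by auto
    have Wm: "W r \<in> borel_measurable M" using r(2) by (rule W_measurable)
    define \<beta> where "\<beta> w = indicat_real (below J) w * \<eta> w" for w
    have \<beta>i: "integrable M \<beta>"
      unfolding \<beta>_def[abs_def] using integrable_mult_indicator[OF bM \<eta>i, of J] insert by simp
    have split: "indicat_real (below (insert p J)) w = indicator {..a} (W r w) * indicator (below J) w" if "w \<in> space M" for w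
      using that by (auto simp: p below_def split: split_indicator)
    show ?case
    proof (intro allI impI)
      fix l :: "(real \<times> real) list" assume l: "\<forall>(c, r)\<in>set l. r \<in> dyad T"
      have IH: "(\<integral>w. \<beta> w * cos (lin l w + c * W r w) \<partial>M) = 0" "(\<integral>w. \<beta> w * sin (lin l w + c * W r w) \<partial>M) = 0" for c
        using insert.IH insert.prems spec[OF insert.IH, of "(c, r) # l"] l r(1) by (auto simp: \<beta>_def lin_def add.commute)
      have lm: "lin l \<in> borel_measurable M" by (rule lin_measurable[OF l])
      note int = integrable_trig_mult[OF \<beta>i]
      have lmW: "(\<lambda>w. lin l w + c * W r w) \<in> borel_measurable M" for c using lm Wm by measurable
      have pm: "cos (lin l w) * cos (c * W r w) = (cos (lin l w + c * W r w) + cos (lin l w + (- c) * W r w)) / 2"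
        "cos (lin l w) * sin (c * W r w) = (sin (lin l w + c * W r w) - sin (lin l w + (- c) * W r w)) / 2"
        "sin (lin l w) * cos (c * W r w) = (sin (lin l w + c * W r w) + sin (lin l w + (- c) * W r w)) / 2"
        "sin (lin l w) * sin (c * W r w) = (cos (lin l w + (- c) * W r w) - cos (lin l w + c * W r w)) / 2" for c w
        by (simp_all add: cos_add sin_add cos_diff sin_diff)
      have z: "(\<integral>w. (\<beta> w * cos (lin l w)) * cos (c * W r w) \<partial>M) = 0" "(\<integral>w. (\<beta> w * cos (lin l w)) * sin (c * W r w) \<partial>M) = 0"
        "(\<integral>w. (\<beta> w * sin (lin l w)) * cos (c * W r w) \<partial>M) = 0" "(\<integral>w. (\<beta> w * sin (lin l w)) * sin (c * W r w) \<partial>M) = 0" for c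
        using int[OF lmW[of c]] int[OF lmW[of "- c"]] IH[of c] IH[of "- c"]
        unfolding mult.assoc pm by (simp_all add: distrib_left right_diff_distrib)
      have "(\<integral>w. indicator {..a} (W r w) * (\<beta> w * cos (lin l w)) \<partial>M) = 0" "(\<integral>w. indicator {..a} (W r w) * (\<beta> w * sin (lin l w)) \<partial>M) = 0"
        by (rule set_integral_eq_0_of_char[OF int(1)[OF lm] Wm z(1,2)], simp)
          (rule set_integral_eq_0_of_char[OF int(2)[OF lm] Wm z(3,4)], simp)
      moreover have "(\<integral>w. indicator (below (insert p J)) w * \<eta> w * h w \<partial>M) = (\<integral>w. indicator {..a} (W r w) * (\<beta> w * h w) \<partial>M)" for h :: "'w \<Rightarrow> real"
        by (intro LINT_cong) (auto simp: split \<beta>_def)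
      ultimately show "(\<integral>w. indicator (below (insert p J)) w * \<eta> w * cos (lin l w) \<partial>M) = 0 \<and>
          (\<integral>w. indicator (below (insert p J)) w * \<eta> w * sin (lin l w) \<partial>M) = 0" by simp
    qed
  qed
  show ?thesis
  proof (rule AE_eq_0_if_Fil_integrals_zero[OF \<eta>F \<eta>i])
    fix A assume A: "A \<in> sets (Fil T)"
    show "(LINT w:A|M. \<eta> w) = 0"
    proof (rule set_integral_eq_0_Fil[OF _ dT _ \<eta>i _ A])
      fix J :: "(real \<times> real) set" assume J: "finite J" "J \<subseteq> dyad T \<times> \<rat>"
      then have "J \<subseteq> dyad T \<times> UNIV" by auto
      from spec[OF claim[OF J(1) this], of "[]"] show "(LINT w:below J|M. \<eta> w) = 0"
        by (simp add: lin_def set_lebesgue_integral_def)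
    qed (use T_pos dyad_closure in auto)
  qed
qed

text \<open>By uniqueness of the limit: the constant sequence is an admissible approximation.\<close>

lemma ito_of_simple:
  assumes I: "is_ito \<phi> I" and sp: "simple_process M W T k \<tau> \<xi>" and \<phi>: "\<phi> = simple_value k \<tau> \<xi>"
    and t: "t \<in> {0..T}"
  shows "AE w in M. I t w = simple_ito W k \<tau> \<xi> t w"
proof -
  obtain k' \<tau>' \<xi>' where 1: "\<And>j. simple_process M W T (k' j) (\<tau>' j) (\<xi>' j)"
    "(\<lambda>j. DR (simple_value (k' j) (\<tau>' j) (\<xi>' j)) \<phi>) \<longlonglongrightarrow> 0"
    "\<And>t. t \<in> {0..T} \<Longrightarrow> I t \<in> L2 M"
    "\<And>t. t \<in> {0..T} \<Longrightarrow> (\<lambda>j. dst M (simple_ito W (k' j) (\<tau>' j) (\<xi>' j) t) (I t)) \<longlonglongrightarrow> 0"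
    by (rule ito_approximation[OF I]) blast
  have t0: "0 \<le> t" using t by simp
  let ?S = "simple_ito W k \<tau> \<xi> t" and ?J = "\<lambda>j. simple_ito W (k' j) (\<tau>' j) (\<xi>' j) t"
  note L = simple_ito_L2[OF sp t0] simple_ito_L2[OF 1(1) t0] 1(3)[OF t]
  have le: "dst M (I t) ?S \<le> dst M (?J j) (I t) + DR (simple_value (k' j) (\<tau>' j) (\<xi>' j)) \<phi>" for j
  proof -
    have "dst M (?J j) ?S \<le> DR (simple_value (k' j) (\<tau>' j) (\<xi>' j)) \<phi>"
      unfolding simple_ito_nrm[OF 1(1) sp t0] \<phi> by (intro NR_cut_le L2P_diff simple_value_L2P 1(1) sp)
    then show ?thesis using nrm_triangle_diff[OF L(3,1) L(2), of j] nrm_minus[of M "I t" "?J j"] by linarith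
  qed
  have "dst M (I t) ?S \<le> 0"
  proof (rule LIMSEQ_le_const)
    show "(\<lambda>j. dst M (?J j) (I t) + DR (simple_value (k' j) (\<tau>' j) (\<xi>' j)) \<phi>) \<longlonglongrightarrow> 0"
      using tendsto_add[OF 1(4)[OF t] 1(2)] by simp
  qed (use le in blast)
  then have "dst M (I t) ?S = 0" using nrm_nonneg[of M "\<lambda>w. I t w - ?S w"] by linarith
  then have "AE w in M. I t w - ?S w = 0" using nrm_eq_0_iff[OF L2_diff[OF L(3,1)]] by simp
  then show ?thesis by eventually_elim simp
qed

lemma ito_mean_0:
  assumes I: "is_ito \<phi> I" and t: "0 \<le> t" "t \<le> T" shows "ip M (I t) (\<lambda>w. v) = 0"
proof -
  note m = L2martD[OF ito_L2mart[OF I]]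
  have c: "(\<lambda>w. v) \<in> L2 M" by (simp add: L2_def)
  have "ip M (\<lambda>w. I t w - I 0 w) (\<lambda>w. v) = 0" using m(3)[of t 0] t c by simp
  moreover have "ip M (\<lambda>w. I t w - I 0 w) (\<lambda>w. v) = ip M (I t) (\<lambda>w. v)"
  proof (rule ip_cong_AE)
    show "AE w in M. I t w - I 0 w = I t w" using ito_at_0[OF I] by eventually_elim simp
  qed (use L2_measurable m(2)[of t] m(2)[of 0] t T_pos in \<open>auto intro!: borel_measurable_diff\<close>)
  ultimately show ?thesis by simp
qed

text \<open>The integrand represents \<open>\<phi> \<mapsto> E (\<xi> \<bullet> \<integral> \<phi> dW)\<close>. What is left of \<open>\<xi>\<close> is centred and orthogonal to all
  simple integrals.\<close>

theorem martingale_representation: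
  fixes \<xi> :: "'w \<Rightarrow> 'a::euclidean_space"
  assumes \<xi>F: "\<xi> \<in> borel_measurable (Fil T)" and \<xi>: "\<xi> \<in> L2 M"
  shows "\<exists>Z I. is_ito Z I \<and> (AE w in M. \<xi> w = (\<integral>w. \<xi> w \<partial>M) + I T w)"
proof -
  have TT: "T \<in> {0..T}" "0 \<le> T" using T_pos by auto
  define It where "It \<phi> = (SOME I. is_ito \<phi> I)" for \<phi> :: "('w, 'a) process"
  have It: "is_ito \<phi> (It \<phi>)" if "\<phi> \<in> L2P" for \<phi> :: "('w, 'a) process"
    unfolding It_def using ito_integral_exists[OF that] by (rule someI_ex)
  have ItL: "It \<phi> T \<in> L2 M" if "\<phi> \<in> L2P" for \<phi> :: "('w, 'a) process"
    using L2martD(2)[OF ito_L2mart[OF It[OF that]]] TT by auto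
  have lin: "It \<theta> T \<in> L2 M \<and> ip M \<xi> (It \<theta> T) = ip M \<xi> (It \<phi> T) + r * ip M \<xi> (It \<psi> T)"
    if v: "\<phi> \<in> L2P" "\<psi> \<in> L2P" and \<theta>: "\<theta> = (\<lambda>s w. \<phi> s w + r *\<^sub>R \<psi> s w)" for \<phi> \<psi> \<theta> :: "('w, 'a) process" and r
  proof -
    have \<theta>L: "\<theta> \<in> L2P" unfolding \<theta> by (intro L2P_add L2P_scaleR v)
    have "NR (\<lambda>s w. \<theta> s w - (\<phi> s w + r *\<^sub>R \<psi> s w)) = 0" unfolding \<theta> by (intro NR_eq_0_I) auto
    from ito_linear[OF It[OF v(1)] It[OF v(2)] It[OF \<theta>L] this]
    have "AE w in M. It \<theta> T w = It \<phi> T w + r *\<^sub>R It \<psi> T w" by eventually_elim (use TT in auto)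
    then have "ip M \<xi> (It \<theta> T) = ip M \<xi> (\<lambda>w. It \<phi> T w + r *\<^sub>R It \<psi> T w)"
      by (intro ip_cong_AE L2_measurable L2_add L2_scaleR \<xi> ItL v \<theta>L) auto
    then show ?thesis using ItL v \<theta>L \<xi> by (simp add: ip_add_right ip_scaleR_right L2_scaleR)
  qed
  have "\<exists>Z\<in>L2P. \<forall>\<phi>\<in>L2P. ip M \<xi> (It \<phi> T) = IP Z \<phi>"
  proof (rule L2P_Riesz)
    show "ip M \<xi> (It (\<lambda>s w. \<phi> s w + \<psi> s w) T) = ip M \<xi> (It \<phi> T) + ip M \<xi> (It \<psi> T)"
      if "\<phi> \<in> L2P" "\<psi> \<in> L2P" for \<phi> \<psi> using lin[OF that, of _ 1] by simp
    have z: "ip M \<xi> (It (\<lambda>s w. 0) T) = 0"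
    proof -
      have "ip M \<xi> (It (\<lambda>s w. 0) T) = ip M \<xi> (It (\<lambda>s w. 0) T) + 1 * ip M \<xi> (It (\<lambda>s w. 0) T)"
        by (rule lin[THEN conjunct2]) auto
      then show ?thesis by linarith
    qed
    show "ip M \<xi> (It (\<lambda>s w. r *\<^sub>R \<phi> s w) T) = r * ip M \<xi> (It \<phi> T)" if "\<phi> \<in> L2P" for \<phi> r
      using lin[of "\<lambda>s w. 0" \<phi> _ r] that z by simp
    show "\<bar>ip M \<xi> (It \<phi> T)\<bar> \<le> nrm M \<xi> * NR \<phi>" if \<phi>: "\<phi> \<in> L2P" for \<phi>
    proof -
      have "nrm M (It \<phi> T) = NR \<phi>"
        unfolding nrm_def NR_def_IP ito_isometry[OF It[OF \<phi>] It[OF \<phi>] TT(1)] cut_T[OF \<phi>] ..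
      then show ?thesis using ip_Cauchy_Schwarz[OF \<xi> ItL[OF \<phi>]] by simp
    qed
  qed
  then obtain Z where Z: "Z \<in> L2P" and Zl: "\<And>\<phi>. \<phi> \<in> L2P \<Longrightarrow> ip M \<xi> (It \<phi> T) = IP Z \<phi>" by blast
  define m where "m = (\<integral>w. \<xi> w \<partial>M)"
  define \<eta> where "\<eta> w = \<xi> w - m - It Z T w" for w
  have cL: "(\<lambda>w. v) \<in> L2 M" for v :: 'a by (simp add: L2_def)
  have \<eta>L: "\<eta> \<in> L2 M" unfolding \<eta>_def[abs_def] by (intro L2_diff \<xi> cL ItL Z)
  have \<eta>F: "\<eta> \<in> borel_measurable (Fil T)"
    unfolding \<eta>_def[abs_def] using L2martD(1)[OF ito_L2mart[OF It[OF Z]], of T] TT \<xi>F by (intro borel_measurable_diff) auto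
  have \<xi>i: "integrable M (\<lambda>w. \<xi> w)"
    using integrable_norm_cancel[of M \<xi>] L2_inner_integrable[of "\<lambda>w. norm (\<xi> w)" M "\<lambda>_. 1"] \<xi>
      measurable_compose[OF L2_measurable[OF \<xi>] borel_measurable_norm] by (simp add: L2_def)
  have "AE w in M. \<eta> w \<bullet> b = 0" if b: "b \<in> Basis" for b
  proof (rule increments_total)
    show "(\<lambda>w. \<eta> w \<bullet> b) \<in> borel_measurable (Fil T)" using \<eta>F by (intro borel_measurable_inner) auto
    show "(\<lambda>w. \<eta> w \<bullet> b) \<in> L2 M"
      by (rule L2_bound[OF _ \<eta>L, where K = 1]) (use L2_measurable[OF \<eta>L] b in \<open>auto intro!: borel_measurable_inner AE_I2 Basis_le_norm\<close>)
    have "ip M \<eta> (\<lambda>w. b) = ip M \<xi> (\<lambda>w. b) - ip M (\<lambda>w. m) (\<lambda>w. b) - ip M (It Z T) (\<lambda>w. b)"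
      unfolding \<eta>_def[abs_def] by (simp add: ip_diff_left L2_diff \<xi> cL ItL Z)
    also have "\<dots> = 0" using ito_mean_0[OF It[OF Z], of T b] TT \<xi>i by (simp add: ip_def m_def prob_space)
    finally show "(\<integral>w. \<eta> w \<bullet> b \<partial>M) = 0" by (simp add: ip_def)
    fix n i and \<zeta> :: "'w \<Rightarrow> real" assume i: "i < (2::nat)^n" and \<zeta>: "bounded_Fil (grid T n i) \<zeta>"
    define \<xi>' where "\<xi>' j w = (if j = i then \<zeta> w *\<^sub>R b else 0)" for j w
    have "bounded_Fil (grid T n i) (\<lambda>w. \<zeta> w *\<^sub>R b)"
    proof -
      obtain K where K: "\<And>w. w \<in> space M \<Longrightarrow> norm (\<zeta> w) \<le> K" using bounded_Fil_bound[OF \<zeta>] by blast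
      then show ?thesis using \<zeta> b unfolding bounded_Fil_def bounded_iff by (auto intro!: borel_measurable_scaleR exI[of _ K])
    qed
    then have sp: "simple_process M W T (2^n) (grid T n) \<xi>'"
    proof (intro grid_simple_process)
      fix j show "bounded_Fil (grid T n j) (\<xi>' j)"
        using \<open>bounded_Fil (grid T n i) (\<lambda>w. \<zeta> w *\<^sub>R b)\<close> bounded_Fil_const[of _ "0::'a"]
        by (cases "j = i") (simp_all add: \<xi>'_def[abs_def])
    qed
    define \<phi> where "\<phi> = simple_value (2^n) (grid T n) \<xi>'"
    have \<phi>: "\<phi> \<in> L2P" unfolding \<phi>_def by (rule simple_value_L2P[OF sp])
    let ?S = "\<lambda>w. (W (grid T n (Suc i)) w - W (grid T n i) w) *\<^sub>R (\<zeta> w *\<^sub>R b)"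
    have S: "simple_ito W (2^n) (grid T n) \<xi>' T w = ?S w" for w
    proof -
      have "simple_ito W (2^n) (grid T n) \<xi>' T w = (\<Sum>j<2^n. if j = i then (W (min (grid T n (Suc i)) T) w - W (min (grid T n i) T) w) *\<^sub>R (\<zeta> w *\<^sub>R b) else 0)"
        unfolding simple_ito_def \<xi>'_def by (intro sum.cong) auto
      also have "\<dots> = (W (min (grid T n (Suc i)) T) w - W (min (grid T n i) T) w) *\<^sub>R (\<zeta> w *\<^sub>R b)" using i by (simp add: sum.delta)
      also have "\<dots> = ?S w" using grid_range[of T i n] grid_range[of T "Suc i" n] i TT by (simp add: min_absorb1)
      finally show ?thesis .
    qed
    have ItS: "AE w in M. It \<phi> T w = ?S w"
      using ito_of_simple[OF It[OF \<phi>] sp \<phi>_def TT(1)] unfolding S .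
    have SL: "?S \<in> L2 M" using simple_ito_L2[OF sp TT(2)] unfolding S .
    have "ip M \<eta> (It \<phi> T) = ip M \<xi> (It \<phi> T) - ip M (\<lambda>w. m) (It \<phi> T) - ip M (It Z T) (It \<phi> T)"
      unfolding \<eta>_def[abs_def] by (simp add: ip_diff_left L2_diff \<xi> cL ItL Z \<phi>)
    also have "\<dots> = 0"
      using Zl[OF \<phi>] ito_mean_0[OF It[OF \<phi>], of T m] TT ito_isometry[OF It[OF Z] It[OF \<phi>] TT(1)] cut_T[OF Z, of \<phi>]
      by (simp add: ip_commute[of M "\<lambda>w. m"])
    finally have "ip M \<eta> ?S = 0"
      using ip_cong_AE[of \<eta> \<eta> M "It \<phi> T" ?S] ItS L2_measurable \<eta>L ItL[OF \<phi>] SL by auto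
    then show "ip M (\<lambda>w. \<eta> w \<bullet> b) (\<lambda>w. (W (grid T n (Suc i)) w - W (grid T n i) w) * \<zeta> w) = 0"
      by (simp add: ip_def mult_ac)
  qed
  then have "AE w in M. \<forall>b\<in>Basis. \<eta> w \<bullet> b = 0" by (simp add: AE_ball_countable countable_finite)
  then have "AE w in M. \<eta> w = 0" by eventually_elim (rule euclidean_eqI, simp)
  then have "AE w in M. \<xi> w = (\<integral>w. \<xi> w \<partial>M) + It Z T w"
    by eventually_elim (simp add: \<eta>_def m_def algebra_simps)
  then show ?thesis using It[OF Z] by blast
qed

end

section \<open>Continuous processes and time integrals\<close>

lemma ennreal_add_norm_square: "sqn (x + y) \<le> ennreal (2 * (norm x)\<^sup>2) + ennreal (2 * (norm y)\<^sup>2)"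
  for x y :: "'a::real_normed_vector"
proof -
  have "(norm (x + y))\<^sup>2 \<le> (norm x + norm y)\<^sup>2" by (intro power_mono norm_triangle_ineq) simp
  also have "\<dots> \<le> 2 * (norm x)\<^sup>2 + 2 * (norm y)\<^sup>2"
    using zero_le_power2[of "norm x - norm y"] unfolding power2_sum power2_diff by linarith
  finally have "sqn (x + y) \<le> ennreal (2 * (norm x)\<^sup>2 + 2 * (norm y)\<^sup>2)" by (rule ennreal_leI)
  then show ?thesis by (simp add: ennreal_plus)
qed

lemma L2_integrable_finite:
  fixes f :: "'x \<Rightarrow> 'a::euclidean_space"
  assumes "finite_measure N" "f \<in> L2 N"
  shows "integrable N f" "norm (\<integral>x. f x \<partial>N) \<le> sqrt (measure N (space N)) * nrm N f"
proof -
  interpret finite_measure N by fact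
  have m: "(\<lambda>x. norm (f x)) \<in> borel_measurable N"
    by (rule measurable_compose[OF L2_measurable[OF assms(2)] borel_measurable_norm])
  have n: "(\<lambda>x. norm (f x)) \<in> L2 N" "(\<lambda>x. 1::real) \<in> L2 N" using assms m by (simp_all add: L2_def)
  have i: "integrable N (\<lambda>x. norm (f x))" using L2_inner_integrable[OF n] by simp
  then show "integrable N f" by (rule integrable_norm_cancel[OF _ L2_measurable[OF assms(2)]])
  have "norm (\<integral>x. f x \<partial>N) \<le> ip N (\<lambda>x. 1) (\<lambda>x. norm (f x))" using integral_norm_bound[of N f] by (simp add: ip_def)
  also have "\<dots> \<le> nrm N (\<lambda>x. 1::real) * nrm N (\<lambda>x. norm (f x))" using ip_Cauchy_Schwarz[OF n(2,1)] by linarith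
  also have "\<dots> = sqrt (measure N (space N)) * nrm N f"
    by (simp add: nrm_def ip_def dot_square_norm power2_eq_square)
  finally show "norm (\<integral>x. f x \<partial>N) \<le> sqrt (measure N (space N)) * nrm N f" .
qed

text \<open>Split the product of the two integrals along the diagonal of the square \<open>[0, T]\<^sup>2\<close>.\<close>

lemma integral_by_parts_TI:
  fixes f g :: "real \<Rightarrow> 'a::euclidean_space"
  assumes f: "integrable (lebesgue_on {0..T}) f" and g: "integrable (lebesgue_on {0..T}) g"
  defines "F \<equiv> \<lambda>s. \<integral>r. f r \<partial>lebesgue_on {0..s}" and "G \<equiv> \<lambda>s. \<integral>r. g r \<partial>lebesgue_on {0..s}"
  shows "(\<integral>s. f s \<partial>lebesgue_on {0..T}) \<bullet> (\<integral>s. g s \<partial>lebesgue_on {0..T})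
    = (\<integral>s. f s \<bullet> G s \<partial>lebesgue_on {0..T}) + (\<integral>s. F s \<bullet> g s \<partial>lebesgue_on {0..T})"
proof -
  let ?L = "lebesgue_on {0..T}"
  interpret L: finite_measure ?L by (rule finite_measure_lebesgue_on) simp
  interpret LL: pair_sigma_finite ?L ?L ..
  note [measurable] = borel_measurable_integrable[OF f] borel_measurable_integrable[OF g]
  have [measurable]: "(\<lambda>s. s) \<in> borel_measurable ?L" by (intro measurable_restrict_space1 measurable_completion) simp
  have int: "integrable (?L \<Otimes>\<^sub>M ?L) (\<lambda>(s, r). f s \<bullet> g r)"
  proof (rule LL.Fubini_integrable)
    show "(\<lambda>(s, r). f s \<bullet> g r) \<in> borel_measurable (?L \<Otimes>\<^sub>M ?L)" by measurable
    have gn: "integrable ?L (\<lambda>r. norm (f s \<bullet> g r))" for s using g by (intro integrable_norm integrable_inner_right)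
    show "integrable ?L (\<lambda>s. \<integral>r. norm (case (s, r) of (s, r) \<Rightarrow> f s \<bullet> g r) \<partial>?L)"
    proof (rule Bochner_Integration.integrable_bound)
      show "integrable ?L (\<lambda>s. norm (f s) * (\<integral>r. norm (g r) \<partial>?L))" using f by simp
      show "(\<lambda>s. \<integral>r. norm (case (s, r) of (s, r) \<Rightarrow> f s \<bullet> g r) \<partial>?L) \<in> borel_measurable ?L" by simp
      show "AE s in ?L. norm (\<integral>r. norm (case (s, r) of (s, r) \<Rightarrow> f s \<bullet> g r) \<partial>?L) \<le> norm (norm (f s) * (\<integral>r. norm (g r) \<partial>?L))"
      proof (rule AE_I2)
        fix s
        have "(\<integral>r. norm (f s \<bullet> g r) \<partial>?L) \<le> (\<integral>r. norm (f s) * norm (g r) \<partial>?L)"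
          using gn g by (intro integral_mono) (auto intro: Cauchy_Schwarz_ineq2)
        then show "norm (\<integral>r. norm (case (s, r) of (s, r) \<Rightarrow> f s \<bullet> g r) \<partial>?L) \<le> norm (norm (f s) * (\<integral>r. norm (g r) \<partial>?L))"
          by (simp add: abs_mult)
      qed
    qed
    show "AE s in ?L. integrable ?L (\<lambda>r. case (s, r) of (s, r) \<Rightarrow> f s \<bullet> g r)" using g by (intro AE_I2) simp
  qed
  have [measurable]: "Measurable.pred (?L \<Otimes>\<^sub>M ?L) (\<lambda>(s, r). r \<le> s)" by measurable
  have half: "integrable (?L \<Otimes>\<^sub>M ?L) (\<lambda>(s, r). (if r \<le> s then 1 else 0) * (f s \<bullet> g r))"
    "integrable (?L \<Otimes>\<^sub>M ?L) (\<lambda>(s, r). (if r \<le> s then 0 else 1) * (f s \<bullet> g r))"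
    by (rule Bochner_Integration.integrable_bound[OF int]; auto)+
  have "(\<integral>s. f s \<partial>?L) \<bullet> (\<integral>s. g s \<partial>?L) = (\<integral>s. (\<integral>r. f s \<bullet> g r \<partial>?L) \<partial>?L)"
    using f g by simp
  also have "\<dots> = (\<integral>p. (case p of (s, r) \<Rightarrow> f s \<bullet> g r) \<partial>(?L \<Otimes>\<^sub>M ?L))" by (rule LL.integral_fst[OF int])
  also have "\<dots> = (\<integral>p. (case p of (s, r) \<Rightarrow> (if r \<le> s then 1 else 0) * (f s \<bullet> g r)) +
      (case p of (s, r) \<Rightarrow> (if r \<le> s then 0 else 1) * (f s \<bullet> g r)) \<partial>(?L \<Otimes>\<^sub>M ?L))"
    by (intro LINT_cong) auto
  also have "\<dots> = (\<integral>p. (case p of (s, r) \<Rightarrow> (if r \<le> s then 1 else 0) * (f s \<bullet> g r)) \<partial>(?L \<Otimes>\<^sub>M ?L)) +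
      (\<integral>p. (case p of (s, r) \<Rightarrow> (if r \<le> s then 0 else 1) * (f s \<bullet> g r)) \<partial>(?L \<Otimes>\<^sub>M ?L))"
    by (rule Bochner_Integration.integral_add[OF half])
  also have "(\<integral>p. (case p of (s, r) \<Rightarrow> (if r \<le> s then 1 else 0) * (f s \<bullet> g r)) \<partial>(?L \<Otimes>\<^sub>M ?L)) = (\<integral>s. f s \<bullet> G s \<partial>?L)"
    unfolding LL.integral_fst[OF half(1), symmetric]
  proof (intro LINT_cong refl)
    fix s assume s: "s \<in> space ?L"
    have "(\<integral>r. (if r \<le> s then 1 else 0) * (f s \<bullet> g r) \<partial>?L) = (\<integral>r. f s \<bullet> (indicat_real {0..s} r *\<^sub>R g r) \<partial>?L)"
      by (intro LINT_cong) auto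
    also have "\<dots> = f s \<bullet> (\<integral>r. indicat_real {0..s} r *\<^sub>R g r \<partial>?L)"
      using s g by (intro integral_inner_right integrable_mult_indicator) (auto simp: sets_restrict_space_iff)
    also have "\<dots> = f s \<bullet> G s" using s integral_TI_atMost[of s T g] by (simp add: G_def)
    finally show "(\<integral>r. (if r \<le> s then 1 else 0) * (f s \<bullet> g r) \<partial>?L) = f s \<bullet> G s" .
  qed
  also have "(\<integral>p. (case p of (s, r) \<Rightarrow> (if r \<le> s then 0 else 1) * (f s \<bullet> g r)) \<partial>(?L \<Otimes>\<^sub>M ?L)) = (\<integral>s. F s \<bullet> g s \<partial>?L)"
    unfolding LL.integral_snd[OF half(2), symmetric]
  proof (intro LINT_cong refl)
    fix r assume r: "r \<in> space ?L"
    have "(\<integral>s. (if r \<le> s then 0 else 1) * (f s \<bullet> g r) \<partial>?L) = (\<integral>s. (indicat_real {0..r} s *\<^sub>R f s) \<bullet> g r \<partial>?L)"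
    proof (rule integral_cong_AE)
      have "AE s in ?L. s \<noteq> r" by (rule AE_I'[of "{r}"]) (use r in \<open>auto simp: null_sets_restrict_space\<close>)
      then show "AE s in ?L. (if r \<le> s then 0 else 1) * (f s \<bullet> g r) = (indicat_real {0..r} s *\<^sub>R f s) \<bullet> g r"
        using AE_space by eventually_elim (auto split: split_indicator)
    qed (use r in \<open>auto intro!: borel_measurable_inner borel_measurable_scaleR borel_measurable_indicator\<close>)
    also have "\<dots> = (\<integral>s. indicat_real {0..r} s *\<^sub>R f s \<partial>?L) \<bullet> g r"
      using r f by (intro integral_inner_left integrable_mult_indicator) (auto simp: sets_restrict_space_iff)
    also have "\<dots> = F r \<bullet> g r" using r integral_TI_atMost[of r T f] by (simp add: F_def)
    finally show "(\<integral>s. (if r \<le> s then 0 else 1) * (f s \<bullet> g r) \<partial>?L) = F r \<bullet> g r" .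
  qed
  finally show ?thesis .
qed

context bm_horizon
begin

abbreviation "XH \<equiv> Xhat M W T"

lemma XhatD:
  assumes "X \<in> XH"
  shows "t \<in> {0..T} \<Longrightarrow> X t \<in> borel_measurable (Fil t)"
    and "w \<in> space M \<Longrightarrow> continuous_on {0..T} (\<lambda>t. X t w)"
    and "(\<integral>\<^sup>+w. (SUP s\<in>{0..T}. sqn (X s w)) \<partial>M) < \<infinity>"
  using assms by (auto simp: Xhat_def)

lemma Xhat_L2:
  assumes X: "X \<in> XH"
  shows "t \<in> {0..T} \<Longrightarrow> X t \<in> L2 M"
    and "\<exists>C\<ge>0. \<forall>t\<in>{0..T}. ip M (X t) (X t) \<le> C"
proof -
  let ?S = "\<integral>\<^sup>+w. (SUP s\<in>{0..T}. sqn (X s w)) \<partial>M"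
  have le: "(\<integral>\<^sup>+w. sqn (X t w) \<partial>M) \<le> ?S" if "t \<in> {0..T}" for t
    by (intro nn_integral_mono SUP_upper that)
  show L: "X t \<in> L2 M" if "t \<in> {0..T}" for t
    using le_less_trans[OF le[OF that] XhatD(3)[OF X]] XhatD(1)[OF X that] Fil_measurable_M by (auto simp: L2_iff_nn_integral)
  obtain C where C: "?S = ennreal C" "0 \<le> C" using XhatD(3)[OF X] by (cases ?S) auto
  have "ip M (X t) (X t) \<le> C" if "t \<in> {0..T}" for t
    using le[OF that] nn_integral_norm2[OF L[OF that]] C by (simp add: ennreal_le_iff)
  then show "\<exists>C\<ge>0. \<forall>t\<in>{0..T}. ip M (X t) (X t) \<le> C" using C(2) by blast
qed

text \<open>Continuous paths give joint measurability: the process is the limit of its values at the dyadic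
  times to the left.\<close>

lemma Xhat_L2P:
  fixes X :: "('w, 'a::euclidean_space) process"
  assumes X: "X \<in> XH" shows "X \<in> L2P"
proof -
  define k where "k n s = nat \<lfloor>s * 2^n / T\<rfloor>" for n :: nat and s
  have idm[measurable]: "(\<lambda>s. s) \<in> borel_measurable TI" by (intro measurable_restrict_space1 measurable_completion) simp
  have "(\<lambda>p. X (fst p) (snd p)) \<in> borel_measurable LM"
  proof (rule borel_measurable_LIMSEQ_metric)
    fix n
    have "X (min T (grid T n i)) \<in> borel_measurable M" for i
      using XhatD(1)[OF X, of "min T (grid T n i)"] Fil_measurable_M T_pos grid_mono[of T 0 i n] by auto
    then have "(\<lambda>p. X (min T (grid T n i)) (snd p)) \<in> borel_measurable LM" for i by measurable
    moreover have "(\<lambda>p. k n (fst p)) \<in> measurable LM (count_space UNIV)" unfolding k_def by measurable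
    ultimately show "(\<lambda>p. X (min T (grid T n (k n (fst p)))) (snd p)) \<in> borel_measurable LM"
      by (rule measurable_compose_countable)
  next
    fix p assume "p \<in> space LM"
    then obtain s w where p: "p = (s, w)" "0 \<le> s" "s \<le> T" "w \<in> space M" by (cases p) (auto simp: space_LM)
    have b: "s - T / 2^n \<le> grid T n (k n s)" "grid T n (k n s) \<le> s" "0 \<le> grid T n (k n s)" for n
    proof -
      have "0 \<le> s * 2^n / T" using p T_pos by simp
      then have "real (k n s) \<le> s * 2^n / T" "s * 2^n / T \<le> real (k n s) + 1" unfolding k_def by linarith+
      then show "s - T / 2^n \<le> grid T n (k n s)" "grid T n (k n s) \<le> s" "0 \<le> grid T n (k n s)"
        using mult_left_mono[of "real (k n s)" "s * 2^n / T" "T / 2^n"] mult_left_mono[of "s * 2^n / T" "real (k n s) + 1" "T / 2^n"] T_pos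
        by (simp_all add: grid_def distrib_left)
    qed
    have "(\<lambda>n. grid T n (k n s)) \<longlonglongrightarrow> s"
    proof (rule tendsto_sandwich[OF _ _ _ tendsto_const])
      have "(\<lambda>n. T * (1/2)^n) \<longlonglongrightarrow> 0" using tendsto_mult_right_zero[OF LIMSEQ_power_zero[of "1/2::real"]] by simp
      from tendsto_diff[OF tendsto_const[of s] this] show "(\<lambda>n. s - T / 2^n) \<longlonglongrightarrow> s" by (simp add: power_divide)
    qed (use b in auto)
    moreover have "min T (grid T n (k n s)) = grid T n (k n s)" for n using b(2)[of n] p(3) by simp
    ultimately show "(\<lambda>n. X (min T (grid T n (k n (fst p)))) (snd p)) \<longlonglongrightarrow> X (fst p) (snd p)"
      using XhatD(2)[OF X p(4)] b p unfolding continuous_on_sequentially by (auto simp: o_def order_trans[OF b(2)])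
  qed
  moreover have "(\<integral>\<^sup>+w. (\<integral>\<^sup>+s. sqn (X s w) \<partial>TI) \<partial>M) < \<infinity>"
  proof -
    have "(\<integral>\<^sup>+w. (\<integral>\<^sup>+s. sqn (X s w) \<partial>TI) \<partial>M)
        = (\<integral>\<^sup>+s. (\<integral>\<^sup>+w. sqn (X s w) \<partial>M) \<partial>TI)"
      using calculation by (intro LM.Fubini') (simp add: case_prod_beta')
    also have "\<dots> \<le> (\<integral>\<^sup>+s. (\<integral>\<^sup>+w. (SUP s\<in>{0..T}. sqn (X s w)) \<partial>M) \<partial>TI)"
      by (intro nn_integral_mono SUP_upper) auto
    also have "\<dots> < \<infinity>" using XhatD(3)[OF X] by (simp add: ennreal_mult_less_top TI.emeasure_eq_measure)
    finally show ?thesis .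
  qed
  ultimately show ?thesis using XhatD(1)[OF X] unfolding L2F_def by (simp add: case_prod_beta')
qed

lemma Xhat_I:
  assumes "\<And>t. t \<in> {0..T} \<Longrightarrow> X t \<in> borel_measurable (Fil t)"
    and "\<And>w. w \<in> space M \<Longrightarrow> continuous_on {0..T} (\<lambda>t. X t w)"
    and "AE w in M. \<forall>t\<in>{0..T}. sqn (X t w) \<le> G w" "(\<integral>\<^sup>+w. G w \<partial>M) < \<infinity>"
  shows "X \<in> XH"
proof -
  have "(\<integral>\<^sup>+w. (SUP s\<in>{0..T}. sqn (X s w)) \<partial>M) \<le> (\<integral>\<^sup>+w. G w \<partial>M)"
    using assms(3) by (intro nn_integral_mono_AE) (auto elim!: eventually_mono intro: SUP_least)
  then show ?thesis unfolding Xhat_def using assms le_less_trans by blast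
qed

lemma Xhat_bound:
  assumes X: "X \<in> XH"
  shows "\<exists>G\<in>borel_measurable M. (AE w in M. \<forall>t\<in>{0..T}. sqn (X t w) \<le> G w) \<and> (\<integral>\<^sup>+w. G w \<partial>M) < \<infinity>"
proof -
  define G where "G w = (SUP s\<in>dyad T. sqn (X s w))" for w
  have dT: "dyad T \<subseteq> {0..T}" using T_pos by (intro dyad_range) auto
  have "X s \<in> borel_measurable M" if "s \<in> dyad T" for s using XhatD(1)[OF X, of s] Fil_measurable_M that dT by blast
  then have m: "G \<in> borel_measurable M" unfolding G_def
    by (intro borel_measurable_SUP dyad_countable measurable_compose[of "X _" M borel, OF _ measurable_compose[OF borel_measurable_norm]]) auto
  have "(\<integral>\<^sup>+w. G w \<partial>M) \<le> (\<integral>\<^sup>+w. (SUP s\<in>{0..T}. sqn (X s w)) \<partial>M)"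
    unfolding G_def by (intro nn_integral_mono SUP_subset_mono dT) auto
  then have fin: "(\<integral>\<^sup>+w. G w \<partial>M) < \<infinity>" using XhatD(3)[OF X] le_less_trans by blast
  have "sqn (X t w) \<le> G w" if "w \<in> space M" "t \<in> {0..T}" for w t
    by (rule dyad_norm_bound[OF XhatD(2)[OF X that(1)] _ that(2)]) (unfold G_def, rule SUP_upper)
  then have "AE w in M. \<forall>t\<in>{0..T}. sqn (X t w) \<le> G w" by (intro AE_I2) blast
  then show ?thesis using m fin by blast
qed

lemma Xhat_add:
  fixes X Y :: "('w, 'a::euclidean_space) process"
  assumes X: "X \<in> XH" and Y: "Y \<in> XH" shows "(\<lambda>t w. X t w + r *\<^sub>R Y t w) \<in> XH"
proof -
  obtain G where G: "G \<in> borel_measurable M" "AE w in M. \<forall>t\<in>{0..T}. sqn (X t w) \<le> G w" "(\<integral>\<^sup>+w. G w \<partial>M) < \<infinity>"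
    using Xhat_bound[OF X] by blast
  obtain H where H: "H \<in> borel_measurable M" "AE w in M. \<forall>t\<in>{0..T}. sqn (Y t w) \<le> H w" "(\<integral>\<^sup>+w. H w \<partial>M) < \<infinity>"
    using Xhat_bound[OF Y] by blast
  show ?thesis
  proof (rule Xhat_I)
    show "(\<lambda>w. X t w + r *\<^sub>R Y t w) \<in> borel_measurable (Fil t)" if "t \<in> {0..T}" for t
      using XhatD(1)[OF X that] XhatD(1)[OF Y that] by (intro borel_measurable_add borel_measurable_scaleR) auto
    show "continuous_on {0..T} (\<lambda>t. X t w + r *\<^sub>R Y t w)" if "w \<in> space M" for w
      using XhatD(2)[OF X that] XhatD(2)[OF Y that] by (intro continuous_intros)
    show "AE w in M. \<forall>t\<in>{0..T}. sqn (X t w + r *\<^sub>R Y t w) \<le> ennreal 2 * G w + ennreal (2 * r\<^sup>2) * H w"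
      using G(2) H(2)
    proof eventually_elim
      case (elim w)
      show ?case
      proof
        fix t assume t: "t \<in> {0..T}"
        have "sqn (X t w + r *\<^sub>R Y t w) \<le> ennreal (2 * (norm (X t w))\<^sup>2) + ennreal (2 * (norm (r *\<^sub>R Y t w))\<^sup>2)"
          by (rule ennreal_add_norm_square)
        also have "\<dots> = ennreal 2 * sqn (X t w) + ennreal (2 * r\<^sup>2) * sqn (Y t w)"
          by (subst (1 2) ennreal_mult[symmetric]) (simp_all add: power_mult_distrib mult.assoc)
        also have "\<dots> \<le> ennreal 2 * G w + ennreal (2 * r\<^sup>2) * H w" using elim t by (intro add_mono mult_left_mono) auto
        finally show "sqn (X t w + r *\<^sub>R Y t w) \<le> ennreal 2 * G w + ennreal (2 * r\<^sup>2) * H w" .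
      qed
    qed
    show "(\<integral>\<^sup>+w. ennreal 2 * G w + ennreal (2 * r\<^sup>2) * H w \<partial>M) < \<infinity>"
      using G H by (simp add: nn_integral_add nn_integral_cmult ennreal_mult_less_top)
  qed
qed

lemma ito_Xhat:
  assumes I: "is_ito \<phi> I" shows "I \<in> XH"
proof -
  obtain G where G: "AE w in M. \<forall>t\<in>{0..T}. sqn (I t w) \<le> G w" "(\<integral>\<^sup>+w. G w \<partial>M) \<le> ennreal (4 * ip M (I T) (I T))"
    using Doob_maximal[OF ito_L2mart[OF I] ito_continuous[OF I]] by blast
  show ?thesis
    by (rule Xhat_I[OF _ _ G(1)]) (use I G(2) in \<open>auto simp: is_ito_integral_def intro: le_less_trans\<close>)
qed

lemma L2P_L2_LM: "\<phi> \<in> L2P \<Longrightarrow> case_prod \<phi> \<in> L2 LM"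
  unfolding L2P_iff by (auto simp: L2_def measurable_PM measurable_ADP_iff intro: integrable_PM)

text \<open>On the null set of paths that are not integrable this has the default value of the Bochner
  integral; hence pathwise identities hold for almost every path only.\<close>

definition Tint :: "('w, 'a::euclidean_space) process \<Rightarrow> ('w, 'a) process" where
  "Tint a t w = (\<integral>s. a s w \<partial>lebesgue_on {0..t})"

lemma path_integrable:
  assumes a: "a \<in> L2P" shows "AE w in M. integrable TI (\<lambda>s. a s w)"
  using L2P_AE_path[OF a] by eventually_elim (rule L2_integrable_finite(1)[OF TI.finite_measure_axioms])

lemma Tint_cut: "t \<in> {0..T} \<Longrightarrow> Tint a t w = (\<integral>s. cut t a s w \<partial>TI)"
  unfolding Tint_def cut_def by (rule integral_TI_atMost) auto

lemma Tint_pathwise_bound: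
  assumes a: "a \<in> L2P" and t: "t \<in> {0..T}"
  shows "AE w in M. sqn (Tint a t w) \<le> ennreal T * (\<integral>\<^sup>+s. sqn (cut t a s w) \<partial>TI)"
  using L2P_AE_path[OF cut_L2P[OF a, of t]]
proof eventually_elim
  case (elim w)
  have "measure TI (space TI) = T" using T_pos by (simp add: measure_restrict_space)
  then have "norm (Tint a t w) \<le> sqrt T * nrm TI (\<lambda>s. cut t a s w)"
    using L2_integrable_finite(2)[OF TI.finite_measure_axioms elim] by (simp add: Tint_cut[OF t])
  then have "(norm (Tint a t w))\<^sup>2 \<le> (sqrt T * nrm TI (\<lambda>s. cut t a s w))\<^sup>2" by (intro power_mono) auto
  also have "\<dots> = T * ip TI (\<lambda>s. cut t a s w) (\<lambda>s. cut t a s w)" using T_pos by (simp add: power_mult_distrib nrm_power2)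
  finally show ?case unfolding nn_integral_norm2[OF elim] using T_pos by (simp add: ennreal_mult[symmetric] ennreal_leI)
qed

lemma Tint_measurable_M:
  assumes a: "a \<in> L2P" and t: "t \<in> {0..T}" shows "Tint a t \<in> borel_measurable M"
proof -
  have "(\<lambda>(s, w). cut t a s w) \<in> borel_measurable LM" using L2P_measurable[OF cut_L2P[OF a, of t]] by (simp add: case_prod_beta')
  then have "(\<lambda>(w, s). cut t a s w) \<in> borel_measurable (M \<Otimes>\<^sub>M TI)"
    using measurable_pair_swap[of "\<lambda>(s, w). cut t a s w"] by (simp add: case_prod_beta')
  then have "(\<lambda>w. \<integral>s. cut t a s w \<partial>TI) \<in> borel_measurable M" by (rule TI.borel_measurable_lebesgue_integral)
  moreover have "Tint a t = (\<lambda>w. \<integral>s. cut t a s w \<partial>TI)" by (rule ext, rule Tint_cut[OF t])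
  ultimately show ?thesis by simp
qed

lemma Tint_L2:
  assumes a: "a \<in> L2P" and t: "t \<in> {0..T}"
  shows "Tint a t \<in> L2 M" "nrm M (Tint a t) \<le> sqrt T * NR (cut t a)"
proof -
  have cm: "(\<lambda>w. \<integral>\<^sup>+s. sqn (cut t a s w) \<partial>TI) \<in> borel_measurable M"
  proof -
    have [measurable]: "case_prod (cut t a) \<in> borel_measurable LM" using L2P_measurable[OF cut_L2P[OF a]] .
    have "(\<lambda>w. \<integral>\<^sup>+s. sqn (case_prod (cut t a) (s, w)) \<partial>TI) \<in> borel_measurable M" by measurable
    then show ?thesis by simp
  qed
  have "(\<integral>\<^sup>+w. sqn (Tint a t w) \<partial>M) \<le> (\<integral>\<^sup>+w. ennreal T * (\<integral>\<^sup>+s. sqn (cut t a s w) \<partial>TI) \<partial>M)"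
    by (rule nn_integral_mono_AE[OF Tint_pathwise_bound[OF a t]])
  also have "\<dots> = ennreal T * ennreal ((NR (cut t a))\<^sup>2)"
    using cm by (simp add: nn_integral_cmult nn_integral_L2P(1)[OF cut_L2P[OF a]])
  also have "\<dots> = ennreal (T * (NR (cut t a))\<^sup>2)" using T_pos by (simp add: ennreal_mult)
  finally have le: "(\<integral>\<^sup>+w. sqn (Tint a t w) \<partial>M) \<le> ennreal (T * (NR (cut t a))\<^sup>2)" .
  then show L: "Tint a t \<in> L2 M"
    unfolding L2_iff_nn_integral using Tint_measurable_M[OF a t] by (auto intro: le_less_trans)
  have "(nrm M (Tint a t))\<^sup>2 \<le> T * (NR (cut t a))\<^sup>2"
    using le T_pos unfolding nn_integral_norm2[OF L] nrm_power2 by (subst (asm) ennreal_le_iff) auto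
  also have "\<dots> = (sqrt T * NR (cut t a))\<^sup>2" using T_pos by (simp add: power_mult_distrib)
  finally show "nrm M (Tint a t) \<le> sqrt T * NR (cut t a)" by (rule power2_le_imp_le) (use T_pos in auto)
qed

lemma Tint_linear:
  assumes a: "a \<in> L2P" and b: "b \<in> L2P"
  shows "AE w in M. \<forall>t\<in>{0..T}. Tint (\<lambda>s w. a s w + r *\<^sub>R b s w) t w = Tint a t w + r *\<^sub>R Tint b t w"
  using path_integrable[OF a] path_integrable[OF b]
proof eventually_elim
  case (elim w)
  show ?case
  proof
    fix t assume "t \<in> {0..T}"
    then have "integrable (lebesgue_on {0..t}) (\<lambda>s. a s w)" "integrable (lebesgue_on {0..t}) (\<lambda>s. b s w)"
      using \<open>t \<in> {0..T}\<close> Equivalence_Lebesgue_Henstock_Integration.integrable_subinterval[OF elim(1)]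
        Equivalence_Lebesgue_Henstock_Integration.integrable_subinterval[OF elim(2)] by auto
    then show "Tint (\<lambda>s w. a s w + r *\<^sub>R b s w) t w = Tint a t w + r *\<^sub>R Tint b t w" by (simp add: Tint_def)
  qed
qed

lemma Tint_cong:
  assumes a: "a \<in> L2P" and b: "b \<in> L2P" and 0: "DR a b = 0"
  shows "AE w in M. \<forall>t\<in>{0..T}. Tint a t w = Tint b t w"
  using NR_eq_0(2)[OF L2P_diff[OF a b] 0] AE_space
proof eventually_elim
  case (elim w)
  show ?case
  proof
    fix t assume t: "t \<in> {0..T}"
    show "Tint a t w = Tint b t w" unfolding Tint_cut[OF t]
    proof (rule integral_cong_AE)
      show "AE s in TI. cut t a s w = cut t b s w" using elim(1) by eventually_elim (simp add: cut_def)
    qed (use L2P_measurable_path[OF cut_L2P[OF a] elim(2)] L2P_measurable_path[OF cut_L2P[OF b] elim(2)] in auto)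
  qed
qed

text \<open>The integrand is only adapted and jointly measurable, so this needs approximation by simple
  processes, for which the time integral is a finite sum of past values.\<close>

lemma Tint_Fil:
  fixes a :: "('w, 'a::euclidean_space) process"
  assumes a: "a \<in> L2P" and t: "t \<in> {0..T}" shows "Tint a t \<in> borel_measurable (Fil t)"
proof -
  obtain F where F: "\<And>n. F n \<in> dyadic_simple" and Flim: "(\<lambda>n. DR (F n) a) \<longlonglongrightarrow> 0"
    using dyadic_simple_dense[OF a] by blast
  note FL = dyadic_simple_L2P[OF F]
  have simple: "Tint (F m) t \<in> borel_measurable (Fil t)" for m
  proof -
    obtain n \<xi> where Fm: "F m = simple_value (2^n) (grid T n) \<xi>" and b: "\<forall>i<2^n. bounded_Fil (grid T n i) (\<xi> i)"
      using F[of m] unfolding dyadic_simple_def by blast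
    have "Tint (F m) t = (\<lambda>w. \<Sum>i<2^n. (\<integral>s. indicator {0..t} s * indicat_real {grid T n i<..grid T n (Suc i)} s \<partial>TI) *\<^sub>R \<xi> i w)"
    proof
      fix w
      have i1: "integrable TI (\<lambda>s. indicat_real {0..t} s * indicat_real {c<..d} s)" for c d
      proof (rule TI.integrable_const_bound[where B = 1])
        show "(\<lambda>s. indicat_real {0..t} s * indicat_real {c<..d} s) \<in> borel_measurable TI"
          by (intro measurable_restrict_space1 borel_measurable_times borel_measurable_indicator) auto
      qed (auto split: split_indicator)
      have "Tint (F m) t w = (\<integral>s. (\<Sum>i<2^n. (indicator {0..t} s * indicat_real {grid T n i<..grid T n (Suc i)} s) *\<^sub>R \<xi> i w) \<partial>TI)"
        unfolding Tint_cut[OF t] cut_def Fm simple_value_def by (simp only: scaleR_sum_right scaleR_scaleR)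
      also have "\<dots> = (\<Sum>i<2^n. (\<integral>s. (indicator {0..t} s * indicat_real {grid T n i<..grid T n (Suc i)} s) *\<^sub>R \<xi> i w \<partial>TI))"
        by (rule Bochner_Integration.integral_sum) (rule integrable_scaleR_left[OF i1])
      finally show "Tint (F m) t w = (\<Sum>i<2^n. (\<integral>s. indicator {0..t} s * indicat_real {grid T n i<..grid T n (Suc i)} s \<partial>TI) *\<^sub>R \<xi> i w)"
        by (simp only: integral_scaleR_left[OF i1])
    qed
    also have "\<dots> \<in> borel_measurable (Fil t)"
    proof (rule borel_measurable_sum)
      fix i :: nat assume i: "i \<in> {..<2^n}"
      show "(\<lambda>w. (\<integral>s. indicator {0..t} s * indicat_real {grid T n i<..grid T n (Suc i)} s \<partial>TI) *\<^sub>R \<xi> i w) \<in> borel_measurable (Fil t)"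
      proof (cases "grid T n i \<le> t")
        case True
        then have "\<xi> i \<in> borel_measurable (Fil t)" using b i bounded_Fil_measurable by blast
        then show ?thesis by (intro borel_measurable_scaleR) auto
      next
        case False
        then have "(\<lambda>s. indicat_real {0..t} s * indicat_real {grid T n i<..grid T n (Suc i)} s) = (\<lambda>s. 0)"
          by (auto simp: fun_eq_iff split: split_indicator)
        then show ?thesis by (simp only: Bochner_Integration.integral_zero) simp
      qed
    qed
    finally show ?thesis .
  qed
  have "(\<lambda>n. dst M (Tint (F n) t) (Tint a t)) \<longlonglongrightarrow> 0"
  proof (rule tendsto_sandwich[OF _ _ tendsto_const])
    show "(\<lambda>n. sqrt T * DR (F n) a) \<longlonglongrightarrow> 0" using tendsto_mult_right_zero[OF Flim] .
    have "dst M (Tint (F n) t) (Tint a t) \<le> sqrt T * DR (F n) a" for n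
    proof -
      have d: "(\<lambda>s w. F n s w - a s w) \<in> L2P" by (intro L2P_diff FL a)
      have "AE w in M. Tint (F n) t w - Tint a t w = Tint (\<lambda>s w. F n s w - a s w) t w"
        using Tint_linear[OF FL a, of n "-1"] by eventually_elim (use t in auto)
      then have "dst M (Tint (F n) t) (Tint a t) = nrm M (Tint (\<lambda>s w. F n s w - a s w) t)"
        unfolding nrm_def by (intro arg_cong[where f = sqrt] ip_cong_AE L2_measurable L2_diff Tint_L2 FL a t d)
      also have "\<dots> \<le> sqrt T * NR (cut t (\<lambda>s w. F n s w - a s w))" by (rule Tint_L2(2)[OF d t])
      also have "\<dots> \<le> sqrt T * DR (F n) a" using T_pos by (intro mult_left_mono NR_cut_le d) auto
      finally show ?thesis .
    qed
    then show "\<forall>\<^sub>F n in sequentially. dst M (Tint (F n) t) (Tint a t) \<le> sqrt T * DR (F n) a"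
      by (intro always_eventually allI)
  qed auto
  from L2_limit_AE_subsequence[OF Tint_L2(1)[OF FL t] Tint_L2(1)[OF a t] this]
  obtain r where r: "AE w in M. (\<lambda>k. Tint (F (r k)) t w) \<longlonglongrightarrow> Tint a t w" by blast
  show ?thesis
  proof (rule Fil_cong_AE)
    show "(\<lambda>w. lim (\<lambda>k. Tint (F (r k)) t w)) \<in> borel_measurable (Fil t)" by (intro borel_measurable_lim_metric simple)
    show "AE w in M. lim (\<lambda>k. Tint (F (r k)) t w) = Tint a t w" using r by eventually_elim (rule limI)
  qed simp
qed

text \<open>Paths that are not integrable are replaced by \<open>0\<close>, which makes all paths continuous.\<close>

lemma Tint_version:
  fixes a :: "('w, 'a::euclidean_space) process"
  assumes a: "a \<in> L2P"
  shows "\<exists>A\<in>XH. (AE w in M. \<forall>t\<in>{0..T}. A t w = Tint a t w)"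
proof -
  define A where "A t w = (if integrable TI (\<lambda>s. a s w) then Tint a t w else 0)" for t w
  have AE: "AE w in M. \<forall>t\<in>{0..T}. A t w = Tint a t w"
    using path_integrable[OF a] by eventually_elim (simp add: A_def)
  have "A \<in> XH"
  proof (rule Xhat_I)
    show "A t \<in> borel_measurable (Fil t)" if "t \<in> {0..T}" for t
    proof (rule Fil_cong_AE[OF Tint_Fil[OF a that]])
      show "AE w in M. Tint a t w = A t w" using AE by eventually_elim (use that in auto)
    qed simp
    show "continuous_on {0..T} (\<lambda>t. A t w)" for w
      unfolding A_def Tint_def by (cases "integrable TI (\<lambda>s. a s w)") (simp_all add: indefinite_integral_continuous_real)
    show "(\<integral>\<^sup>+w. ennreal T * (\<integral>\<^sup>+s. sqn (a s w) \<partial>TI) \<partial>M) < \<infinity>"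
    proof -
      have [measurable]: "case_prod a \<in> borel_measurable LM" using L2P_measurable[OF a] .
      have "(\<lambda>w. \<integral>\<^sup>+s. sqn (case_prod a (s, w)) \<partial>TI) \<in> borel_measurable M" by measurable
      then show ?thesis by (simp add: nn_integral_cmult nn_integral_L2P(1)[OF a] ennreal_mult_less_top)
    qed
    show "AE w in M. \<forall>t\<in>{0..T}. sqn (A t w) \<le> ennreal T * (\<integral>\<^sup>+s. sqn (a s w) \<partial>TI)"
    proof -
      have "AE w in M. \<forall>t\<in>dyad T. sqn (A t w) \<le> ennreal T * (\<integral>\<^sup>+s. sqn (a s w) \<partial>TI)"
        unfolding AE_ball_countable[OF dyad_countable]
      proof
        fix t assume "t \<in> dyad T"
        then have t: "t \<in> {0..T}" using dyad_range[of T] T_pos by auto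
        show "AE w in M. sqn (A t w) \<le> ennreal T * (\<integral>\<^sup>+s. sqn (a s w) \<partial>TI)"
          using Tint_pathwise_bound[OF a t] AE
        proof eventually_elim
          case (elim w)
          have "(\<integral>\<^sup>+s. sqn (cut t a s w) \<partial>TI) \<le> (\<integral>\<^sup>+s. sqn (a s w) \<partial>TI)"
            by (intro nn_integral_mono) (auto simp: cut_def split: split_indicator)
          from mult_left_mono[OF this, of "ennreal T"] show ?case using elim t order_trans by fastforce
        qed
      qed
      then show ?thesis
      proof eventually_elim
        case (elim w)
        have c: "continuous_on {0..T} (\<lambda>t. A t w)"
          unfolding A_def Tint_def by (cases "integrable TI (\<lambda>s. a s w)") (simp_all add: indefinite_integral_continuous_real)
        from dyad_norm_bound[OF c bspec[OF elim]] show ?case by blast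
      qed
    qed
  qed
  with AE show ?thesis by blast
qed

section \<open>Ito processes and the expected product rule\<close>

text \<open>\<open>X\<close> has drift \<open>a\<close> and diffusion \<open>b\<close>, with an arbitrary initial value.\<close>

definition itoproc :: "('w, 'a::euclidean_space) process \<Rightarrow> ('w, 'a) process \<Rightarrow> ('w, 'a) process \<Rightarrow> bool" where
  "itoproc a b X \<longleftrightarrow> X \<in> XH \<and> a \<in> L2P \<and>
    (\<exists>I. is_ito b I \<and> (AE w in M. \<forall>t\<in>{0..T}. X t w = X 0 w + Tint a t w + I t w))"

lemma itoprocD: "itoproc a b X \<Longrightarrow> X \<in> XH" "itoproc a b X \<Longrightarrow> a \<in> L2P" "itoproc a b X \<Longrightarrow> b \<in> L2P"
  by (auto simp: itoproc_def is_ito_integral_def)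

lemma Xhat_const: "(\<lambda>t w. y) \<in> XH"
  by (rule Xhat_I[where G = "\<lambda>w. sqn y"]) (auto simp: emeasure_space_1)

lemma Tint_0: "Tint a 0 w = 0"
proof -
  have "AE s in lebesgue_on {0..0::real}. a s w = 0"
    by (rule AE_I'[of "{0}"]) (auto simp: null_sets_restrict_space)
  then show ?thesis unfolding Tint_def by (rule integral_eq_zero_AE)
qed

lemma itoproc_exists:
  fixes a b :: "('w, 'a::euclidean_space) process"
  assumes a: "a \<in> L2P" and b: "b \<in> L2P"
  shows "\<exists>X. itoproc a b X \<and> (AE w in M. X 0 w = y)"
proof -
  obtain A where A: "A \<in> XH" "AE w in M. \<forall>t\<in>{0..T}. A t w = Tint a t w" using Tint_version[OF a] by blast
  obtain I where I: "is_ito b I" using ito_integral_exists[OF b] by blast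
  define X where "X t w = (y + 1 *\<^sub>R A t w) + 1 *\<^sub>R I t w" for t w
  have X: "X \<in> XH" unfolding X_def[abs_def] by (intro Xhat_add Xhat_const A ito_Xhat[OF I])
  have X0: "AE w in M. X 0 w = y"
    using A(2) ito_at_0[OF I]
  proof eventually_elim
    case (elim w)
    then have "A 0 w = 0" using bspec[OF elim(1), of 0] T_pos by (simp add: Tint_0)
    then show ?case using elim(2) by (simp add: X_def)
  qed
  moreover have "AE w in M. \<forall>t\<in>{0..T}. X t w = X 0 w + Tint a t w + I t w"
    using A(2) X0
  proof eventually_elim
    case (elim w)
    show ?case unfolding elim(2) using elim(1) by (simp add: X_def)
  qed
  ultimately show ?thesis using X a I unfolding itoproc_def by blast
qed

lemma itoproc_linear:
  assumes X: "itoproc a b X" and Y: "itoproc a' b' Y"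
  shows "itoproc (\<lambda>s w. a s w + r *\<^sub>R a' s w) (\<lambda>s w. b s w + r *\<^sub>R b' s w) (\<lambda>s w. X s w + r *\<^sub>R Y s w)"
proof -
  obtain I where I: "is_ito b I" "AE w in M. \<forall>t\<in>{0..T}. X t w = X 0 w + Tint a t w + I t w"
    using X by (auto simp: itoproc_def)
  obtain J where J: "is_ito b' J" "AE w in M. \<forall>t\<in>{0..T}. Y t w = Y 0 w + Tint a' t w + J t w"
    using Y by (auto simp: itoproc_def)
  have bL: "(\<lambda>s w. b s w + r *\<^sub>R b' s w) \<in> L2P" by (intro L2P_add L2P_scaleR itoprocD(3)[OF X] itoprocD(3)[OF Y])
  then obtain K where K: "is_ito (\<lambda>s w. b s w + r *\<^sub>R b' s w) K" using ito_integral_exists by blast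
  have z: "NR (\<lambda>s w. (b s w + r *\<^sub>R b' s w) - (b s w + r *\<^sub>R b' s w)) = 0" by (intro NR_eq_0_I) auto
  have "AE w in M. \<forall>t\<in>{0..T}. X t w + r *\<^sub>R Y t w = (X 0 w + r *\<^sub>R Y 0 w) + Tint (\<lambda>s w. a s w + r *\<^sub>R a' s w) t w + K t w"
    using I(2) J(2) ito_linear[OF I(1) J(1) K z] Tint_linear[OF itoprocD(2)[OF X] itoprocD(2)[OF Y], of r]
  proof eventually_elim
    case (elim w)
    show ?case
    proof
      fix t assume t: "t \<in> {0..T}"
      show "X t w + r *\<^sub>R Y t w = (X 0 w + r *\<^sub>R Y 0 w) + Tint (\<lambda>s w. a s w + r *\<^sub>R a' s w) t w + K t w"
        using bspec[OF elim(1) t] bspec[OF elim(2) t] bspec[OF elim(3) t] bspec[OF elim(4) t] by (simp add: algebra_simps)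
    qed
  qed
  then show ?thesis unfolding itoproc_def
    using Xhat_add[OF itoprocD(1)[OF X] itoprocD(1)[OF Y], of r] L2P_add[OF itoprocD(2)[OF X] L2P_scaleR[OF itoprocD(2)[OF Y], of r]] K by blast
qed

lemma itoproc_cong:
  assumes X: "itoproc a b X" and a': "a' \<in> L2P" "DR a a' = 0" and b': "b' \<in> L2P" "DR b b' = 0"
  shows "itoproc a' b' X"
proof -
  obtain I where I: "is_ito b I" "AE w in M. \<forall>t\<in>{0..T}. X t w = X 0 w + Tint a t w + I t w"
    using X by (auto simp: itoproc_def)
  obtain K where K: "is_ito b' K" using ito_integral_exists[OF b'(1)] by blast
  have z: "NR (\<lambda>s w. b' s w - (b s w + 0 *\<^sub>R b s w)) = 0" using b'(2) by (simp add: NR_minus[of b'])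
  have "AE w in M. \<forall>t\<in>{0..T}. X t w = X 0 w + Tint a' t w + K t w"
    using I(2) ito_linear[OF I(1) I(1) K z] Tint_cong[OF itoprocD(2)[OF X] a']
  proof eventually_elim
    case (elim w)
    show ?case
    proof
      fix t assume t: "t \<in> {0..T}"
      show "X t w = X 0 w + Tint a' t w + K t w"
        using bspec[OF elim(1) t] bspec[OF elim(2) t] bspec[OF elim(3) t] by simp
    qed
  qed
  then show ?thesis using X a' K by (auto simp: itoproc_def)
qed

text \<open>Cutting the coefficients at \<open>t\<close> keeps the estimate causal, which is what the contraction argument
  for linear equations exploits.\<close>

lemma itoproc_estimate:
  assumes X: "itoproc a b X" and X0: "AE w in M. X 0 w = 0" and t: "t \<in> {0..T}"
  shows "nrm M (X t) \<le> sqrt T * NR (cut t a) + NR (cut t b)"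
proof -
  obtain I where I: "is_ito b I" "AE w in M. \<forall>t\<in>{0..T}. X t w = X 0 w + Tint a t w + I t w"
    using X by (auto simp: itoproc_def)
  note L = Xhat_L2(1)[OF itoprocD(1)[OF X] t] Tint_L2[OF itoprocD(2)[OF X] t] L2martD(2)[OF ito_L2mart[OF I(1)], of t]
  have b: "b \<in> L2P" by (rule itoprocD(3)[OF X])
  have IL: "I t \<in> L2 M" using L(4) t by auto
  have "AE w in M. X t w = Tint a t w + I t w" using X0 I(2) by eventually_elim (use t in auto)
  then have "nrm M (X t) = nrm M (\<lambda>w. Tint a t w + I t w)"
    unfolding nrm_def by (intro arg_cong[where f = sqrt] ip_cong_AE L2_measurable L2_add L IL)
  also have "\<dots> \<le> nrm M (Tint a t) + nrm M (I t)" by (intro nrm_triangle L IL)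
  also have "nrm M (I t) = NR (cut t b)"
    unfolding nrm_def NR_def_IP ito_isometry[OF I(1) I(1) t] IP_cut_cut[OF b b] ..
  finally show ?thesis using L(3) by linarith
qed

text \<open>Inside the time integral the martingale may be evaluated at the current time, because the integrand
  is adapted.\<close>

lemma mart_time_integral:
  assumes N: "L2mart N" and NX: "N \<in> L2P" and a: "a \<in> L2P"
  shows "ip M (N T) (Tint a T) = IP N a"
proof -
  have TT: "T \<in> {0..T}" "0 \<le> T" using T_pos by auto
  have NT: "N T \<in> L2 M" using L2martD(2)[OF N] TT by auto
  have "(\<lambda>(s, w). N T w) \<in> L2 LM"
  proof -
    have "(\<lambda>p. N T (snd p)) \<in> borel_measurable LM" using L2_measurable[OF NT] by measurable
    moreover have "(\<integral>\<^sup>+p. sqn (N T (snd p)) \<partial>LM) < \<infinity>"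
    proof -
      have "(\<integral>\<^sup>+p. sqn (N T (snd p)) \<partial>LM) = (\<integral>\<^sup>+s. (\<integral>\<^sup>+w. sqn (N T w) \<partial>M) \<partial>TI)"
        using nn_integral_fst[of "\<lambda>p. sqn (N T (snd p))" TI] calculation by simp
      then show ?thesis using NT by (simp add: nn_integral_norm2 ennreal_mult_less_top TI.emeasure_eq_measure)
    qed
    ultimately show ?thesis by (simp add: L2_iff_nn_integral case_prod_beta')
  qed
  from L2_inner_integrable[OF this L2P_L2_LM[OF a]]
  have int: "integrable LM (\<lambda>(s, w). N T w \<bullet> a s w)" by (simp add: case_prod_beta')
  have "ip M (N T) (Tint a T) = (\<integral>w. (\<integral>s. N T w \<bullet> a s w \<partial>TI) \<partial>M)"
    unfolding ip_def
  proof (rule integral_cong_AE)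
    show "AE w in M. N T w \<bullet> Tint a T w = (\<integral>s. N T w \<bullet> a s w \<partial>TI)"
      using path_integrable[OF a] by eventually_elim (simp add: Tint_def)
    show "(\<lambda>w. N T w \<bullet> Tint a T w) \<in> borel_measurable M"
      by (intro borel_measurable_inner L2_measurable NT Tint_L2 a TT)
  qed (use LM.integrable_snd[OF int] in auto)
  also have "\<dots> = (\<integral>s. ip M (N T) (a s) \<partial>TI)"
    unfolding ip_def LM.integral_snd[OF int] LM.integral_fst[OF int, symmetric] ..
  also have "\<dots> = (\<integral>s. ip M (N s) (a s) \<partial>TI)"
  proof (rule integral_cong_AE)
    show "(\<lambda>s. ip M (N T) (a s)) \<in> borel_measurable TI" using LM.integrable_fst[OF int] by (auto simp: ip_def)
    show "(\<lambda>s. ip M (N s) (a s)) \<in> borel_measurable TI" using ip_time_integrable[OF NX a] by auto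
    show "AE s in TI. ip M (N T) (a s) = ip M (N s) (a s)"
      using L2P_AE_L2[OF a] AE_space
    proof eventually_elim
      case (elim s)
      then have "ip M (\<lambda>w. N T w - N s w) (a s) = 0" using L2martD(3)[OF N, of T s "a s"] L2P_adapted[OF a, of s] TT by auto
      then show ?case using L2martD(2)[OF N, of s] elim NT by (simp add: ip_diff_left)
    qed
  qed
  also have "\<dots> = IP N a" by (rule IP_eq_time_outer[OF NX a, symmetric])
  finally show ?thesis .
qed

text \<open>Write \<open>Y = N - H\<close> with a martingale \<open>N\<close> and a time integral \<open>H\<close>, and \<open>X = \<alpha> + \<beta>\<close> with the time integral
  \<open>\<alpha>\<close> and the Ito integral \<open>\<beta>\<close>. The four products at time \<open>T\<close> have known expectations: two are of
  martingale times time integral, one is the Ito isometry, and one is integration by parts. Summed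
  up, \<open>N\<close>, \<open>H\<close>, \<open>\<alpha>\<close> and \<open>\<beta>\<close> recombine to \<open>X\<close> and \<open>Y\<close>.\<close>

theorem itoproc_duality:
  assumes X: "itoproc a b X" and X0: "AE w in M. X 0 w = 0" and Y: "itoproc (\<lambda>s w. - h s w) Z Y" and h: "h \<in> L2P"
  shows "ip M (Y T) (X T) + IP h X = IP Y a + IP Z b"
proof -
  have TT: "T \<in> {0..T}" "0 \<le> T" using T_pos by auto
  obtain \<beta> where \<beta>: "is_ito b \<beta>" "AE w in M. \<forall>t\<in>{0..T}. X t w = X 0 w + Tint a t w + \<beta> t w"
    using X by (auto simp: itoproc_def)
  obtain J where J: "is_ito Z J" "AE w in M. \<forall>t\<in>{0..T}. Y t w = Y 0 w + Tint (\<lambda>s w. - h s w) t w + J t w"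
    using Y by (auto simp: itoproc_def)
  have a: "a \<in> L2P" and Z: "Z \<in> L2P" and XX: "X \<in> XH" and YX: "Y \<in> XH"
    using itoprocD[OF X] itoprocD[OF Y] by auto
  obtain \<alpha> where \<alpha>: "\<alpha> \<in> XH" "AE w in M. \<forall>t\<in>{0..T}. \<alpha> t w = Tint a t w" using Tint_version[OF a] by blast
  obtain H where H: "H \<in> XH" "AE w in M. \<forall>t\<in>{0..T}. H t w = Tint h t w" using Tint_version[OF h] by blast
  define N where "N t w = Y 0 w + 1 *\<^sub>R J t w" for t w
  have Y0F: "Y 0 \<in> borel_measurable (Fil 0)" and Y0L: "Y 0 \<in> L2 M" using XhatD(1)[OF YX] Xhat_L2(1)[OF YX] TT by auto
  have Jm: "L2mart J" by (rule ito_L2mart[OF J(1)])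
  have Nm: "L2mart N"
    unfolding L2mart_def
  proof (intro conjI ballI allI impI)
    fix t assume t: "t \<in> {0..T}"
    show "N t \<in> borel_measurable (Fil t)" unfolding N_def[abs_def]
      using L2martD(1)[OF Jm, of t] t Fil_measurable_mono[OF _ Y0F, of t] by (intro borel_measurable_add borel_measurable_scaleR) auto
    show "N t \<in> L2 M" unfolding N_def[abs_def] using L2martD(2)[OF Jm, of t] t by (intro L2_add L2_scaleR Y0L) auto
  next
    fix s t and \<zeta> :: "'w \<Rightarrow> 'a" assume "0 \<le> s \<and> s \<le> t \<and> t \<le> T \<and> \<zeta> \<in> borel_measurable (Fil s) \<and> \<zeta> \<in> L2 M"
    then show "ip M (\<lambda>w. N t w - N s w) \<zeta> = 0" using L2martD(3)[OF Jm, of t s \<zeta>] by (simp add: N_def)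
  qed
  have NX: "N \<in> XH"
  proof -
    obtain G where G: "G \<in> borel_measurable M" "AE w in M. \<forall>t\<in>{0..T}. sqn (Y t w) \<le> G w" "(\<integral>\<^sup>+w. G w \<partial>M) < \<infinity>"
      using Xhat_bound[OF YX] by blast
    have "(\<lambda>t. Y 0) \<in> XH"
    proof (rule Xhat_I[OF _ _ _ G(3)])
      show "AE w in M. \<forall>t\<in>{0..T}. sqn (Y 0 w) \<le> G w" using G(2) by eventually_elim (use TT in auto)
    qed (use Fil_measurable_mono[OF _ Y0F] in auto)
    from Xhat_add[OF this ito_Xhat[OF J(1)], of 1] show ?thesis by (simp add: N_def[abs_def])
  qed
  note NP = Xhat_L2P[OF NX] and \<beta>P = Xhat_L2P[OF ito_Xhat[OF \<beta>(1)]] and \<alpha>P = Xhat_L2P[OF \<alpha>(1)] and HP = Xhat_L2P[OF H(1)]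
  have Yeq: "AE w in M. \<forall>t\<in>{0..T}. Y t w = N t w - H t w"
    using J(2) H(2)
  proof eventually_elim
    case (elim w)
    show ?case
    proof
      fix t assume t: "t \<in> {0..T}"
      have "Tint (\<lambda>s w. - h s w) t w = - Tint h t w" by (simp add: Tint_def)
      then show "Y t w = N t w - H t w" using bspec[OF elim(1) t] bspec[OF elim(2) t] by (simp add: N_def)
    qed
  qed
  have Xeq: "AE w in M. \<forall>t\<in>{0..T}. X t w = \<alpha> t w + \<beta> t w"
    using \<beta>(2) \<alpha>(2) X0 by eventually_elim simp
  have L: "N T \<in> L2 M" "H T \<in> L2 M" "\<alpha> T \<in> L2 M" "\<beta> T \<in> L2 M" "X T \<in> L2 M" "Y T \<in> L2 M" "J T \<in> L2 M"
    using Xhat_L2(1) NX H(1) \<alpha>(1) ito_Xhat[OF \<beta>(1)] XX YX ito_Xhat[OF J(1)] TT by blast+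
  have TaL: "Tint a T \<in> L2 M" "Tint h T \<in> L2 M" using Tint_L2(1) a h TT by blast+
  have aeT: "AE w in M. \<alpha> T w = Tint a T w" "AE w in M. H T w = Tint h T w" "AE w in M. Y T w = N T w - H T w" "AE w in M. X T w = \<alpha> T w + \<beta> T w"
    subgoal using \<alpha>(2) by (rule eventually_mono) (use TT in auto)
    subgoal using H(2) by (rule eventually_mono) (use TT in auto)
    subgoal using Yeq by (rule eventually_mono) (use TT in auto)
    subgoal using Xeq by (rule eventually_mono) (use TT in auto)
    done
  have "ip M (Y T) (X T) = ip M (\<lambda>w. N T w - H T w) (\<lambda>w. \<alpha> T w + \<beta> T w)"
    by (intro ip_cong_AE aeT L2_measurable L L2_add L2_diff)
  also have "\<dots> = ip M (N T) (\<alpha> T) + ip M (N T) (\<beta> T) - ip M (H T) (\<alpha> T) - ip M (H T) (\<beta> T)"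
    using L by (simp add: ip_diff_left ip_add_right L2_add L2_diff)
  also have "ip M (N T) (\<alpha> T) = IP N a"
  proof -
    have "ip M (N T) (\<alpha> T) = ip M (N T) (Tint a T)" by (intro ip_cong_AE aeT L2_measurable L TaL) auto
    then show ?thesis using mart_time_integral[OF Nm NP a] by simp
  qed
  also have "ip M (N T) (\<beta> T) = IP Z b"
  proof -
    have "ip M (N T) (\<beta> T) = ip M (Y 0) (\<beta> T) + ip M (J T) (\<beta> T)"
      unfolding N_def[abs_def] using L Y0L by (simp add: ip_add_left)
    moreover have "ip M (Y 0) (\<beta> T) = 0"
    proof -
      have "ip M (\<lambda>w. \<beta> T w - \<beta> 0 w) (Y 0) = 0" using L2martD(3)[OF ito_L2mart[OF \<beta>(1)], of T 0 "Y 0"] Y0F Y0L TT by auto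
      moreover have "ip M (\<lambda>w. \<beta> T w - \<beta> 0 w) (Y 0) = ip M (\<beta> T) (Y 0)"
      proof (rule ip_cong_AE)
        show "AE w in M. \<beta> T w - \<beta> 0 w = \<beta> T w" using ito_at_0[OF \<beta>(1)] by eventually_elim simp
        have "\<beta> 0 \<in> L2 M" using Xhat_L2(1)[OF ito_Xhat[OF \<beta>(1)], of 0] TT by auto
        then show "(\<lambda>w. \<beta> T w - \<beta> 0 w) \<in> borel_measurable M" by (intro L2_measurable L2_diff L)
      qed (use L Y0L L2_measurable in auto)
      ultimately show ?thesis by (simp add: ip_commute)
    qed
    ultimately show ?thesis using ito_isometry[OF J(1) \<beta>(1) TT(1)] cut_T[OF Z, of b] by simp
  qed
  also have "ip M (H T) (\<beta> T) = IP h \<beta>"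
  proof -
    have "ip M (H T) (\<beta> T) = ip M (Tint h T) (\<beta> T)" by (intro ip_cong_AE aeT L2_measurable L TaL) auto
    then show ?thesis using mart_time_integral[OF ito_L2mart[OF \<beta>(1)] \<beta>P h] by (simp add: ip_commute IP_commute)
  qed
  also have "ip M (H T) (\<alpha> T) = IP h \<alpha> + IP H a"
  proof -
    have "ip M (H T) (\<alpha> T) = (\<integral>w. (\<integral>s. h s w \<bullet> \<alpha> s w \<partial>TI) + (\<integral>s. H s w \<bullet> a s w \<partial>TI) \<partial>M)"
      unfolding ip_def
    proof (rule integral_cong_AE)
      show "(\<lambda>w. H T w \<bullet> \<alpha> T w) \<in> borel_measurable M" by (intro borel_measurable_inner L2_measurable L)
      show "(\<lambda>w. (\<integral>s. h s w \<bullet> \<alpha> s w \<partial>TI) + (\<integral>s. H s w \<bullet> a s w \<partial>TI)) \<in> borel_measurable M"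
        using LM.integrable_snd[OF IP_inner_integrable[OF h \<alpha>P]] LM.integrable_snd[OF IP_inner_integrable[OF HP a]]
        by (intro borel_measurable_add) auto
      show "AE w in M. H T w \<bullet> \<alpha> T w = (\<integral>s. h s w \<bullet> \<alpha> s w \<partial>TI) + (\<integral>s. H s w \<bullet> a s w \<partial>TI)"
        using path_integrable[OF a] path_integrable[OF h] \<alpha>(2) H(2)
      proof eventually_elim
        case (elim w)
        have "(\<integral>s. h s w \<bullet> \<alpha> s w \<partial>TI) = (\<integral>s. h s w \<bullet> Tint a s w \<partial>TI)" "(\<integral>s. H s w \<bullet> a s w \<partial>TI) = (\<integral>s. Tint h s w \<bullet> a s w \<partial>TI)"
          using elim by (auto intro!: LINT_cong)
        moreover have "H T w = (\<integral>s. h s w \<partial>TI)" "\<alpha> T w = (\<integral>s. a s w \<partial>TI)"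
          using elim TT by (auto simp: Tint_def)
        ultimately show ?case using integral_by_parts_TI[OF elim(2,1)] by (simp add: Tint_def)
      qed
    qed
    also have "\<dots> = IP h \<alpha> + IP H a"
      unfolding IP_eq_time_inner[OF h \<alpha>P] IP_eq_time_inner[OF HP a]
      by (rule Bochner_Integration.integral_add[OF LM.integrable_snd[OF IP_inner_integrable[OF h \<alpha>P]] LM.integrable_snd[OF IP_inner_integrable[OF HP a]]])
    finally show ?thesis .
  qed
  finally have 1: "ip M (Y T) (X T) = IP N a + IP Z b - (IP h \<alpha> + IP H a) - IP h \<beta>" .
  have XP: "X \<in> L2P" and YP: "Y \<in> L2P" using Xhat_L2P XX YX by auto
  have z1: "NR (\<lambda>s w. X s w - (\<alpha> s w + \<beta> s w)) = 0"
    by (rule NR_eq_0_I[OF L2P_diff[OF XP L2P_add[OF \<alpha>P \<beta>P]]], rule AE_I2, rule eventually_mono[OF Xeq]) auto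
  have z2: "NR (\<lambda>s w. Y s w - (N s w - H s w)) = 0"
    by (rule NR_eq_0_I[OF L2P_diff[OF YP L2P_diff[OF NP HP]]], rule AE_I2, rule eventually_mono[OF Yeq]) auto
  from IP_cong[OF XP L2P_add[OF \<alpha>P \<beta>P] z1 h] IP_cong[OF YP L2P_diff[OF NP HP] z2 a]
  have "IP h X = IP h \<alpha> + IP h \<beta>" "IP Y a = IP N a - IP H a"
    using \<alpha>P \<beta>P NP HP h a by (simp_all add: IP_commute[of h] IP_add_left IP_diff_left)
  with 1 show ?thesis by simp
qed

end

section \<open>Linear equations with causal coefficients\<close>

context bm_horizon
begin

lemma NR_cut_T: "\<phi> \<in> L2P \<Longrightarrow> NR (cut T \<phi>) = NR \<phi>"
  unfolding NR_def_IP cut_T IP_commute[of \<phi> "cut T \<phi>"] ..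

lemma NR_scaleR: "NR (\<lambda>s w. r *\<^sub>R \<phi> s w) = \<bar>r\<bar> * NR \<phi>"
  unfolding NR_def_IP IP_scaleR_left IP_scaleR_right by (simp add: real_sqrt_mult mult.assoc[symmetric] flip: power2_eq_square)

lemma NR_zero [simp]: "NR (\<lambda>s w. 0) = 0"
  by (intro NR_eq_0_I) auto

lemma NR_cong_0:
  assumes "\<phi> \<in> L2P" "\<psi> \<in> L2P" "DR \<phi> \<psi> = 0" shows "NR \<phi> = NR \<psi>"
proof -
  have "NR \<phi> \<le> NR \<psi>" if "\<phi> \<in> L2P" "\<psi> \<in> L2P" "DR \<phi> \<psi> = 0" for \<phi> \<psi> :: "('w, 'a) process"
    using NR_triangle[OF L2P_diff[OF that(1,2)] that(2)] that(3) by simp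
  from this[OF assms] this[OF assms(2,1)] show ?thesis using assms(3) by (simp add: NR_minus[of \<psi> \<phi>])
qed

text \<open>All that the theory of the state equation uses of its coefficients: they act linearly on processes,
  up to null sets, and their output up to time \<open>t\<close> is controlled by the input up to time \<open>t\<close>.
  Mean-field terms are of this kind although they do not act path by path.\<close>

definition causal_op :: "(('w, 'a::euclidean_space) process \<Rightarrow> ('w, 'b::euclidean_space) process) \<Rightarrow> bool" where
  "causal_op L \<longleftrightarrow> (\<forall>X\<in>L2P. L X \<in> L2P) \<and>
    (\<forall>X\<in>L2P. \<forall>Y\<in>L2P. \<forall>r. NR (\<lambda>s w. L (\<lambda>s w. X s w + r *\<^sub>R Y s w) s w - (L X s w + r *\<^sub>R L Y s w)) = 0) \<and>
    (\<exists>K\<ge>0. \<forall>X\<in>L2P. \<forall>t\<in>{0..T}. NR (cut t (L X)) \<le> K * NR (cut t X))"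

lemma causal_opD:
  assumes "causal_op L"
  shows "X \<in> L2P \<Longrightarrow> L X \<in> L2P"
    and "X \<in> L2P \<Longrightarrow> Y \<in> L2P \<Longrightarrow> NR (\<lambda>s w. L (\<lambda>s w. X s w + r *\<^sub>R Y s w) s w - (L X s w + r *\<^sub>R L Y s w)) = 0"
    and "\<exists>K\<ge>0. \<forall>X\<in>L2P. \<forall>t\<in>{0..T}. NR (cut t (L X)) \<le> K * NR (cut t X)"
  using assms unfolding causal_op_def by blast+

lemma causal_op_diff_cut:
  assumes L: "causal_op L" and K: "\<forall>X\<in>L2P. \<forall>t\<in>{0..T}. NR (cut t (L X)) \<le> K * NR (cut t X)"
    and UV: "U \<in> L2P" "V \<in> L2P" and t: "t \<in> {0..T}"
  shows "NR (cut t (\<lambda>s w. L U s w + (-1) *\<^sub>R L V s w)) \<le> K * NR (cut t (\<lambda>s w. U s w - V s w))"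
proof -
  let ?D = "\<lambda>s w. U s w + (-1) *\<^sub>R V s w"
  let ?E = "\<lambda>s w. L U s w + (-1) *\<^sub>R L V s w"
  have P: "?D \<in> L2P" "?E \<in> L2P" using UV causal_opD(1)[OF L] by (intro L2P_add L2P_scaleR; blast)+
  note LD = causal_opD(1)[OF L P(1)]
  have "NR (cut t (\<lambda>s w. L ?D s w - ?E s w)) \<le> NR (\<lambda>s w. L ?D s w - ?E s w)"
    by (rule NR_cut_le[OF L2P_diff[OF LD P(2)]])
  also have "\<dots> = 0" by (rule causal_opD(2)[OF L UV])
  finally have "NR (\<lambda>s w. cut t (L ?D) s w - cut t ?E s w) = 0"
    unfolding cut_diff using NR_nonneg order_antisym by blast
  from NR_cong_0[OF cut_L2P[OF LD] cut_L2P[OF P(2)] this] bspec[OF bspec[OF K P(1)] t]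
  show ?thesis by simp
qed

lemma cut_add: "cut t (\<lambda>s w. \<phi> s w + \<psi> s w) = (\<lambda>s w. cut t \<phi> s w + cut t \<psi> s w)"
  by (simp add: cut_def fun_eq_iff scaleR_add_right)

text \<open>The distance of two images under the Picard map is controlled by the distance of the arguments up to
  the same time. One constant serves for all processes, so the estimate can be iterated.\<close>

definition stability_const :: "(('w, 'a::euclidean_space) process \<Rightarrow> ('w, 'a) process) \<Rightarrow>
    (('w, 'a) process \<Rightarrow> ('w, 'a) process) \<Rightarrow> real \<Rightarrow> bool" where
  "stability_const L0 L1 \<kappa> \<longleftrightarrow> \<kappa> \<ge> 0 \<and> (\<forall>U V X Y f0 f1 g0 g1 t. U \<in> L2P \<and> V \<in> L2P \<and> f0 \<in> L2P \<and> f1 \<in> L2P \<and> g0 \<in> L2P \<and> g1 \<in> L2P \<and>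
    itoproc (\<lambda>s w. L0 U s w + f0 s w) (\<lambda>s w. L1 U s w + f1 s w) X \<and>
    itoproc (\<lambda>s w. L0 V s w + g0 s w) (\<lambda>s w. L1 V s w + g1 s w) Y \<and> (AE w in M. X 0 w = Y 0 w) \<and> t \<in> {0..T} \<longrightarrow>
    dst M (X t) (Y t) \<le> \<kappa> * (NR (cut t (\<lambda>s w. U s w - V s w)) + DR f0 g0 + DR f1 g1))"

lemma causal_difference:
  fixes L0 L1 :: "('w, 'a::euclidean_space) process \<Rightarrow> ('w, 'a) process"
  assumes L0: "causal_op L0" and L1: "causal_op L1"
  shows "\<exists>\<kappa>. stability_const L0 L1 \<kappa>"
proof -
  obtain K0 where K0: "K0 \<ge> 0" "\<forall>X\<in>L2P. \<forall>t\<in>{0..T}. NR (cut t (L0 X)) \<le> K0 * NR (cut t X)" using causal_opD(3)[OF L0] by blast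
  obtain K1 where K1: "K1 \<ge> 0" "\<forall>X\<in>L2P. \<forall>t\<in>{0..T}. NR (cut t (L1 X)) \<le> K1 * NR (cut t X)" using causal_opD(3)[OF L1] by blast
  have coef: "NR (cut t (\<lambda>s w. (L U s w + f s w) + (-1) *\<^sub>R (L V s w + g s w)))
      \<le> K * NR (cut t (\<lambda>s w. U s w - V s w)) + DR f g"
    if L: "causal_op L" "\<forall>X\<in>L2P. \<forall>t\<in>{0..T}. NR (cut t (L X)) \<le> K * NR (cut t X)" and p: "U \<in> L2P" "V \<in> L2P" "f \<in> L2P" "g \<in> L2P"
      and t: "t \<in> {0..T}" for L and K :: real and U V f g :: "('w, 'a) process" and t
  proof -
    have eq: "(\<lambda>s w. (L U s w + f s w) + (-1) *\<^sub>R (L V s w + g s w))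
        = (\<lambda>s w. (L U s w + (-1) *\<^sub>R L V s w) + (f s w - g s w))" by (simp add: fun_eq_iff algebra_simps)
    have P: "(\<lambda>s w. L U s w + (-1) *\<^sub>R L V s w) \<in> L2P" using p causal_opD(1)[OF L(1)] by (intro L2P_add L2P_scaleR; blast)
    note Q = L2P_diff[OF p(3,4)]
    have "NR (cut t (\<lambda>s w. (L U s w + f s w) + (-1) *\<^sub>R (L V s w + g s w)))
        \<le> NR (cut t (\<lambda>s w. L U s w + (-1) *\<^sub>R L V s w)) + NR (cut t (\<lambda>s w. f s w - g s w))"
      unfolding eq cut_add[of t "\<lambda>s w. L U s w + (-1) *\<^sub>R L V s w"] by (rule NR_triangle[OF cut_L2P[OF P] cut_L2P[OF Q]])
    also have "\<dots> \<le> K * NR (cut t (\<lambda>s w. U s w - V s w)) + DR f g"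
      by (intro add_mono causal_op_diff_cut L p t NR_cut_le Q)
    finally show ?thesis .
  qed
  define \<kappa> where "\<kappa> = sqrt T * K0 + K1 + sqrt T + 1"
  have \<kappa>: "\<kappa> \<ge> 0" using K0(1) K1(1) T_pos by (simp add: \<kappa>_def)
  moreover have "dst M (X t) (Y t) \<le> \<kappa> * (NR (cut t (\<lambda>s w. U s w - V s w))
      + DR f0 g0 + DR f1 g1)"
    if p: "U \<in> L2P" "V \<in> L2P" "f0 \<in> L2P" "f1 \<in> L2P" "g0 \<in> L2P" "g1 \<in> L2P"
      and X: "itoproc (\<lambda>s w. L0 U s w + f0 s w) (\<lambda>s w. L1 U s w + f1 s w) X"
      and Y: "itoproc (\<lambda>s w. L0 V s w + g0 s w) (\<lambda>s w. L1 V s w + g1 s w) Y"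
      and XY: "AE w in M. X 0 w = Y 0 w" and t: "t \<in> {0..T}" for U V X Y f0 f1 g0 g1 t
  proof -
    have z: "AE w in M. X 0 w + (-1) *\<^sub>R Y 0 w = 0" using XY by eventually_elim simp
    let ?n = "NR (cut t (\<lambda>s w. U s w - V s w))" and ?f0 = "DR f0 g0" and ?f1 = "DR f1 g1"
    have "dst M (X t) (Y t) \<le> sqrt T * (K0 * ?n + ?f0) + (K1 * ?n + ?f1)"
    proof -
      have eq: "(\<lambda>w. X t w - Y t w) = (\<lambda>w. X t w + (-1) *\<^sub>R Y t w)" by simp
      show ?thesis unfolding eq
        by (rule order_trans[OF itoproc_estimate[OF itoproc_linear[OF X Y] z t] add_mono[OF mult_left_mono[OF coef[OF L0 K0(2) p(1,2,3,5) t]]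
              coef[OF L1 K1(2) p(1,2,4,6) t]]]) (use T_pos in simp)
    qed
    also have "\<dots> \<le> \<kappa> * (?n + ?f0 + ?f1)"
    proof -
      have "0 \<le> ?n" "0 \<le> ?f0" "0 \<le> ?f1" "0 \<le> sqrt T" using T_pos by auto
      then have "0 \<le> sqrt T * K0 * ?f0" "0 \<le> sqrt T * K0 * ?f1" "0 \<le> K1 * ?f0" "0 \<le> K1 * ?f1" "0 \<le> sqrt T * ?n" "0 \<le> sqrt T * ?f1"
        using K0(1) K1(1) by (intro mult_nonneg_nonneg; simp)+
      then show ?thesis using \<open>0 \<le> ?n\<close> \<open>0 \<le> ?f0\<close> by (simp add: \<kappa>_def algebra_simps)
    qed
    finally show ?thesis .
  qed
  ultimately show ?thesis unfolding stability_const_def by blast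
qed

text \<open>With an exponential weight in time, integration over the past gains the factor \<open>1 / sqrt (2 \<beta>)\<close>. A
  large \<open>\<beta>\<close> therefore makes the solution map a contraction on the whole interval.\<close>

lemma exp_weighted_bound:
  assumes D: "D \<in> L2P" "\<And>s. s \<in> {0..T} \<Longrightarrow> nrm M (D s) \<le> m * exp (\<beta> * s)" and \<beta>: "\<beta> > 0" and t: "t \<in> {0..T}"
  shows "NR (cut t D) \<le> m * exp (\<beta> * t) / sqrt (2 * \<beta>)"
proof -
  have m: "0 \<le> m" using order_trans[OF nrm_nonneg D(2)[of 0]] T_pos by simp
  have c: "continuous_on {0..t} (\<lambda>s. m\<^sup>2 * exp (2 * \<beta> * s))" by (intro continuous_intros)
  have "(NR (cut t D))\<^sup>2 = (\<integral>s. indicator {0..t} s * ip M (D s) (D s) \<partial>TI)"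
    unfolding NR_power2 IP_cut_cut[OF D(1) D(1)] IP_cut[OF D(1) D(1)] ..
  also have "\<dots> = (\<integral>s. ip M (D s) (D s) \<partial>lebesgue_on {0..t})" using integral_TI_atMost[of t T "\<lambda>s. ip M (D s) (D s)"] t by simp
  also have "\<dots> \<le> (\<integral>s. m\<^sup>2 * exp (2 * \<beta> * s) \<partial>lebesgue_on {0..t})"
  proof (rule integral_mono)
    show "integrable (lebesgue_on {0..t}) (\<lambda>s. ip M (D s) (D s))"
      using t by (intro Equivalence_Lebesgue_Henstock_Integration.integrable_subinterval[OF ip_time_integrable[OF D(1) D(1)]]) auto
    show "integrable (lebesgue_on {0..t}) (\<lambda>s. m\<^sup>2 * exp (2 * \<beta> * s))" by (rule continuous_imp_integrable_real[OF c])
    fix s assume "s \<in> space (lebesgue_on {0..t})"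
    then have "(nrm M (D s))\<^sup>2 \<le> (m * exp (\<beta> * s))\<^sup>2" using t by (intro power_mono D(2)) auto
    then show "ip M (D s) (D s) \<le> m\<^sup>2 * exp (2 * \<beta> * s)" by (simp add: nrm_power2 power_mult_distrib mult.assoc flip: exp_double)
  qed
  also have "\<dots> = integral {0..t} (\<lambda>s. m\<^sup>2 * exp (2 * \<beta> * s))"
    by (rule lebesgue_integral_eq_integral[OF continuous_imp_integrable_real[OF c]]) simp
  also have "\<dots> = m\<^sup>2 * exp (2 * \<beta> * t) / (2 * \<beta>) - m\<^sup>2 * exp (2 * \<beta> * 0) / (2 * \<beta>)"
    using t \<beta> by (intro integral_unique fundamental_theorem_of_calculus)
      (auto intro!: derivative_eq_intros simp: has_real_derivative_iff_has_vector_derivative[symmetric])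
  also have "\<dots> \<le> m\<^sup>2 * exp (2 * \<beta> * t) / (2 * \<beta>)" using \<beta> by simp
  also have "\<dots> = (m * exp (\<beta> * t) / sqrt (2 * \<beta>))\<^sup>2"
    using \<beta> by (simp add: power_divide power_mult_distrib mult.assoc flip: exp_double)
  finally show ?thesis by (rule power2_le_imp_le) (use m \<beta> in simp)
qed

text \<open>The linear equation \<open>dX = (L\<^sub>0 X + f\<^sub>0) ds + (L\<^sub>1 X + f\<^sub>1) dW\<close> with forcing \<open>(f\<^sub>0, f\<^sub>1)\<close>.\<close>

definition solves where
  "solves L0 L1 f0 f1 X \<longleftrightarrow> f0 \<in> L2P \<and> f1 \<in> L2P \<and> itoproc (\<lambda>s w. L0 X s w + f0 s w) (\<lambda>s w. L1 X s w + f1 s w) X"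

lemma solvesD:
  assumes "solves L0 L1 f0 f1 X"
  shows "f0 \<in> L2P" "f1 \<in> L2P" "itoproc (\<lambda>s w. L0 X s w + f0 s w) (\<lambda>s w. L1 X s w + f1 s w) X" "X \<in> XH" "X \<in> L2P"
  using assms itoprocD(1) Xhat_L2P unfolding solves_def by blast+

lemma solves_linear:
  assumes L: "causal_op L0" "causal_op L1" and X: "solves L0 L1 f0 f1 X" and Y: "solves L0 L1 g0 g1 Y"
  shows "solves L0 L1 (\<lambda>s w. f0 s w + r *\<^sub>R g0 s w) (\<lambda>s w. f1 s w + r *\<^sub>R g1 s w) (\<lambda>s w. X s w + r *\<^sub>R Y s w)"
proof -
  note x = solvesD[OF X] and y = solvesD[OF Y]
  let ?Z = "\<lambda>s w. X s w + r *\<^sub>R Y s w"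
  have Z: "?Z \<in> L2P" by (intro L2P_add L2P_scaleR x y)
  have *: "(\<lambda>s w. L ?Z s w + (f s w + r *\<^sub>R g s w)) \<in> L2P \<and>
      NR (\<lambda>s w. (L X s w + f s w) + r *\<^sub>R (L Y s w + g s w) - (L ?Z s w + (f s w + r *\<^sub>R g s w))) = 0"
    if "causal_op L" "f \<in> L2P" "g \<in> L2P" for L f g
  proof
    show "(\<lambda>s w. L ?Z s w + (f s w + r *\<^sub>R g s w)) \<in> L2P" by (intro L2P_add L2P_scaleR causal_opD(1)[OF that(1)] that Z)
    have "(\<lambda>s w. (L X s w + f s w) + r *\<^sub>R (L Y s w + g s w) - (L ?Z s w + (f s w + r *\<^sub>R g s w)))
        = (\<lambda>s w. (L X s w + r *\<^sub>R L Y s w) - L ?Z s w)" by (simp add: fun_eq_iff algebra_simps)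
    then show "NR (\<lambda>s w. (L X s w + f s w) + r *\<^sub>R (L Y s w + g s w) - (L ?Z s w + (f s w + r *\<^sub>R g s w))) = 0"
      using causal_opD(2)[OF that(1) x(5) y(5), of r] by (simp add: NR_minus[of "L ?Z"])
  qed
  from itoproc_cong[OF itoproc_linear[OF x(3) y(3), of r]] *[OF L(1) x(1) y(1)] *[OF L(2) x(2) y(2)]
  have "itoproc (\<lambda>s w. L0 ?Z s w + (f0 s w + r *\<^sub>R g0 s w)) (\<lambda>s w. L1 ?Z s w + (f1 s w + r *\<^sub>R g1 s w)) ?Z" by blast
  then show ?thesis unfolding solves_def using L2P_add L2P_scaleR x y by blast
qed

text \<open>Picard iteration. The iterates converge in \<open>L2F\<close> to some \<open>U\<close> that need not have continuous paths;
  the solution is the image of \<open>U\<close> under the iteration map, which equals \<open>U\<close> almost everywhere and so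
  solves the equation.\<close>

lemma solves_exists:
  fixes L0 L1 :: "('w, 'a::euclidean_space) process \<Rightarrow> ('w, 'a) process"
  assumes L: "causal_op L0" "causal_op L1" and f: "f0 \<in> L2P" "f1 \<in> L2P"
  shows "\<exists>X. solves L0 L1 f0 f1 X \<and> (AE w in M. X 0 w = y)"
proof -
  obtain \<kappa> where sc: "stability_const L0 L1 \<kappa>" using causal_difference[OF L] by blast
  then have \<kappa>: "\<kappa> \<ge> 0" by (simp add: stability_const_def)
  \<comment> \<open>large enough for the contraction factor \<open>\<kappa> / sqrt (2 * \<beta>)\<close> to be at most \<open>1 / 2\<close>\<close>
  define \<beta> where "\<beta> = 2 * \<kappa>\<^sup>2 + 1"
  have \<beta>: "\<beta> > 0" "2 * \<kappa> \<le> sqrt (2 * \<beta>)" by (auto simp: \<beta>_def power2_eq_square intro!: add_nonneg_pos real_le_rsqrt)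
  define F where "F U = (SOME X. itoproc (\<lambda>s w. L0 U s w + f0 s w) (\<lambda>s w. L1 U s w + f1 s w) X \<and> (AE w in M. X 0 w = y))" for U
  have F: "itoproc (\<lambda>s w. L0 U s w + f0 s w) (\<lambda>s w. L1 U s w + f1 s w) (F U)" "AE w in M. F U 0 w = y" if "U \<in> L2P" for U
  proof -
    have "\<exists>X. itoproc (\<lambda>s w. L0 U s w + f0 s w) (\<lambda>s w. L1 U s w + f1 s w) X \<and> (AE w in M. X 0 w = y)"
      by (intro itoproc_exists L2P_add causal_opD(1)[OF L(1)] causal_opD(1)[OF L(2)] \<open>U \<in> L2P\<close> f)
    from someI_ex[OF this]
    show "itoproc (\<lambda>s w. L0 U s w + f0 s w) (\<lambda>s w. L1 U s w + f1 s w) (F U)" "AE w in M. F U 0 w = y"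
      unfolding F_def by blast+
  qed
  have FX: "F U \<in> XH" if "U \<in> L2P" for U using itoprocD(1)[OF F(1)[OF that]] .
  have FF: "dst M (F U t) (F V t) \<le> \<kappa> * NR (cut t (\<lambda>s w. U s w - V s w))" if "U \<in> L2P" "V \<in> L2P" "t \<in> {0..T}" for U V t
  proof -
    have "AE w in M. F U 0 w = F V 0 w" using F(2)[OF that(1)] F(2)[OF that(2)] by eventually_elim simp
    then have "dst M (F U t) (F V t) \<le> \<kappa> * (NR (cut t (\<lambda>s w. U s w - V s w)) + DR f0 f0 + DR f1 f1)"
      using sc that f F(1) unfolding stability_const_def by blast
    then show ?thesis by simp
  qed
  define X where "X n = (F ^^ Suc n) (\<lambda>s w. 0)" for n
  have XS: "X (Suc n) = F (X n)" for n by (simp add: X_def)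
  have XX: "X n \<in> XH" for n by (induction n) (use FX Xhat_L2P in \<open>auto simp: XS, auto simp: X_def\<close>)
  note XP = Xhat_L2P[OF XX]
  define D where "D n s w = X (Suc n) s w - X n s w" for n s w
  have DP: "D n \<in> L2P" for n unfolding D_def[abs_def] by (intro L2P_diff XP)
  obtain m where m: "0 \<le> m" "\<And>t. t \<in> {0..T} \<Longrightarrow> nrm M (D 0 t) \<le> m"
  proof -
    have "D 0 \<in> XH" using Xhat_add[OF XX[of 1] XX[of 0], of "-1"] by (simp add: D_def[abs_def])
    then obtain C where "\<forall>t\<in>{0..T}. ip M (D 0 t) (D 0 t) \<le> C" "C \<ge> 0" using Xhat_L2(2) by blast
    then show thesis using that[of "sqrt C"] by (simp add: nrm_def)
  qed
  have Dn: "nrm M (D n t) \<le> m / 2^n * exp (\<beta> * t)" if "t \<in> {0..T}" for n t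
    using that
  proof (induction n arbitrary: t)
    case 0
    have "m * 1 \<le> m * exp (\<beta> * t)" using m(1) \<beta>(1) 0 by (intro mult_left_mono) auto
    then show ?case using m(2)[OF 0] by simp
  next
    case (Suc n)
    have "nrm M (D (Suc n) t) \<le> \<kappa> * NR (cut t (D n))"
      using FF[OF XP XP Suc.prems, of "Suc n" n] by (simp add: D_def[abs_def] XS)
    also have "\<dots> \<le> \<kappa> * (m / 2^n * exp (\<beta> * t) / sqrt (2 * \<beta>))"
      by (intro mult_left_mono exp_weighted_bound DP Suc.IH \<beta> \<kappa> Suc.prems)
    also have "\<dots> = (2 * \<kappa> / sqrt (2 * \<beta>)) * (m / 2^Suc n * exp (\<beta> * t))" by simp
    also have "\<dots> \<le> 1 * (m / 2^Suc n * exp (\<beta> * t))" using \<beta> m(1) by (intro mult_right_mono) auto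
    finally show ?case by simp
  qed
  define C where "C = m * exp (\<beta> * T) / sqrt (2 * \<beta>)"
  have C: "0 \<le> C" using m(1) \<beta>(1) by (simp add: C_def)
  have DC: "NR (D n) \<le> C / 2^n" for n
    using exp_weighted_bound[OF DP Dn \<beta>(1), of T n] T_pos by (simp add: NR_cut_T DP C_def mult.commute)
  have tel: "DR (X (n + k)) (X n) \<le> 2 * C / 2^n * (1 - 1 / 2^k)" for n k
  proof (induction k)
    case (Suc k)
    have "DR (X (n + Suc k)) (X n) \<le> NR (D (n + k)) + DR (X (n + k)) (X n)"
      using NR_triangle_diff[OF XP XP XP, of "n + Suc k" n "n + k"] by (simp add: D_def[abs_def])
    also have "\<dots> \<le> C / 2^(n + k) + 2 * C / 2^n * (1 - 1 / 2^k)" using Suc DC by (intro add_mono)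
    also have "\<dots> = 2 * C / 2^n * (1 - 1 / 2^Suc k)" by (simp add: field_simps power_add)
    finally show ?case .
  qed simp
  have tel': "DR (X m) (X n) \<le> 2 * C / 2^n" if "n \<le> m" for m n
  proof -
    have "2 * C / 2^n * (1 - 1 / 2^(m - n)) \<le> 2 * C / 2^n * 1" using C by (intro mult_left_mono) auto
    then show ?thesis using tel[of n "m - n"] that by simp
  qed
  have "\<exists>U\<in>L2P. (\<lambda>n. DR (X n) U) \<longlonglongrightarrow> 0"
  proof (rule L2P_complete[OF XP])
    fix e :: real assume e: "e > 0"
    have "(\<lambda>n. 2 * C * (1/2)^n) \<longlonglongrightarrow> 0" using tendsto_mult_right_zero[OF LIMSEQ_power_zero[of "1/2::real"]] by simp
    then obtain n0 where n0: "\<forall>n\<ge>n0. 2 * C * (1/2)^n < e" using e by (force dest: order_tendstoD(2) simp: eventually_sequentially)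
    have "DR (X m) (X n) < e" if "n0 \<le> m" "n0 \<le> n" for m n
    proof (cases "n \<le> m")
      case True
      then show ?thesis using tel'[OF True] n0 that by (force simp: power_divide)
    next
      case False
      then have "DR (X n) (X m) \<le> 2 * C / 2^m" using tel'[of m n] by simp
      then show ?thesis using n0 that by (force simp: power_divide NR_minus[of "X m"])
    qed
    then show "\<exists>n0. \<forall>m\<ge>n0. \<forall>n\<ge>n0. DR (X m) (X n) < e" by blast
  qed
  then obtain U where U: "U \<in> L2P" "(\<lambda>n. DR (X n) U) \<longlonglongrightarrow> 0" by blast
  note FU = Xhat_L2P[OF FX[OF U(1)]]
  have b: "DR (X (Suc n)) (F U) \<le> exp T / sqrt 2 * \<kappa> * DR (X n) U" for n
  proof -
    let ?e = "\<kappa> * DR (X n) U"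
    note P = L2P_diff[OF XP[of "Suc n"] FU]
    have e: "0 \<le> ?e" using \<kappa> by simp
    have "dst M (X (Suc n) s) (F U s) \<le> ?e * exp (1 * s)" if s: "s \<in> {0..T}" for s
    proof -
      have "dst M (X (Suc n) s) (F U s) \<le> \<kappa> * NR (cut s (\<lambda>s w. X n s w - U s w))"
        using FF[OF XP U(1) s] by (simp add: XS)
      also have "\<dots> \<le> ?e" by (intro mult_left_mono NR_cut_le L2P_diff XP U \<kappa>)
      also have "\<dots> * 1 \<le> ?e * exp (1 * s)" using e s by (intro mult_left_mono) auto
      finally show ?thesis by simp
    qed
    from exp_weighted_bound[OF P this, of T] show ?thesis using T_pos by (simp add: NR_cut_T P mult_ac)
  qed
  have "(\<lambda>n. exp T / sqrt 2 * \<kappa> * DR (X n) U) \<longlonglongrightarrow> 0" using tendsto_mult_right_zero[OF U(2)] .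
  then have "(\<lambda>n. DR (X (Suc n)) (F U)) \<longlonglongrightarrow> 0"
    by (rule tendsto_sandwich[OF _ _ tendsto_const, rotated 2]) (use b in auto)
  then have "(\<lambda>n. DR (X (Suc n)) U + DR (X (Suc n)) (F U)) \<longlonglongrightarrow> 0"
    using tendsto_add[OF LIMSEQ_Suc[OF U(2)]] by fastforce
  moreover have "DR U (F U) \<le> DR (X (Suc n)) U + DR (X (Suc n)) (F U)" for n
    using NR_triangle_diff[OF U(1) FU XP, of "Suc n"] by (simp add: NR_minus[of U])
  ultimately have "DR U (F U) \<le> 0" by (intro LIMSEQ_le_const) blast+
  then have z: "DR U (F U) = 0" using NR_nonneg order_antisym by blast
  have *: "(\<lambda>s w. L (F U) s w + f s w) \<in> L2P \<and> NR (\<lambda>s w. (L U s w + f s w) - (L (F U) s w + f s w)) = 0"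
    if L: "causal_op L" and f: "f \<in> L2P" for L and f :: "('w, 'a) process"
  proof
    show "(\<lambda>s w. L (F U) s w + f s w) \<in> L2P" by (intro L2P_add causal_opD(1)[OF L] f FU)
    obtain K where K: "\<forall>X\<in>L2P. \<forall>t\<in>{0..T}. NR (cut t (L X)) \<le> K * NR (cut t X)" using causal_opD(3)[OF L] by blast
    have "(\<lambda>s w. L U s w - L (F U) s w) \<in> L2P" by (intro L2P_diff causal_opD(1)[OF L] U FU)
    then have "DR (L U) (L (F U)) \<le> 0"
      using causal_op_diff_cut[OF L K U(1) FU, of T] T_pos z by (simp add: NR_cut_T L2P_diff U FU)
    then show "NR (\<lambda>s w. (L U s w + f s w) - (L (F U) s w + f s w)) = 0" using NR_nonneg order_antisym by fastforce
  qed
  have "solves L0 L1 f0 f1 (F U)"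
    unfolding solves_def using itoproc_cong[OF F(1)[OF U(1)]] *[OF L(1) f(1)] *[OF L(2) f(2)] f by blast
  with F(2)[OF U(1)] show ?thesis by blast
qed

text \<open>The supremum \<open>m\<close> of the exponentially weighted norms of the difference satisfies \<open>m \<le> m / 2 + \<kappa> \<Phi>\<close>, where
  \<open>\<Phi>\<close> measures the difference of the forcings.\<close>

lemma solves_stable:
  fixes L0 L1 :: "('w, 'a::euclidean_space) process \<Rightarrow> ('w, 'a) process"
  assumes L: "causal_op L0" "causal_op L1"
  shows "\<exists>C\<ge>0. \<forall>f0 f1 g0 g1 X Y. solves L0 L1 f0 f1 X \<longrightarrow> solves L0 L1 g0 g1 Y \<longrightarrow> (AE w in M. X 0 w = Y 0 w) \<longrightarrow>
    (\<forall>t\<in>{0..T}. dst M (X t) (Y t) \<le> C * (DR f0 g0 + DR f1 g1))"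
proof -
  obtain \<kappa> where sc: "stability_const L0 L1 \<kappa>" using causal_difference[OF L] by blast
  then have \<kappa>: "\<kappa> \<ge> 0" by (simp add: stability_const_def)
  \<comment> \<open>large enough for the contraction factor \<open>\<kappa> / sqrt (2 * \<beta>)\<close> to be at most \<open>1 / 2\<close>\<close>
  define \<beta> where "\<beta> = 2 * \<kappa>\<^sup>2 + 1"
  have \<beta>: "\<beta> > 0" "2 * \<kappa> \<le> sqrt (2 * \<beta>)" by (auto simp: \<beta>_def power2_eq_square intro!: add_nonneg_pos real_le_rsqrt)
  have "dst M (X t) (Y t) \<le> 2 * \<kappa> * exp (\<beta> * T) * (DR f0 g0 + DR f1 g1)"
    if X: "solves L0 L1 f0 f1 X" and Y: "solves L0 L1 g0 g1 Y" and XY: "AE w in M. X 0 w = Y 0 w" and t: "t \<in> {0..T}"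
    for f0 f1 g0 g1 X Y t
  proof -
    note x = solvesD[OF X] and y = solvesD[OF Y]
    define \<Phi> where "\<Phi> = DR f0 g0 + DR f1 g1"
    have \<Phi>: "0 \<le> \<Phi>" by (simp add: \<Phi>_def)
    define D where "D s w = X s w - Y s w" for s w
    have DX: "D \<in> XH" using Xhat_add[OF x(4) y(4), of "-1"] by (simp add: D_def[abs_def])
    note DP = Xhat_L2P[OF DX]
    have step: "nrm M (D s) \<le> \<kappa> * (NR (cut s D) + \<Phi>)" if "s \<in> {0..T}" for s
    proof -
      have "dst M (X s) (Y s) \<le> \<kappa> * (NR (cut s (\<lambda>s w. X s w - Y s w)) + DR f0 g0 + DR f1 g1)"
        using sc x(1-3,5) y(1-3,5) XY that unfolding stability_const_def by blast
      then show ?thesis by (simp add: D_def[abs_def] \<Phi>_def add.assoc)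
    qed
    define g where "g s = nrm M (D s) / exp (\<beta> * s)" for s
    obtain C where C: "\<forall>t\<in>{0..T}. ip M (D t) (D t) \<le> C" "C \<ge> 0" using Xhat_L2(2)[OF DX] by blast
    have "g s \<le> sqrt C" if s: "s \<in> {0..T}" for s
    proof -
      have "nrm M (D s) \<le> sqrt C" using C s by (simp add: nrm_def)
      also have "\<dots> * 1 \<le> sqrt C * exp (\<beta> * s)" using C(2) s \<beta>(1) by (intro mult_left_mono) auto
      finally show ?thesis by (simp add: g_def divide_le_eq)
    qed
    then have bdd: "bdd_above (g ` {0..T})" by (intro bdd_aboveI2)
    define m where "m = (SUP s\<in>{0..T}. g s)"
    have mD: "nrm M (D s) \<le> m * exp (\<beta> * s)" if "s \<in> {0..T}" for s
      using cSUP_upper[OF that bdd] by (simp add: m_def g_def divide_le_eq)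
    have m0: "0 \<le> m" using order_trans[OF nrm_nonneg mD[of 0]] T_pos by simp
    have "m \<le> m / 2 + \<kappa> * \<Phi>"
    proof (rule cSUP_least[of "{0..T}" g "m / 2 + \<kappa> * \<Phi>", folded m_def])
      show "{0..T} \<noteq> {}" using T_pos by auto
      fix s assume s: "s \<in> {0..T}"
      have "nrm M (D s) \<le> \<kappa> * (m * exp (\<beta> * s) / sqrt (2 * \<beta>) + \<Phi>)"
        by (rule order_trans[OF step[OF s]], intro mult_left_mono add_right_mono exp_weighted_bound DP mD \<beta> s \<kappa>)
      also have "\<dots> = 2 * \<kappa> / sqrt (2 * \<beta>) * (m / 2 * exp (\<beta> * s)) + \<kappa> * \<Phi> * 1" by (simp add: algebra_simps)
      also have "\<dots> \<le> 1 * (m / 2 * exp (\<beta> * s)) + \<kappa> * \<Phi> * exp (\<beta> * s)"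
        using \<beta> m0 \<kappa> \<Phi> s by (intro add_mono mult_right_mono mult_left_mono) auto
      also have "\<dots> = (m / 2 + \<kappa> * \<Phi>) * exp (\<beta> * s)" by (simp add: algebra_simps)
      finally show "g s \<le> m / 2 + \<kappa> * \<Phi>" by (simp add: g_def divide_le_eq)
    qed
    then have "m \<le> 2 * \<kappa> * \<Phi>" by simp
    then have "m * exp (\<beta> * t) \<le> 2 * \<kappa> * \<Phi> * exp (\<beta> * T)"
      using t \<beta>(1) \<kappa> \<Phi> by (intro mult_mono) auto
    with mD[OF t] show ?thesis by (simp add: D_def[abs_def] \<Phi>_def algebra_simps)
  qed
  then show ?thesis using \<kappa> by (intro exI[of _ "2 * \<kappa> * exp (\<beta> * T)"]) simp
qed

lemma solves_unique:
  assumes L: "causal_op L0" "causal_op L1" and X: "solves L0 L1 f0 f1 X" and Y: "solves L0 L1 g0 g1 Y" and XY: "AE w in M. X 0 w = Y 0 w"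
    and fg: "DR f0 g0 = 0" "DR f1 g1 = 0"
  shows "AE w in M. \<forall>t\<in>{0..T}. X t w = Y t w"
proof (rule indistinguishable)
  note x = solvesD(4)[OF X] and y = solvesD(4)[OF Y]
  show "AE w in M. continuous_on {0..T} (\<lambda>t. X t w)" "AE w in M. continuous_on {0..T} (\<lambda>t. Y t w)"
    using XhatD(2) x y by (auto intro!: AE_I2)
  fix t assume "t \<in> dyad T"
  then have t: "t \<in> {0..T}" using dyad_range[of T] T_pos by auto
  obtain C where "dst M (X t) (Y t) \<le> C * (DR f0 g0 + DR f1 g1)"
    using solves_stable[OF L] X Y XY t by blast
  then have "dst M (X t) (Y t) = 0" unfolding fg by (intro order_antisym) auto
  then show "AE w in M. X t w = Y t w" using nrm_eq_0_iff[OF L2_diff[OF Xhat_L2(1)[OF x t] Xhat_L2(1)[OF y t]]] by simp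
qed

lemma solves_bound:
  fixes L0 L1 :: "('w, 'a::euclidean_space) process \<Rightarrow> ('w, 'a) process"
  assumes L: "causal_op L0" "causal_op L1"
  shows "\<exists>C\<ge>0. \<forall>f0 f1 X. solves L0 L1 f0 f1 X \<longrightarrow> (AE w in M. X 0 w = 0) \<longrightarrow>
    nrm M (X T) \<le> C * (NR f0 + NR f1) \<and> NR X \<le> C * (NR f0 + NR f1)"
proof -
  obtain C where C: "C \<ge> 0" "\<And>f0 f1 g0 g1 X Y t. solves L0 L1 f0 f1 X \<Longrightarrow> solves L0 L1 g0 g1 Y \<Longrightarrow> (AE w in M. X 0 w = Y 0 w) \<Longrightarrow>
    t \<in> {0..T} \<Longrightarrow> dst M (X t) (Y t) \<le> C * (DR f0 g0 + DR f1 g1)"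
    using solves_stable[OF L] by blast
  have "nrm M (X T) \<le> C * exp T * (NR f0 + NR f1) \<and> NR X \<le> C * exp T * (NR f0 + NR f1)"
    if X: "solves L0 L1 f0 f1 X" and X0: "AE w in M. X 0 w = 0" for f0 f1 X
  proof -
    note x = solvesD[OF X]
    \<comment> \<open>compare with the zero process, which solves the equation without forcing\<close>
    have z: "solves L0 L1 (\<lambda>s w. 0) (\<lambda>s w. 0) (\<lambda>s w. 0)" using solves_linear[OF L X X, of "-1"] by simp
    let ?F = "C * (NR f0 + NR f1)"
    have F: "0 \<le> ?F" using C(1) by simp
    have "nrm M (X t) \<le> ?F" if "t \<in> {0..T}" for t using C(2)[OF X z _ that] X0 by simp
    moreover have "?F * 1 \<le> ?F * exp s" if "s \<in> {0..T}" for s using F that by (intro mult_left_mono) auto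
    ultimately have b: "nrm M (X s) \<le> ?F * exp (1 * s)" if "s \<in> {0..T}" for s using that by fastforce
    have "NR X \<le> ?F * exp T / sqrt 2"
      using exp_weighted_bound[OF x(5) b, of T] T_pos by (simp add: NR_cut_T x)
    also have "\<dots> \<le> ?F * exp T" using F divide_left_mono[of 1 "sqrt 2" "?F * exp T"] by simp
    finally show ?thesis using b[of T] T_pos by (simp add: mult_ac)
  qed
  then show ?thesis using C(1) by (intro exI[of _ "C * exp T"]) simp
qed

end

section \<open>The dual backward equation\<close>

lemma continuous_AE_zero:
  fixes f :: "real \<Rightarrow> 'a::real_normed_vector"
  assumes T: "0 < T" and c: "continuous_on {0..T} f" and ae: "AE s in lebesgue_on {0..T}. f s = 0" and t: "t \<in> {0..T}"
  shows "f t = 0"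
proof -
  let ?C = "{t \<in> {0..T}. f t = 0}"
  have C: "closed ?C" using continuous_closed_preimage_constant[OF c, of 0] by simp
  have "AE s in lebesgue. s \<in> {0..T} \<longrightarrow> f s = 0" using ae by (simp add: AE_restrict_space_iff)
  then have "AE s\<in>{0<..<T} in lebesgue. s \<in> ?C" by eventually_elim auto
  then have "{0<..<T} \<subseteq> ?C" using mem_closed_if_AE_lebesgue_open[OF _ C, of "{0<..<T}"] by auto
  then have "closure {0<..<T} \<subseteq> ?C" using C by (rule closure_minimal)
  then show ?thesis using t T by auto
qed

context bm_horizon
begin

definition adjoint_op :: "(('w, 'a::euclidean_space) process \<Rightarrow> ('w, 'b::euclidean_space) process) \<Rightarrow> (('w, 'b) process \<Rightarrow> ('w, 'a) process) \<Rightarrow> bool" where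
  "adjoint_op L L' \<longleftrightarrow> (\<forall>Y\<in>L2P. L' Y \<in> L2P) \<and> (\<forall>X\<in>L2P. \<forall>Y\<in>L2P. IP (L X) Y = IP X (L' Y))"

lemma adjoint_opD:
  assumes "adjoint_op L L'" shows "Y \<in> L2P \<Longrightarrow> L' Y \<in> L2P" "X \<in> L2P \<Longrightarrow> Y \<in> L2P \<Longrightarrow> IP (L X) Y = IP (L' Y) X"
  using assms unfolding adjoint_op_def by (simp_all add: IP_commute[of X])

text \<open>An adjoint operator respects equality almost everywhere, because it is determined by its inner
  products.\<close>

lemma adjoint_op_cong:
  fixes L :: "('w, 'a::euclidean_space) process \<Rightarrow> ('w, 'b::euclidean_space) process"
  assumes L: "causal_op L" "adjoint_op L L'" and Y: "Y \<in> L2P" "Y' \<in> L2P" "DR Y Y' = 0"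
  shows "DR (L' Y) (L' Y') = 0"
proof (rule L2P_eq_AE_testing)
  fix X :: "('w, 'a) process" assume X: "X \<in> L2P"
  show "IP (L' Y) X = IP (L' Y') X"
    using IP_cong[OF Y causal_opD(1)[OF L(1) X]] adjoint_opD(2)[OF L(2) X Y(1)] adjoint_opD(2)[OF L(2) X Y(2)]
    by (simp add: IP_commute[of "L X"])
qed (use adjoint_opD(1)[OF L(2)] Y in auto)

text \<open>The linear backward equation \<open>dY = - (L\<^sub>0' Y + L\<^sub>1' Z + g) ds + Z dW\<close> with \<open>Y(T) = \<xi>\<close>.\<close>

definition backward where
  "backward L0' L1' g \<xi> Y Z \<longleftrightarrow> itoproc (\<lambda>s w. - (L0' Y s w + L1' Z s w + g s w)) Z Y \<and> (AE w in M. Y T w = \<xi> w)"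

text \<open>In the expected product rule the terms with \<open>L\<^sub>0\<close> and \<open>L\<^sub>1\<close> cancel against those with their adjoints,
  and only the forcing remains.\<close>

lemma backward_duality:
  assumes L: "causal_op L0" "causal_op L1" "adjoint_op L0 L0'" "adjoint_op L1 L1'" and g: "g \<in> L2P" and \<xi>: "\<xi> \<in> L2 M"
    and Y: "backward L0' L1' g \<xi> Y Z" and X: "solves L0 L1 f0 f1 X" and X0: "AE w in M. X 0 w = 0"
  shows "ip M \<xi> (X T) + IP g X = IP Y f0 + IP Z f1"
proof -
  have Yi: "itoproc (\<lambda>s w. - (L0' Y s w + L1' Z s w + g s w)) Z Y" and YT: "AE w in M. Y T w = \<xi> w"
    using Y by (auto simp: backward_def)
  note x = solvesD[OF X] and yP = Xhat_L2P[OF itoprocD(1)[OF Yi]] and zP = itoprocD(3)[OF Yi]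
  note p = adjoint_opD(1)[OF L(3) yP] adjoint_opD(1)[OF L(4) zP] causal_opD(1)[OF L(1) x(5)] causal_opD(1)[OF L(2) x(5)]
  have T: "T \<in> {0..T}" using T_pos by auto
  have "ip M (Y T) (X T) = ip M \<xi> (X T)"
    using YT L2_measurable[OF \<xi>] L2_measurable[OF Xhat_L2(1)[OF x(4) T]] L2_measurable[OF Xhat_L2(1)[OF itoprocD(1)[OF Yi] T]]
    by (intro ip_cong_AE) auto
  moreover have "ip M (Y T) (X T) + IP (\<lambda>s w. L0' Y s w + L1' Z s w + g s w) X
      = IP Y (\<lambda>s w. L0 X s w + f0 s w) + IP Z (\<lambda>s w. L1 X s w + f1 s w)"
    by (rule itoproc_duality[OF x(3) X0 Yi]) (intro L2P_add p g)
  moreover have "IP (\<lambda>s w. L0' Y s w + L1' Z s w + g s w) X = IP (L0' Y) X + IP (L1' Z) X + IP g X"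
    by (simp add: IP_add_left L2P_add p g x(5))
  moreover have "IP Y (\<lambda>s w. L0 X s w + f0 s w) = IP (L0' Y) X + IP Y f0"
    using adjoint_opD(2)[OF L(3) x(5) yP] by (simp add: IP_add_right p x yP IP_commute[of Y "L0 X"])
  moreover have "IP Z (\<lambda>s w. L1 X s w + f1 s w) = IP (L1' Z) X + IP Z f1"
    using adjoint_opD(2)[OF L(4) x(5) zP] by (simp add: IP_add_right p x zP IP_commute[of Z "L1 X"])
  ultimately show ?thesis by simp
qed

text \<open>Forcings are arbitrary, so both solutions have the same inner products with all processes. Path
  continuity turns equality of \<open>Y\<close> and \<open>Y'\<close> at almost every time into equality at all times.\<close>

lemma backward_unique:
  fixes L0 L1 L0' L1' :: "('w, 'a::euclidean_space) process \<Rightarrow> ('w, 'a) process"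
  assumes L: "causal_op L0" "causal_op L1" "adjoint_op L0 L0'" "adjoint_op L1 L1'" and g: "g \<in> L2P" and \<xi>: "\<xi> \<in> L2 M"
    and Y: "backward L0' L1' g \<xi> Y Z" and Y': "backward L0' L1' g \<xi> Y' Z'"
  shows "AE w in M. \<forall>t\<in>{0..T}. Y' t w = Y t w" and "AE s in TI. AE w in M. Z' s w = Z s w"
proof -
  have y: "Y \<in> XH" "Z \<in> L2P" "Y' \<in> XH" "Z' \<in> L2P" using Y Y' itoprocD unfolding backward_def by blast+
  note yP = Xhat_L2P[OF y(1)] Xhat_L2P[OF y(3)]
  have eq: "IP Y f0 + IP Z f1 = IP Y' f0 + IP Z' f1" if f: "f0 \<in> L2P" "f1 \<in> L2P" for f0 f1
  proof -
    obtain X where "solves L0 L1 f0 f1 X" "AE w in M. X 0 w = 0" using solves_exists[OF L(1,2) f] by blast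
    from backward_duality[OF L g \<xi> Y this] backward_duality[OF L g \<xi> Y' this] show ?thesis by simp
  qed
  have IP0: "IP V (\<lambda>s w. 0) = 0" for V :: "('w, 'a) process" using IP_scaleR_right[of V 0 "\<lambda>s w. 0"] by simp
  have nY: "DR Y' Y = 0"
    using eq[OF _ L2P_zero] by (intro L2P_eq_AE_testing yP) (simp add: IP0)
  have nZ: "DR Z' Z = 0"
    using eq[OF L2P_zero] by (intro L2P_eq_AE_testing y) (simp add: IP0)
  show "AE s in TI. AE w in M. Z' s w = Z s w" using NR_eq_0(1)[OF L2P_diff[OF y(4,2)] nZ] by simp
  show "AE w in M. \<forall>t\<in>{0..T}. Y' t w = Y t w"
    using NR_eq_0(2)[OF L2P_diff[OF yP(2,1)] nY] AE_space
  proof eventually_elim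
    case (elim w)
    have "continuous_on {0..T} (\<lambda>t. Y' t w - Y t w)" using XhatD(2) y elim(2) by (intro continuous_on_diff) blast+
    from continuous_AE_zero[OF T_pos this elim(1)] show ?case by simp
  qed
qed

text \<open>\<open>\<Lambda> f\<^sub>0 f\<^sub>1\<close> is the functional of the forcing that a solution has to represent, and \<open>(Y\<^sub>0, Z\<^sub>0)\<close> is its
  Riesz representer. Put \<open>h = L\<^sub>0' Y\<^sub>0 + L\<^sub>1' Z\<^sub>0 + g\<close>. Martingale representation of \<open>\<xi> + \<integral>\<^sub>0\<^sup>T h ds\<close> gives an Ito
  process \<open>Y\<close> with drift \<open>- h\<close>, diffusion \<open>\<zeta>\<close> and \<open>Y(T) = \<xi>\<close>. Every Ito process with drift \<open>a\<close> and diffusion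
  \<open>b\<close> that starts at \<open>0\<close> solves the forward equation for the forcing \<open>(a - L\<^sub>0 X, b - L\<^sub>1 X)\<close>, so the product
  rule and the representation yield \<open>\<langle>Y, a\<rangle> + \<langle>\<zeta>, b\<rangle> = \<langle>Y\<^sub>0, a\<rangle> + \<langle>Z\<^sub>0, b\<rangle>\<close> for all \<open>a\<close> and \<open>b\<close>. Thus \<open>Y\<close> and \<open>\<zeta>\<close>
  may replace \<open>Y\<^sub>0\<close> and \<open>Z\<^sub>0\<close> in the drift.\<close>

lemma backward_exists:
  fixes L0 L1 L0' L1' :: "('w, 'a::euclidean_space) process \<Rightarrow> ('w, 'a) process"
  assumes L: "causal_op L0" "causal_op L1" "adjoint_op L0 L0'" "adjoint_op L1 L1'" and g: "g \<in> L2P"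
    and \<xi>: "\<xi> \<in> L2 M" "\<xi> \<in> borel_measurable (Fil T)"
  shows "\<exists>Y Z. backward L0' L1' g \<xi> Y Z"
proof -
  have TT: "T \<in> {0..T}" using T_pos by auto
  define S where "S f0 f1 = (SOME X. solves L0 L1 f0 f1 X \<and> (AE w in M. X 0 w = 0))" for f0 f1
  have S: "solves L0 L1 f0 f1 (S f0 f1)" "AE w in M. S f0 f1 0 w = 0" if "f0 \<in> L2P" "f1 \<in> L2P" for f0 f1
    unfolding S_def using someI_ex[OF solves_exists[OF L(1,2) that]] by blast+
  define \<Lambda> where "\<Lambda> f0 f1 = ip M \<xi> (S f0 f1 T) + IP g (S f0 f1)" for f0 f1
  have \<Lambda>: "\<Lambda> f0 f1 = ip M \<xi> (X T) + IP g X" if X: "solves L0 L1 f0 f1 X" and X0: "AE w in M. X 0 w = 0" for f0 f1 X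
  proof -
    note x = solvesD[OF X] and s = S[OF solvesD(1,2)[OF X]]
    note sx = solvesD[OF s(1)]
    have "AE w in M. S f0 f1 0 w = X 0 w" using s(2) X0 by eventually_elim simp
    then have ae: "AE w in M. \<forall>t\<in>{0..T}. S f0 f1 t w = X t w" by (intro solves_unique[OF L(1,2) s(1) X]) auto
    have "AE w in M. S f0 f1 T w = X T w" using ae by (rule eventually_mono) (use TT in blast)
    then have "ip M \<xi> (S f0 f1 T) = ip M \<xi> (X T)"
      using \<xi>(1) Xhat_L2(1)[OF x(4) TT] Xhat_L2(1)[OF sx(4) TT] by (intro ip_cong_AE L2_measurable) auto
    moreover have "DR (S f0 f1) X = 0"
      by (rule NR_eq_0_I[OF L2P_diff[OF sx(5) x(5)]], rule AE_I2, rule eventually_mono[OF ae]) auto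
    ultimately show ?thesis using IP_cong[OF sx(5) x(5) _ g] by (simp add: \<Lambda>_def IP_commute[of g])
  qed
  have \<Lambda>lin: "\<Lambda> (\<lambda>s w. f0 s w + r *\<^sub>R g0 s w) (\<lambda>s w. f1 s w + r *\<^sub>R g1 s w) = \<Lambda> f0 f1 + r * \<Lambda> g0 g1"
    if f: "f0 \<in> L2P" "f1 \<in> L2P" "g0 \<in> L2P" "g1 \<in> L2P" for f0 f1 g0 g1 r
  proof -
    note a = S[OF f(1,2)] and b = S[OF f(3,4)]
    note a' = solvesD(4,5)[OF a(1)] and b' = solvesD(4,5)[OF b(1)]
    have z: "AE w in M. S f0 f1 0 w + r *\<^sub>R S g0 g1 0 w = 0" using a(2) b(2) by eventually_elim simp
    show ?thesis
      unfolding \<Lambda>[OF solves_linear[OF L(1,2) a(1) b(1)] z]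
      using \<xi>(1) g a' b' Xhat_L2(1)[OF a'(1) TT] Xhat_L2(1)[OF b'(1) TT]
      by (simp add: \<Lambda>_def ip_add_right L2_scaleR ip_scaleR_right IP_add_right L2P_scaleR IP_scaleR_right algebra_simps)
  qed
  obtain C where C: "C \<ge> 0" "\<And>f0 f1 X. solves L0 L1 f0 f1 X \<Longrightarrow> (AE w in M. X 0 w = 0) \<Longrightarrow>
    nrm M (X T) \<le> C * (NR f0 + NR f1) \<and> NR X \<le> C * (NR f0 + NR f1)" using solves_bound[OF L(1,2)] by blast
  have \<Lambda>b: "\<bar>\<Lambda> f0 f1\<bar> \<le> (nrm M \<xi> + NR g) * C * (NR f0 + NR f1)" if f: "f0 \<in> L2P" "f1 \<in> L2P" for f0 f1
  proof -
    note s = S[OF f]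
    note s' = solvesD(4,5)[OF s(1)]
    have "\<bar>\<Lambda> f0 f1\<bar> \<le> nrm M \<xi> * nrm M (S f0 f1 T) + NR g * NR (S f0 f1)"
      using ip_Cauchy_Schwarz[OF \<xi>(1) Xhat_L2(1)[OF s'(1) TT]] IP_Cauchy_Schwarz[OF g s'(2)] unfolding \<Lambda>_def by linarith
    also have "\<dots> \<le> nrm M \<xi> * (C * (NR f0 + NR f1)) + NR g * (C * (NR f0 + NR f1))"
      using C(2)[OF s] by (intro add_mono mult_left_mono) auto
    also have "\<dots> = (nrm M \<xi> + NR g) * C * (NR f0 + NR f1)" by (simp add: algebra_simps)
    finally show ?thesis .
  qed
  let ?z = "\<lambda>(s::real) (w::'w). 0 :: 'a"
  have \<Lambda>z: "\<Lambda> ?z ?z = 0" using \<Lambda>b[OF L2P_zero L2P_zero] by simp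
  have "\<exists>Y0\<in>L2P. \<forall>\<phi>\<in>L2P. \<Lambda> \<phi> ?z = IP Y0 \<phi>"
  proof (rule L2P_Riesz)
    show "\<Lambda> (\<lambda>s w. \<phi> s w + \<psi> s w) ?z = \<Lambda> \<phi> ?z + \<Lambda> \<psi> ?z" if "\<phi> \<in> L2P" "\<psi> \<in> L2P" for \<phi> \<psi>
      using \<Lambda>lin[OF that(1) L2P_zero that(2) L2P_zero, of 1] by simp
    show "\<Lambda> (\<lambda>s w. r *\<^sub>R \<phi> s w) ?z = r * \<Lambda> \<phi> ?z" if "\<phi> \<in> L2P" for \<phi> r
      using \<Lambda>lin[OF L2P_zero L2P_zero that L2P_zero, of r] \<Lambda>z by simp
    show "\<bar>\<Lambda> \<phi> ?z\<bar> \<le> ((nrm M \<xi> + NR g) * C) * NR \<phi>" if "\<phi> \<in> L2P" for \<phi> using \<Lambda>b[OF that L2P_zero] by simp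
  qed
  then obtain Y0 where Y0: "Y0 \<in> L2P" "\<And>\<phi>. \<phi> \<in> L2P \<Longrightarrow> \<Lambda> \<phi> ?z = IP Y0 \<phi>" by blast
  have "\<exists>Z0\<in>L2P. \<forall>\<phi>\<in>L2P. \<Lambda> ?z \<phi> = IP Z0 \<phi>"
  proof (rule L2P_Riesz)
    show "\<Lambda> ?z (\<lambda>s w. \<phi> s w + \<psi> s w) = \<Lambda> ?z \<phi> + \<Lambda> ?z \<psi>" if "\<phi> \<in> L2P" "\<psi> \<in> L2P" for \<phi> \<psi>
      using \<Lambda>lin[OF L2P_zero that(1) L2P_zero that(2), of 1] by simp
    show "\<Lambda> ?z (\<lambda>s w. r *\<^sub>R \<phi> s w) = r * \<Lambda> ?z \<phi>" if "\<phi> \<in> L2P" for \<phi> r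
      using \<Lambda>lin[OF L2P_zero L2P_zero L2P_zero that, of r] \<Lambda>z by simp
    show "\<bar>\<Lambda> ?z \<phi>\<bar> \<le> ((nrm M \<xi> + NR g) * C) * NR \<phi>" if "\<phi> \<in> L2P" for \<phi> using \<Lambda>b[OF L2P_zero that] by simp
  qed
  then obtain Z0 where Z0: "Z0 \<in> L2P" "\<And>\<phi>. \<phi> \<in> L2P \<Longrightarrow> \<Lambda> ?z \<phi> = IP Z0 \<phi>" by blast
  have rep: "\<Lambda> f0 f1 = IP Y0 f0 + IP Z0 f1" if f: "f0 \<in> L2P" "f1 \<in> L2P" for f0 f1
    using \<Lambda>lin[OF f(1) L2P_zero L2P_zero f(2), of 1] Y0(2)[OF f(1)] Z0(2)[OF f(2)] by simp
  define h where "h s w = L0' Y0 s w + L1' Z0 s w + g s w" for s w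
  note p0 = adjoint_opD(1)[OF L(3) Y0(1)] adjoint_opD(1)[OF L(4) Z0(1)]
  have h: "h \<in> L2P" unfolding h_def[abs_def] by (intro L2P_add p0 g)
  define N where "N w = \<xi> w + Tint h T w" for w
  have "N \<in> L2 M" "N \<in> borel_measurable (Fil T)" unfolding N_def[abs_def]
    by (intro L2_add \<xi> Tint_L2(1) h TT borel_measurable_add Tint_Fil)+
  then obtain \<zeta> I where I: "is_ito \<zeta> I" "AE w in M. N w = (\<integral>w. N w \<partial>M) + I T w"
    using martingale_representation by blast
  have \<zeta>: "\<zeta> \<in> L2P" using I(1) by (simp add: is_ito_integral_def)
  have mh: "(\<lambda>s w. - h s w) \<in> L2P" using L2P_scaleR[OF h, of "-1"] by simp
  obtain Y where Y: "itoproc (\<lambda>s w. - h s w) \<zeta> Y" "AE w in M. Y 0 w = (\<integral>w. N w \<partial>M)"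
    using itoproc_exists[OF mh \<zeta>] by blast
  note YP = Xhat_L2P[OF itoprocD(1)[OF Y(1)]]
  obtain J where J: "is_ito \<zeta> J" "AE w in M. \<forall>t\<in>{0..T}. Y t w = Y 0 w + Tint (\<lambda>s w. - h s w) t w + J t w"
    using Y(1) by (auto simp: itoproc_def)
  have "AE w in M. \<forall>t\<in>{0..T}. J t w = I t w + 0 *\<^sub>R I t w" by (rule ito_linear[OF I(1) I(1) J(1)]) simp
  then have YT: "AE w in M. Y T w = \<xi> w"
    using J(2) I(2) Y(2)
  proof eventually_elim
    case (elim w)
    have "Tint (\<lambda>s w. - h s w) T w = - Tint h T w" by (simp add: Tint_def)
    then show ?case using bspec[OF elim(1) TT] bspec[OF elim(2) TT] elim(3,4)
      by (simp add: N_def algebra_simps) (metis add_right_imp_eq)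
  qed
  have key: "IP Y a + IP \<zeta> b = IP Y0 a + IP Z0 b" if a: "a \<in> L2P" and b: "b \<in> L2P" for a b
  proof -
    obtain X where X: "itoproc a b X" "AE w in M. X 0 w = 0" using itoproc_exists[OF a b] by blast
    note XP = Xhat_L2P[OF itoprocD(1)[OF X(1)]] and XT = Xhat_L2(1)[OF itoprocD(1)[OF X(1)] TT]
    note p = causal_opD(1)[OF L(1) XP] causal_opD(1)[OF L(2) XP]
    let ?f0 = "\<lambda>s w. a s w - L0 X s w" and ?f1 = "\<lambda>s w. b s w - L1 X s w"
    have f: "?f0 \<in> L2P" "?f1 \<in> L2P" by (intro L2P_diff a b p)+
    have s: "solves L0 L1 ?f0 ?f1 X" unfolding solves_def using f X(1) by simp
    have "ip M \<xi> (X T) + IP g X = IP Y0 ?f0 + IP Z0 ?f1" using \<Lambda>[OF s X(2)] rep[OF f] by simp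
    also have "\<dots> = IP Y0 a + IP Z0 b - IP (L0' Y0) X - IP (L1' Z0) X"
      using adjoint_opD(2)[OF L(3) XP Y0(1)] adjoint_opD(2)[OF L(4) XP Z0(1)]
      by (simp add: IP_diff_right a b p Y0 Z0 IP_commute[of Y0 "L0 X"] IP_commute[of Z0 "L1 X"])
    finally have 1: "ip M \<xi> (X T) + IP g X = IP Y0 a + IP Z0 b - IP (L0' Y0) X - IP (L1' Z0) X" .
    have "ip M (Y T) (X T) = ip M \<xi> (X T)"
      using YT L2_measurable[OF \<xi>(1)] L2_measurable[OF XT] L2_measurable[OF Xhat_L2(1)[OF itoprocD(1)[OF Y(1)] TT]]
      by (intro ip_cong_AE) auto
    moreover have "IP h X = IP (L0' Y0) X + IP (L1' Z0) X + IP g X"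
      unfolding h_def[abs_def] by (simp add: IP_add_left L2P_add p0 g XP)
    ultimately show ?thesis using itoproc_duality[OF X Y(1) h] 1 by simp
  qed
  have IP0: "IP V ?z = 0" for V :: "('w, 'a) process" using IP_scaleR_right[of V 0 ?z] by simp
  have nY: "DR Y0 Y = 0" using key[OF _ L2P_zero] by (intro L2P_eq_AE_testing YP Y0) (simp add: IP0)
  have nZ: "DR Z0 \<zeta> = 0" using key[OF L2P_zero] by (intro L2P_eq_AE_testing \<zeta> Z0) (simp add: IP0)
  \<comment> \<open>the drift may now be written in terms of \<open>Y\<close> and \<open>\<zeta>\<close>\<close>
  note n0 = adjoint_op_cong[OF L(1,3) Y0(1) YP nY] and n1 = adjoint_op_cong[OF L(2,4) Z0(1) \<zeta> nZ]
  note q = adjoint_opD(1)[OF L(3) YP] adjoint_opD(1)[OF L(4) \<zeta>]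
  let ?h = "\<lambda>s w. L0' Y s w + L1' \<zeta> s w + g s w"
  have "NR (\<lambda>s w. (L0' Y0 s w - L0' Y s w) + (L1' Z0 s w - L1' \<zeta> s w)) \<le> 0"
    using NR_triangle[OF L2P_diff[OF p0(1) q(1)] L2P_diff[OF p0(2) q(2)]] n0 n1 by simp
  then have "NR (\<lambda>s w. (-1) *\<^sub>R ((L0' Y0 s w - L0' Y s w) + (L1' Z0 s w - L1' \<zeta> s w))) = 0"
    using NR_nonneg order_antisym unfolding NR_scaleR by fastforce
  moreover have "(\<lambda>s w. (-1) *\<^sub>R ((L0' Y0 s w - L0' Y s w) + (L1' Z0 s w - L1' \<zeta> s w))) = (\<lambda>s w. - h s w - - ?h s w)"
    by (simp add: h_def fun_eq_iff)
  ultimately have nh: "NR (\<lambda>s w. - h s w - - ?h s w) = 0" by (simp only:)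
  have "?h \<in> L2P" by (intro L2P_add q g)
  from L2P_scaleR[OF this, of "-1"] have "(\<lambda>s w. - ?h s w) \<in> L2P" by (simp only: scaleR_minus1_left)
  from itoproc_cong[OF Y(1) this nh \<zeta>] have "itoproc (\<lambda>s w. - ?h s w) \<zeta> Y" by simp
  with YT show ?thesis unfolding backward_def by blast
qed

end

section \<open>Mean-field operators\<close>

lemma matrix_vector_mult_norm_le:
  fixes A :: "real^'k^'n" shows "norm (A *v x) \<le> real CARD('n) * norm A * norm x"
proof -
  have "norm (A *v x) \<le> (\<Sum>i\<in>UNIV. \<bar>(A *v x) $ i\<bar>)" by (rule norm_le_l1_cart)
  also have "\<dots> \<le> (\<Sum>i\<in>(UNIV::'n set). norm A * norm x)"
  proof (rule sum_mono)
    fix i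
    have "\<bar>(A *v x) $ i\<bar> \<le> norm (A $ i) * norm x" unfolding matrix_vector_mul_component by (rule Cauchy_Schwarz_ineq2)
    also have "\<dots> \<le> norm A * norm x" by (intro mult_right_mono Finite_Cartesian_Product.norm_nth_le norm_ge_zero)
    finally show "\<bar>(A *v x) $ i\<bar> \<le> norm A * norm x" .
  qed
  finally show ?thesis by (simp add: mult.assoc)
qed

lemma borel_measurable_matrix_vector_mult:
  fixes A :: "'x \<Rightarrow> real^'k^'n"
  assumes "A \<in> borel_measurable N" "f \<in> borel_measurable N"
  shows "(\<lambda>x. A x *v f x) \<in> borel_measurable N"
proof (rule borel_measurable_continuous_Pair[OF assms])
  show "continuous_on UNIV (\<lambda>x. fst x *v (snd x :: real^'k) :: real^'n)"
    unfolding matrix_vector_mult_def by (intro continuous_intros)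
qed

lemma inner_transpose: "(A *v x) \<bullet> y = x \<bullet> (transpose A *v y)" for A :: "real^'k^'n"
  by (metis dot_lmul_matrix inner_commute transpose_transpose vector_transpose_matrix)

lemma transpose_Linf:
  fixes A :: "real \<Rightarrow> real^'k^'n"
  assumes "A \<in> Linf T" shows "(\<lambda>s. transpose (A s)) \<in> Linf T"
proof -
  have lin: "linear (transpose :: real^'k^'n \<Rightarrow> real^'n^'k)"
    by (rule linearI) (simp_all add: transpose_def vec_eq_iff)
  then have bl: "bounded_linear (transpose :: real^'k^'n \<Rightarrow> real^'n^'k)" by (simp add: linear_conv_bounded_linear)
  obtain K where K: "0 < K" "\<And>B :: real^'k^'n. norm (transpose B) \<le> norm B * K" using bounded_linear.pos_bounded[OF bl] by blast
  obtain C where C: "AE s in lebesgue_on {0..T}. norm (A s) \<le> C" and m: "A \<in> borel_measurable (lebesgue_on {0..T})"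
    using assms by (auto simp: Linf_def)
  have "AE s in lebesgue_on {0..T}. norm (transpose (A s)) \<le> C * K"
    using C by eventually_elim (use K mult_right_mono order_trans less_imp_le in metis)
  moreover have "(\<lambda>s. transpose (A s)) \<in> borel_measurable (lebesgue_on {0..T})"
    by (rule measurable_compose[OF m borel_measurable_continuous_onI[OF linear_continuous_on[OF bl]]])
  ultimately show ?thesis by (auto simp: Linf_def)
qed

context bm_horizon
begin

definition mat_op :: "(real \<Rightarrow> real^'k::finite^'n::finite) \<Rightarrow> (real \<Rightarrow> 'w \<Rightarrow> real^'k) \<Rightarrow> real \<Rightarrow> 'w \<Rightarrow> real^'n" where
  "mat_op A X s w = A s *v X s w"

definition mean_op :: "('w, 'a::euclidean_space) process \<Rightarrow> ('w, 'a) process" where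
  "mean_op X s w = mean M X s"

lemma mat_op_bound:
  fixes A :: "real \<Rightarrow> real^'k^'n"
  assumes A: "A \<in> Linf T"
  shows "\<exists>K\<ge>0. \<forall>X\<in>L2P. mat_op A X \<in> L2P \<and> NR (mat_op A X) \<le> K * NR X"
proof -
  obtain C where C: "AE s in TI. norm (A s) \<le> C" and m[measurable]: "A \<in> borel_measurable TI" using A by (auto simp: Linf_def)
  define K where "K = real CARD('n) * \<bar>C\<bar>"
  have K: "0 \<le> K" by (simp add: K_def)
  have le: "AE s in TI. sqn (mat_op A X s w) \<le> ennreal (K\<^sup>2) * sqn (X s w)" for X w
    using C
  proof eventually_elim
    case (elim s)
    have "norm (mat_op A X s w) \<le> real CARD('n) * norm (A s) * norm (X s w)" unfolding mat_op_def by (rule matrix_vector_mult_norm_le)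
    also have "\<dots> \<le> K * norm (X s w)" unfolding K_def using elim by (intro mult_right_mono mult_left_mono) auto
    finally have "(norm (mat_op A X s w))\<^sup>2 \<le> (K * norm (X s w))\<^sup>2" by (intro power_mono) auto
    then show ?case by (simp add: power_mult_distrib ennreal_mult[symmetric] ennreal_leI)
  qed
  have "mat_op A X \<in> L2P \<and> NR (mat_op A X) \<le> K * NR X" if X: "X \<in> L2P" for X
  proof -
    have [measurable]: "case_prod X \<in> borel_measurable LM" using L2P_measurable[OF X] .
    have "(\<integral>\<^sup>+w. (\<integral>\<^sup>+s. sqn (mat_op A X s w) \<partial>TI) \<partial>M)
        \<le> (\<integral>\<^sup>+w. (\<integral>\<^sup>+s. ennreal (K\<^sup>2) * sqn (X s w) \<partial>TI) \<partial>M)"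
      by (intro nn_integral_mono nn_integral_mono_AE le)
    also have "\<dots> = (\<integral>\<^sup>+w. ennreal (K\<^sup>2) * (\<integral>\<^sup>+s. sqn (X s w) \<partial>TI) \<partial>M)"
    proof (intro nn_integral_cong nn_integral_cmult)
      fix w assume "w \<in> space M"
      from L2P_measurable_path[OF X this] show "(\<lambda>s. sqn (X s w)) \<in> borel_measurable TI" by measurable
    qed
    also have "\<dots> = ennreal (K\<^sup>2) * (\<integral>\<^sup>+w. (\<integral>\<^sup>+s. sqn (X s w) \<partial>TI) \<partial>M)"
    proof (rule nn_integral_cmult)
      have "(\<lambda>w. \<integral>\<^sup>+s. sqn (case_prod X (s, w)) \<partial>TI) \<in> borel_measurable M" by measurable
      then show "(\<lambda>w. \<integral>\<^sup>+s. sqn (X s w) \<partial>TI) \<in> borel_measurable M" by simp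
    qed
    also have "\<dots> = ennreal ((K * NR X)\<^sup>2)" unfolding nn_integral_L2P(1)[OF X] by (simp add: ennreal_mult[symmetric] power_mult_distrib)
    finally have b: "(\<integral>\<^sup>+w. (\<integral>\<^sup>+s. sqn (mat_op A X s w) \<partial>TI) \<partial>M) \<le> ennreal ((K * NR X)\<^sup>2)" .
    have "(\<lambda>p. A (fst p) *v case_prod X p) \<in> borel_measurable LM"
      by (intro borel_measurable_matrix_vector_mult) measurable
    moreover have "mat_op A X t \<in> borel_measurable (Fil t)" if "t \<in> {0..T}" for t
      unfolding mat_op_def[abs_def] using L2P_adapted[OF X that] by (intro borel_measurable_matrix_vector_mult) auto
    ultimately have L: "mat_op A X \<in> L2P"
      unfolding L2F_def using le_less_trans[OF b] by (simp add: mat_op_def case_prod_beta')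
    have "ennreal ((NR (mat_op A X))\<^sup>2) \<le> ennreal ((K * NR X)\<^sup>2)" using b unfolding nn_integral_L2P(1)[OF L] .
    then have "(NR (mat_op A X))\<^sup>2 \<le> (K * NR X)\<^sup>2" by (rule ennreal_le_iff[THEN iffD1, rotated]) simp
    then have "NR (mat_op A X) \<le> K * NR X" by (rule power2_le_imp_le) (use K in simp)
    with L show ?thesis ..
  qed
  with K show ?thesis by blast
qed

lemma mat_op_L2P: "A \<in> Linf T \<Longrightarrow> X \<in> L2P \<Longrightarrow> mat_op A X \<in> L2P"
  using mat_op_bound by blast

lemma mean_op_L2P:
  fixes X :: "('w, 'a::euclidean_space) process"
  assumes X: "X \<in> L2P" shows "mean_op X \<in> L2P" "NR (mean_op X) \<le> NR X"
proof -
  have XM: "case_prod X \<in> borel_measurable LM" using L2P_measurable[OF X] .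
  have "(\<lambda>s. \<integral>w. X s w \<partial>M) \<in> borel_measurable TI" using borel_measurable_lebesgue_integral[of X TI] XM by simp
  then have mm: "(\<lambda>s. mean M X s) \<in> borel_measurable TI" by (simp add: mean_def)
  then have m: "(\<lambda>(s, w). mean_op X s w) \<in> borel_measurable LM"
    unfolding mean_op_def case_prod_beta' by measurable
  have "(\<integral>\<^sup>+w. (\<integral>\<^sup>+s. sqn (mean_op X s w) \<partial>TI) \<partial>M) = (\<integral>\<^sup>+s. (\<integral>\<^sup>+w. sqn (mean_op X s w) \<partial>M) \<partial>TI)"
    using m by (intro LM.Fubini') (simp add: case_prod_beta')
  also have "\<dots> \<le> (\<integral>\<^sup>+s. (\<integral>\<^sup>+w. sqn (X s w) \<partial>M) \<partial>TI)"
  proof (rule nn_integral_mono_AE)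
    show "AE s in TI. (\<integral>\<^sup>+w. sqn (mean_op X s w) \<partial>M) \<le> (\<integral>\<^sup>+w. sqn (X s w) \<partial>M)"
      using L2P_AE_L2[OF X]
    proof eventually_elim
      case (elim s)
      have "norm (mean M X s) \<le> nrm M (X s)" using L2_integrable_finite(2)[OF finite_measure_axioms elim] by (simp add: mean_def prob_space)
      then have "(norm (mean M X s))\<^sup>2 \<le> ip M (X s) (X s)" unfolding nrm_power2[symmetric] by (intro power_mono) auto
      then show ?case by (simp add: mean_op_def nn_integral_norm2[OF elim] emeasure_space_1 ennreal_leI)
    qed
  qed
  also have "\<dots> = ennreal ((NR X)\<^sup>2)" by (rule nn_integral_L2P(2)[OF X])
  finally have b: "(\<integral>\<^sup>+w. (\<integral>\<^sup>+s. sqn (mean_op X s w) \<partial>TI) \<partial>M) \<le> ennreal ((NR X)\<^sup>2)" .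
  have "(\<integral>\<^sup>+w. (\<integral>\<^sup>+s. sqn (mean_op X s w) \<partial>TI) \<partial>M) < \<infinity>" by (rule le_less_trans[OF b]) simp
  moreover have "mean_op X t \<in> borel_measurable (Fil t)" for t unfolding mean_op_def[abs_def] by simp
  ultimately show L: "mean_op X \<in> L2P" unfolding L2F_def using m by blast
  have "ennreal ((NR (mean_op X))\<^sup>2) \<le> ennreal ((NR X)\<^sup>2)" using b unfolding nn_integral_L2P(1)[OF L] .
  then have "(NR (mean_op X))\<^sup>2 \<le> (NR X)\<^sup>2" by (rule ennreal_le_iff[THEN iffD1, rotated]) simp
  then show "NR (mean_op X) \<le> NR X" by (rule power2_le_imp_le) simp
qed

definition mf :: "(real \<Rightarrow> real^'k::finite^'n::finite) \<Rightarrow> (real \<Rightarrow> real^'k^'n) \<Rightarrow> (real \<Rightarrow> 'w \<Rightarrow> real^'k) \<Rightarrow> real \<Rightarrow> 'w \<Rightarrow> real^'n" where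
  "mf A Ah X s w = A s *v X s w + Ah s *v mean M X s"

lemma mf_eq: "mf A Ah X = (\<lambda>s w. mat_op A X s w + mat_op Ah (mean_op X) s w)"
  by (simp add: fun_eq_iff mf_def mat_op_def mean_op_def)

lemma mf_L2P:
  assumes "A \<in> Linf T" "Ah \<in> Linf T" "X \<in> L2P" shows "mf A Ah X \<in> L2P"
  unfolding mf_eq by (rule L2P_add[OF mat_op_L2P[OF assms(1,3)] mat_op_L2P[OF assms(2) mean_op_L2P(1)[OF assms(3)]]])

lemma mean_linear:
  fixes X Y :: "('w, 'a::euclidean_space) process"
  assumes "X s \<in> L2 M" "Y s \<in> L2 M" shows "mean M (\<lambda>s w. X s w + r *\<^sub>R Y s w) s = mean M X s + r *\<^sub>R mean M Y s"
  using L2_integrable_finite(1)[OF finite_measure_axioms assms(1)] L2_integrable_finite(1)[OF finite_measure_axioms assms(2)]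
  by (simp add: mean_def)

lemma mf_linear_at:
  assumes "X s \<in> L2 M" "Y s \<in> L2 M"
  shows "mf A Ah (\<lambda>s w. X s w + r *\<^sub>R Y s w) s w = mf A Ah X s w + r *\<^sub>R mf A Ah Y s w"
  unfolding mf_def mean_linear[of X s Y r, OF assms] by (simp add: matrix_vector_right_distrib matrix_vector_mult_scaleR scaleR_add_right)

text \<open>Additivity fails at times where the process is not integrable, since the mean is then a default
  value. Such times form a null set.\<close>

lemma mf_causal:
  fixes A Ah :: "real \<Rightarrow> real^'k^'n"
  assumes A: "A \<in> Linf T" "Ah \<in> Linf T" shows "causal_op (mf A Ah)"
  unfolding causal_op_def
proof (intro conjI ballI allI)
  show "mf A Ah X \<in> L2P" if "X \<in> L2P" for X by (rule mf_L2P[OF A that])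
  show "NR (\<lambda>s w. mf A Ah (\<lambda>s w. X s w + r *\<^sub>R Y s w) s w - (mf A Ah X s w + r *\<^sub>R mf A Ah Y s w)) = 0"
    if X: "X \<in> L2P" and Y: "Y \<in> L2P" for X Y r
  proof (rule NR_eq_0_I)
    show "AE s in TI. AE w in M. mf A Ah (\<lambda>s w. X s w + r *\<^sub>R Y s w) s w - (mf A Ah X s w + r *\<^sub>R mf A Ah Y s w) = 0"
      using L2P_AE_L2[OF X] L2P_AE_L2[OF Y] by eventually_elim (simp add: mf_linear_at)
  qed (intro L2P_diff L2P_add L2P_scaleR mf_L2P A X Y)
  obtain K where K: "K \<ge> 0" "\<And>X. X \<in> L2P \<Longrightarrow> NR (mat_op A X) \<le> K * NR X" using mat_op_bound[OF A(1)] by blast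
  obtain Kh where Kh: "Kh \<ge> 0" "\<And>X. X \<in> L2P \<Longrightarrow> NR (mat_op Ah X) \<le> Kh * NR X" using mat_op_bound[OF A(2)] by blast
  have b: "NR (mf A Ah X) \<le> (K + Kh) * NR X" if X: "X \<in> L2P" for X
  proof -
    have "NR (mf A Ah X) \<le> NR (mat_op A X) + NR (mat_op Ah (mean_op X))"
      unfolding mf_eq by (intro NR_triangle mat_op_L2P mean_op_L2P A X)
    also have "\<dots> \<le> K * NR X + Kh * NR X"
      using K(2)[OF X] Kh(2)[OF mean_op_L2P(1)[OF X]] mult_left_mono[OF mean_op_L2P(2)[OF X] Kh(1)] by linarith
    finally show ?thesis by (simp add: distrib_right)
  qed
  have "cut t (mf A Ah X) = mf A Ah (cut t X)" for t X
    by (simp add: fun_eq_iff cut_def[abs_def] mf_def mean_def matrix_vector_mult_scaleR scaleR_add_right)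
  then have "NR (cut t (mf A Ah X)) \<le> (K + Kh) * NR (cut t X)" if "X \<in> L2P" for X t using b[OF cut_L2P[OF that, of t]] by simp
  then show "\<exists>K\<ge>0. \<forall>X\<in>L2P. \<forall>t\<in>{0..T}. NR (cut t (mf A Ah X)) \<le> K * NR (cut t X)" using K(1) Kh(1) by (intro exI[of _ "K + Kh"]) auto
qed

lemma mat_op_adjoint: "IP (mat_op A X) Y = IP X (mat_op (\<lambda>s. transpose (A s)) Y)"
  unfolding IP_def ip_def by (intro LINT_cong) (auto simp: mat_op_def inner_transpose)

text \<open>At almost every time both sides are the inner product of the two means.\<close>

lemma mean_op_adjoint:
  fixes X Y :: "('w, 'a::euclidean_space) process"
  assumes X: "X \<in> L2P" and Y: "Y \<in> L2P" shows "IP (mean_op X) Y = IP X (mean_op Y)"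
  unfolding IP_eq_time_outer[OF mean_op_L2P(1)[OF X] Y] IP_eq_time_outer[OF X mean_op_L2P(1)[OF Y]]
proof (rule integral_cong_AE)
  show "(\<lambda>s. ip M (mean_op X s) (Y s)) \<in> borel_measurable TI" "(\<lambda>s. ip M (X s) (mean_op Y s)) \<in> borel_measurable TI"
    using ip_time_integrable mean_op_L2P(1) X Y by blast+
  show "AE s in TI. ip M (mean_op X s) (Y s) = ip M (X s) (mean_op Y s)"
    using L2P_AE_L2[OF X] L2P_AE_L2[OF Y]
  proof eventually_elim
    case (elim s)
    note i = L2_integrable_finite(1)[OF finite_measure_axioms elim(1)] L2_integrable_finite(1)[OF finite_measure_axioms elim(2)]
    show ?case unfolding ip_def mean_op_def using i by (simp add: mean_def)
  qed
qed

lemma mean_op_mat_op: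
  fixes A :: "real \<Rightarrow> real^'k^'n"
  assumes A: "A \<in> Linf T" and X: "X \<in> L2P" shows "DR (mean_op (mat_op A X)) (mat_op A (mean_op X)) = 0"
proof (rule NR_eq_0_I)
  show "AE s in TI. AE w in M. mean_op (mat_op A X) s w - mat_op A (mean_op X) s w = 0"
    using L2P_AE_L2[OF X]
  proof eventually_elim
    case (elim s)
    have "(\<integral>w. A s *v X s w \<partial>M) = A s *v (\<integral>w. X s w \<partial>M)"
      by (rule integral_bounded_linear[OF matrix_vector_mul_bounded_linear L2_integrable_finite(1)[OF finite_measure_axioms elim]])
    then show ?case by (simp add: mean_op_def mat_op_def[abs_def] mean_def)
  qed
qed (intro L2P_diff mat_op_L2P mean_op_L2P A X)

lemma mat_op_mean_op_adjoint:
  fixes A :: "real \<Rightarrow> real^'k^'n"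
  assumes A: "A \<in> Linf T" and X: "X \<in> L2P" and Y: "Y \<in> L2P"
  shows "IP (mat_op A (mean_op X)) Y = IP (mat_op A (mean_op X)) (mean_op Y)" "IP (mat_op A (mean_op X)) Y = IP X (mat_op (\<lambda>s. transpose (A s)) (mean_op Y))"
proof -
  note At = transpose_Linf[OF A]
  have "IP (mat_op A (mean_op X)) Y = IP (mean_op X) (mat_op (\<lambda>s. transpose (A s)) Y)" by (rule mat_op_adjoint)
  also have "\<dots> = IP X (mean_op (mat_op (\<lambda>s. transpose (A s)) Y))" by (intro mean_op_adjoint X mat_op_L2P At Y)
  also have "\<dots> = IP X (mat_op (\<lambda>s. transpose (A s)) (mean_op Y))"
    using IP_cong[OF _ _ mean_op_mat_op[OF At Y] X] by (simp add: IP_commute[of X] mean_op_L2P mat_op_L2P At Y)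
  finally show 2: "IP (mat_op A (mean_op X)) Y = IP X (mat_op (\<lambda>s. transpose (A s)) (mean_op Y))" .
  have "IP (mat_op A (mean_op X)) (mean_op Y) = IP (mean_op (mat_op A (mean_op X))) Y" by (intro mean_op_adjoint[symmetric] mat_op_L2P A mean_op_L2P X Y)
  also have "mean_op (mat_op A (mean_op X)) = mat_op A (mean_op X)" by (simp add: fun_eq_iff mean_op_def[abs_def] mat_op_def[abs_def] mean_def prob_space)
  finally show "IP (mat_op A (mean_op X)) Y = IP (mat_op A (mean_op X)) (mean_op Y)" ..
qed

lemma mf_adjoint:
  fixes A Ah :: "real \<Rightarrow> real^'k^'n"
  assumes A: "A \<in> Linf T" "Ah \<in> Linf T"
  shows "adjoint_op (mf A Ah) (mf (\<lambda>s. transpose (A s)) (\<lambda>s. transpose (Ah s)))"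
  unfolding adjoint_op_def
proof (intro conjI ballI)
  note At = transpose_Linf[OF A(1)] transpose_Linf[OF A(2)]
  show "mf (\<lambda>s. transpose (A s)) (\<lambda>s. transpose (Ah s)) Y \<in> L2P" if "Y \<in> L2P" for Y by (rule mf_L2P[OF At that])
  show "IP (mf A Ah X) Y = IP X (mf (\<lambda>s. transpose (A s)) (\<lambda>s. transpose (Ah s)) Y)" if X: "X \<in> L2P" and Y: "Y \<in> L2P" for X Y
    unfolding mf_eq by (simp add: IP_add_left IP_add_right mat_op_L2P mean_op_L2P A At X Y mat_op_adjoint[of A] mat_op_mean_op_adjoint(2)[OF A(2)])
qed

lemma mf_symmetric:
  fixes Q Qh :: "real \<Rightarrow> real^'n^'n"
  assumes Q: "Q \<in> Linf_sym T" "Qh \<in> Linf_sym T" and X: "X \<in> L2P" and Y: "Y \<in> L2P"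
  shows "IP (mf Q Qh X) Y = IP (mf Q Qh Y) X"
proof -
  have A: "Q \<in> Linf T" "Qh \<in> Linf T" and s: "AE s in TI. transpose (Q s) = Q s" "AE s in TI. transpose (Qh s) = Qh s"
    using Q by (auto simp: Linf_sym_def sym_matrix_def)
  let ?Y = "mf (\<lambda>s. transpose (Q s)) (\<lambda>s. transpose (Qh s)) Y"
  have P: "?Y \<in> L2P" "mf Q Qh Y \<in> L2P" by (intro mf_L2P transpose_Linf A Y)+
  have "AE s in TI. AE w in M. ?Y s w - mf Q Qh Y s w = 0" using s by eventually_elim (simp add: mf_def)
  then have "DR ?Y (mf Q Qh Y) = 0" by (intro NR_eq_0_I L2P_diff P)
  from IP_cong[OF P this X] adjoint_opD(2)[OF mf_adjoint[OF A] X Y] show ?thesis by simp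
qed

end

section \<open>The mean-field control problem\<close>

lemma lebesgue_integral_split:
  fixes f :: "real \<Rightarrow> 'a::euclidean_space"
  assumes f: "integrable (lebesgue_on {0..T}) f" and t: "t \<in> {0..T}"
  shows "(\<integral>s. f s \<partial>lebesgue_on {t..T}) = (\<integral>s. f s \<partial>lebesgue_on {0..T}) - (\<integral>s. f s \<partial>lebesgue_on {0..t})"
proof -
  have i: "integrable (lebesgue_on {0..t}) f" "integrable (lebesgue_on {t..T}) f"
    using t by (intro Equivalence_Lebesgue_Henstock_Integration.integrable_subinterval[OF f]; auto)+
  have "integral {0..t} f + integral {t..T} f = integral {0..T} f"
    using t f by (intro Henstock_Kurzweil_Integration.integral_combine integrable_on_lebesgue_on) auto
  then show ?thesis using i f by (simp add: lebesgue_integral_eq_integral algebra_simps)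
qed

context bm_horizon
begin

text \<open>The coefficients of the problem as operators on processes: \<open>0\<close> marks drift terms and weights, \<open>1\<close>
  diffusion terms, and \<open>t\<close> the transposed operators.\<close>

abbreviation "A0 c \<equiv> mf (cA c) (cAh c)"
abbreviation "A1 c \<equiv> mf (cA1 c) (cA1h c)"
abbreviation "B0 c \<equiv> mf (cB c) (cBh c)"
abbreviation "B1 c \<equiv> mf (cB1 c) (cB1h c)"
abbreviation "Q0 c \<equiv> mf (cQ c) (cQh c)"
abbreviation "R0 c \<equiv> mf (cR c) (cRh c)"
abbreviation "A0t c \<equiv> mf (\<lambda>s. transpose (cA c s)) (\<lambda>s. transpose (cAh c s))"
abbreviation "A1t c \<equiv> mf (\<lambda>s. transpose (cA1 c s)) (\<lambda>s. transpose (cA1h c s))"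
abbreviation "B0t c \<equiv> mf (\<lambda>s. transpose (cB c s)) (\<lambda>s. transpose (cBh c s))"
abbreviation "B1t c \<equiv> mf (\<lambda>s. transpose (cB1 c s)) (\<lambda>s. transpose (cB1h c s))"

lemma Xhat_T: "X \<in> XH \<Longrightarrow> X T \<in> L2 M"
  using Xhat_L2(1)[of X T] T_pos by simp

text \<open>The terminal value of the adjoint equation that belongs to the state \<open>X\<close>.\<close>

definition terminal :: "('n::finite, 'm::finite) mf_coeffs \<Rightarrow> (real \<Rightarrow> 'w \<Rightarrow> real^'n) \<Rightarrow> 'w \<Rightarrow> real^'n" where
  "terminal c X w = cG c *v X T w + cGh c *v mean M X T"

definition regular :: "('n::finite, 'm::finite) mf_coeffs \<Rightarrow> bool" where
  "regular c \<longleftrightarrow> cA c \<in> Linf T \<and> cAh c \<in> Linf T \<and> cA1 c \<in> Linf T \<and> cA1h c \<in> Linf T \<and>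
    cB c \<in> Linf T \<and> cBh c \<in> Linf T \<and> cB1 c \<in> Linf T \<and> cB1h c \<in> Linf T \<and>
    cQ c \<in> Linf_sym T \<and> cQh c \<in> Linf_sym T \<and> cR c \<in> Linf_sym T \<and> cRh c \<in> Linf_sym T \<and>
    sym_matrix (cG c) \<and> sym_matrix (cGh c)"

lemma regularD:
  assumes "regular c"
  shows "causal_op (A0 c)" "causal_op (A1 c)" "causal_op (B0 c)" "causal_op (B1 c)" "causal_op (Q0 c)" "causal_op (R0 c)"
    and "adjoint_op (A0 c) (A0t c)" "adjoint_op (A1 c) (A1t c)" "adjoint_op (B0 c) (B0t c)" "adjoint_op (B1 c) (B1t c)"
  using assms unfolding regular_def Linf_sym_def by (auto intro: mf_causal mf_adjoint)

lemma mult_const_L2: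
  fixes f :: "'w \<Rightarrow> real^'n" and G :: "real^'n^'k"
  assumes "f \<in> L2 M" shows "(\<lambda>w. G *v f w) \<in> L2 M"
  by (rule L2_bound[OF borel_measurable_matrix_vector_mult[OF _ L2_measurable[OF assms]] assms, where K = "real CARD('k) * norm G"])
    (auto simp: matrix_vector_mult_norm_le)

lemma const_L2: "(\<lambda>w. y) \<in> L2 M" for y :: "'a::euclidean_space"
  by (simp add: L2_def)

lemma terminal_L2:
  assumes "X \<in> XH" shows "terminal c X \<in> L2 M" "terminal c X \<in> borel_measurable (Fil T)"
  unfolding terminal_def[abs_def] using Xhat_L2(1)[OF assms, of T] XhatD(1)[OF assms, of T] T_pos
  by (intro L2_add mult_const_L2 const_L2 borel_measurable_add borel_measurable_matrix_vector_mult; simp)+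

lemma terminal_ip:
  assumes X: "X \<in> XH" and Y: "Y \<in> XH"
  shows "ip M (terminal c X) (Y T) = ip M (\<lambda>w. cG c *v X T w) (Y T) + (cGh c *v mean M X T) \<bullet> mean M Y T"
proof -
  have L: "X T \<in> L2 M" "Y T \<in> L2 M" using Xhat_T X Y by blast+
  have "ip M (terminal c X) (Y T) = ip M (\<lambda>w. cG c *v X T w) (Y T) + ip M (\<lambda>w. cGh c *v mean M X T) (Y T)"
    unfolding terminal_def[abs_def] by (rule ip_add_left[OF mult_const_L2[OF L(1)] const_L2 L(2)])
  also have "ip M (\<lambda>w. cGh c *v mean M X T) (Y T) = (cGh c *v mean M X T) \<bullet> mean M Y T"
    using L2_integrable_finite(1)[OF finite_measure_axioms L(2)] by (simp add: ip_def mean_def)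
  finally show ?thesis .
qed

lemma terminal_symmetric:
  assumes "regular c" and X: "X \<in> XH" and Y: "Y \<in> XH"
  shows "ip M (terminal c X) (Y T) = ip M (terminal c Y) (X T)"
proof -
  have s: "transpose (cG c) = cG c" "transpose (cGh c) = cGh c" using assms by (auto simp: regular_def sym_matrix_def)
  have "ip M (\<lambda>w. cG c *v X T w) (Y T) = ip M (\<lambda>w. cG c *v Y T w) (X T)"
    unfolding ip_def by (intro LINT_cong refl) (metis inner_transpose s(1) inner_commute)
  moreover have "(cGh c *v mean M X T) \<bullet> mean M Y T = (cGh c *v mean M Y T) \<bullet> mean M X T"
    by (metis inner_transpose s(2) inner_commute)
  ultimately show ?thesis unfolding terminal_ip[OF X Y] terminal_ip[OF Y X] by simp
qed

lemma terminal_linear: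
  assumes X: "X \<in> XH" and Y: "Y \<in> XH"
  shows "terminal c (\<lambda>s w. X s w + r *\<^sub>R Y s w) = (\<lambda>w. terminal c X w + r *\<^sub>R terminal c Y w)"
proof -
  have L: "X T \<in> L2 M" "Y T \<in> L2 M" using Xhat_T X Y by blast+
  show ?thesis unfolding terminal_def[abs_def] mean_linear[of X T Y r, OF L]
    by (simp add: fun_eq_iff matrix_vector_right_distrib matrix_vector_mult_scaleR scaleR_add_right)
qed

lemma mean_cong_AE:
  assumes "AE w in M. X t w = Y t w" "X t \<in> L2 M" "Y t \<in> L2 M" shows "mean M X t = mean M Y t"
  unfolding mean_def using assms by (intro integral_cong_AE L2_measurable) auto

lemma is_state_iff:
  assumes c: "regular c" and u: "u \<in> L2P"
  shows "is_state M W T c x u X \<longleftrightarrow> solves (A0 c) (A1 c) (B0 c u) (B1 c u) X \<and> (AE w in M. X 0 w = x)"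
proof -
  have f: "B0 c u \<in> L2P" "B1 c u \<in> L2P" using regularD[OF c] causal_opD(1) u by blast+
  have e1: "(\<lambda>s w. cA1 c s *v X s w + cB1 c s *v u s w + cA1h c s *v mean M X s + cB1h c s *v mean M u s)
      = (\<lambda>s w. A1 c X s w + B1 c u s w)" by (simp add: fun_eq_iff mf_def add_ac)
  have e0: "(\<integral>s. cA c s *v X s w + cB c s *v u s w + cAh c s *v mean M X s + cBh c s *v mean M u s \<partial>lebesgue_on {0..t})
      = Tint (\<lambda>s w. A0 c X s w + B0 c u s w) t w" for t w by (simp add: Tint_def mf_def add_ac)
  show ?thesis
  proof
    assume "is_state M W T c x u X"
    then obtain I where X: "X \<in> XH" and I: "is_ito (\<lambda>s w. A1 c X s w + B1 c u s w) I"
      and eq: "AE w in M. \<forall>t\<in>{0..T}. X t w = x + Tint (\<lambda>s w. A0 c X s w + B0 c u s w) t w + I t w"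
      unfolding is_state_def e1 e0 by blast
    have X0: "AE w in M. X 0 w = x" using eq ito_at_0[OF I]
    proof eventually_elim
      case (elim w)
      show ?case using bspec[OF elim(1), of 0] elim(2) T_pos by (simp add: Tint_0)
    qed
    have "AE w in M. \<forall>t\<in>{0..T}. X t w = X 0 w + Tint (\<lambda>s w. A0 c X s w + B0 c u s w) t w + I t w"
      using eq X0
    proof eventually_elim
      case (elim w)
      show ?case unfolding elim(2) by (rule elim(1))
    qed
    moreover have "(\<lambda>s w. A0 c X s w + B0 c u s w) \<in> L2P"
      by (rule L2P_add[OF causal_opD(1)[OF regularD(1)[OF c] Xhat_L2P[OF X]] f(1)])
    ultimately show "solves (A0 c) (A1 c) (B0 c u) (B1 c u) X \<and> (AE w in M. X 0 w = x)"
      unfolding solves_def itoproc_def using X I X0 f by blast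
  next
    assume s: "solves (A0 c) (A1 c) (B0 c u) (B1 c u) X \<and> (AE w in M. X 0 w = x)"
    then obtain I where X: "X \<in> XH" and I: "is_ito (\<lambda>s w. A1 c X s w + B1 c u s w) I"
      and eq: "AE w in M. \<forall>t\<in>{0..T}. X t w = X 0 w + Tint (\<lambda>s w. A0 c X s w + B0 c u s w) t w + I t w"
      unfolding solves_def itoproc_def by blast
    have X0: "AE w in M. X 0 w = x" using s by blast
    have "AE w in M. \<forall>t\<in>{0..T}. X t w = x + Tint (\<lambda>s w. A0 c X s w + B0 c u s w) t w + I t w"
      using eq X0
    proof eventually_elim
      case (elim w)
      show ?case by (rule elim(1)[unfolded elim(2)])
    qed
    then show "is_state M W T c x u X" unfolding is_state_def e1 e0 using X I by blast
  qed
qed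

lemma adjoint_solution_iff:
  fixes c :: "('n::finite, 'm::finite) mf_coeffs"
  assumes c: "regular c" and Xb: "Xb \<in> XH"
  shows "adjoint_solution M W T c Xb Y Z \<longleftrightarrow> backward (A0t c) (A1t c) (Q0 c Xb) (terminal c Xb) Y Z"
proof -
  define h where "h s w = A0t c Y s w + A1t c Z s w + Q0 c Xb s w" for s w
  have e: "(\<integral>s. transpose (cA c s) *v Y s w + transpose (cA1 c s) *v Z s w + transpose (cAh c s) *v mean M Y s
      + transpose (cA1h c s) *v mean M Z s + cQ c s *v Xb s w + cQh c s *v mean M Xb s \<partial>lebesgue_on {t..T})
      = (\<integral>s. h s w \<partial>lebesgue_on {t..T})" for t w by (simp add: h_def mf_def add_ac)
  have h: "h \<in> L2P" if "Y \<in> XH" "Z \<in> L2P"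
    unfolding h_def[abs_def] using adjoint_opD(1)[OF regularD(7)[OF c] Xhat_L2P[OF that(1)]] adjoint_opD(1)[OF regularD(8)[OF c] that(2)]
      causal_opD(1)[OF regularD(5)[OF c] Xhat_L2P[OF Xb]] by (intro L2P_add)
  have neg: "Tint (\<lambda>s w. - h s w) t w = - Tint h t w" for t w by (simp add: Tint_def)
  have TT: "0 \<in> {0..T}" "T \<in> {0..T}" using T_pos by auto
  have tail: "AE w in M. \<forall>t\<in>{0..T}. (\<integral>s. h s w \<partial>lebesgue_on {t..T}) = Tint h T w - Tint h t w" if "h \<in> L2P"
    using path_integrable[OF that]
  proof eventually_elim
    case (elim w)
    show ?case unfolding Tint_def by (intro ballI lebesgue_integral_split[OF elim])
  qed
  have A: "adjoint_solution M W T c Xb Y Z \<longleftrightarrow> Y \<in> XH \<and> Z \<in> L2P \<and> (\<exists>I. is_ito Z I \<and>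
      (AE w in M. \<forall>t\<in>{0..T}. Y t w = terminal c Xb w + (\<integral>s. h s w \<partial>lebesgue_on {t..T}) - (I T w - I t w)))"
    unfolding adjoint_solution_def e terminal_def ..
  have B: "backward (A0t c) (A1t c) (Q0 c Xb) (terminal c Xb) Y Z \<longleftrightarrow> itoproc (\<lambda>s w. - h s w) Z Y \<and> (AE w in M. Y T w = terminal c Xb w)"
    unfolding backward_def h_def ..
  show ?thesis
    unfolding A B
  proof
    assume "Y \<in> XH \<and> Z \<in> L2P \<and> (\<exists>I. is_ito Z I \<and>
      (AE w in M. \<forall>t\<in>{0..T}. Y t w = terminal c Xb w + (\<integral>s. h s w \<partial>lebesgue_on {t..T}) - (I T w - I t w)))"
    then obtain I where Y: "Y \<in> XH" "Z \<in> L2P" and I: "is_ito Z I"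
      and eq: "AE w in M. \<forall>t\<in>{0..T}. Y t w = terminal c Xb w + (\<integral>s. h s w \<partial>lebesgue_on {t..T}) - (I T w - I t w)" by blast
    note hP = h[OF Y]
    have mh: "(\<lambda>s w. - h s w) \<in> L2P" using L2P_scaleR[OF hP, of "-1"] by simp
    have "AE w in M. \<forall>t\<in>{0..T}. Y t w = Y 0 w + Tint (\<lambda>s w. - h s w) t w + I t w"
      using eq tail[OF hP] ito_at_0[OF I]
    proof eventually_elim
      case (elim w)
      show ?case
      proof
        fix t assume t: "t \<in> {0..T}"
        show "Y t w = Y 0 w + Tint (\<lambda>s w. - h s w) t w + I t w"
          using bspec[OF elim(1) t] bspec[OF elim(1) TT(1)] bspec[OF elim(2) t] bspec[OF elim(2) TT(1)] elim(3)
          unfolding neg by (simp add: Tint_0)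
      qed
    qed
    moreover have "AE w in M. Y T w = terminal c Xb w"
      using eq tail[OF hP]
    proof eventually_elim
      case (elim w)
      show ?case using bspec[OF elim(1) TT(2)] bspec[OF elim(2) TT(2)] by simp
    qed
    ultimately show "itoproc (\<lambda>s w. - h s w) Z Y \<and> (AE w in M. Y T w = terminal c Xb w)"
      unfolding itoproc_def using Y I mh by blast
  next
    assume a: "itoproc (\<lambda>s w. - h s w) Z Y \<and> (AE w in M. Y T w = terminal c Xb w)"
    then have Y: "Y \<in> XH" "Z \<in> L2P" and YT: "AE w in M. Y T w = terminal c Xb w" using itoprocD by blast+
    obtain I where I: "is_ito Z I" and eq: "AE w in M. \<forall>t\<in>{0..T}. Y t w = Y 0 w + Tint (\<lambda>s w. - h s w) t w + I t w"
      using a unfolding itoproc_def by blast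
    have "AE w in M. \<forall>t\<in>{0..T}. Y t w = terminal c Xb w + (\<integral>s. h s w \<partial>lebesgue_on {t..T}) - (I T w - I t w)"
      using eq tail[OF h[OF Y]] YT
    proof eventually_elim
      case (elim w)
      show ?case
      proof
        fix t assume t: "t \<in> {0..T}"
        show "Y t w = terminal c Xb w + (\<integral>s. h s w \<partial>lebesgue_on {t..T}) - (I T w - I t w)"
          using bspec[OF elim(1) t] bspec[OF elim(1) TT(2)] bspec[OF elim(2) t] elim(3) unfolding neg by simp
      qed
    qed
    with Y I show "Y \<in> XH \<and> Z \<in> L2P \<and> (\<exists>I. is_ito Z I \<and>
      (AE w in M. \<forall>t\<in>{0..T}. Y t w = terminal c Xb w + (\<integral>s. h s w \<partial>lebesgue_on {t..T}) - (I T w - I t w)))" by blast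
  qed
qed

text \<open>The cost in terms of inner products: a symmetric quadratic form in state and control.\<close>

definition cost_form :: "('n::finite, 'm::finite) mf_coeffs \<Rightarrow> (real \<Rightarrow> 'w \<Rightarrow> real^'n) \<Rightarrow> (real \<Rightarrow> 'w \<Rightarrow> real^'m) \<Rightarrow> real" where
  "cost_form c X u = IP (Q0 c X) X + IP (R0 c u) u + ip M (terminal c X) (X T)"

text \<open>The cost weights the means with each other, the mean-field operator weights the mean with the process.
  Both have the same integral.\<close>

lemma cost_integral:
  fixes c :: "('n::finite, 'm::finite) mf_coeffs"
  assumes c: "regular c" and X: "X \<in> XH" and u: "u \<in> L2P"
  shows "(\<integral>w. (\<integral>s. (cQ c s *v X s w) \<bullet> X s w + (cQh c s *v mean M X s) \<bullet> mean M X s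
         + (cR c s *v u s w) \<bullet> u s w + (cRh c s *v mean M u s) \<bullet> mean M u s \<partial>TI)
       + (cG c *v X T w) \<bullet> X T w + (cGh c *v mean M X T) \<bullet> mean M X T \<partial>M) = cost_form c X u"
proof -
  note XP = Xhat_L2P[OF X]
  have L: "cQ c \<in> Linf T" "cQh c \<in> Linf T" "cR c \<in> Linf T" "cRh c \<in> Linf T" using c by (auto simp: regular_def Linf_sym_def)
  define q1 where "q1 = mat_op (cQ c) X"
  define q2 where "q2 = mat_op (cQh c) (mean_op X)"
  define r1 where "r1 = mat_op (cR c) u"
  define r2 where "r2 = mat_op (cRh c) (mean_op u)"
  have P: "q1 \<in> L2P" "q2 \<in> L2P" "r1 \<in> L2P" "r2 \<in> L2P" "mean_op X \<in> L2P" "mean_op u \<in> L2P"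
    unfolding q1_def q2_def r1_def r2_def by (intro mat_op_L2P mean_op_L2P L XP u)+
  have int: "integrable M (\<lambda>w. \<integral>s. \<phi> s w \<bullet> \<psi> s w \<partial>TI)" if "\<phi> \<in> L2P" "\<psi> \<in> L2P" for \<phi> \<psi> :: "('w, 'b::euclidean_space) process"
    by (rule LM.integrable_snd[OF IP_inner_integrable[OF that]])
  have pth: "AE w in M. integrable TI (\<lambda>s. \<phi> s w \<bullet> \<psi> s w)" if "\<phi> \<in> L2P" "\<psi> \<in> L2P" for \<phi> \<psi> :: "('w, 'b::euclidean_space) process"
    using L2P_AE_path[OF that(1)] L2P_AE_path[OF that(2)] by eventually_elim (rule L2_inner_integrable)
  have XT: "X T \<in> L2 M" using Xhat_T[OF X] .
  note iG = L2_inner_integrable[OF mult_const_L2[OF XT, of "cG c"] XT]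
  let ?I = "\<lambda>\<phi> \<psi> w. \<integral>s. \<phi> s w \<bullet> \<psi> s w \<partial>TI"
  let ?k = "(cGh c *v mean M X T) \<bullet> mean M X T"
  have "(\<integral>w. (\<integral>s. (cQ c s *v X s w) \<bullet> X s w + (cQh c s *v mean M X s) \<bullet> mean M X s
         + (cR c s *v u s w) \<bullet> u s w + (cRh c s *v mean M u s) \<bullet> mean M u s \<partial>TI)
       + (cG c *v X T w) \<bullet> X T w + ?k \<partial>M)
     = (\<integral>w. (\<integral>s. q1 s w \<bullet> X s w + q2 s w \<bullet> mean_op X s w + r1 s w \<bullet> u s w + r2 s w \<bullet> mean_op u s w \<partial>TI)
       + (cG c *v X T w) \<bullet> X T w + ?k \<partial>M)"
    by (simp add: q1_def q2_def r1_def r2_def mat_op_def mean_op_def)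
  also have "\<dots> = (\<integral>w. ?I q1 X w + ?I q2 (mean_op X) w + ?I r1 u w + ?I r2 (mean_op u) w + (cG c *v X T w) \<bullet> X T w + ?k \<partial>M)"
  proof (rule integral_cong_AE)
    show ae: "AE w in M. (\<integral>s. q1 s w \<bullet> X s w + q2 s w \<bullet> mean_op X s w + r1 s w \<bullet> u s w + r2 s w \<bullet> mean_op u s w \<partial>TI)
       + (cG c *v X T w) \<bullet> X T w + ?k = ?I q1 X w + ?I q2 (mean_op X) w + ?I r1 u w + ?I r2 (mean_op u) w + (cG c *v X T w) \<bullet> X T w + ?k"
      using pth[OF P(1) XP] pth[OF P(2,5)] pth[OF P(3) u] pth[OF P(4,6)] by eventually_elim simp
    show m: "(\<lambda>w. ?I q1 X w + ?I q2 (mean_op X) w + ?I r1 u w + ?I r2 (mean_op u) w + (cG c *v X T w) \<bullet> X T w + ?k) \<in> borel_measurable M"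
      using int[OF P(1) XP] int[OF P(2,5)] int[OF P(3) u] int[OF P(4,6)] iG by (intro borel_measurable_add) auto
    show "(\<lambda>w. (\<integral>s. q1 s w \<bullet> X s w + q2 s w \<bullet> mean_op X s w + r1 s w \<bullet> u s w + r2 s w \<bullet> mean_op u s w \<partial>TI)
       + (cG c *v X T w) \<bullet> X T w + ?k) \<in> borel_measurable M"
    proof -
      have "(\<lambda>(s, w). \<phi> s w \<bullet> \<psi> s w) \<in> borel_measurable LM" if "\<phi> \<in> L2P" "\<psi> \<in> L2P" for \<phi> \<psi> :: "('w, 'b::euclidean_space) process"
        using IP_inner_integrable[OF that] by auto
      from borel_measurable_add[OF borel_measurable_add[OF borel_measurable_add[OF this[OF P(1) XP] this[OF P(2,5)]] this[OF P(3) u]] this[OF P(4,6)]]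
      have "(\<lambda>(s, w). q1 s w \<bullet> X s w + q2 s w \<bullet> mean_op X s w + r1 s w \<bullet> u s w + r2 s w \<bullet> mean_op u s w) \<in> borel_measurable LM"
        by (simp add: case_prod_beta')
      from measurable_compose[OF measurable_pair_swap' this]
      have "(\<lambda>(w, s). q1 s w \<bullet> X s w + q2 s w \<bullet> mean_op X s w + r1 s w \<bullet> u s w + r2 s w \<bullet> mean_op u s w) \<in> borel_measurable (M \<Otimes>\<^sub>M TI)"
        by (simp add: case_prod_beta')
      from TI.borel_measurable_lebesgue_integral[OF this] show ?thesis using iG by (intro borel_measurable_add) auto
    qed
  qed
  also have "\<dots> = IP q1 X + IP q2 (mean_op X) + IP r1 u + IP r2 (mean_op u) + ip M (\<lambda>w. cG c *v X T w) (X T) + ?k"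
    unfolding IP_eq_time_inner[OF P(1) XP] IP_eq_time_inner[OF P(2,5)] IP_eq_time_inner[OF P(3) u] IP_eq_time_inner[OF P(4,6)] ip_def
    using int[OF P(1) XP] int[OF P(2,5)] int[OF P(3) u] int[OF P(4,6)] iG by (simp add: prob_space)
  also have "IP q2 (mean_op X) = IP q2 X" unfolding q2_def by (rule mat_op_mean_op_adjoint(1)[OF L(2) XP XP, symmetric])
  also have "IP r2 (mean_op u) = IP r2 u" unfolding r2_def by (rule mat_op_mean_op_adjoint(1)[OF L(4) u u, symmetric])
  also have "IP q1 X + IP q2 X + IP r1 u + IP r2 u + ip M (\<lambda>w. cG c *v X T w) (X T) + ?k = cost_form c X u"
    unfolding cost_form_def mf_eq q1_def[symmetric] q2_def[symmetric] r1_def[symmetric] r2_def[symmetric] terminal_ip[OF X X]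
    by (simp add: IP_add_left P XP u)
  finally show ?thesis .
qed

text \<open>The cost is defined with a chosen version of the state. Versions are indistinguishable, so any state
  computes it.\<close>

lemma cost_eq:
  fixes c :: "('n::finite, 'm::finite) mf_coeffs"
  assumes c: "regular c" and u: "u \<in> L2P" and X: "is_state M W T c x u X"
  shows "cost M W T c x u = cost_form c X u"
proof -
  define X' where "X' = state M W T c x u"
  have X': "is_state M W T c x u X'" unfolding X'_def state_def by (rule someI[of "is_state M W T c x u", OF X])
  have s: "solves (A0 c) (A1 c) (B0 c u) (B1 c u) X" "AE w in M. X 0 w = x" and s': "solves (A0 c) (A1 c) (B0 c u) (B1 c u) X'" "AE w in M. X' 0 w = x"
    using X X' by (simp_all add: is_state_iff[OF c u])
  note x = solvesD(4,5)[OF s(1)] and x' = solvesD(4,5)[OF s'(1)]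
  have "AE w in M. X' 0 w = X 0 w" using s(2) s'(2) by eventually_elim simp
  then have ae: "AE w in M. \<forall>t\<in>{0..T}. X' t w = X t w" by (intro solves_unique[OF regularD(1,2)[OF c] s'(1) s(1)]) auto
  have aeT: "AE w in M. X' T w = X T w" using ae by (rule eventually_mono) (use T_pos in simp)
  have n: "DR X' X = 0"
    by (rule NR_eq_0_I[OF L2P_diff[OF x'(2) x(2)]], rule AE_I2, rule eventually_mono[OF ae]) auto
  have Qs: "cQ c \<in> Linf_sym T" "cQh c \<in> Linf_sym T" using c by (auto simp: regular_def)
  note QP = causal_opD(1)[OF regularD(5)[OF c]]
  have "IP (Q0 c X') X' = IP (Q0 c X') X" using IP_cong[OF x'(2) x(2) n QP[OF x'(2)]] by (simp add: IP_commute)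
  also have "\<dots> = IP (Q0 c X) X'" by (rule mf_symmetric[OF Qs x'(2) x(2)])
  also have "\<dots> = IP (Q0 c X) X" using IP_cong[OF x'(2) x(2) n QP[OF x(2)]] by (simp add: IP_commute)
  finally have 1: "IP (Q0 c X') X' = IP (Q0 c X) X" .
  have L: "X T \<in> L2 M" "X' T \<in> L2 M" using Xhat_T x(1) x'(1) by blast+
  have "AE w in M. terminal c X' w = terminal c X w"
    unfolding terminal_def mean_cong_AE[of X' T X, OF aeT L(2,1)] using aeT by eventually_elim simp
  then have 2: "ip M (terminal c X') (X' T) = ip M (terminal c X) (X T)"
    using aeT L terminal_L2(1)[OF x(1)] terminal_L2(1)[OF x'(1)] by (intro ip_cong_AE L2_measurable)
  have "cost M W T c x u = cost_form c X' u" unfolding cost_def Let_def X'_def[symmetric] by (rule cost_integral[OF c x'(1) u])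
  then show ?thesis unfolding cost_form_def 1 2 .
qed

lemma quadratic_form_expand:
  fixes Q Qh :: "real \<Rightarrow> real^'n^'n"
  assumes Q: "Q \<in> Linf_sym T" "Qh \<in> Linf_sym T" and X: "X \<in> L2P" and Y: "Y \<in> L2P"
  shows "IP (mf Q Qh (\<lambda>s w. X s w + r *\<^sub>R Y s w)) (\<lambda>s w. X s w + r *\<^sub>R Y s w)
    = IP (mf Q Qh X) X + 2 * r * IP (mf Q Qh X) Y + r\<^sup>2 * IP (mf Q Qh Y) Y"
proof -
  have A: "Q \<in> Linf T" "Qh \<in> Linf T" using Q by (auto simp: Linf_sym_def)
  let ?Z = "\<lambda>s w. X s w + r *\<^sub>R Y s w"
  have Z: "?Z \<in> L2P" by (intro L2P_add L2P_scaleR X Y)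
  note P = mf_L2P[OF A X] mf_L2P[OF A Y] mf_L2P[OF A Z]
  have "IP (mf Q Qh ?Z) ?Z = IP (\<lambda>s w. mf Q Qh X s w + r *\<^sub>R mf Q Qh Y s w) ?Z"
    by (rule IP_cong[OF P(3) _ causal_opD(2)[OF mf_causal[OF A] X Y] Z]) (intro L2P_add L2P_scaleR P)
  also have "\<dots> = IP (mf Q Qh X) X + r * IP (mf Q Qh X) Y + r * (IP (mf Q Qh Y) X + r * IP (mf Q Qh Y) Y)"
    by (simp add: IP_add_left IP_add_right IP_scaleR_left IP_scaleR_right L2P_add L2P_scaleR P X Y algebra_simps)
  also have "IP (mf Q Qh Y) X = IP (mf Q Qh X) Y" by (rule mf_symmetric[OF Q Y X])
  finally show ?thesis by (simp add: algebra_simps power2_eq_square)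
qed

lemma cost_form_expand:
  fixes c :: "('n::finite, 'm::finite) mf_coeffs"
  assumes c: "regular c" and X: "X \<in> XH" "Y \<in> XH" and u: "u \<in> L2P" "v \<in> L2P"
  shows "cost_form c (\<lambda>s w. X s w + r *\<^sub>R Y s w) (\<lambda>s w. u s w + r *\<^sub>R v s w)
    = cost_form c X u + 2 * r * (IP (Q0 c X) Y + IP (R0 c u) v + ip M (terminal c X) (Y T)) + r\<^sup>2 * cost_form c Y v"
proof -
  have s: "cQ c \<in> Linf_sym T" "cQh c \<in> Linf_sym T" "cR c \<in> Linf_sym T" "cRh c \<in> Linf_sym T" using c by (auto simp: regular_def)
  have L: "X T \<in> L2 M" "Y T \<in> L2 M" using Xhat_T X by blast+
  have "ip M (\<lambda>w. terminal c X w + r *\<^sub>R terminal c Y w) (\<lambda>w. X T w + r *\<^sub>R Y T w)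
      = ip M (terminal c X) (X T) + 2 * r * ip M (terminal c X) (Y T) + r\<^sup>2 * ip M (terminal c Y) (Y T)"
    using terminal_symmetric[OF c X(2,1)]
    by (simp add: ip_add_left ip_add_right ip_scaleR_left ip_scaleR_right L2_add L2_scaleR L terminal_L2 X algebra_simps power2_eq_square)
  then show ?thesis
    unfolding cost_form_def quadratic_form_expand[OF s(1,2) Xhat_L2P[OF X(1)] Xhat_L2P[OF X(2)]] quadratic_form_expand[OF s(3,4) u]
      terminal_linear[OF X] by (simp add: algebra_simps)
qed

text \<open>A version of the state for the perturbed control, affine in the perturbation.\<close>

lemma state_perturbation:
  fixes c :: "('n::finite, 'm::finite) mf_coeffs"
  assumes c: "regular c" and X: "is_state M W T c x u X" and Y: "is_state M W T c 0 v Y" and u: "u \<in> L2P" "v \<in> L2P"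
  shows "is_state M W T c x (\<lambda>s w. u s w + r *\<^sub>R v s w) (\<lambda>s w. X s w + r *\<^sub>R Y s w)"
proof -
  let ?w = "\<lambda>s w. u s w + r *\<^sub>R v s w" and ?Z = "\<lambda>s w. X s w + r *\<^sub>R Y s w"
  have w: "?w \<in> L2P" by (intro L2P_add L2P_scaleR u)
  have x: "solves (A0 c) (A1 c) (B0 c u) (B1 c u) X" "AE w in M. X 0 w = x"
    and y: "solves (A0 c) (A1 c) (B0 c v) (B1 c v) Y" "AE w in M. Y 0 w = 0"
    using X Y by (simp_all add: is_state_iff[OF c] u)
  have Z: "solves (A0 c) (A1 c) (\<lambda>s w. B0 c u s w + r *\<^sub>R B0 c v s w) (\<lambda>s w. B1 c u s w + r *\<^sub>R B1 c v s w) ?Z"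
    by (rule solves_linear[OF regularD(1,2)[OF c] x(1) y(1)])
  note z = solvesD[OF Z]
  have shift: "(\<lambda>s w. L ?Z s w + B ?w s w) \<in> L2P \<and> NR (\<lambda>s w. (L ?Z s w + (B u s w + r *\<^sub>R B v s w)) - (L ?Z s w + B ?w s w)) = 0"
    if L: "causal_op L" and B: "causal_op B" for L :: "(real \<Rightarrow> 'w \<Rightarrow> real^'n) \<Rightarrow> (real \<Rightarrow> 'w \<Rightarrow> real^'n)" and B
  proof
    show "(\<lambda>s w. L ?Z s w + B ?w s w) \<in> L2P" by (rule L2P_add[OF causal_opD(1)[OF L z(5)] causal_opD(1)[OF B w]])
    have "(\<lambda>s w. (L ?Z s w + (B u s w + r *\<^sub>R B v s w)) - (L ?Z s w + B ?w s w)) = (\<lambda>s w. (B u s w + r *\<^sub>R B v s w) - B ?w s w)" by simp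
    then show "NR (\<lambda>s w. (L ?Z s w + (B u s w + r *\<^sub>R B v s w)) - (L ?Z s w + B ?w s w)) = 0"
      using causal_opD(2)[OF B u, of r] by (simp only: NR_minus[of "B ?w"])
  qed
  have "itoproc (\<lambda>s w. A0 c ?Z s w + B0 c ?w s w) (\<lambda>s w. A1 c ?Z s w + B1 c ?w s w) ?Z"
    using itoproc_cong[OF z(3)] shift[OF regularD(1,3)[OF c]] shift[OF regularD(2,4)[OF c]] by blast
  moreover have "AE w in M. ?Z 0 w = x" using x(2) y(2) by eventually_elim simp
  ultimately show ?thesis unfolding is_state_iff[OF c w] solves_def
    using causal_opD(1)[OF regularD(3)[OF c] w] causal_opD(1)[OF regularD(4)[OF c] w] by blast
qed

text \<open>Along the line \<open>u + r v\<close> the cost is a quadratic polynomial in \<open>r\<close> that is minimal at \<open>r = 0\<close>.\<close>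

lemma optimal_first_order:
  fixes c :: "('n::finite, 'm::finite) mf_coeffs"
  assumes c: "regular c" and opt: "optimal_pair M W T c x Xb ub" and v: "v \<in> L2P" and Y: "is_state M W T c 0 v Y"
  shows "IP (Q0 c Xb) Y + IP (R0 c ub) v + ip M (terminal c Xb) (Y T) = 0"
proof -
  have u: "ub \<in> L2P" and X: "is_state M W T c x ub Xb" and inf: "ereal (cost M W T c x ub) = (INF v\<in>L2P. ereal (cost M W T c x v))"
    using opt by (auto simp: optimal_pair_def)
  have XX: "Xb \<in> XH" "Y \<in> XH" using X Y by (auto simp: is_state_def)
  let ?a = "IP (Q0 c Xb) Y + IP (R0 c ub) v + ip M (terminal c Xb) (Y T)"
  have "0 \<le> 2 * r * ?a + r\<^sup>2 * cost_form c Y v" for r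
  proof -
    let ?w = "\<lambda>s w. ub s w + r *\<^sub>R v s w"
    have w: "?w \<in> L2P" by (intro L2P_add L2P_scaleR u v)
    have "ereal (cost M W T c x ub) \<le> ereal (cost M W T c x ?w)" unfolding inf by (rule INF_lower[OF w])
    then show ?thesis
      unfolding cost_eq[OF c u X] cost_eq[OF c w state_perturbation[OF c X Y u v]] cost_form_expand[OF c XX u v] by simp
  qed
  then show ?thesis by (rule quadratic_min_derivative)
qed

text \<open>Duality turns the first-order condition into orthogonality to every direction.\<close>

theorem maximum_principle:
  fixes c :: "('n::finite, 'm::finite) mf_coeffs"
  assumes c: "regular c" and opt: "optimal_pair M W T c x Xb ub" and YZ: "adjoint_solution M W T c Xb Y Z"
  shows "AE s in TI. AE w in M. R0 c ub s w + B0t c Y s w + B1t c Z s w = 0"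
proof -
  have u: "ub \<in> L2P" and Xb: "Xb \<in> XH" using opt by (auto simp: optimal_pair_def is_state_def)
  note b = YZ[unfolded adjoint_solution_iff[OF c Xb]]
  have y: "Y \<in> L2P" "Z \<in> L2P" using YZ Xhat_L2P by (auto simp: adjoint_solution_def)
  note D = regularD[OF c]
  have P: "R0 c ub \<in> L2P" "B0t c Y \<in> L2P" "B1t c Z \<in> L2P" using causal_opD(1)[OF D(6) u] adjoint_opD(1)[OF D(9) y(1)] adjoint_opD(1)[OF D(10) y(2)] by auto
  let ?S = "\<lambda>s w. R0 c ub s w + B0t c Y s w + B1t c Z s w"
  have S: "?S \<in> L2P" by (intro L2P_add P)
  have "IP ?S v = 0" if v: "v \<in> L2P" for v
  proof -
    note f = causal_opD(1)[OF D(3) v] causal_opD(1)[OF D(4) v]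
    obtain X1 where X1: "solves (A0 c) (A1 c) (B0 c v) (B1 c v) X1" "AE w in M. X1 0 w = 0" using solves_exists[OF D(1,2) f] by blast
    then have "is_state M W T c 0 v X1" by (simp add: is_state_iff[OF c v])
    then have "IP (Q0 c Xb) X1 + IP (R0 c ub) v + ip M (terminal c Xb) (X1 T) = 0" by (rule optimal_first_order[OF c opt v])
    moreover have "ip M (terminal c Xb) (X1 T) + IP (Q0 c Xb) X1 = IP Y (B0 c v) + IP Z (B1 c v)"
      by (rule backward_duality[OF D(1,2,7,8) causal_opD(1)[OF D(5) Xhat_L2P[OF Xb]] terminal_L2(1)[OF Xb] b X1])
    ultimately show ?thesis
      using adjoint_opD(2)[OF D(9) v y(1)] adjoint_opD(2)[OF D(10) v y(2)]
      by (simp add: IP_add_left L2P_add P v IP_commute[of Y "B0 c v"] IP_commute[of Z "B1 c v"])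
  qed
  from this[OF S] have "NR ?S = 0" by (simp add: NR_def_IP)
  from NR_eq_0(1)[OF S this] show ?thesis .
qed

end

theorem theorem3p1:
  fixes M :: "'w measure" and W :: "real \<Rightarrow> 'w \<Rightarrow> real" and T :: real
    and c :: "('n::finite, 'm::finite) mf_coeffs"
    and x :: "real ^ 'n"
    and Xbar :: "real \<Rightarrow> 'w \<Rightarrow> real ^ 'n" and ubar :: "real \<Rightarrow> 'w \<Rightarrow> real ^ 'm"
  assumes "T > 0"
    and "complete_measure M" and "brownian_motion M W"
    and "cA c \<in> Linf T" and "cAh c \<in> Linf T" and "cA1 c \<in> Linf T" and "cA1h c \<in> Linf T"
    and "cB c \<in> Linf T" and "cBh c \<in> Linf T" and "cB1 c \<in> Linf T" and "cB1h c \<in> Linf T"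
    and "cQ c \<in> Linf_sym T" and "cQh c \<in> Linf_sym T"
    and "cR c \<in> Linf_sym T" and "cRh c \<in> Linf_sym T"
    and "sym_matrix (cG c)" and "sym_matrix (cGh c)"
    and "optimal_pair M W T c x Xbar ubar"
  shows "\<exists>Y Z. adjoint_solution M W T c Xbar Y Z \<and>
    (\<forall>Y' Z'. adjoint_solution M W T c Xbar Y' Z' \<longrightarrow>
       (AE \<omega> in M. \<forall>t\<in>{0..T}. Y' t \<omega> = Y t \<omega>) \<and>
       (AE s in lebesgue_on {0..T}. AE \<omega> in M. Z' s \<omega> = Z s \<omega>)) \<and>
    (AE s in lebesgue_on {0..T}. AE \<omega> in M.
       cR c s *v ubar s \<omega> + transpose (cB c s) *v Y s \<omega> + transpose (cB1 c s) *v Z s \<omega>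
       + cRh c s *v mean M ubar s + transpose (cBh c s) *v mean M Y s
       + transpose (cB1h c s) *v mean M Z s = 0)"
proof -
  interpret bm_horizon M W T
    by (intro bm_horizon.intro bm_horizon_axioms.intro assms(1-3))
  have c: "regular c" using assms(4-17) by (simp add: regular_def)
  have Xb: "Xbar \<in> XH" using assms(18) by (auto simp: optimal_pair_def is_state_def)
  note D = regularD[OF c]
  note q = causal_opD(1)[OF D(5) Xhat_L2P[OF Xb]] and g = terminal_L2[OF Xb, of c]
  obtain Y Z where YZ: "backward (A0t c) (A1t c) (Q0 c Xbar) (terminal c Xbar) Y Z"
    using backward_exists[OF D(1,2,7,8) q g] by blast
  then have a: "adjoint_solution M W T c Xbar Y Z" by (simp add: adjoint_solution_iff[OF c Xb])
  have "(AE w in M. \<forall>t\<in>{0..T}. Y' t w = Y t w) \<and> (AE s in TI. AE w in M. Z' s w = Z s w)"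
    if "adjoint_solution M W T c Xbar Y' Z'" for Y' Z'
    using backward_unique[OF D(1,2,7,8) q g(1) YZ] that by (simp add: adjoint_solution_iff[OF c Xb])
  moreover have "AE s in TI. AE w in M.
       cR c s *v ubar s w + transpose (cB c s) *v Y s w + transpose (cB1 c s) *v Z s w
       + cRh c s *v mean M ubar s + transpose (cBh c s) *v mean M Y s
       + transpose (cB1h c s) *v mean M Z s = 0"
    using maximum_principle[OF c assms(18) a] by (simp add: mf_def add_ac)
  ultimately show ?thesis using a by blast
qed

end
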